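(* There exist constants $\epsilon_0>0$ and $C>0$ such that for every $\epsilon\in(0,\epsilon_0)$ and every $v\in W^{1,2}(S;\mathbb{R}^2)$, $$\|v-\Pi_\epsilon(v)\|_{W^{1,2}(S)}\le \frac{C}{\epsilon}\,\|\mathrm{sym}(\bar\nabla_\epsilon v\,\bar R_0^T)\|_{L^2(S)}.$$
   Context: Let $\gamma:[0,1]\to\mathbb{R}^3$, $\gamma(s)=(0,\gamma_2(s),\gamma_3(s))$, be a simple planar curve of class $C^6$ parametrized by arclength. Set $\tau:=\dot\gamma$, $n:=(0,-\tau_3,\tau_2)$, and let $k:=\dot\tau\cdot n$ be the curvature, assumed not identically zero on $[0,1]$. Two-dimensional versions: $\bar\tau=(\tau_2,\tau_3)$, $\bar n=(-\tau_3,\tau_2)$, and $\bar R_0=(\bar\tau\,|\,\bar n)$. Let $S=(0,1)\times(-\tfrac12,\tfrac12)$ with coordinates $(s,t)$. For $\epsilon>0$ and $v\in W^{1,2}(S;\mathbb{R}^2)$ let $\bar\nabla_\epsilon v:=\big(\tfrac{1}{1-\epsilon t k}\partial_s v\,\big|\,\tfrac1\epsilon\partial_t v\big)$. Let $M_\epsilon:=\{v\in W^{1,2}(S;\mathbb{R}^2):\mathrm{sym}(\bar\nabla_\epsilon v\,\bar R_0^T)=0\}$ (a closed subspace of $W^{1,2}(S;\mathbb{R}^2)$), and let $\Pi_\epsilon:W^{1,2}(S;\mathbb{R}^2)\to M_\epsilon$ be the orthogonal projection with respect to the $W^{1,2}$ scalar product. *)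

theory Defs
  imports "HOL-Analysis.Analysis"
begin

definition stripS :: "(real \<times> real) set" where
  "stripS = {0<..<1} \<times> {-1/2<..<1/2}"

definition pdir :: "(real \<times> real) \<Rightarrow> (real \<times> real \<Rightarrow> real) \<Rightarrow> (real \<times> real \<Rightarrow> real)" where
  "pdir e f = (\<lambda>p. frechet_derivative f (at p) e)"

fun iter_pd :: "(real \<times> real) list \<Rightarrow> (real \<times> real \<Rightarrow> real) \<Rightarrow> (real \<times> real \<Rightarrow> real)" where
  "iter_pd [] f = f"
| "iter_pd (e # es) f = pdir e (iter_pd es f)"

definition smooth2 :: "(real \<times> real \<Rightarrow> real) \<Rightarrow> bool" where
  "smooth2 f \<longleftrightarrow> (\<forall>es. iter_pd es f differentiable_on UNIV \<and> continuous_on UNIV (iter_pd es f))"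

definition test_fn :: "(real \<times> real \<Rightarrow> real) \<Rightarrow> bool" where
  "test_fn \<phi> \<longleftrightarrow> smooth2 \<phi> \<and> compact (closure {p. \<phi> p \<noteq> 0})
      \<and> closure {p. \<phi> p \<noteq> 0} \<subseteq> stripS"

definition L2S :: "(real \<times> real \<Rightarrow> real) \<Rightarrow> bool" where
  "L2S f \<longleftrightarrow> set_borel_measurable lborel stripS f
      \<and> set_integrable lborel stripS (\<lambda>p. (f p)\<^sup>2)"

definition weak_pd :: "(real \<times> real) \<Rightarrow> (real \<times> real \<Rightarrow> real) \<Rightarrow> (real \<times> real \<Rightarrow> real) \<Rightarrow> bool" where
  "weak_pd e f g \<longleftrightarrow> L2S g \<and> (\<forall>\<phi>. test_fn \<phi> \<longrightarrow>
      (LINT p:stripS|lborel. f p * pdir e \<phi> p) = - (LINT p:stripS|lborel. g p * \<phi> p))"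

definition e_s :: "real \<times> real" where "e_s = (1, 0)"
definition e_t :: "real \<times> real" where "e_t = (0, 1)"

definition W12s :: "(real \<times> real \<Rightarrow> real) \<Rightarrow> bool" where
  "W12s f \<longleftrightarrow> L2S f \<and> (\<exists>g. weak_pd e_s f g) \<and> (\<exists>g. weak_pd e_t f g)"

text \<open>Weak partial derivatives (a representative; unique a.e.).\<close>
definition wd_s :: "(real \<times> real \<Rightarrow> real) \<Rightarrow> (real \<times> real \<Rightarrow> real)" where
  "wd_s f = (SOME g. weak_pd e_s f g)"
definition wd_t :: "(real \<times> real \<Rightarrow> real) \<Rightarrow> (real \<times> real \<Rightarrow> real)" where
  "wd_t f = (SOME g. weak_pd e_t f g)"

definition W12 :: "(real \<times> real \<Rightarrow> real \<times> real) set" where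
  "W12 = {v. W12s (\<lambda>p. fst (v p)) \<and> W12s (\<lambda>p. snd (v p))}"

definition W12_inner :: "(real \<times> real \<Rightarrow> real \<times> real) \<Rightarrow> (real \<times> real \<Rightarrow> real \<times> real) \<Rightarrow> real" where
  "W12_inner v w = (\<Sum>c\<in>{fst, snd}.
      (LINT p:stripS|lborel. c (v p) * c (w p)
        + wd_s (\<lambda>q. c (v q)) p * wd_s (\<lambda>q. c (w q)) p
        + wd_t (\<lambda>q. c (v q)) p * wd_t (\<lambda>q. c (w q)) p))"

definition W12_norm :: "(real \<times> real \<Rightarrow> real \<times> real) \<Rightarrow> real" where
  "W12_norm v = sqrt (W12_inner v v)"

text \<open>The entries of sym(grad_eps v R0bar^T), where
  grad_eps v = ( 1/(1 - eps t k(s)) d_s v | 1/eps d_t v ),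
  R0bar = (taubar | nbar), taubar = (tau2, tau3), nbar = (-tau3, tau2).
  Here tau2, tau3 :: real => real are the components of the tangent and k the curvature.
  The matrix A = grad_eps v R0bar^T has entries A i j = a_i taubar_j + b_i nbar_j
  with a = first column, b = second column of grad_eps v.\<close>
definition gradRT :: "(real \<Rightarrow> real) \<Rightarrow> (real \<Rightarrow> real) \<Rightarrow> (real \<Rightarrow> real) \<Rightarrow> real
     \<Rightarrow> (real \<times> real \<Rightarrow> real \<times> real) \<Rightarrow> real \<times> real \<Rightarrow> nat \<Rightarrow> nat \<Rightarrow> real" where
  "gradRT tau2 tau3 k \<epsilon> v p i j =
     (let s = fst p; t = snd p;
          comp = (\<lambda>i::nat. if i = 1 then (\<lambda>q. fst (v q)) else (\<lambda>q. snd (v q)));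
          a = (\<lambda>i. 1 / (1 - \<epsilon> * t * k s) * wd_s (comp i) p);
          b = (\<lambda>i. 1 / \<epsilon> * wd_t (comp i) p);
          taub = (\<lambda>j::nat. if j = 1 then tau2 s else tau3 s);
          nb = (\<lambda>j::nat. if j = 1 then - tau3 s else tau2 s)
      in a i * taub j + b i * nb j)"

definition symGradRT :: "(real \<Rightarrow> real) \<Rightarrow> (real \<Rightarrow> real) \<Rightarrow> (real \<Rightarrow> real) \<Rightarrow> real
     \<Rightarrow> (real \<times> real \<Rightarrow> real \<times> real) \<Rightarrow> real \<times> real \<Rightarrow> nat \<Rightarrow> nat \<Rightarrow> real" where
  "symGradRT tau2 tau3 k \<epsilon> v p i j =
     (gradRT tau2 tau3 k \<epsilon> v p i j + gradRT tau2 tau3 k \<epsilon> v p j i) / 2"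

definition symL2 :: "(real \<Rightarrow> real) \<Rightarrow> (real \<Rightarrow> real) \<Rightarrow> (real \<Rightarrow> real) \<Rightarrow> real
     \<Rightarrow> (real \<times> real \<Rightarrow> real \<times> real) \<Rightarrow> real" where
  "symL2 tau2 tau3 k \<epsilon> v = sqrt (LINT p:stripS|lborel.
       (\<Sum>i\<in>{1::nat,2}. \<Sum>j\<in>{1::nat,2}. (symGradRT tau2 tau3 k \<epsilon> v p i j)\<^sup>2))"

definition Meps :: "(real \<Rightarrow> real) \<Rightarrow> (real \<Rightarrow> real) \<Rightarrow> (real \<Rightarrow> real) \<Rightarrow> real
     \<Rightarrow> (real \<times> real \<Rightarrow> real \<times> real) set" where
  "Meps tau2 tau3 k \<epsilon> = {v \<in> W12. AE p in lborel. p \<in> stripS \<longrightarrow>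
       (\<forall>i\<in>{1::nat,2}. \<forall>j\<in>{1::nat,2}. symGradRT tau2 tau3 k \<epsilon> v p i j = 0)}"

text \<open>Orthogonal projection onto M_eps w.r.t. the W^{1,2} scalar product:
  the element w of M_eps with v - w orthogonal to M_eps (unique up to a.e. equality).\<close>
definition Pi_eps :: "(real \<Rightarrow> real) \<Rightarrow> (real \<Rightarrow> real) \<Rightarrow> (real \<Rightarrow> real) \<Rightarrow> real
     \<Rightarrow> (real \<times> real \<Rightarrow> real \<times> real) \<Rightarrow> (real \<times> real \<Rightarrow> real \<times> real)" where
  "Pi_eps tau2 tau3 k \<epsilon> v = (SOME w. w \<in> Meps tau2 tau3 k \<epsilon>
       \<and> (\<forall>u\<in>Meps tau2 tau3 k \<epsilon>. W12_inner (\<lambda>p. v p - w p) u = 0))"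

text \<open>C^m on [0,1]: successive derivatives D 0 = f, D (i+1) = (D i)', D m continuous.\<close>
definition Ck_derivs :: "nat \<Rightarrow> (nat \<Rightarrow> real \<Rightarrow> real) \<Rightarrow> bool" where
  "Ck_derivs m D \<longleftrightarrow> (\<forall>i<m. \<forall>x\<in>{0..1}. (D i has_real_derivative D (Suc i) x) (at x within {0..1}))
      \<and> continuous_on {0..1} (D m)"

end

theory Submission
  imports Defs
begin

text \<open>On the unit square, Korn's inequality for differentiable fields follows from the null form
  (ay * bx - ax * by), whose integral depends only on boundary values, and a partition into corners.
  In the moving frame of the curve, dividing the oscillation of the tangential component by \<open>\<epsilon>\<close> turns
  the thin curved strip into the unit square up to lower order terms, so that a displacement is
  \<open>C / \<epsilon>\<close>-close to an infinitesimal rigid motion. Truncated cosine expansions approximate a Sobolev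
  function together with its weak derivatives, which extends this estimate to \<open>W\<^sup>1\<^sup>,\<^sup>2\<close>. Hence elements of
  \<open>M\<^sub>\<epsilon>\<close> are rigid motions almost everywhere, and the projection error is at most the distance to any
  rigid motion.\<close>

section \<open>Integrals and partial derivatives on the closed unit square\<close>

text \<open>The power of \<epsilon> is that of bending: on a straight strip, a normal displacement
  f(s) with tangential part - \<epsilon> t f'(s) has strain of order \<epsilon> and gradient of
  order one, so no bound uniform in \<epsilon> can hold. Curvature couples the components: k times
  the normal one enters the tangential strain, k times the tangential one the shear. The mean of the
  tangential component over a cross-section need not be small, so division by \<epsilon> is possible
  only after subtracting it, and its effect on the shear must be compensated in the normal
  component. What then remains of the coupling is \<epsilon> times the local rotation, which is
  absorbed for small \<epsilon> once the rotation has mean zero; an infinitesimal rotation of the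
  curved strip, whose strain vanishes exactly, arranges this. On the square the obstacle is that
  fields have arbitrary boundary values, on which the null form depends. Comparison with dilated
  copies of the same field cancels the boundary terms and takes the place of an extension operator.
  That elements of \<open>Meps\<close> are rigid is not shown separately: it is the final estimate
  at zero energy.\<close>

definition usq :: "(real \<times> real) set" where
  "usq = {0..1} \<times> {0..1}"

text \<open>Functions are curried so that a partial derivative is an ordinary derivative in one
  variable, one-sided on the edges; continuity up to the boundary makes every integral below
  exist.\<close>

definition cont2 :: "(real \<Rightarrow> real \<Rightarrow> real) \<Rightarrow> bool" where
  "cont2 F \<longleftrightarrow> continuous_on usq (\<lambda>p. F (fst p) (snd p))"

definition int2 :: "(real \<Rightarrow> real \<Rightarrow> real) \<Rightarrow> real" where
  "int2 F = integral usq (\<lambda>p. F (fst p) (snd p))"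

definition has_dx :: "(real \<Rightarrow> real \<Rightarrow> real) \<Rightarrow> (real \<Rightarrow> real \<Rightarrow> real) \<Rightarrow> bool" where
  "has_dx F G \<longleftrightarrow> (\<forall>x\<in>{0..1}. \<forall>y\<in>{0..1}. ((\<lambda>x. F x y) has_real_derivative G x y) (at x within {0..1}))"

definition has_dy :: "(real \<Rightarrow> real \<Rightarrow> real) \<Rightarrow> (real \<Rightarrow> real \<Rightarrow> real) \<Rightarrow> bool" where
  "has_dy F G \<longleftrightarrow> (\<forall>x\<in>{0..1}. \<forall>y\<in>{0..1}. ((\<lambda>y. F x y) has_real_derivative G x y) (at y within {0..1}))"

lemma usq_eq_cbox: "usq = cbox (0,0) (1,1)"
  by (simp add: usq_def cbox_Pair_eq)

lemma cont2_const [simp, intro]: "cont2 (\<lambda>x y. c)"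
  by (simp add: cont2_def)

lemma cont2_add: "cont2 F \<Longrightarrow> cont2 G \<Longrightarrow> cont2 (\<lambda>x y. F x y + G x y)"
  unfolding cont2_def by (intro continuous_intros)

lemma cont2_diff: "cont2 F \<Longrightarrow> cont2 G \<Longrightarrow> cont2 (\<lambda>x y. F x y - G x y)"
  unfolding cont2_def by (intro continuous_intros)

lemma cont2_minus: "cont2 F \<Longrightarrow> cont2 (\<lambda>x y. - F x y)"
  unfolding cont2_def by (intro continuous_intros)

lemma cont2_mult: "cont2 F \<Longrightarrow> cont2 G \<Longrightarrow> cont2 (\<lambda>x y. F x y * G x y)"
  unfolding cont2_def by (intro continuous_intros)

lemma cont2_power: "cont2 F \<Longrightarrow> cont2 (\<lambda>x y. F x y ^ n)"
  unfolding cont2_def by (intro continuous_intros)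

lemma cont2_x: "continuous_on {0..1} f \<Longrightarrow> cont2 (\<lambda>x y. f x)"
  unfolding cont2_def usq_def
  by (rule continuous_on_compose2[where g=f and f=fst]) (auto intro: continuous_intros)

lemma cont2_y: "continuous_on {0..1} f \<Longrightarrow> cont2 (\<lambda>x y. f y)"
  unfolding cont2_def usq_def
  by (rule continuous_on_compose2[where g=f and f=snd]) (auto intro: continuous_intros)

lemma cont2_compose:
  assumes "cont2 F" "cont2 f" "cont2 g"
    and "\<And>x y. x \<in> {0..1} \<Longrightarrow> y \<in> {0..1} \<Longrightarrow> f x y \<in> {0..1} \<and> g x y \<in> {0..1}"
  shows "cont2 (\<lambda>x y. F (f x y) (g x y))"
proof -
  have c: "continuous_on usq (\<lambda>p. (f (fst p) (snd p), g (fst p) (snd p)))"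
    using assms(2,3) unfolding cont2_def by (rule continuous_on_Pair)
  have "(\<lambda>p. (f (fst p) (snd p), g (fst p) (snd p))) ` usq \<subseteq> usq"
    using assms(4) by (auto simp: usq_def)
  from continuous_on_compose2[OF assms(1)[unfolded cont2_def] c this]
  show ?thesis by (simp add: cont2_def)
qed

lemma cont2_swap: "cont2 F \<Longrightarrow> cont2 (\<lambda>x y. F y x)"
  by (rule cont2_compose[where f="\<lambda>x y. y" and g="\<lambda>x y. x"])
    (auto intro: cont2_x cont2_y continuous_intros)

lemma cont2_slice_y: "cont2 F \<Longrightarrow> x \<in> {0..1} \<Longrightarrow> continuous_on {0..1} (\<lambda>y. F x y)"
  unfolding cont2_def
  by (rule continuous_on_compose2[where g="\<lambda>p. F (fst p) (snd p)" and f="\<lambda>y. (x,y)", simplified])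
    (auto simp: usq_def intro!: continuous_intros)

lemma cont2_slice_x: "cont2 F \<Longrightarrow> y \<in> {0..1} \<Longrightarrow> continuous_on {0..1} (\<lambda>x. F x y)"
  using cont2_slice_y[OF cont2_swap] .

lemmas cont2_intros = cont2_const cont2_add cont2_diff cont2_minus cont2_mult cont2_power

lemma int2_integrable: "cont2 F \<Longrightarrow> (\<lambda>p. F (fst p) (snd p)) integrable_on usq"
  unfolding cont2_def usq_eq_cbox by (rule integrable_continuous)

lemma int2_add: "cont2 F \<Longrightarrow> cont2 G \<Longrightarrow> int2 (\<lambda>x y. F x y + G x y) = int2 F + int2 G"
  unfolding int2_def by (intro integral_add int2_integrable)

lemma int2_diff: "cont2 F \<Longrightarrow> cont2 G \<Longrightarrow> int2 (\<lambda>x y. F x y - G x y) = int2 F - int2 G"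
  unfolding int2_def by (intro integral_diff int2_integrable)

lemma int2_cmult: "int2 (\<lambda>x y. c * F x y) = c * int2 F"
  unfolding int2_def by simp

lemma int2_minus: "int2 (\<lambda>x y. - F x y) = - int2 F"
  unfolding int2_def by simp

lemma int2_mono:
  "cont2 F \<Longrightarrow> cont2 G \<Longrightarrow> (\<And>x y. x \<in> {0..1} \<Longrightarrow> y \<in> {0..1} \<Longrightarrow> F x y \<le> G x y) \<Longrightarrow> int2 F \<le> int2 G"
  unfolding int2_def by (intro integral_le int2_integrable) (auto simp: usq_def)

lemma int2_cong:
  "(\<And>x y. x \<in> {0..1} \<Longrightarrow> y \<in> {0..1} \<Longrightarrow> F x y = G x y) \<Longrightarrow> int2 F = int2 G"
  unfolding int2_def by (intro integral_cong) (auto simp: usq_def)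

lemma int2_nonneg: "cont2 F \<Longrightarrow> (\<And>x y. x \<in> {0..1} \<Longrightarrow> y \<in> {0..1} \<Longrightarrow> F x y \<ge> 0) \<Longrightarrow> int2 F \<ge> 0"
  unfolding int2_def by (intro integral_nonneg int2_integrable) (auto simp: usq_def)

lemma int2_sq_nonneg [simp]: "cont2 F \<Longrightarrow> int2 (\<lambda>x y. (F x y)\<^sup>2) \<ge> 0"
  by (intro int2_nonneg cont2_intros) auto

lemma int2_iterated: "cont2 F \<Longrightarrow> int2 F = integral {0..1} (\<lambda>x. integral {0..1} (\<lambda>y. F x y))"
  unfolding int2_def cont2_def usq_eq_cbox by (subst integral_prod_continuous) auto

lemma int2_swap: "cont2 F \<Longrightarrow> int2 (\<lambda>x y. F y x) = int2 F"
  using integral_swap_continuous[of 0 0 "1::real" "1::real" F] int2_iterated[of F] int2_iterated[OF cont2_swap[of F]]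
  by (simp add: cont2_def usq_eq_cbox case_prod_unfold)

lemma int2_iterated': "cont2 F \<Longrightarrow> int2 F = integral {0..1} (\<lambda>y. integral {0..1} (\<lambda>x. F x y))"
  using int2_iterated[OF cont2_swap[of F]] int2_swap[of F] by simp

lemma cont2_integral_y: "cont2 F \<Longrightarrow> continuous_on {0..1} (\<lambda>x. integral {0..1} (\<lambda>y. F x y))"
  using integral_continuous_on_param[of "{0..1::real}" 0 "1::real" F]
  by (simp add: cont2_def usq_def case_prod_unfold)

lemma cont2_integral_x: "cont2 F \<Longrightarrow> continuous_on {0..1} (\<lambda>y. integral {0..1} (\<lambda>x. F x y))"
  using cont2_integral_y[OF cont2_swap] .

lemma int2_x: "continuous_on {0..1} f \<Longrightarrow> int2 (\<lambda>x y. f x) = integral {0..1} f"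
  by (simp add: int2_iterated cont2_x)

lemma int2_y: "continuous_on {0..1} f \<Longrightarrow> int2 (\<lambda>x y. f y) = integral {0..1} f"
  by (simp add: int2_iterated cont2_y)

lemma int2_const [simp]: "int2 (\<lambda>x y. c) = c"
  by (simp add: int2_x)

lemma has_dx_integral_y:
  assumes "cont2 F" "cont2 G" "has_dx F G" "x \<in> {0..1}"
  shows "((\<lambda>x. integral {0..1} (\<lambda>y. F x y)) has_real_derivative integral {0..1} (\<lambda>y. G x y)) (at x within {0..1})"
proof -
  have "F x integrable_on {0..1}" if "x \<in> {0..1}" for x
    using cont2_slice_y[OF assms(1) that] by (intro integrable_continuous_interval) simp
  then show ?thesis
    using leibniz_rule_field_derivative[of "{0..1}" 0 "1::real" F G x] assms
    by (auto simp: has_dx_def cont2_def usq_def case_prod_unfold)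
qed

lemma has_dy_swap: "has_dy F G \<longleftrightarrow> has_dx (\<lambda>x y. F y x) (\<lambda>x y. G y x)"
  by (auto simp: has_dx_def has_dy_def)

lemma has_dxD:
  "has_dx F G \<Longrightarrow> x \<in> {0..1} \<Longrightarrow> y \<in> {0..1} \<Longrightarrow> ((\<lambda>x. F x y) has_real_derivative G x y) (at x within {0..1})"
  by (simp add: has_dx_def)

lemma has_dyD:
  "has_dy F G \<Longrightarrow> x \<in> {0..1} \<Longrightarrow> y \<in> {0..1} \<Longrightarrow> ((\<lambda>y. F x y) has_real_derivative G x y) (at y within {0..1})"
  by (simp add: has_dy_def)

section \<open>Averaging inequalities on the unit interval\<close>

lemma integral_deriv_01:
  fixes f :: "real \<Rightarrow> real"
  assumes "\<And>x. x \<in> {0..1} \<Longrightarrow> (f has_real_derivative f' x) (at x within {0..1})"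
    and "a \<in> {0..1}" "b \<in> {0..1}" "a \<le> b"
  shows "(f' has_integral f b - f a) {a..b}"
proof (rule fundamental_theorem_of_calculus)
  fix x assume "x \<in> {a..b}"
  then have "(f has_real_derivative f' x) (at x within {a..b})"
    using assms by (intro DERIV_subset[OF assms(1)]) auto
  then show "(f has_vector_derivative f' x) (at x within {a..b})"
    by (simp add: has_real_derivative_iff_has_vector_derivative)
qed (rule assms)

lemma sq_le_if_abs_le: "\<bar>a::real\<bar> \<le> M \<Longrightarrow> a\<^sup>2 \<le> M\<^sup>2"
  by (metis abs_ge_zero power2_abs power_mono)

text \<open>The integral of \<open>(f x - m)\<^sup>2\<close> about the mean \<open>m\<close> is
  nonnegative, and expanding it leaves the integral of the square minus
  \<open>m\<^sup>2\<close>.\<close>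

lemma integral_sq_le_01:
  fixes f :: "real \<Rightarrow> real"
  assumes "continuous_on {0..1} f"
  shows "(integral {0..1} f)\<^sup>2 \<le> integral {0..1} (\<lambda>x. (f x)\<^sup>2)"
proof -
  define m where "m = integral {0..1} f"
  have i: "f integrable_on {0..1}" "(\<lambda>x. (f x)\<^sup>2) integrable_on {0..1}"
    using assms by (auto intro!: integrable_continuous_interval continuous_intros)
  have "0 \<le> integral {0..1} (\<lambda>x. (f x - m)\<^sup>2)"
    using assms by (intro integral_nonneg integrable_continuous_interval continuous_intros) auto
  also have "(\<lambda>x. (f x - m)\<^sup>2) = (\<lambda>x. (f x)\<^sup>2 - (2 * m) * f x + m\<^sup>2)"
    by (auto simp: power2_eq_square algebra_simps)
  also have "integral {0..1} \<dots> = integral {0..1} (\<lambda>x. (f x)\<^sup>2 - (2 * m) * f x) + integral {0..1::real} (\<lambda>x. m\<^sup>2)"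
    by (rule integral_add) (use assms in \<open>auto intro!: integrable_continuous_interval continuous_intros\<close>)
  also have "integral {0..1} (\<lambda>x. (f x)\<^sup>2 - (2 * m) * f x) = integral {0..1} (\<lambda>x. (f x)\<^sup>2) - integral {0..1} (\<lambda>x. (2 * m) * f x)"
    by (rule integral_diff) (use assms in \<open>auto intro!: integrable_continuous_interval continuous_intros\<close>)
  also have "integral {0..1} (\<lambda>x. (2 * m) * f x) = 2 * m * m"
    by (simp add: m_def)
  finally show ?thesis by (simp add: power2_eq_square m_def)
qed

lemma integral_weighted_sq_le_01:
  fixes f r :: "real \<Rightarrow> real"
  assumes "continuous_on {0..1} f" "continuous_on {0..1} r"
    and "\<And>x. x \<in> {0..1} \<Longrightarrow> \<bar>r x\<bar> \<le> M"
  shows "(integral {0..1} (\<lambda>x. r x * f x))\<^sup>2 \<le> M\<^sup>2 * integral {0..1} (\<lambda>x. (f x)\<^sup>2)"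
proof -
  have "(integral {0..1} (\<lambda>x. r x * f x))\<^sup>2 \<le> integral {0..1} (\<lambda>x. (r x * f x)\<^sup>2)"
    using assms by (intro integral_sq_le_01 continuous_intros)
  also have "\<dots> \<le> integral {0..1} (\<lambda>x. M\<^sup>2 * (f x)\<^sup>2)"
    using assms
    by (intro integral_le integrable_continuous_interval continuous_intros)
      (auto simp: power_mult_distrib intro!: mult_right_mono sq_le_if_abs_le)
  finally show ?thesis by simp
qed

text \<open>Every oscillation is at most the integral of the absolute derivative over the whole
  interval, whose square is bounded by the mean of squares.\<close>

lemma diff_sq_le_integral_deriv_sq:
  fixes f :: "real \<Rightarrow> real"
  assumes d: "\<And>x. x \<in> {0..1} \<Longrightarrow> (f has_real_derivative f' x) (at x within {0..1})"
    and c: "continuous_on {0..1} f'" and ab: "a \<in> {0..1}" "b \<in> {0..1}"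
  shows "(f a - f b)\<^sup>2 \<le> integral {0..1} (\<lambda>x. (f' x)\<^sup>2)"
proof -
  have *: "\<bar>f b - f a\<bar> \<le> integral {0..1} (\<lambda>x. \<bar>f' x\<bar>)" if "a \<in> {0..1}" "b \<in> {0..1}" "a \<le> b" for a b
  proof -
    have ci: "(\<lambda>x. \<bar>f' x\<bar>) integrable_on {0..1}" "(\<lambda>x. \<bar>f' x\<bar>) integrable_on {a..b}"
      using c that
      by (auto intro!: integrable_continuous_interval continuous_intros continuous_on_subset[OF c])
    have "\<bar>f b - f a\<bar> = \<bar>integral {a..b} f'\<bar>"
      using integral_unique[OF integral_deriv_01[OF d that]] by simp
    also have "\<dots> \<le> integral {a..b} (\<lambda>x. \<bar>f' x\<bar>)"
    proof -
      have "f' integrable_on {a..b}"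
        using that by (intro integrable_continuous_interval continuous_on_subset[OF c]) auto
      then show ?thesis
        using integral_norm_bound_integral[of f' "{a..b}" "\<lambda>x. \<bar>f' x\<bar>"] ci by auto
    qed
    also have "\<dots> \<le> integral {0..1} (\<lambda>x. \<bar>f' x\<bar>)"
      using ci that by (intro integral_subset_le) auto
    finally show ?thesis .
  qed
  have "\<bar>f a - f b\<bar> \<le> integral {0..1} (\<lambda>x. \<bar>f' x\<bar>)"
    using *[of a b] *[of b a] ab by (cases "a \<le> b") (auto simp: abs_minus_commute)
  then have "(f a - f b)\<^sup>2 \<le> (integral {0..1} (\<lambda>x. \<bar>f' x\<bar>))\<^sup>2"
    by (metis abs_ge_zero power2_abs power_mono)
  also have "\<dots> \<le> integral {0..1} (\<lambda>x. \<bar>f' x\<bar>\<^sup>2)"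
    using c by (intro integral_sq_le_01 continuous_intros)
  finally show ?thesis by simp
qed

text \<open>All values of \<open>f\<close> lie within \<open>D\<close> of \<open>f a\<close>, hence
  so does every average of them. The weight is left free: \<open>rho\<close> and the constant 1 are
  both needed.\<close>

lemma diff_weighted_mean_sq_le:
  fixes f r :: "real \<Rightarrow> real"
  assumes d: "\<And>x. x \<in> {0..1} \<Longrightarrow> (f has_real_derivative f' x) (at x within {0..1})"
    and c: "continuous_on {0..1} f'" and r: "continuous_on {0..1} r"
    and r0: "\<And>x. x \<in> {0..1} \<Longrightarrow> r x \<ge> 0" and r1: "integral {0..1} r = 1" and a: "a \<in> {0..1}"
  shows "(f a - integral {0..1} (\<lambda>x. r x * f x))\<^sup>2 \<le> integral {0..1} (\<lambda>x. (f' x)\<^sup>2)"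
proof -
  define D where "D = sqrt (integral {0..1} (\<lambda>x. (f' x)\<^sup>2))"
  have D: "\<bar>f a - f b\<bar> \<le> D" if "b \<in> {0..1}" for b
    unfolding D_def using diff_sq_le_integral_deriv_sq[OF d c a that] by (simp add: real_le_rsqrt)
  have D': "f b \<le> f a + D" "f a - D \<le> f b" if "b \<in> {0..1}" for b
    using D[OF that] by linarith+
  have cf: "continuous_on {0..1} f"
    using d by (meson DERIV_continuous continuous_on_eq_continuous_within)
  have "integral {0..1} (\<lambda>x. r x * f x) \<le> integral {0..1} (\<lambda>x. r x * (f a + D))"
    by (intro integral_le integrable_continuous_interval continuous_intros cf r mult_left_mono D' r0)
  moreover have "integral {0..1} (\<lambda>x. r x * f x) \<ge> integral {0..1} (\<lambda>x. r x * (f a - D))"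
    by (intro integral_le integrable_continuous_interval continuous_intros cf r mult_left_mono D' r0)
  ultimately have "\<bar>f a - integral {0..1} (\<lambda>x. r x * f x)\<bar> \<le> D"
    using r1 by (auto simp: abs_le_iff)
  moreover have "D \<ge> 0" using D[OF a] by auto
  ultimately have "(f a - integral {0..1} (\<lambda>x. r x * f x))\<^sup>2 \<le> D\<^sup>2"
    by (metis abs_ge_zero power2_abs power_mono)
  also have "D\<^sup>2 = integral {0..1} (\<lambda>x. (f' x)\<^sup>2)"
    unfolding D_def using c by (intro real_sqrt_pow2 integral_nonneg integrable_continuous_interval continuous_intros) auto
  finally show ?thesis .
qed

section \<open>Poincare inequalities on the square\<close>

lemma sq_add_le: "((a::real) + b)\<^sup>2 \<le> 2 * a\<^sup>2 + 2 * b\<^sup>2"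
  using zero_le_power2[of "a - b"] by (simp add: power2_eq_square algebra_simps)

lemma sq_diff_le: "((a::real) - b)\<^sup>2 \<le> 2 * a\<^sup>2 + 2 * b\<^sup>2"
  using zero_le_power2[of "a + b"] by (simp add: power2_eq_square algebra_simps)

lemma int2_sq_add_le:
  assumes "cont2 F" "cont2 G"
  shows "int2 (\<lambda>x y. (F x y + G x y)\<^sup>2) \<le> 2 * int2 (\<lambda>x y. (F x y)\<^sup>2) + 2 * int2 (\<lambda>x y. (G x y)\<^sup>2)"
proof -
  have "int2 (\<lambda>x y. (F x y + G x y)\<^sup>2) \<le> int2 (\<lambda>x y. 2 * (F x y)\<^sup>2 + 2 * (G x y)\<^sup>2)"
    by (intro int2_mono cont2_intros assms sq_add_le)
  also have "\<dots> = 2 * int2 (\<lambda>x y. (F x y)\<^sup>2) + 2 * int2 (\<lambda>x y. (G x y)\<^sup>2)"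
    by (subst int2_add) (auto intro!: cont2_intros assms simp: int2_cmult)
  finally show ?thesis .
qed

lemma int2_sq_diff_le:
  assumes "cont2 F" "cont2 G"
  shows "int2 (\<lambda>x y. (F x y - G x y)\<^sup>2) \<le> 2 * int2 (\<lambda>x y. (F x y)\<^sup>2) + 2 * int2 (\<lambda>x y. (G x y)\<^sup>2)"
  using int2_sq_add_le[OF assms(1) cont2_minus[OF assms(2)]] by simp

lemma int2_sq_mult_le:
  assumes "cont2 F" "cont2 w" "\<And>x y. x \<in> {0..1} \<Longrightarrow> y \<in> {0..1} \<Longrightarrow> \<bar>w x y\<bar> \<le> M"
  shows "int2 (\<lambda>x y. (w x y * F x y)\<^sup>2) \<le> M\<^sup>2 * int2 (\<lambda>x y. (F x y)\<^sup>2)"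
proof -
  have "int2 (\<lambda>x y. (w x y * F x y)\<^sup>2) \<le> int2 (\<lambda>x y. M\<^sup>2 * (F x y)\<^sup>2)"
    using assms
    by (intro int2_mono cont2_intros)
      (auto simp: power_mult_distrib intro!: mult_right_mono sq_le_if_abs_le)
  then show ?thesis by (simp add: int2_cmult)
qed

lemma int2_sq_minus_mean_x_le:
  assumes F: "cont2 F" "cont2 G" "has_dx F G" and r: "continuous_on {0..1} r"
    "\<And>x. x \<in> {0..1} \<Longrightarrow> r x \<ge> 0" "integral {0..1} r = 1"
  shows "int2 (\<lambda>x y. (F x y - integral {0..1} (\<lambda>x. r x * F x y))\<^sup>2) \<le> int2 (\<lambda>x y. (G x y)\<^sup>2)"
proof -
  have c: "continuous_on {0..1} (\<lambda>y. integral {0..1} (\<lambda>x. r x * F x y))"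
    by (intro cont2_integral_x cont2_intros F cont2_x r)
  have c': "continuous_on {0..1} (\<lambda>y. integral {0..1} (\<lambda>x. (G x y)\<^sup>2))"
    by (intro cont2_integral_x cont2_intros F cont2_x r)
  have "int2 (\<lambda>x y. (F x y - integral {0..1} (\<lambda>x. r x * F x y))\<^sup>2)
      \<le> int2 (\<lambda>x y. integral {0..1} (\<lambda>x. (G x y)\<^sup>2))"
    using F by (intro int2_mono cont2_intros cont2_y[OF c] cont2_y[OF c'] diff_weighted_mean_sq_le r)
      (auto intro: has_dxD cont2_slice_x)
  also have "\<dots> = int2 (\<lambda>x y. (G x y)\<^sup>2)"
    by (simp add: int2_y[OF c'] int2_iterated' cont2_power F)
  finally show ?thesis .
qed

lemma int2_sq_minus_mean_y_le:
  assumes F: "cont2 F" "cont2 G" "has_dy F G"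
  shows "int2 (\<lambda>x y. (F x y - integral {0..1} (\<lambda>y. F x y))\<^sup>2) \<le> int2 (\<lambda>x y. (G x y)\<^sup>2)"
proof -
  have c: "cont2 (\<lambda>x y. (F x y - integral {0..1} (\<lambda>y. F x y))\<^sup>2)"
    by (intro cont2_intros F cont2_x cont2_integral_y)
  show ?thesis
    using int2_sq_minus_mean_x_le[OF cont2_swap[OF F(1)] cont2_swap[OF F(2)], of "\<lambda>x. 1"] F(3)
      int2_swap[OF c] int2_swap[OF cont2_power[OF F(2)], of 2]
    unfolding has_dy_swap[of F] by simp
qed

text \<open>With \<open>A x\<close> the mean over a vertical line, \<open>F - int2 F\<close> splits
  into \<open>F - A\<close>, controlled by the y-derivative, and \<open>A - int2 F\<close>,
  controlled by the x-derivative.\<close>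

lemma int2_sq_minus_mean_le:
  assumes F: "cont2 F" "cont2 Fx" "cont2 Fy" "has_dx F Fx" "has_dy F Fy"
  shows "int2 (\<lambda>x y. (F x y - int2 F)\<^sup>2) \<le> 2 * int2 (\<lambda>x y. (Fx x y)\<^sup>2) + 2 * int2 (\<lambda>x y. (Fy x y)\<^sup>2)"
proof -
  define A where "A = (\<lambda>x. integral {0..1} (\<lambda>y. F x y))"
  have cA: "continuous_on {0..1} A" unfolding A_def by (intro cont2_integral_y F)
  have dA: "(A has_real_derivative integral {0..1} (\<lambda>y. Fx x y)) (at x within {0..1})" if "x \<in> {0..1}" for x
    unfolding A_def using F that by (intro has_dx_integral_y)
  have cA': "continuous_on {0..1} (\<lambda>x. integral {0..1} (\<lambda>y. Fx x y))" by (intro cont2_integral_y F)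
  have A: "(A x - int2 F)\<^sup>2 \<le> int2 (\<lambda>x y. (Fx x y)\<^sup>2)" if "x \<in> {0..1}" for x
  proof -
    have "(A x - int2 F)\<^sup>2 \<le> integral {0..1} (\<lambda>x. (integral {0..1} (\<lambda>y. Fx x y))\<^sup>2)"
      using diff_weighted_mean_sq_le[OF dA cA', of "\<lambda>x. 1" x] that by (simp add: int2_iterated F A_def)
    also have "\<dots> \<le> integral {0..1} (\<lambda>x. integral {0..1} (\<lambda>y. (Fx x y)\<^sup>2))"
      using F by (intro integral_le integrable_continuous_interval continuous_intros cA' cont2_integral_y
        cont2_intros integral_sq_le_01 cont2_slice_y) auto
    also have "\<dots> = int2 (\<lambda>x y. (Fx x y)\<^sup>2)"
      by (simp add: int2_iterated cont2_power F)
    finally show ?thesis .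
  qed
  have c1: "cont2 (\<lambda>x y. F x y - A x)" "cont2 (\<lambda>x y. A x - int2 F)"
    by (intro cont2_intros F cont2_x[OF cA])+
  have "int2 (\<lambda>x y. (F x y - int2 F)\<^sup>2) = int2 (\<lambda>x y. ((F x y - A x) + (A x - int2 F))\<^sup>2)"
    by simp
  also have "\<dots> \<le> 2 * int2 (\<lambda>x y. (F x y - A x)\<^sup>2) + 2 * int2 (\<lambda>x y. (A x - int2 F)\<^sup>2)"
    by (intro int2_sq_add_le c1)
  also have "int2 (\<lambda>x y. (A x - int2 F)\<^sup>2) \<le> int2 (\<lambda>x y. int2 (\<lambda>x y. (Fx x y)\<^sup>2))"
    using A by (intro int2_mono cont2_intros c1) auto
  also have "int2 (\<lambda>x y. (F x y - A x)\<^sup>2) \<le> int2 (\<lambda>x y. (Fy x y)\<^sup>2)"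
    unfolding A_def by (intro int2_sq_minus_mean_y_le F)
  finally show ?thesis by simp
qed

section \<open>Korn's inequality on the unit square\<close>

definition C1sq :: "(real \<Rightarrow> real \<Rightarrow> real) \<Rightarrow> (real \<Rightarrow> real \<Rightarrow> real) \<Rightarrow> (real \<Rightarrow> real \<Rightarrow> real) \<Rightarrow> bool" where
  "C1sq F Fx Fy \<longleftrightarrow> cont2 F \<and> cont2 Fx \<and> cont2 Fy \<and> has_dx F Fx \<and> has_dy F Fy"

text \<open>One function serves as the mixed derivative in both orders; integrating the null form by
  parts produces it. Korn's inequality on the square asks for it in one of the two components
  only.\<close>

definition C11sq :: "(real \<Rightarrow> real \<Rightarrow> real) \<Rightarrow> (real \<Rightarrow> real \<Rightarrow> real) \<Rightarrow> (real \<Rightarrow> real \<Rightarrow> real)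
    \<Rightarrow> (real \<Rightarrow> real \<Rightarrow> real) \<Rightarrow> bool" where
  "C11sq F Fx Fy Fxy \<longleftrightarrow> C1sq F Fx Fy \<and> cont2 Fxy \<and> has_dy Fx Fxy \<and> has_dx Fy Fxy"

lemma C1sqD:
  assumes "C1sq F Fx Fy"
  shows "cont2 F" "cont2 Fx" "cont2 Fy" "has_dx F Fx" "has_dy F Fy"
  using assms by (auto simp: C1sq_def)

lemma C11sqD:
  assumes "C11sq F Fx Fy Fxy"
  shows "C1sq F Fx Fy" "cont2 F" "cont2 Fx" "cont2 Fy" "cont2 Fxy" "has_dx F Fx" "has_dy F Fy" "has_dy Fx Fxy" "has_dx Fy Fxy"
  using assms by (auto simp: C1sq_def C11sq_def)

lemma C1sq_swap: "C1sq F Fx Fy \<Longrightarrow> C1sq (\<lambda>x y. F y x) (\<lambda>x y. Fy y x) (\<lambda>x y. Fx y x)"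
  using cont2_swap[of F] cont2_swap[of Fx] cont2_swap[of Fy]
  by (auto simp: C1sq_def has_dx_def has_dy_def)

lemma C11sqI: "C1sq F Fx Fy \<Longrightarrow> cont2 Fxy \<Longrightarrow> has_dy Fx Fxy \<Longrightarrow> has_dx Fy Fxy \<Longrightarrow> C11sq F Fx Fy Fxy"
  by (simp add: C11sq_def)

section \<open>Distance to infinitesimal rotations in terms of the strain\<close>

lemma has_dy_integral_x:
  assumes "cont2 F" "cont2 G" "has_dy F G" "y \<in> {0..1}"
  shows "((\<lambda>y. integral {0..1} (\<lambda>x. F x y)) has_real_derivative integral {0..1} (\<lambda>x. G x y)) (at y within {0..1})"
  using has_dx_integral_y[OF cont2_swap[OF assms(1)] cont2_swap[OF assms(2)] _ assms(4)] assms(3)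
  unfolding has_dy_swap[of F] by simp

text \<open>The weight \<open>f\<close> vanishes at both ends, so no boundary value of
  \<open>F\<close> appears.\<close>

lemma integral_by_parts_x:
  fixes f f' :: "real \<Rightarrow> real"
  assumes f: "\<And>x. x \<in> {0..1} \<Longrightarrow> (f has_real_derivative f' x) (at x within {0..1})" "continuous_on {0..1} f'"
    and f0: "f 0 = 0" "f 1 = 0" and F: "cont2 F" "cont2 G" "has_dx F G" and y: "y \<in> {0..1}"
  shows "integral {0..1} (\<lambda>x. f x * G x y) = - integral {0..1} (\<lambda>x. f' x * F x y)"
proof -
  have cf: "continuous_on {0..1} f"
    using f by (meson DERIV_continuous continuous_on_eq_continuous_within)
  have "((\<lambda>x. f' x * F x y + f x * G x y) has_integral f 1 * F 1 y - f 0 * F 0 y) {0..1}"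
    by (rule integral_deriv_01) (auto intro!: derivative_eq_intros f has_dxD[OF F(3) _ y])
  then have "integral {0..1} (\<lambda>x. f' x * F x y + f x * G x y) = 0"
    by (simp add: integral_unique f0)
  moreover have "integral {0..1} (\<lambda>x. f' x * F x y + f x * G x y)
      = integral {0..1} (\<lambda>x. f' x * F x y) + integral {0..1} (\<lambda>x. f x * G x y)"
    by (intro integral_add integrable_continuous_interval continuous_intros f cf cont2_slice_x F y)
  ultimately show ?thesis by linarith
qed

text \<open>A quadratic weight of mass one vanishing at 0 and 1. Its maximum 3/2 and the bound 6 on
  its derivative are the source of the constants that follow.\<close>

definition rho :: "real \<Rightarrow> real" where "rho x = 6 * x * (1 - x)"

lemma rho_deriv: "(rho has_real_derivative 6 - 12 * x) (at x within A)"
  unfolding rho_def by (auto intro!: derivative_eq_intros simp: algebra_simps)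

lemma rho_cont: "continuous_on A rho"
  unfolding rho_def by (intro continuous_intros)

lemma rho_bounds: "x \<in> {0..1} \<Longrightarrow> 0 \<le> rho x \<and> rho x \<le> 3/2"
  using zero_le_power2[of "2 * x - 1"] by (auto simp: rho_def power2_eq_square algebra_simps mult_left_le)

lemma rho_integral: "integral {0..1} rho = 1"
proof -
  have "(rho has_integral ((\<lambda>x. 3 * x\<^sup>2 - 2 * x ^ 3) 1 - (\<lambda>x. 3 * x\<^sup>2 - 2 * x ^ 3) 0)) {0..1}"
    by (rule integral_deriv_01) (auto intro!: derivative_eq_intros simp: rho_def power2_eq_square algebra_simps)
  then show ?thesis by (simp add: integral_unique)
qed

text \<open>Averaging in x against a weight that vanishes at both ends replaces the shear by the other two
  strains, without boundary terms: this is what makes the bound independent of traces.\<close>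

lemma skew_L2_bound_aux:
  assumes a: "C1sq a ax ay" and b: "C1sq b bx by"
  defines "c \<equiv> int2 (\<lambda>x y. rho x * rho y * bx x y)"
  shows "\<exists>m. int2 (\<lambda>x y. (a x y - m + c * y)\<^sup>2)
    \<le> 150 * (int2 (\<lambda>x y. (ax x y)\<^sup>2) + int2 (\<lambda>x y. (by x y)\<^sup>2) + int2 (\<lambda>x y. (ay x y + bx x y)\<^sup>2))"
proof -
  note a = C1sqD[OF a] and b = C1sqD[OF b]
  note rc = rho_cont[of "{0..1}"]
  have r1c: "continuous_on {0..1} (\<lambda>x. 6 - 12 * x :: real)" by (intro continuous_intros)
  define A where "A = (\<lambda>y. integral {0..1} (\<lambda>x. rho x * a x y))"
  define A' where "A' = (\<lambda>y. integral {0..1} (\<lambda>x. rho x * ay x y))"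
  define D where "D = (\<lambda>y. integral {0..1} (\<lambda>x. rho x * bx x y))"
  define D' where "D' = (\<lambda>y. - integral {0..1} (\<lambda>x. (6 - 12 * x) * by x y))"
  define H where "H = (\<lambda>y. integral {0..1} (\<lambda>x. rho x * (ay x y + bx x y)))"
  have dA: "(A has_real_derivative A' y) (at y within {0..1})" if "y \<in> {0..1}" for y
    unfolding A_def A'_def using that a
    by (intro has_dy_integral_x cont2_intros cont2_x rc) (auto simp: has_dy_def intro!: derivative_eq_intros)
  \<comment> \<open>With the x-derivative moved onto the weight, the y-derivative of
    \<open>D\<close> involves \<open>by\<close> alone and no second derivative; hence
    \<open>D\<close> stays close to the constant \<open>c\<close>.\<close>
  have D_eq: "D y = - integral {0..1} (\<lambda>x. (6 - 12 * x) * b x y)" if "y \<in> {0..1}" for y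
    unfolding D_def using b that r1c by (intro integral_by_parts_x rho_deriv) (auto simp: rho_def)
  have dD: "(D has_real_derivative D' y) (at y within {0..1})" if "y \<in> {0..1}" for y
  proof -
    have "((\<lambda>y. integral {0..1} (\<lambda>x. (6 - 12 * x) * b x y)) has_real_derivative
        integral {0..1} (\<lambda>x. (6 - 12 * x) * by x y)) (at y within {0..1})"
      using that b by (intro has_dy_integral_x cont2_mult cont2_x r1c) (auto simp: has_dy_def intro!: derivative_eq_intros)
    from DERIV_minus[OF this] show ?thesis
      unfolding D'_def
      by (rule has_field_derivative_transform_within[where d=1]) (use that D_eq in auto)
  qed
  have cA': "continuous_on {0..1} A'" and cA: "continuous_on {0..1} A" and cD': "continuous_on {0..1} D'"
    and cD: "continuous_on {0..1} D" and cH: "continuous_on {0..1} H"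
    unfolding A_def A'_def D'_def D_def H_def
    by (intro continuous_intros cont2_integral_x cont2_intros cont2_x rc r1c a b)+
  have A'_eq: "A' y = H y - D y" if "y \<in> {0..1}" for y
  proof -
    have "H y = integral {0..1} (\<lambda>x. rho x * ay x y + rho x * bx x y)"
      by (simp add: H_def algebra_simps)
    also have "\<dots> = A' y + D y" unfolding A'_def D_def
      by (intro integral_add integrable_continuous_interval continuous_intros rc cont2_slice_x a b that)
    finally show ?thesis by simp
  qed
  have c_eq: "c = integral {0..1} (\<lambda>y. rho y * D y)"
  proof -
    have "c = integral {0..1} (\<lambda>y. integral {0..1} (\<lambda>x. rho y * (rho x * bx x y)))"
      unfolding c_def by (subst int2_iterated') (auto intro!: cont2_intros cont2_x cont2_y rc b simp: mult_ac)
    then show ?thesis by (simp add: D_def)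
  qed
  have Dc: "(D y - c)\<^sup>2 \<le> 36 * int2 (\<lambda>x y. (by x y)\<^sup>2)" if "y \<in> {0..1}" for y
  proof -
    have "(D y - c)\<^sup>2 \<le> integral {0..1} (\<lambda>y. (D' y)\<^sup>2)"
      unfolding c_eq using rho_bounds that
      by (intro diff_weighted_mean_sq_le dD cD' rc rho_integral) auto
    also have "\<dots> \<le> integral {0..1} (\<lambda>y. 6\<^sup>2 * integral {0..1} (\<lambda>x. (by x y)\<^sup>2))"
    proof (intro integral_le integrable_continuous_interval continuous_intros cD' cont2_integral_x cont2_intros b)
      fix y :: real assume y: "y \<in> {0..1}"
      have "(integral {0..1} (\<lambda>x. (6 - 12 * x) * by x y))\<^sup>2 \<le> 6\<^sup>2 * integral {0..1} (\<lambda>x. (by x y)\<^sup>2)"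
        by (intro integral_weighted_sq_le_01 cont2_slice_x b y r1c) auto
      then show "(D' y)\<^sup>2 \<le> 6\<^sup>2 * integral {0..1} (\<lambda>x. (by x y)\<^sup>2)"
        by (simp add: D'_def)
    qed
    also have "\<dots> = 36 * int2 (\<lambda>x y. (by x y)\<^sup>2)"
      by (simp add: int2_iterated' cont2_power b)
    finally show ?thesis .
  qed
  have H: "integral {0..1} (\<lambda>y. (H y)\<^sup>2) \<le> 9/4 * int2 (\<lambda>x y. (ay x y + bx x y)\<^sup>2)"
  proof -
    have "integral {0..1} (\<lambda>y. (H y)\<^sup>2) \<le> integral {0..1} (\<lambda>y. (3/2)\<^sup>2 * integral {0..1} (\<lambda>x. (ay x y + bx x y)\<^sup>2))"
      unfolding H_def
      by (intro integral_le integrable_continuous_interval continuous_intros cH[unfolded H_def] cont2_integral_x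
          cont2_intros a b integral_weighted_sq_le_01 rc cont2_slice_x) (use rho_bounds in auto)
    also have "\<dots> = 9/4 * int2 (\<lambda>x y. (ay x y + bx x y)\<^sup>2)"
      by (simp add: int2_iterated' cont2_power cont2_add a b power_divide)
    finally show ?thesis .
  qed
  \<comment> \<open>The derivative \<open>A' y + c\<close> equals \<open>H y - (D y - c)\<close>,
    which is controlled by the strain, so \<open>A y + c * y\<close> is nearly constant. The factor
    1 is the uniform weight of the averaging inequality.\<close>
  define m where "m = integral {0..1} (\<lambda>y. 1 * (A y + c * y))"
  have Ac: "(A y + c * y - m)\<^sup>2 \<le> 9/2 * int2 (\<lambda>x y. (ay x y + bx x y)\<^sup>2) + 72 * int2 (\<lambda>x y. (by x y)\<^sup>2)"
    if "y \<in> {0..1}" for y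
  proof -
    have "(A y + c * y - m)\<^sup>2 \<le> integral {0..1} (\<lambda>y. (A' y + c)\<^sup>2)"
      unfolding m_def using that
      by (intro diff_weighted_mean_sq_le continuous_intros cA') (auto intro!: derivative_eq_intros dA)
    also have "\<dots> \<le> integral {0..1} (\<lambda>y. 2 * (H y)\<^sup>2 + 72 * int2 (\<lambda>x y. (by x y)\<^sup>2))"
    proof (intro integral_le integrable_continuous_interval continuous_intros cA' cH)
      fix y :: real assume y: "y \<in> {0..1}"
      have "A' y + c = H y - (D y - c)" using A'_eq[OF y] by linarith
      then have "(A' y + c)\<^sup>2 = (H y - (D y - c))\<^sup>2" by (rule arg_cong)
      also have "\<dots> \<le> 2 * (H y)\<^sup>2 + 2 * (D y - c)\<^sup>2" by (rule sq_diff_le)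
      finally show "(A' y + c)\<^sup>2 \<le> 2 * (H y)\<^sup>2 + 72 * int2 (\<lambda>x y. (by x y)\<^sup>2)" using Dc[OF y] by linarith
    qed
    also have "\<dots> = integral {0..1} (\<lambda>y. 2 * (H y)\<^sup>2) + integral {0..1::real} (\<lambda>y. 72 * int2 (\<lambda>x y. (by x y)\<^sup>2))"
      by (intro integral_add integrable_continuous_interval continuous_intros cH)
    also have "\<dots> = 2 * integral {0..1} (\<lambda>y. (H y)\<^sup>2) + 72 * int2 (\<lambda>x y. (by x y)\<^sup>2)"
      by simp
    finally show ?thesis using H by linarith
  qed
  have c1: "cont2 (\<lambda>x y. a x y - A y)" "cont2 (\<lambda>x y. A y + c * y - m)"
    by (intro cont2_intros a cont2_y cA continuous_intros)+
  have "int2 (\<lambda>x y. (a x y - m + c * y)\<^sup>2) = int2 (\<lambda>x y. ((a x y - A y) + (A y + c * y - m))\<^sup>2)"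
    by (simp add: algebra_simps)
  also have "\<dots> \<le> 2 * int2 (\<lambda>x y. (a x y - A y)\<^sup>2) + 2 * int2 (\<lambda>x y. (A y + c * y - m)\<^sup>2)"
    by (intro int2_sq_add_le c1)
  also have "int2 (\<lambda>x y. (A y + c * y - m)\<^sup>2)
      \<le> int2 (\<lambda>x y. 9/2 * int2 (\<lambda>x y. (ay x y + bx x y)\<^sup>2) + 72 * int2 (\<lambda>x y. (by x y)\<^sup>2))"
    by (intro int2_mono cont2_intros c1 Ac)
  also have "int2 (\<lambda>x y. (a x y - A y)\<^sup>2) \<le> int2 (\<lambda>x y. (ax x y)\<^sup>2)"
    unfolding A_def using rho_bounds by (intro int2_sq_minus_mean_x_le a rc rho_integral) auto
  finally have "int2 (\<lambda>x y. (a x y - m + c * y)\<^sup>2) \<le> 2 * int2 (\<lambda>x y. (ax x y)\<^sup>2)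
      + 9 * int2 (\<lambda>x y. (ay x y + bx x y)\<^sup>2) + 144 * int2 (\<lambda>x y. (by x y)\<^sup>2)"
    by simp
  moreover have "int2 (\<lambda>x y. (ax x y)\<^sup>2) \<ge> 0" "int2 (\<lambda>x y. (by x y)\<^sup>2) \<ge> 0"
    "int2 (\<lambda>x y. (ay x y + bx x y)\<^sup>2) \<ge> 0"
    by (intro int2_sq_nonneg cont2_intros a b)+
  ultimately show ?thesis by (intro exI[of _ m]) argo
qed

text \<open>The one-component bound for (a, b) and for the transposed pair gives two rates c and d,
  the weighted means of \<open>bx\<close> and \<open>ay\<close>. Their sum is a weighted mean of the
  shear, so \<open>(c + d)\<^sup>2\<close> is at most (9/4)(9/4) E and d may be replaced by -c; 320
  exceeds 2 * 150 + 2 * 81/16.\<close>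

lemma skew_L2_bound:
  assumes a: "C1sq a ax ay" and b: "C1sq b bx by"
  defines "E \<equiv> int2 (\<lambda>x y. (ax x y)\<^sup>2) + int2 (\<lambda>x y. (by x y)\<^sup>2) + int2 (\<lambda>x y. (ay x y + bx x y)\<^sup>2)"
  shows "\<exists>l m c. int2 (\<lambda>x y. (a x y - l + c * y)\<^sup>2) \<le> 150 * E \<and> int2 (\<lambda>x y. (b x y - m - c * x)\<^sup>2) \<le> 320 * E"
proof -
  note a' = C1sqD[OF a] and b' = C1sqD[OF b]
  note rc = rho_cont[of "{0..1}"]
  define c where "c = int2 (\<lambda>x y. rho x * rho y * bx x y)"
  define d where "d = int2 (\<lambda>x y. rho x * rho y * ay x y)"
  have d_eq: "d = int2 (\<lambda>x y. rho x * rho y * ay y x)"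
  proof -
    have "cont2 (\<lambda>x y. rho x * rho y * ay x y)" by (intro cont2_intros cont2_x cont2_y rc a')
    from int2_swap[OF this] show ?thesis unfolding d_def by (simp add: mult.commute)
  qed
  obtain l where l: "int2 (\<lambda>x y. (a x y - l + c * y)\<^sup>2) \<le> 150 * E"
    using skew_L2_bound_aux[OF a b] unfolding E_def c_def by blast
  obtain m where m: "int2 (\<lambda>x y. (b y x - m + d * y)\<^sup>2) \<le> 150 * E"
  proof -
    have ch: "cont2 (\<lambda>x y. bx x y + ay x y)" by (intro cont2_intros a' b')
    have sw: "int2 (\<lambda>x y. (by y x)\<^sup>2) = int2 (\<lambda>x y. (by x y)\<^sup>2)"
      "int2 (\<lambda>x y. (ax y x)\<^sup>2) = int2 (\<lambda>x y. (ax x y)\<^sup>2)"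
      "int2 (\<lambda>x y. (bx y x + ay y x)\<^sup>2) = int2 (\<lambda>x y. (bx x y + ay x y)\<^sup>2)"
      using int2_swap[OF cont2_power[OF b'(3), of 2]] int2_swap[OF cont2_power[OF a'(2), of 2]]
        int2_swap[OF cont2_power[OF ch, of 2]] .
    have "E = int2 (\<lambda>x y. (by y x)\<^sup>2) + int2 (\<lambda>x y. (ax y x)\<^sup>2) + int2 (\<lambda>x y. (bx y x + ay y x)\<^sup>2)"
      unfolding sw E_def by (simp add: add.commute)
    then show ?thesis
      using skew_L2_bound_aux[OF C1sq_swap[OF b] C1sq_swap[OF a]] that
      unfolding d_eq[symmetric] by auto
  qed
  have m': "int2 (\<lambda>x y. (b x y - m + d * x)\<^sup>2) \<le> 150 * E"
  proof -
    have "cont2 (\<lambda>x y. (b x y - m + d * x)\<^sup>2)" by (intro cont2_intros b' cont2_x continuous_intros)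
    from int2_swap[OF this] m show ?thesis by linarith
  qed
  have ch: "cont2 (\<lambda>x y. ay x y + bx x y)" by (intro cont2_intros a' b')
  have cd: "(c + d)\<^sup>2 \<le> 81/16 * E"
  proof -
    have "c + d = int2 (\<lambda>x y. rho x * rho y * (ay x y + bx x y))"
      unfolding c_def d_def
      by (subst int2_add[symmetric]) (auto intro!: cont2_intros cont2_x cont2_y rc a' b' simp: algebra_simps)
    also have "\<dots> = integral {0..1} (\<lambda>x. integral {0..1} (\<lambda>y. rho x * (rho y * (ay x y + bx x y))))"
      by (subst int2_iterated) (auto intro!: cont2_intros cont2_x cont2_y rc a' b' simp: mult_ac)
    also have "\<dots> = integral {0..1} (\<lambda>x. rho x * integral {0..1} (\<lambda>y. rho y * (ay x y + bx x y)))"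
      by simp
    also have "(\<dots>)\<^sup>2 \<le> (3/2)\<^sup>2 * integral {0..1} (\<lambda>x. (integral {0..1} (\<lambda>y. rho y * (ay x y + bx x y)))\<^sup>2)"
      by (intro integral_weighted_sq_le_01 cont2_integral_y cont2_mult ch cont2_y rc) (use rho_bounds in auto)
    also have "integral {0..1} (\<lambda>x. (integral {0..1} (\<lambda>y. rho y * (ay x y + bx x y)))\<^sup>2)
        \<le> integral {0..1} (\<lambda>x. (3/2)\<^sup>2 * integral {0..1} (\<lambda>y. (ay x y + bx x y)\<^sup>2))"
      by (intro integral_le integrable_continuous_interval continuous_on_power continuous_on_mult continuous_on_const
          cont2_integral_y cont2_mult cont2_power ch integral_weighted_sq_le_01 rc cont2_y cont2_slice_y[OF ch]) (use rho_bounds in auto)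
    also have "\<dots> = 9/4 * int2 (\<lambda>x y. (ay x y + bx x y)\<^sup>2)"
      by (simp add: int2_iterated cont2_power ch power_divide)
    finally have "(c + d)\<^sup>2 \<le> 81/16 * int2 (\<lambda>x y. (ay x y + bx x y)\<^sup>2)"
      by (simp add: power2_eq_square)
    moreover have "int2 (\<lambda>x y. (ax x y)\<^sup>2) \<ge> 0" "int2 (\<lambda>x y. (by x y)\<^sup>2) \<ge> 0"
      by (intro int2_sq_nonneg a' b')+
    ultimately show ?thesis unfolding E_def by argo
  qed
  have c1: "cont2 (\<lambda>x y. b x y - m + d * x)" "cont2 (\<lambda>x y. (c + d) * x)"
    by (intro cont2_intros b' cont2_x continuous_intros)+
  have "int2 (\<lambda>x y. (b x y - m - c * x)\<^sup>2) = int2 (\<lambda>x y. ((b x y - m + d * x) - (c + d) * x)\<^sup>2)"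
    by (simp add: algebra_simps)
  also have "\<dots> \<le> 2 * int2 (\<lambda>x y. (b x y - m + d * x)\<^sup>2) + 2 * int2 (\<lambda>x y. ((c + d) * x)\<^sup>2)"
    by (rule int2_sq_diff_le[OF c1])
  also have "int2 (\<lambda>x y. ((c + d) * x)\<^sup>2) \<le> int2 (\<lambda>x y. (c + d)\<^sup>2)"
    by (intro int2_mono cont2_intros c1) (auto simp: power_mult_distrib mult_left_le power_le_one)
  finally have "int2 (\<lambda>x y. (b x y - m - c * x)\<^sup>2) \<le> 2 * (150 * E) + 2 * (81/16 * E)"
    using m' cd by simp
  moreover have "E \<ge> 0"
  proof -
    have "0 \<le> 81/16 * E" using cd zero_le_power2[of "c + d"] by linarith
    then show ?thesis by simp
  qed
  ultimately have "int2 (\<lambda>x y. (b x y - m - c * x)\<^sup>2) \<le> 320 * E" by argo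
  with l show ?thesis by blast
qed

section \<open>Dilated copies towards an edge\<close>

definition sy :: "real \<Rightarrow> real \<Rightarrow> (real \<Rightarrow> real \<Rightarrow> real) \<Rightarrow> real \<Rightarrow> real \<Rightarrow> real" where
  "sy p q F = (\<lambda>x y. p * F x y + q * F x (3/4 * y))"

definition sx :: "real \<Rightarrow> real \<Rightarrow> (real \<Rightarrow> real \<Rightarrow> real) \<Rightarrow> real \<Rightarrow> real \<Rightarrow> real" where
  "sx p q F = (\<lambda>x y. p * F x y + q * F (3/4 * x) y)"

lemma cont2_scale_y: "cont2 F \<Longrightarrow> cont2 (\<lambda>x y. F x (3/4 * y))"
  by (rule cont2_compose[where f="\<lambda>x y. x" and g="\<lambda>x y. 3/4 * y"])
    (auto intro!: cont2_x cont2_y continuous_intros)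

lemma cont2_scale_x: "cont2 F \<Longrightarrow> cont2 (\<lambda>x y. F (3/4 * x) y)"
  by (rule cont2_compose[where f="\<lambda>x y. 3/4 * x" and g="\<lambda>x y. y"])
    (auto intro!: cont2_x cont2_y continuous_intros)

lemma cont2_sy: "cont2 F \<Longrightarrow> cont2 (sy p q F)"
  unfolding sy_def by (intro cont2_intros cont2_scale_y)

lemma cont2_sx: "cont2 F \<Longrightarrow> cont2 (sx p q F)"
  unfolding sx_def by (intro cont2_intros cont2_scale_x)

lemma deriv_scale_01:
  fixes f :: "real \<Rightarrow> real"
  assumes "\<And>x. x \<in> {0..1} \<Longrightarrow> (f has_real_derivative f' x) (at x within {0..1})" "x \<in> {0..1}"
  shows "((\<lambda>x. f (3/4 * x)) has_real_derivative 3/4 * f' (3/4 * x)) (at x within {0..1})"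
proof -
  have "(f has_real_derivative f' (3/4 * x)) (at (3/4 * x) within (\<lambda>x. 3/4 * x) ` {0..1})"
    using assms(2) by (intro DERIV_subset[OF assms(1)]) auto
  moreover have "((\<lambda>x. 3/4 * x) has_real_derivative 3/4) (at x within {0..1})"
    by (auto intro!: derivative_eq_intros)
  ultimately have "(f \<circ> (\<lambda>x. 3/4 * x) has_real_derivative f' (3/4 * x) * (3/4)) (at x within {0..1})"
    by (rule DERIV_image_chain)
  then show ?thesis by (simp add: o_def mult.commute)
qed

lemma has_dx_sx: "has_dx F G \<Longrightarrow> has_dx (sx p q F) (sx p (3/4 * q) G)"
  unfolding has_dx_def sx_def
  by (auto intro!: derivative_eq_intros deriv_scale_01[where f'="\<lambda>x. G x y" for y] simp del: times_divide_eq_left)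

lemma has_dy_sy: "has_dy F G \<Longrightarrow> has_dy (sy p q F) (sy p (3/4 * q) G)"
  unfolding has_dy_def sy_def
  by (auto intro!: derivative_eq_intros deriv_scale_01[where f'="G x" for x] simp del: times_divide_eq_left)

lemma has_dy_sx: "has_dy F G \<Longrightarrow> has_dy (sx p q F) (sx p q G)"
  unfolding has_dy_def sx_def by (auto intro!: derivative_eq_intros)

lemma has_dx_sy: "has_dx F G \<Longrightarrow> has_dx (sy p q F) (sy p q G)"
  unfolding has_dx_def sy_def by (auto intro!: derivative_eq_intros)

text \<open>Differentiating in the dilated variable multiplies the second coefficient by 3/4,
  differentiating in the other variable does not. This asymmetry is what later changes the sign
  between \<open>ay\<close> and \<open>bx\<close>.\<close>

lemma C1sq_sx: "C1sq F Fx Fy \<Longrightarrow> C1sq (sx p q F) (sx p (3/4 * q) Fx) (sx p q Fy)"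
  unfolding C1sq_def by (intro conjI cont2_sx has_dx_sx has_dy_sx) auto

lemma C1sq_sy: "C1sq F Fx Fy \<Longrightarrow> C1sq (sy p q F) (sy p q Fx) (sy p (3/4 * q) Fy)"
  unfolding C1sq_def by (intro conjI cont2_sy has_dx_sy has_dy_sy) auto

lemma C11sq_sx: "C11sq F Fx Fy Fxy \<Longrightarrow> C11sq (sx p q F) (sx p (3/4 * q) Fx) (sx p q Fy) (sx p (3/4 * q) Fxy)"
  unfolding C11sq_def by (intro conjI C1sq_sx cont2_sx has_dx_sx has_dy_sx) auto

lemma C11sq_sy: "C11sq F Fx Fy Fxy \<Longrightarrow> C11sq (sy p q F) (sy p q Fx) (sy p (3/4 * q) Fy) (sy p (3/4 * q) Fxy)"
  unfolding C11sq_def by (intro conjI C1sq_sy cont2_sy has_dx_sy has_dy_sy) auto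

text \<open>Substitution turns the left side into 4/3 times the integral over
  \<open>{0..3/4}\<close>, and \<open>f\<close> is nonnegative on the rest.\<close>

lemma integral_scale_le:
  fixes f :: "real \<Rightarrow> real"
  assumes "continuous_on {0..1} f" "\<And>x. x \<in> {0..1} \<Longrightarrow> f x \<ge> 0"
  shows "integral {0..1} (\<lambda>x. f (3/4 * x)) \<le> 4/3 * integral {0..1} f"
proof -
  have i: "f integrable_on {0..3/4}" "f integrable_on {0..1}"
    using assms(1) by (auto intro!: integrable_continuous_interval continuous_on_subset[OF assms(1)])
  have "((\<lambda>x. f (3/4 * x)) has_integral 4/3 * integral {0..3/4} f) {0..1}"
    using has_integral_affinity'[of f "integral {0..3/4} f" 0 "3/4" "3/4" 0] i integrable_integral[OF i(1)]
    by simp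
  then have "integral {0..1} (\<lambda>x. f (3/4 * x)) = 4/3 * integral {0..3/4} f"
    by (rule integral_unique)
  also have "\<dots> \<le> 4/3 * integral {0..1} f"
    using i assms(2) by (intro mult_left_mono integral_subset_le) auto
  finally show ?thesis .
qed

lemma int2_scale_y_le:
  assumes F: "cont2 F" "\<And>x y. x \<in> {0..1} \<Longrightarrow> y \<in> {0..1} \<Longrightarrow> F x y \<ge> 0"
  shows "int2 (\<lambda>x y. F x (3/4 * y)) \<le> 4/3 * int2 F"
proof -
  have "int2 (\<lambda>x y. F x (3/4 * y)) = integral {0..1} (\<lambda>x. integral {0..1} (\<lambda>y. F x (3/4 * y)))"
    by (intro int2_iterated cont2_scale_y F)
  also have "\<dots> \<le> integral {0..1} (\<lambda>x. 4/3 * integral {0..1} (\<lambda>y. F x y))"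
    by (intro integral_le integrable_continuous_interval cont2_integral_y cont2_scale_y F continuous_intros
        integral_scale_le cont2_slice_y)
  finally show ?thesis by (simp add: int2_iterated F)
qed

lemma int2_scale_x_le:
  assumes F: "cont2 F" "\<And>x y. x \<in> {0..1} \<Longrightarrow> y \<in> {0..1} \<Longrightarrow> F x y \<ge> 0"
  shows "int2 (\<lambda>x y. F (3/4 * x) y) \<le> 4/3 * int2 F"
  using int2_scale_y_le[OF cont2_swap[OF F(1)]] int2_swap[OF cont2_scale_x[OF F(1)]] int2_swap[OF F(1)] F(2)
  by auto

lemma int2_sq_sy_le:
  assumes F: "cont2 F" and pq: "\<bar>p\<bar> \<le> 7" "\<bar>q\<bar> \<le> 8"
  shows "int2 (\<lambda>x y. (sy p q F x y)\<^sup>2) \<le> 300 * int2 (\<lambda>x y. (F x y)\<^sup>2)"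
proof -
  have "int2 (\<lambda>x y. (sy p q F x y)\<^sup>2) \<le> 2 * int2 (\<lambda>x y. (p * F x y)\<^sup>2) + 2 * int2 (\<lambda>x y. (q * F x (3/4 * y))\<^sup>2)"
    unfolding sy_def by (intro int2_sq_add_le cont2_intros cont2_scale_y F)
  also have "int2 (\<lambda>x y. (p * F x y)\<^sup>2) \<le> 7\<^sup>2 * int2 (\<lambda>x y. (F x y)\<^sup>2)"
    by (intro int2_sq_mult_le cont2_intros F pq)
  also have "int2 (\<lambda>x y. (q * F x (3/4 * y))\<^sup>2) \<le> 8\<^sup>2 * int2 (\<lambda>x y. (F x (3/4 * y))\<^sup>2)"
    by (intro int2_sq_mult_le cont2_intros F pq cont2_scale_y)
  also have "int2 (\<lambda>x y. (F x (3/4 * y))\<^sup>2) \<le> 4/3 * int2 (\<lambda>x y. (F x y)\<^sup>2)"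
    by (intro int2_scale_y_le[where F="\<lambda>x y. (F x y)\<^sup>2"] cont2_intros F) auto
  \<comment> \<open>The sum is 2 * 49 + 2 * 64 * 4/3, which is below 300.\<close>
  finally show ?thesis using int2_sq_nonneg[OF F] by auto
qed

lemma int2_sq_sx_le:
  assumes F: "cont2 F" and pq: "\<bar>p\<bar> \<le> 7" "\<bar>q\<bar> \<le> 8"
  shows "int2 (\<lambda>x y. (sx p q F x y)\<^sup>2) \<le> 300 * int2 (\<lambda>x y. (F x y)\<^sup>2)"
proof -
  have "int2 (\<lambda>x y. (sx p q F x y)\<^sup>2) \<le> 2 * int2 (\<lambda>x y. (p * F x y)\<^sup>2) + 2 * int2 (\<lambda>x y. (q * F (3/4 * x) y)\<^sup>2)"
    unfolding sx_def by (intro int2_sq_add_le cont2_intros cont2_scale_x F)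
  also have "int2 (\<lambda>x y. (p * F x y)\<^sup>2) \<le> 7\<^sup>2 * int2 (\<lambda>x y. (F x y)\<^sup>2)"
    by (intro int2_sq_mult_le cont2_intros F pq)
  also have "int2 (\<lambda>x y. (q * F (3/4 * x) y)\<^sup>2) \<le> 8\<^sup>2 * int2 (\<lambda>x y. (F (3/4 * x) y)\<^sup>2)"
    by (intro int2_sq_mult_le cont2_intros F pq cont2_scale_x)
  also have "int2 (\<lambda>x y. (F (3/4 * x) y)\<^sup>2) \<le> 4/3 * int2 (\<lambda>x y. (F x y)\<^sup>2)"
    by (intro int2_scale_x_le[where F="\<lambda>x y. (F x y)\<^sup>2"] cont2_intros F) auto
  finally show ?thesis using int2_sq_nonneg[OF F] by auto
qed

text \<open>Adding \<open>a * bxy\<close> to each of the two products makes them the exact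
  derivatives of \<open>a * bx\<close> in y and of \<open>a * by\<close> in x; the mixed terms
  cancel in the difference.\<close>

lemma null_form_boundary:
  assumes a: "C1sq a ax ay" and b: "C11sq b bx by bxy"
    and a0: "\<And>x. x \<in> {0..1} \<Longrightarrow> a x 1 = 0" "\<And>y. y \<in> {0..1} \<Longrightarrow> a 1 y = 0"
  shows "int2 (\<lambda>x y. ay x y * bx x y - ax x y * by x y)
    = integral {0..1} (\<lambda>y. a 0 y * by 0 y) - integral {0..1} (\<lambda>x. a x 0 * bx x 0)"
proof -
  note a = C1sqD[OF a] and b = C11sqD[OF b]
  have 1: "integral {0..1} (\<lambda>y. ay x y * bx x y + a x y * bxy x y) = - (a x 0 * bx x 0)" if x: "x \<in> {0..1}" for x
  proof (rule integral_unique)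
    have "((\<lambda>y. ay x y * bx x y + a x y * bxy x y) has_integral a x 1 * bx x 1 - a x 0 * bx x 0) {0..1}"
      by (rule integral_deriv_01) (auto intro!: derivative_eq_intros has_dyD[OF a(5) x] has_dyD[OF b(8) x])
    then show "((\<lambda>y. ay x y * bx x y + a x y * bxy x y) has_integral - (a x 0 * bx x 0)) {0..1}"
      using a0(1)[OF x] by simp
  qed
  have 2: "integral {0..1} (\<lambda>x. ax x y * by x y + a x y * bxy x y) = - (a 0 y * by 0 y)" if y: "y \<in> {0..1}" for y
  proof (rule integral_unique)
    have "((\<lambda>x. ax x y * by x y + a x y * bxy x y) has_integral a 1 y * by 1 y - a 0 y * by 0 y) {0..1}"
      by (rule integral_deriv_01) (auto intro!: derivative_eq_intros has_dxD[OF a(4) _ y] has_dxD[OF b(9) _ y])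
    then show "((\<lambda>x. ax x y * by x y + a x y * bxy x y) has_integral - (a 0 y * by 0 y)) {0..1}"
      using a0(2)[OF y] by simp
  qed
  have "int2 (\<lambda>x y. ay x y * bx x y + a x y * bxy x y) = integral {0..1} (\<lambda>x. - (a x 0 * bx x 0))"
    using 1 by (subst int2_iterated) (intro cont2_intros a b integral_cong; simp)+
  moreover have "int2 (\<lambda>x y. ax x y * by x y + a x y * bxy x y) = integral {0..1} (\<lambda>y. - (a 0 y * by 0 y))"
    using 2 by (subst int2_iterated') (intro cont2_intros a b integral_cong; simp)+
  moreover have "int2 (\<lambda>x y. ay x y * bx x y - ax x y * by x y)
     = int2 (\<lambda>x y. (ay x y * bx x y + a x y * bxy x y) - (ax x y * by x y + a x y * bxy x y))"
    by simp
  moreover have "\<dots> = int2 (\<lambda>x y. ay x y * bx x y + a x y * bxy x y) - int2 (\<lambda>x y. ax x y * by x y + a x y * bxy x y)"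
    by (intro int2_diff cont2_intros a b)
  ultimately show ?thesis by simp
qed

text \<open>Pointwise, \<open>2 * ay * bx\<close> is the square of the shear minus the two
  off-diagonal squares, and \<open>- 2 * ax * by\<close> is at most the sum of the diagonal
  squares.\<close>

lemma null_form_le_plus:
  assumes "cont2 ax" "cont2 ay" "cont2 bx" "cont2 by"
  shows "2 * int2 (\<lambda>x y. ay x y * bx x y - ax x y * by x y)
    \<le> int2 (\<lambda>x y. (ay x y + bx x y)\<^sup>2) + int2 (\<lambda>x y. (ax x y)\<^sup>2) + int2 (\<lambda>x y. (by x y)\<^sup>2)
      - int2 (\<lambda>x y. (ay x y)\<^sup>2 + (bx x y)\<^sup>2)"
proof -
  have c: "cont2 (\<lambda>x y. (ay x y + bx x y)\<^sup>2)" "cont2 (\<lambda>x y. (ax x y)\<^sup>2)" "cont2 (\<lambda>x y. (by x y)\<^sup>2)"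
    "cont2 (\<lambda>x y. (ay x y)\<^sup>2 + (bx x y)\<^sup>2)"
    by (intro cont2_intros assms)+
  have "2 * int2 (\<lambda>x y. ay x y * bx x y - ax x y * by x y) = int2 (\<lambda>x y. 2 * (ay x y * bx x y - ax x y * by x y))"
    by (rule int2_cmult[symmetric])
  also have "\<dots> \<le> int2 (\<lambda>x y. (ay x y + bx x y)\<^sup>2 + (ax x y)\<^sup>2 + (by x y)\<^sup>2 - ((ay x y)\<^sup>2 + (bx x y)\<^sup>2))"
  proof (intro int2_mono cont2_intros assms)
    fix x y
    show "2 * (ay x y * bx x y - ax x y * by x y)
      \<le> (ay x y + bx x y)\<^sup>2 + (ax x y)\<^sup>2 + (by x y)\<^sup>2 - ((ay x y)\<^sup>2 + (bx x y)\<^sup>2)"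
      using zero_le_power2[of "ax x y + by x y"] by (simp add: power2_eq_square algebra_simps)
  qed
  also have "\<dots> = int2 (\<lambda>x y. (ay x y + bx x y)\<^sup>2) + int2 (\<lambda>x y. (ax x y)\<^sup>2) + int2 (\<lambda>x y. (by x y)\<^sup>2)
      - int2 (\<lambda>x y. (ay x y)\<^sup>2 + (bx x y)\<^sup>2)"
    using int2_diff[OF cont2_add[OF cont2_add[OF c(1) c(2)] c(3)] c(4)]
      int2_add[OF cont2_add[OF c(1) c(2)] c(3)] int2_add[OF c(1) c(2)] by simp
  finally show ?thesis .
qed

text \<open>Changing the sign of b changes the sign of the null form and turns the shear into a
  difference.\<close>

lemma null_form_le_minus:
  assumes "cont2 ax" "cont2 ay" "cont2 bx" "cont2 by"
  shows "- 2 * int2 (\<lambda>x y. ay x y * bx x y - ax x y * by x y)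
    \<le> int2 (\<lambda>x y. (ay x y - bx x y)\<^sup>2) + int2 (\<lambda>x y. (ax x y)\<^sup>2) + int2 (\<lambda>x y. (by x y)\<^sup>2)
      - int2 (\<lambda>x y. (ay x y)\<^sup>2 + (bx x y)\<^sup>2)"
proof -
  have "int2 (\<lambda>x y. ay x y * - bx x y - ax x y * - by x y) = - int2 (\<lambda>x y. ay x y * bx x y - ax x y * by x y)"
    by (subst int2_minus[symmetric]) simp
  then show ?thesis
    using null_form_le_plus[OF assms(1,2) cont2_minus[OF assms(3)] cont2_minus[OF assms(4)]] by simp
qed

text \<open>The null form depends only on boundary values. The coefficients (-7, 8) and (7, -6) each
  sum to 1, which keeps the trace on the line y = 0 or x = 0, and 8 * 3/4 = 6 turns the shear ay + bx into
  ay - bx; summing the null form over the four combinations with alternating signs cancels all traces.\<close>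

lemma korn_corner:
  assumes a: "C1sq a ax ay" and b: "C11sq b bx by bxy"
    and a0: "\<And>x y. x \<in> {0..1} \<Longrightarrow> y \<in> {3/4..1} \<Longrightarrow> a x y = 0"
      "\<And>x y. x \<in> {3/4..1} \<Longrightarrow> y \<in> {0..1} \<Longrightarrow> a x y = 0"
  defines "E \<equiv> int2 (\<lambda>x y. (ax x y)\<^sup>2) + int2 (\<lambda>x y. (by x y)\<^sup>2) + int2 (\<lambda>x y. (ay x y + bx x y)\<^sup>2)"
  shows "int2 (\<lambda>x y. (ay x y)\<^sup>2 + (bx x y)\<^sup>2) \<le> 100000 * E"
proof -
  note ac = C1sqD[OF a] and bc = C11sqD[OF b]
  note a1 = C1sq_sy[OF a, of "-7" 8] and b1 = C11sq_sy[OF b, of 7 "-6"]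
  note a2 = C1sq_sx[OF a, of 7 "-6"] and b2 = C11sq_sx[OF b, of "-7" 8]
  note a3 = C1sq_sx[OF a1, of 7 "-6"] and b3 = C11sq_sx[OF b1, of "-7" 8]
  note bd0 = null_form_boundary[OF a b]
  note bd1 = null_form_boundary[OF a1 b1]
  note bd2 = null_form_boundary[OF a2 b2]
  note bd3 = null_form_boundary[OF a3 b3]
  define h where "h = (\<lambda>x y. ay x y + bx x y)"
  have hc: "cont2 h" unfolding h_def by (intro cont2_intros ac bc)
  define B1 where "B1 = int2 (\<lambda>x y. sy (-7) 6 ay x y * sy 7 (-6) bx x y - sy (-7) 8 ax x y * sy 7 (-9/2) by x y)"
  define B2 where "B2 = int2 (\<lambda>x y. sx 7 (-6) ay x y * sx (-7) 6 bx x y - sx 7 (-9/2) ax x y * sx (-7) 8 by x y)"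
  define B3 where "B3 = int2 (\<lambda>x y. sx 7 (-6) (sy (-7) 6 ay) x y * sx (-7) 6 (sy 7 (-6) bx) x y
      - sx 7 (-9/2) (sy (-7) 8 ax) x y * sx (-7) 8 (sy 7 (-9/2) by) x y)"
  define B0 where "B0 = int2 (\<lambda>x y. ay x y * bx x y - ax x y * by x y)"
  \<comment> \<open>A dilation moves the far edge to 3/4, where \<open>a\<close> already vanishes;
    this is why vanishing is required on the whole range from 3/4 to 1 and not just at 1.\<close>
  have sum: "B0 - B1 - B2 + B3 = 0"
  proof -
    have "B0 = integral {0..1} (\<lambda>y. a 0 y * by 0 y) - integral {0..1} (\<lambda>x. a x 0 * bx x 0)"
      unfolding B0_def by (rule bd0) (use a0 in auto)
    moreover have "B1 = integral {0..1} (\<lambda>y. sy (-7) 8 a 0 y * sy 7 (-9/2) by 0 y) - integral {0..1} (\<lambda>x. a x 0 * bx x 0)"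
      using bd1 a0 unfolding B1_def by (simp add: sy_def)
    moreover have "B2 = integral {0..1} (\<lambda>y. a 0 y * by 0 y) - integral {0..1} (\<lambda>x. sx 7 (-6) a x 0 * sx (-7) 6 bx x 0)"
      using bd2 a0 unfolding B2_def by (simp add: sx_def)
    moreover have "B3 = integral {0..1} (\<lambda>y. sy (-7) 8 a 0 y * sy 7 (-9/2) by 0 y) - integral {0..1} (\<lambda>x. sx 7 (-6) a x 0 * sx (-7) 6 bx x 0)"
      using bd3 a0 unfolding B3_def by (simp add: sx_def sy_def)
    ultimately show ?thesis by simp
  qed
  have Np: "int2 (\<lambda>x y. (p x y)\<^sup>2 + (q x y)\<^sup>2) \<ge> 0" if "cont2 p" "cont2 q" for p q
    using that by (intro int2_nonneg cont2_intros) auto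
  \<comment> \<open>One dilation turns the shear into a difference and the second turns it back into
    a sum. So \<open>B1\<close> and \<open>B2\<close> can be bounded from below, \<open>B0\<close>
    and \<open>B3\<close> from above, exactly the signs with which they enter the alternating
    sum.\<close>
  have h1: "(\<lambda>x y. sy (-7) 6 ay x y - sy 7 (-6) bx x y) = sy (-7) 6 h"
    by (auto simp: sy_def h_def algebra_simps)
  have h2: "(\<lambda>x y. sx 7 (-6) ay x y - sx (-7) 6 bx x y) = sx 7 (-6) h"
    by (auto simp: sx_def h_def algebra_simps)
  have h3: "(\<lambda>x y. sx 7 (-6) (sy (-7) 6 ay) x y + sx (-7) 6 (sy 7 (-6) bx) x y) = sx 7 (-6) (sy (-7) 6 h)"
    by (auto simp: sx_def sy_def h_def algebra_simps)
  have 0: "2 * B0 \<le> E - int2 (\<lambda>x y. (ay x y)\<^sup>2 + (bx x y)\<^sup>2)"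
    unfolding B0_def E_def using null_form_le_plus[OF ac(2,3) bc(3,4)] by simp
  have 1: "- 2 * B1 \<le> 300 * E"
  proof -
    have "- 2 * B1 \<le> int2 (\<lambda>x y. (sy (-7) 6 h x y)\<^sup>2) + int2 (\<lambda>x y. (sy (-7) 8 ax x y)\<^sup>2) + int2 (\<lambda>x y. (sy 7 (-9/2) by x y)\<^sup>2)
        - int2 (\<lambda>x y. (sy (-7) 6 ay x y)\<^sup>2 + (sy 7 (-6) bx x y)\<^sup>2)"
      unfolding B1_def fun_cong[OF fun_cong[OF h1], symmetric]
      by (intro null_form_le_minus cont2_sy ac bc)
    also have "\<dots> \<le> int2 (\<lambda>x y. (sy (-7) 6 h x y)\<^sup>2) + int2 (\<lambda>x y. (sy (-7) 8 ax x y)\<^sup>2) + int2 (\<lambda>x y. (sy 7 (-9/2) by x y)\<^sup>2)"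
      using Np[OF cont2_sy[OF ac(3)] cont2_sy[OF bc(3)]] by simp
    also have "\<dots> \<le> 300 * int2 (\<lambda>x y. (h x y)\<^sup>2) + 300 * int2 (\<lambda>x y. (ax x y)\<^sup>2) + 300 * int2 (\<lambda>x y. (by x y)\<^sup>2)"
      by (intro add_mono int2_sq_sy_le hc ac bc) auto
    finally show ?thesis unfolding E_def h_def by simp
  qed
  have 2: "- 2 * B2 \<le> 300 * E"
  proof -
    have "- 2 * B2 \<le> int2 (\<lambda>x y. (sx 7 (-6) h x y)\<^sup>2) + int2 (\<lambda>x y. (sx 7 (-9/2) ax x y)\<^sup>2) + int2 (\<lambda>x y. (sx (-7) 8 by x y)\<^sup>2)
        - int2 (\<lambda>x y. (sx 7 (-6) ay x y)\<^sup>2 + (sx (-7) 6 bx x y)\<^sup>2)"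
      unfolding B2_def fun_cong[OF fun_cong[OF h2], symmetric]
      by (intro null_form_le_minus cont2_sx ac bc)
    also have "\<dots> \<le> int2 (\<lambda>x y. (sx 7 (-6) h x y)\<^sup>2) + int2 (\<lambda>x y. (sx 7 (-9/2) ax x y)\<^sup>2) + int2 (\<lambda>x y. (sx (-7) 8 by x y)\<^sup>2)"
      using Np[OF cont2_sx[OF ac(3)] cont2_sx[OF bc(3)]] by simp
    also have "\<dots> \<le> 300 * int2 (\<lambda>x y. (h x y)\<^sup>2) + 300 * int2 (\<lambda>x y. (ax x y)\<^sup>2) + 300 * int2 (\<lambda>x y. (by x y)\<^sup>2)"
      by (intro add_mono int2_sq_sx_le hc ac bc) auto
    finally show ?thesis unfolding E_def h_def by simp
  qed
  have 3: "2 * B3 \<le> 90000 * E"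
  proof -
    have "2 * B3 \<le> int2 (\<lambda>x y. (sx 7 (-6) (sy (-7) 6 h) x y)\<^sup>2) + int2 (\<lambda>x y. (sx 7 (-9/2) (sy (-7) 8 ax) x y)\<^sup>2)
        + int2 (\<lambda>x y. (sx (-7) 8 (sy 7 (-9/2) by) x y)\<^sup>2)
        - int2 (\<lambda>x y. (sx 7 (-6) (sy (-7) 6 ay) x y)\<^sup>2 + (sx (-7) 6 (sy 7 (-6) bx) x y)\<^sup>2)"
      unfolding B3_def fun_cong[OF fun_cong[OF h3], symmetric]
      by (intro null_form_le_plus cont2_sx cont2_sy ac bc)
    also have "\<dots> \<le> int2 (\<lambda>x y. (sx 7 (-6) (sy (-7) 6 h) x y)\<^sup>2) + int2 (\<lambda>x y. (sx 7 (-9/2) (sy (-7) 8 ax) x y)\<^sup>2)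
        + int2 (\<lambda>x y. (sx (-7) 8 (sy 7 (-9/2) by) x y)\<^sup>2)"
      using Np[OF cont2_sx[OF cont2_sy[OF ac(3)]] cont2_sx[OF cont2_sy[OF bc(3)]]] by simp
    also have "\<dots> \<le> 300 * (300 * int2 (\<lambda>x y. (h x y)\<^sup>2)) + 300 * (300 * int2 (\<lambda>x y. (ax x y)\<^sup>2)) + 300 * (300 * int2 (\<lambda>x y. (by x y)\<^sup>2))"
      by (intro add_mono order_trans[OF int2_sq_sx_le] mult_left_mono int2_sq_sy_le cont2_sy hc ac bc) auto
    finally show ?thesis unfolding E_def h_def by simp
  qed
  \<comment> \<open>The off-diagonal squares are kept in the bound for \<open>B0\<close> and dropped
    in the other three; the sum bounds them by (1 + 300 + 300 + 90000) E.\<close>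
  have "E \<ge> 0" unfolding E_def by (intro add_nonneg_nonneg int2_sq_nonneg cont2_intros ac bc)
  then show ?thesis using sum 0 1 2 3 by argo
qed

section \<open>Localisation at the corner (0, 0)\<close>

definition cutoff :: "real \<Rightarrow> real" where "cutoff x = (max 0 (3/4 - x))\<^sup>2"

definition cutoff' :: "real \<Rightarrow> real" where "cutoff' x = - 2 * max 0 (3/4 - x)"

text \<open>A uniform quadratic remainder covers the point 3/4, where the formula for
  \<open>cutoff\<close> changes, together with all other points.\<close>

lemma DERIV_if_quadratic_error:
  fixes f :: "real \<Rightarrow> real"
  assumes "\<And>y. \<bar>f y - f x - D * (y - x)\<bar> \<le> C * (y - x)\<^sup>2"
  shows "(f has_real_derivative D) (at x within A)"
proof -
  have "((\<lambda>y. (f y - f x) / (y - x) - D) \<longlongrightarrow> 0) (at x)"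
  proof (rule Lim_null_comparison)
    show "\<forall>\<^sub>F y in at x. norm ((f y - f x) / (y - x) - D) \<le> C * \<bar>y - x\<bar>"
    proof (rule eventually_at_filter[THEN iffD2], rule always_eventually, intro allI impI)
      fix y assume "y \<noteq> x"
      then have "norm ((f y - f x) / (y - x) - D) = \<bar>f y - f x - D * (y - x)\<bar> / \<bar>y - x\<bar>"
        by (simp add: abs_divide[symmetric] diff_divide_distrib del: abs_divide)
      also have "\<dots> \<le> C * (y - x)\<^sup>2 / \<bar>y - x\<bar>"
        by (intro divide_right_mono assms) auto
      also have "\<dots> = C * \<bar>y - x\<bar>"
      proof -
        have eq: "(y - x)\<^sup>2 = \<bar>y - x\<bar> * \<bar>y - x\<bar>" by (simp add: power2_eq_square)
        show ?thesis unfolding eq using \<open>y \<noteq> x\<close> by (simp del: abs_mult_self_eq)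
      qed
      finally show "norm ((f y - f x) / (y - x) - D) \<le> C * \<bar>y - x\<bar>" .
    qed
    have "((\<lambda>y. C * \<bar>y - x\<bar>) \<longlongrightarrow> C * \<bar>x - x\<bar>) (at x)" by (intro tendsto_intros)
    then show "((\<lambda>y. C * \<bar>y - x\<bar>) \<longlongrightarrow> 0) (at x)" by simp
  qed
  then have "(f has_real_derivative D) (at x)"
    by (simp add: has_field_derivative_iff LIM_zero_iff)
  then show ?thesis by (rule has_field_derivative_at_within)
qed

lemma cutoff_deriv: "(cutoff has_real_derivative cutoff' x) (at x within A)"
proof (rule DERIV_if_quadratic_error[where C=1])
  fix y
  have *: "\<bar>(max 0 q)\<^sup>2 - (max 0 p)\<^sup>2 - (- 2 * max 0 p) * (p - q)\<bar> \<le> (p - q)\<^sup>2" for p q :: real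
  proof (cases "p \<ge> 0"; cases "q \<ge> 0")
    assume "p \<ge> 0" "\<not> q \<ge> 0"
    then have "max 0 p = p" "max 0 q = 0" "p * q \<le> 0" by (auto intro: mult_nonneg_nonpos)
    moreover have "p * q * 4 \<le> q * q + p * p * 2"
      using \<open>p * q \<le> 0\<close> zero_le_square[of p] zero_le_square[of q] by linarith
    ultimately show ?thesis
      unfolding abs_le_iff by (simp add: power2_eq_square algebra_simps)
  next
    assume "\<not> p \<ge> 0" "q \<ge> 0"
    then have "max 0 p = 0" "max 0 q = q" "p * q \<le> 0" by (auto intro: mult_nonpos_nonneg)
    moreover have "p * q * 2 \<le> p * p"
      using \<open>p * q \<le> 0\<close> zero_le_square[of p] by linarith
    ultimately show ?thesis by (simp add: power2_eq_square algebra_simps)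
  next
    assume "p \<ge> 0" "q \<ge> 0"
    then have "(max 0 q)\<^sup>2 - (max 0 p)\<^sup>2 - (- 2 * max 0 p) * (p - q) = (p - q)\<^sup>2"
      by (simp add: power2_eq_square algebra_simps)
    then show ?thesis by (metis abs_power2 order_refl)
  qed auto
  show "\<bar>cutoff y - cutoff x - cutoff' x * (y - x)\<bar> \<le> 1 * (y - x)\<^sup>2"
    using *[of "3/4 - y" "3/4 - x"] by (simp add: cutoff_def cutoff'_def)
qed

lemma cutoff_cont: "continuous_on A cutoff" "continuous_on A cutoff'"
  unfolding cutoff_def[abs_def] cutoff'_def[abs_def] by (intro continuous_intros)+

lemma cutoff_bounds:
  assumes "x \<in> {0..1}"
  shows "0 \<le> cutoff x" "cutoff x \<le> 1" "\<bar>cutoff' x\<bar> \<le> 2"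
proof -
  have "0 \<le> max 0 (3/4 - x)" "max 0 (3/4 - x) \<le> 1" using assms by auto
  then show "0 \<le> cutoff x" "cutoff x \<le> 1" "\<bar>cutoff' x\<bar> \<le> 2"
    by (auto simp: cutoff_def cutoff'_def power_le_one simp del: max.bounded_iff)
qed

lemma cutoff_0: "x \<ge> 3/4 \<Longrightarrow> cutoff x = 0"
  by (simp add: cutoff_def)

lemma cutoff_ge: "x \<le> 1/2 \<Longrightarrow> cutoff x \<ge> 1/16"
proof -
  assume "x \<le> 1/2"
  then have "(1/4)\<^sup>2 \<le> (3/4 - x)\<^sup>2" by (intro power_mono) auto
  then show ?thesis using \<open>x \<le> 1/2\<close> by (simp add: cutoff_def max_def power2_eq_square)
qed

lemma has_dx_cutoff:
  assumes "has_dx F G"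
  shows "has_dx (\<lambda>x y. cutoff x * r y * F x y) (\<lambda>x y. cutoff' x * r y * F x y + cutoff x * r y * G x y)"
  using assms unfolding has_dx_def by (auto intro!: derivative_eq_intros cutoff_deriv)

lemma has_dy_cutoff:
  assumes "has_dy F G"
  shows "has_dy (\<lambda>x y. r x * cutoff y * F x y) (\<lambda>x y. r x * cutoff' y * F x y + r x * cutoff y * G x y)"
  using assms unfolding has_dy_def by (auto intro!: derivative_eq_intros cutoff_deriv)

lemma C1sq_cutoff:
  assumes "C1sq F Fx Fy"
  shows "C1sq (\<lambda>x y. cutoff x * cutoff y * F x y)
    (\<lambda>x y. cutoff' x * cutoff y * F x y + cutoff x * cutoff y * Fx x y)
    (\<lambda>x y. cutoff x * cutoff' y * F x y + cutoff x * cutoff y * Fy x y)"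
  unfolding C1sq_def
  by (intro conjI has_dx_cutoff has_dy_cutoff cont2_intros cont2_x cont2_y cutoff_cont C1sqD[OF assms])

text \<open>Only first derivatives of \<open>cutoff\<close> occur, because the cut-off is a product
  of one function per variable; a once differentiable \<open>cutoff\<close> is therefore smooth
  enough.\<close>

lemma C11sq_cutoff:
  assumes "C11sq F Fx Fy Fxy"
  shows "C11sq (\<lambda>x y. cutoff x * cutoff y * F x y)
    (\<lambda>x y. cutoff' x * cutoff y * F x y + cutoff x * cutoff y * Fx x y)
    (\<lambda>x y. cutoff x * cutoff' y * F x y + cutoff x * cutoff y * Fy x y)
    (\<lambda>x y. cutoff' x * cutoff' y * F x y + cutoff' x * cutoff y * Fy x y
       + cutoff x * cutoff' y * Fx x y + cutoff x * cutoff y * Fxy x y)"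
proof (rule C11sqI[OF C1sq_cutoff[OF C11sqD(1)[OF assms]]])
  note F = C11sqD[OF assms]
  show "cont2 (\<lambda>x y. cutoff' x * cutoff' y * F x y + cutoff' x * cutoff y * Fy x y
       + cutoff x * cutoff' y * Fx x y + cutoff x * cutoff y * Fxy x y)"
    by (intro cont2_intros cont2_x cont2_y cutoff_cont F)
  show "has_dy (\<lambda>x y. cutoff' x * cutoff y * F x y + cutoff x * cutoff y * Fx x y)
     (\<lambda>x y. cutoff' x * cutoff' y * F x y + cutoff' x * cutoff y * Fy x y
       + cutoff x * cutoff' y * Fx x y + cutoff x * cutoff y * Fxy x y)"
    using F(7,8) unfolding has_dy_def by (auto intro!: derivative_eq_intros cutoff_deriv)
  show "has_dx (\<lambda>x y. cutoff x * cutoff' y * F x y + cutoff x * cutoff y * Fy x y)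
     (\<lambda>x y. cutoff' x * cutoff' y * F x y + cutoff' x * cutoff y * Fy x y
       + cutoff x * cutoff' y * Fx x y + cutoff x * cutoff y * Fxy x y)"
    using F(6,9) unfolding has_dx_def by (auto intro!: derivative_eq_intros cutoff_deriv)
qed

text \<open>The corner estimate is applied to the field multiplied by \<open>w\<close>. Derivatives
  falling on \<open>w\<close> contribute at most the L2 norms collected in \<open>n\<close>, both
  when the strain of the product is bounded and when \<open>w * ay\<close> and \<open>w * bx\<close>
  are recovered from the derivatives of the product.\<close>

lemma korn_weighted:
  assumes a: "C1sq a ax ay" and b: "C11sq b bx by bxy"
  defines "E \<equiv> int2 (\<lambda>x y. (ax x y)\<^sup>2) + int2 (\<lambda>x y. (by x y)\<^sup>2) + int2 (\<lambda>x y. (ay x y + bx x y)\<^sup>2)"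
    and "n \<equiv> int2 (\<lambda>x y. (a x y)\<^sup>2) + int2 (\<lambda>x y. (b x y)\<^sup>2)"
  shows "int2 (\<lambda>x y. (cutoff x * cutoff y)\<^sup>2 * ((ay x y)\<^sup>2 + (bx x y)\<^sup>2)) \<le> 6000000 * (E + n)"
proof -
  note ac = C1sqD[OF a] and bc = C11sqD[OF b]
  note cc = cutoff_cont[of "{0..1}"]
  define w where "w = (\<lambda>x y. cutoff x * cutoff y)"
  define wx where "wx = (\<lambda>x y. cutoff' x * cutoff y)"
  define wy where "wy = (\<lambda>x y. cutoff x * cutoff' y)"
  have wc: "cont2 w" "cont2 wx" "cont2 wy"
    unfolding w_def wx_def wy_def by (intro cont2_intros cont2_x cont2_y cc)+
  have wb: "\<bar>w x y\<bar> \<le> 1" "\<bar>wx x y\<bar> \<le> 2" "\<bar>wy x y\<bar> \<le> 2" if "x \<in> {0..1}" "y \<in> {0..1}" for x y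
    using cutoff_bounds[OF that(1)] cutoff_bounds[OF that(2)]
      mult_mono[of "cutoff x" 1 "cutoff y" 1] mult_mono[of "\<bar>cutoff' x\<bar>" 2 "cutoff y" 1]
      mult_mono[of "cutoff x" 1 "\<bar>cutoff' y\<bar>" 2]
    by (auto simp: w_def wx_def wy_def abs_mult)
  have le1: "int2 (\<lambda>x y. (w x y * F x y)\<^sup>2) \<le> int2 (\<lambda>x y. (F x y)\<^sup>2)" if "cont2 F" for F
    using int2_sq_mult_le[OF that wc(1), of 1] wb(1) by simp
  have le2: "int2 (\<lambda>x y. (wx x y * F x y)\<^sup>2) \<le> 4 * int2 (\<lambda>x y. (F x y)\<^sup>2)"
    "int2 (\<lambda>x y. (wy x y * F x y)\<^sup>2) \<le> 4 * int2 (\<lambda>x y. (F x y)\<^sup>2)" if "cont2 F" for F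
    using int2_sq_mult_le[OF that wc(2), of 2] int2_sq_mult_le[OF that wc(3), of 2] wb by auto
  define A where "A = int2 (\<lambda>x y. (a x y)\<^sup>2)"
  define B where "B = int2 (\<lambda>x y. (b x y)\<^sup>2)"
  define ex where "ex = int2 (\<lambda>x y. (ax x y)\<^sup>2)"
  define ey where "ey = int2 (\<lambda>x y. (by x y)\<^sup>2)"
  define eh where "eh = int2 (\<lambda>x y. (ay x y + bx x y)\<^sup>2)"
  have pos: "A \<ge> 0" "B \<ge> 0" "ex \<ge> 0" "ey \<ge> 0" "eh \<ge> 0"
    unfolding A_def B_def ex_def ey_def eh_def by (intro int2_sq_nonneg cont2_intros ac bc)+
  have 1: "int2 (\<lambda>x y. (wx x y * a x y + w x y * ax x y)\<^sup>2) \<le> 8 * A + 2 * ex"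
    using int2_sq_add_le[OF cont2_mult[OF wc(2) ac(1)] cont2_mult[OF wc(1) ac(2)]] le1[OF ac(2)] le2(1)[OF ac(1)]
    unfolding A_def ex_def by argo
  have 2: "int2 (\<lambda>x y. (wy x y * b x y + w x y * by x y)\<^sup>2) \<le> 8 * B + 2 * ey"
    using int2_sq_add_le[OF cont2_mult[OF wc(3) bc(2)] cont2_mult[OF wc(1) bc(4)]] le1[OF bc(4)] le2(2)[OF bc(2)]
    unfolding B_def ey_def by argo
  have 3: "int2 (\<lambda>x y. ((wy x y * a x y + w x y * ay x y) + (wx x y * b x y + w x y * bx x y))\<^sup>2) \<le> 16 * A + 16 * B + 2 * eh"
  proof -
    have "int2 (\<lambda>x y. ((wy x y * a x y + w x y * ay x y) + (wx x y * b x y + w x y * bx x y))\<^sup>2)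
      = int2 (\<lambda>x y. ((wy x y * a x y + wx x y * b x y) + w x y * (ay x y + bx x y))\<^sup>2)"
      by (simp add: algebra_simps)
    also have "\<dots> \<le> 2 * int2 (\<lambda>x y. (wy x y * a x y + wx x y * b x y)\<^sup>2) + 2 * int2 (\<lambda>x y. (w x y * (ay x y + bx x y))\<^sup>2)"
      by (intro int2_sq_add_le cont2_intros wc ac bc)
    also have "int2 (\<lambda>x y. (w x y * (ay x y + bx x y))\<^sup>2) \<le> eh"
      unfolding eh_def by (intro le1 cont2_intros ac bc)
    also have "int2 (\<lambda>x y. (wy x y * a x y + wx x y * b x y)\<^sup>2) \<le> 8 * A + 8 * B"
      using int2_sq_add_le[OF cont2_mult[OF wc(3) ac(1)] cont2_mult[OF wc(2) bc(2)]] le2(2)[OF ac(1)] le2(1)[OF bc(2)]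
      unfolding A_def B_def by argo
    finally show ?thesis by simp
  qed
  define P where "P = (\<lambda>x y. wy x y * a x y + w x y * ay x y)"
  define Q where "Q = (\<lambda>x y. wx x y * b x y + w x y * bx x y)"
  have PQ: "cont2 P" "cont2 Q" unfolding P_def Q_def by (intro cont2_intros wc ac bc)+
  have "int2 (\<lambda>x y. (P x y)\<^sup>2 + (Q x y)\<^sup>2)
    \<le> 100000 * (int2 (\<lambda>x y. (wx x y * a x y + w x y * ax x y)\<^sup>2) + int2 (\<lambda>x y. (wy x y * b x y + w x y * by x y)\<^sup>2)
      + int2 (\<lambda>x y. (P x y + Q x y)\<^sup>2))"
    unfolding P_def Q_def w_def wx_def wy_def
    by (rule korn_corner[OF C1sq_cutoff[OF a] C11sq_cutoff[OF b]]) (auto simp: cutoff_0)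
  also have "\<dots> \<le> 2400000 * (E + n)"
    using 1 2 3 pos unfolding E_def n_def P_def Q_def A_def B_def ex_def ey_def eh_def by argo
  finally have N: "int2 (\<lambda>x y. (P x y)\<^sup>2) + int2 (\<lambda>x y. (Q x y)\<^sup>2) \<le> 2400000 * (E + n)"
    by (simp add: int2_add cont2_power PQ)
  have "int2 (\<lambda>x y. (w x y * ay x y)\<^sup>2) = int2 (\<lambda>x y. (P x y - wy x y * a x y)\<^sup>2)"
    by (simp add: P_def)
  also have "\<dots> \<le> 2 * int2 (\<lambda>x y. (P x y)\<^sup>2) + 2 * int2 (\<lambda>x y. (wy x y * a x y)\<^sup>2)"
    by (intro int2_sq_diff_le PQ cont2_intros wc ac)
  finally have 4: "int2 (\<lambda>x y. (w x y * ay x y)\<^sup>2) \<le> 2 * int2 (\<lambda>x y. (P x y)\<^sup>2) + 8 * A"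
    using le2(2)[OF ac(1)] unfolding A_def by argo
  have "int2 (\<lambda>x y. (w x y * bx x y)\<^sup>2) = int2 (\<lambda>x y. (Q x y - wx x y * b x y)\<^sup>2)"
    by (simp add: Q_def)
  also have "\<dots> \<le> 2 * int2 (\<lambda>x y. (Q x y)\<^sup>2) + 2 * int2 (\<lambda>x y. (wx x y * b x y)\<^sup>2)"
    by (intro int2_sq_diff_le PQ cont2_intros wc bc)
  finally have 5: "int2 (\<lambda>x y. (w x y * bx x y)\<^sup>2) \<le> 2 * int2 (\<lambda>x y. (Q x y)\<^sup>2) + 8 * B"
    using le2(1)[OF bc(2)] unfolding B_def by argo
  have "int2 (\<lambda>x y. (w x y)\<^sup>2 * ((ay x y)\<^sup>2 + (bx x y)\<^sup>2)) = int2 (\<lambda>x y. (w x y * ay x y)\<^sup>2 + (w x y * bx x y)\<^sup>2)"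
    by (simp add: power_mult_distrib algebra_simps)
  also have "\<dots> = int2 (\<lambda>x y. (w x y * ay x y)\<^sup>2) + int2 (\<lambda>x y. (w x y * bx x y)\<^sup>2)"
    by (intro int2_add cont2_intros wc ac bc)
  also have "\<dots> \<le> 6000000 * (E + n)"
    using 4 5 N pos unfolding E_def n_def A_def[symmetric] B_def[symmetric] ex_def[symmetric] ey_def[symmetric] eh_def[symmetric]
    by argo
  finally show ?thesis by (simp add: w_def)
qed

section \<open>Reflections and the four corners\<close>

lemma integral_reflect_01:
  fixes f :: "real \<Rightarrow> real"
  assumes "continuous_on {0..1} f"
  shows "integral {0..1} (\<lambda>x. f (1 - x)) = integral {0..1} f"
proof (rule integral_unique)
  have img: "(\<lambda>x::real. 1 - x) ` {0..1} = {0..1}"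
    by (force simp: image_iff intro: bexI[of _ "1 - x" for x])
  have "(f has_integral integral {0..1} f) (cbox 0 1)"
    using integrable_integral[OF integrable_continuous_interval[OF assms]] by simp
  from has_integral_affinity[OF this, of "-1" 1] img
  show "((\<lambda>x. f (1 - x)) has_integral integral {0..1} f) {0..1}"
    by (simp add: diff_conv_add_uminus[symmetric] add.commute[of "- _"] del: diff_conv_add_uminus)
qed

lemma cont2_reflect_x: "cont2 F \<Longrightarrow> cont2 (\<lambda>x y. F (1 - x) y)"
  by (rule cont2_compose[where f="\<lambda>x y. 1 - x" and g="\<lambda>x y. y"])
    (auto intro!: cont2_x cont2_y continuous_intros)

lemma cont2_reflect_y: "cont2 F \<Longrightarrow> cont2 (\<lambda>x y. F x (1 - y))"
  by (rule cont2_compose[where f="\<lambda>x y. x" and g="\<lambda>x y. 1 - y"])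
    (auto intro!: cont2_x cont2_y continuous_intros)

lemma int2_reflect_y:
  assumes "cont2 F"
  shows "int2 (\<lambda>x y. F x (1 - y)) = int2 F"
  unfolding int2_iterated[OF cont2_reflect_y[OF assms]] int2_iterated[OF assms]
  by (intro integral_cong integral_reflect_01 cont2_slice_y assms)

lemma int2_reflect_x:
  assumes "cont2 F"
  shows "int2 (\<lambda>x y. F (1 - x) y) = int2 F"
  unfolding int2_iterated'[OF cont2_reflect_x[OF assms]] int2_iterated'[OF assms]
  by (intro integral_cong integral_reflect_01 cont2_slice_x assms)

lemma deriv_reflect_01:
  fixes f :: "real \<Rightarrow> real"
  assumes "\<And>x. x \<in> {0..1} \<Longrightarrow> (f has_real_derivative f' x) (at x within {0..1})" "x \<in> {0..1}"
  shows "((\<lambda>x. f (1 - x)) has_real_derivative - f' (1 - x)) (at x within {0..1})"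
proof -
  have "(f has_real_derivative f' (1 - x)) (at (1 - x) within (\<lambda>x. 1 - x) ` {0..1})"
    using assms(2) by (intro DERIV_subset[OF assms(1)]) auto
  moreover have "((\<lambda>x. 1 - x) has_real_derivative -1) (at x within {0..1})"
    by (auto intro!: derivative_eq_intros)
  ultimately have "(f \<circ> (\<lambda>x. 1 - x) has_real_derivative f' (1 - x) * -1) (at x within {0..1})"
    by (rule DERIV_image_chain)
  then show ?thesis by (simp add: o_def)
qed

lemma has_dx_reflect_x: "has_dx F G \<Longrightarrow> has_dx (\<lambda>x y. F (1 - x) y) (\<lambda>x y. - G (1 - x) y)"
  unfolding has_dx_def by (auto intro!: deriv_reflect_01[where f'="\<lambda>x. G x y" for y])

lemma has_dy_reflect_y: "has_dy F G \<Longrightarrow> has_dy (\<lambda>x y. F x (1 - y)) (\<lambda>x y. - G x (1 - y))"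
  unfolding has_dy_def by (auto intro!: deriv_reflect_01[where f'="G x" for x])

lemma has_dy_reflect_x: "has_dy F G \<Longrightarrow> has_dy (\<lambda>x y. F (1 - x) y) (\<lambda>x y. G (1 - x) y)"
  unfolding has_dy_def by auto

lemma has_dx_reflect_y: "has_dx F G \<Longrightarrow> has_dx (\<lambda>x y. F x (1 - y)) (\<lambda>x y. G x (1 - y))"
  unfolding has_dx_def by auto

lemma has_dx_minus: "has_dx F G \<Longrightarrow> has_dx (\<lambda>x y. - F x y) (\<lambda>x y. - G x y)"
  unfolding has_dx_def by (auto intro!: derivative_eq_intros)

lemma has_dy_minus: "has_dy F G \<Longrightarrow> has_dy (\<lambda>x y. - F x y) (\<lambda>x y. - G x y)"
  unfolding has_dy_def by (auto intro!: derivative_eq_intros)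

text \<open>Korn's inequality with L2 terms on the right and a weight on the off-diagonal
  derivatives. In this form estimates can be reflected and their weights added.\<close>

definition korn_weight :: "(real \<Rightarrow> real \<Rightarrow> real) \<Rightarrow> real \<Rightarrow> bool" where
  "korn_weight w C \<longleftrightarrow> (\<forall>a ax ay b bx by bxy. C1sq a ax ay \<longrightarrow> C11sq b bx by bxy \<longrightarrow>
    int2 (\<lambda>x y. w x y * ((ay x y)\<^sup>2 + (bx x y)\<^sup>2)) \<le> C *
      (int2 (\<lambda>x y. (ax x y)\<^sup>2) + int2 (\<lambda>x y. (by x y)\<^sup>2) + int2 (\<lambda>x y. (ay x y + bx x y)\<^sup>2)
        + (int2 (\<lambda>x y. (a x y)\<^sup>2) + int2 (\<lambda>x y. (b x y)\<^sup>2))))"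

text \<open>Reflecting in x reverses the sign of \<open>bx\<close> but not of \<open>ay\<close>.
  Negating a as well makes the shear change by an overall sign, so its square is preserved.\<close>

lemma korn_weight_reflect_x:
  assumes w: "korn_weight w C" "cont2 w"
  shows "korn_weight (\<lambda>x y. w (1 - x) y) C"
  unfolding korn_weight_def
proof (intro allI impI)
  fix a ax ay b bx "by" bxy :: "real \<Rightarrow> real \<Rightarrow> real"
  assume a: "C1sq a ax ay" and b: "C11sq b bx by bxy"
  note ac = C1sqD[OF a] and bc = C11sqD[OF b]
  have a': "C1sq (\<lambda>x y. - a (1 - x) y) (\<lambda>x y. - (- ax (1 - x) y)) (\<lambda>x y. - ay (1 - x) y)"
    unfolding C1sq_def
    by (intro conjI has_dx_minus has_dy_minus has_dx_reflect_x has_dy_reflect_x cont2_minus ac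
        cont2_reflect_x[OF ac(1)] cont2_reflect_x[OF ac(2)] cont2_reflect_x[OF ac(3)])
  have b': "C11sq (\<lambda>x y. b (1 - x) y) (\<lambda>x y. - bx (1 - x) y) (\<lambda>x y. by (1 - x) y) (\<lambda>x y. - bxy (1 - x) y)"
    unfolding C1sq_def C11sq_def
    by (intro conjI has_dx_minus has_dy_minus has_dx_reflect_x has_dy_reflect_x cont2_minus bc
        cont2_reflect_x[OF bc(2)] cont2_reflect_x[OF bc(3)] cont2_reflect_x[OF bc(4)] cont2_reflect_x[OF bc(5)])
  have c: "cont2 (\<lambda>x y. w (1 - x) y * ((ay x y)\<^sup>2 + (bx x y)\<^sup>2))" "cont2 (\<lambda>x y. (ay x y + bx x y)\<^sup>2)"
    by (intro cont2_intros cont2_reflect_x[OF w(2)] ac bc)+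
  have s: "(- ay (1 - x) y + - bx (1 - x) y)\<^sup>2 = (ay (1 - x) y + bx (1 - x) y)\<^sup>2" for x y
    by (simp add: power2_eq_square algebra_simps)
  show "int2 (\<lambda>x y. w (1 - x) y * ((ay x y)\<^sup>2 + (bx x y)\<^sup>2)) \<le> C *
      (int2 (\<lambda>x y. (ax x y)\<^sup>2) + int2 (\<lambda>x y. (by x y)\<^sup>2) + int2 (\<lambda>x y. (ay x y + bx x y)\<^sup>2)
        + (int2 (\<lambda>x y. (a x y)\<^sup>2) + int2 (\<lambda>x y. (b x y)\<^sup>2)))"
    using w(1)[unfolded korn_weight_def, rule_format, OF a' b']
    unfolding s power2_minus minus_minus
      int2_reflect_x[OF c(2)] int2_reflect_x[OF cont2_power[OF ac(1), of 2]] int2_reflect_x[OF cont2_power[OF ac(2), of 2]]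
      int2_reflect_x[OF cont2_power[OF bc(2), of 2]] int2_reflect_x[OF cont2_power[OF bc(4), of 2]]
      int2_reflect_x[OF c(1), symmetric] by simp
qed

lemma korn_weight_reflect_y:
  assumes w: "korn_weight w C" "cont2 w"
  shows "korn_weight (\<lambda>x y. w x (1 - y)) C"
  unfolding korn_weight_def
proof (intro allI impI)
  fix a ax ay b bx "by" bxy :: "real \<Rightarrow> real \<Rightarrow> real"
  assume a: "C1sq a ax ay" and b: "C11sq b bx by bxy"
  note ac = C1sqD[OF a] and bc = C11sqD[OF b]
  have a': "C1sq (\<lambda>x y. a x (1 - y)) (\<lambda>x y. ax x (1 - y)) (\<lambda>x y. - ay x (1 - y))"
    unfolding C1sq_def
    by (intro conjI has_dx_minus has_dy_minus has_dx_reflect_y has_dy_reflect_y cont2_minus ac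
        cont2_reflect_y[OF ac(1)] cont2_reflect_y[OF ac(2)] cont2_reflect_y[OF ac(3)])
  have b': "C11sq (\<lambda>x y. - b x (1 - y)) (\<lambda>x y. - bx x (1 - y)) (\<lambda>x y. - (- by x (1 - y))) (\<lambda>x y. - (- bxy x (1 - y)))"
    unfolding C1sq_def C11sq_def
    by (intro conjI has_dx_minus has_dy_minus has_dx_reflect_y has_dy_reflect_y cont2_minus bc
        cont2_reflect_y[OF bc(2)] cont2_reflect_y[OF bc(3)] cont2_reflect_y[OF bc(4)] cont2_reflect_y[OF bc(5)])
  have c: "cont2 (\<lambda>x y. w x (1 - y) * ((ay x y)\<^sup>2 + (bx x y)\<^sup>2))" "cont2 (\<lambda>x y. (ay x y + bx x y)\<^sup>2)"
    by (intro cont2_intros cont2_reflect_y[OF w(2)] ac bc)+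
  have s: "(- ay x (1 - y) + - bx x (1 - y))\<^sup>2 = (ay x (1 - y) + bx x (1 - y))\<^sup>2" for x y
    by (simp add: power2_eq_square algebra_simps)
  show "int2 (\<lambda>x y. w x (1 - y) * ((ay x y)\<^sup>2 + (bx x y)\<^sup>2)) \<le> C *
      (int2 (\<lambda>x y. (ax x y)\<^sup>2) + int2 (\<lambda>x y. (by x y)\<^sup>2) + int2 (\<lambda>x y. (ay x y + bx x y)\<^sup>2)
        + (int2 (\<lambda>x y. (a x y)\<^sup>2) + int2 (\<lambda>x y. (b x y)\<^sup>2)))"
    using w(1)[unfolded korn_weight_def, rule_format, OF a' b']
    unfolding s power2_minus minus_minus
      int2_reflect_y[OF c(2)] int2_reflect_y[OF cont2_power[OF ac(1), of 2]] int2_reflect_y[OF cont2_power[OF ac(2), of 2]]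
      int2_reflect_y[OF cont2_power[OF bc(2), of 2]] int2_reflect_y[OF cont2_power[OF bc(4), of 2]]
      int2_reflect_y[OF c(1), symmetric] by simp
qed

lemma korn_weight_mono:
  assumes "korn_weight w C" "korn_weight w' C'" "cont2 w" "cont2 w'" "cont2 u"
    and le: "\<And>x y. x \<in> {0..1} \<Longrightarrow> y \<in> {0..1} \<Longrightarrow> u x y \<le> w x y + w' x y"
  shows "korn_weight u (C + C')"
  unfolding korn_weight_def
proof (intro allI impI)
  fix a ax ay b bx "by" bxy :: "real \<Rightarrow> real \<Rightarrow> real"
  assume a: "C1sq a ax ay" and b: "C11sq b bx by bxy"
  note ac = C1sqD[OF a] and bc = C11sqD[OF b]
  have "int2 (\<lambda>x y. u x y * ((ay x y)\<^sup>2 + (bx x y)\<^sup>2))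
     \<le> int2 (\<lambda>x y. w x y * ((ay x y)\<^sup>2 + (bx x y)\<^sup>2) + w' x y * ((ay x y)\<^sup>2 + (bx x y)\<^sup>2))"
    using le by (intro int2_mono cont2_intros assms ac bc) (auto simp: distrib_right[symmetric] intro!: mult_right_mono)
  also have "\<dots> = int2 (\<lambda>x y. w x y * ((ay x y)\<^sup>2 + (bx x y)\<^sup>2)) + int2 (\<lambda>x y. w' x y * ((ay x y)\<^sup>2 + (bx x y)\<^sup>2))"
    by (intro int2_add cont2_intros assms ac bc)
  finally show "int2 (\<lambda>x y. u x y * ((ay x y)\<^sup>2 + (bx x y)\<^sup>2)) \<le> (C + C') *
      (int2 (\<lambda>x y. (ax x y)\<^sup>2) + int2 (\<lambda>x y. (by x y)\<^sup>2) + int2 (\<lambda>x y. (ay x y + bx x y)\<^sup>2)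
        + (int2 (\<lambda>x y. (a x y)\<^sup>2) + int2 (\<lambda>x y. (b x y)\<^sup>2)))"
    using assms(1)[unfolded korn_weight_def, rule_format, OF a b] assms(2)[unfolded korn_weight_def, rule_format, OF a b]
    by (simp add: distrib_right)
qed

text \<open>Every point lies in the half-size square at one of the four corners. There both cut-off
  factors are at least 1/16, so the four reflected weights add up to at least
  \<open>(1/256)\<^sup>2\<close>.\<close>

lemma korn_second: "\<exists>C\<ge>0. korn_weight (\<lambda>x y. 1) C"
proof -
  define w where "w = (\<lambda>x y. (cutoff x * cutoff y)\<^sup>2)"
  have wc: "cont2 w" unfolding w_def by (intro cont2_intros cont2_x cont2_y cutoff_cont)
  have 1: "korn_weight w 6000000"
    unfolding korn_weight_def w_def using korn_weighted by blast
  note c1 = cont2_reflect_x[OF wc]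
  have 2: "korn_weight (\<lambda>x y. w x y + w (1 - x) y) (6000000 + 6000000)"
    by (rule korn_weight_mono[OF 1 korn_weight_reflect_x[OF 1 wc] wc c1]) (intro cont2_add wc c1, simp)
  have c2: "cont2 (\<lambda>x y. w x y + w (1 - x) y)" by (intro cont2_add wc c1)
  have 3: "korn_weight (\<lambda>x y. (1/256)\<^sup>2) (12000000 + 12000000)"
  proof (rule korn_weight_mono[OF 2[simplified] korn_weight_reflect_y[OF 2[simplified] c2] c2 cont2_reflect_y[OF c2] cont2_const])
    fix x y :: real assume xy: "x \<in> {0..1}" "y \<in> {0..1}"
    have pos: "w p q \<ge> 0" for p q by (simp add: w_def)
    have ge: "(1/256)\<^sup>2 \<le> w p q" if "p \<le> 1/2" "q \<le> 1/2" for p q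
      unfolding w_def using mult_mono[OF cutoff_ge[OF that(1)] cutoff_ge[OF that(2)]] cutoff_ge[OF that(1)]
      by (intro power_mono) auto
    show "(1/256)\<^sup>2 \<le> (w x y + w (1 - x) y) + (w x (1 - y) + w (1 - x) (1 - y))"
      using ge[of x y] ge[of "1 - x" y] ge[of x "1 - y"] ge[of "1 - x" "1 - y"]
        pos[of x y] pos[of "1 - x" y] pos[of x "1 - y"] pos[of "1 - x" "1 - y"]
      by (cases "x \<le> 1/2"; cases "y \<le> 1/2") auto
  qed
  have "korn_weight (\<lambda>x y. 1) (256\<^sup>2 * 24000000)"
    unfolding korn_weight_def
  proof (intro allI impI)
    fix a ax ay b bx "by" bxy :: "real \<Rightarrow> real \<Rightarrow> real"
    assume a: "C1sq a ax ay" and b: "C11sq b bx by bxy"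
    show "int2 (\<lambda>x y. 1 * ((ay x y)\<^sup>2 + (bx x y)\<^sup>2)) \<le> 256\<^sup>2 * 24000000 *
      (int2 (\<lambda>x y. (ax x y)\<^sup>2) + int2 (\<lambda>x y. (by x y)\<^sup>2) + int2 (\<lambda>x y. (ay x y + bx x y)\<^sup>2)
        + (int2 (\<lambda>x y. (a x y)\<^sup>2) + int2 (\<lambda>x y. (b x y)\<^sup>2)))"
      using 3[unfolded korn_weight_def int2_cmult, rule_format, OF a b] by (simp add: power_divide)
  qed
  then show ?thesis by (intro exI[of _ "256\<^sup>2 * 24000000"]) auto
qed

text \<open>Subtracting a skew affine field leaves the strain unchanged and makes the L2 terms of
  the preceding inequality controllable by it; the rate c of that field is the one in the
  conclusion.\<close>

theorem korn_square:
  "\<exists>C>0. \<forall>a ax ay b bx by bxy. C1sq a ax ay \<longrightarrow> C11sq b bx by bxy \<longrightarrow>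
    (\<exists>c. int2 (\<lambda>x y. (ay x y + c)\<^sup>2) + int2 (\<lambda>x y. (bx x y - c)\<^sup>2) \<le> C *
      (int2 (\<lambda>x y. (ax x y)\<^sup>2) + int2 (\<lambda>x y. (by x y)\<^sup>2) + int2 (\<lambda>x y. (ay x y + bx x y)\<^sup>2)))"
proof -
  obtain C where C: "C \<ge> 0" "korn_weight (\<lambda>x y. 1) C" using korn_second by blast
  show ?thesis
  \<comment> \<open>471 = 1 + 150 + 320, the strain itself and the two L2 bounds; the added 1 makes
    the constant positive even if \<open>C\<close> is 0.\<close>
  proof (rule exI[of _ "C * 471 + 1"], intro conjI allI impI)
    fix a ax ay b bx "by" bxy :: "real \<Rightarrow> real \<Rightarrow> real"
    assume a: "C1sq a ax ay" and b: "C11sq b bx by bxy"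
    note ac = C1sqD[OF a] and bc = C11sqD[OF b]
    define E where "E = int2 (\<lambda>x y. (ax x y)\<^sup>2) + int2 (\<lambda>x y. (by x y)\<^sup>2) + int2 (\<lambda>x y. (ay x y + bx x y)\<^sup>2)"
    have E: "E \<ge> 0" unfolding E_def by (intro add_nonneg_nonneg int2_sq_nonneg cont2_intros ac bc)
    obtain l m c where lm: "int2 (\<lambda>x y. (a x y - l + c * y)\<^sup>2) \<le> 150 * E" "int2 (\<lambda>x y. (b x y - m - c * x)\<^sup>2) \<le> 320 * E"
      using skew_L2_bound[OF a bc(1)] unfolding E_def by blast
    have a': "C1sq (\<lambda>x y. a x y - l + c * y) ax (\<lambda>x y. ay x y + c)"
      using ac(4,5) unfolding C1sq_def has_dx_def has_dy_def
      by (auto intro!: cont2_intros ac cont2_y continuous_intros derivative_eq_intros)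
    have b': "C11sq (\<lambda>x y. b x y - m - c * x) (\<lambda>x y. bx x y - c) by bxy"
      using bc(6-9) unfolding C1sq_def C11sq_def has_dx_def has_dy_def
      by (auto intro!: cont2_intros bc cont2_x continuous_intros derivative_eq_intros)
    have "int2 (\<lambda>x y. 1 * ((ay x y + c)\<^sup>2 + (bx x y - c)\<^sup>2)) \<le> C * (E +
        (int2 (\<lambda>x y. (a x y - l + c * y)\<^sup>2) + int2 (\<lambda>x y. (b x y - m - c * x)\<^sup>2)))"
      using C(2)[unfolded korn_weight_def, rule_format, OF a' b'] unfolding E_def by simp
    also have "\<dots> \<le> C * (471 * E)"
      using lm C(1) by (intro mult_left_mono) auto
    also have "\<dots> \<le> (C * 471 + 1) * E" using E by (simp add: algebra_simps)
    finally have "int2 (\<lambda>x y. (ay x y + c)\<^sup>2) + int2 (\<lambda>x y. (bx x y - c)\<^sup>2) \<le> (C * 471 + 1) * E"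
      by (simp add: int2_add cont2_intros ac bc)
    then show "\<exists>c. int2 (\<lambda>x y. (ay x y + c)\<^sup>2) + int2 (\<lambda>x y. (bx x y - c)\<^sup>2) \<le> (C * 471 + 1) *
      (int2 (\<lambda>x y. (ax x y)\<^sup>2) + int2 (\<lambda>x y. (by x y)\<^sup>2) + int2 (\<lambda>x y. (ay x y + bx x y)\<^sup>2))"
      unfolding E_def by blast
  qed (use C in auto)
qed

section \<open>Korn's inequality in curvilinear coordinates\<close>

lemma cont2_divide:
  assumes "cont2 F" "cont2 G" "\<And>x y. x \<in> {0..1} \<Longrightarrow> y \<in> {0..1} \<Longrightarrow> G x y \<noteq> 0"
  shows "cont2 (\<lambda>x y. F x y / G x y)"
  using assms unfolding cont2_def by (intro continuous_on_divide) (auto simp: usq_def)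

lemma int2_sq_minus_ymean_le:
  assumes F: "cont2 F"
  shows "int2 (\<lambda>x y. (F x y - integral {0..1} (\<lambda>y. F x y))\<^sup>2) \<le> 4 * int2 (\<lambda>x y. (F x y)\<^sup>2)"
proof -
  have c: "continuous_on {0..1} (\<lambda>x. integral {0..1} (\<lambda>y. F x y))" by (intro cont2_integral_y F)
  have "int2 (\<lambda>x y. (F x y - integral {0..1} (\<lambda>y. F x y))\<^sup>2)
      \<le> 2 * int2 (\<lambda>x y. (F x y)\<^sup>2) + 2 * int2 (\<lambda>x y. (integral {0..1} (\<lambda>y. F x y))\<^sup>2)"
    by (intro int2_sq_diff_le F cont2_x c)
  also have "int2 (\<lambda>x y. (integral {0..1} (\<lambda>y. F x y))\<^sup>2) = integral {0..1} (\<lambda>x. (integral {0..1} (\<lambda>y. F x y))\<^sup>2)"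
    by (intro int2_x continuous_intros c)
  also have "\<dots> \<le> integral {0..1} (\<lambda>x. integral {0..1} (\<lambda>y. (F x y)\<^sup>2))"
    by (intro integral_le integrable_continuous_interval continuous_on_power c cont2_integral_y cont2_power F
        integral_sq_le_01 cont2_slice_y)
  also have "\<dots> = int2 (\<lambda>x y. (F x y)\<^sup>2)"
    by (simp add: int2_iterated cont2_power F)
  finally show ?thesis by simp
qed

lemma C1sq_lincomb:
  assumes "C1sq F Fx Fy" "C1sq G Gx Gy"
  shows "C1sq (\<lambda>x y. F x y + c * G x y) (\<lambda>x y. Fx x y + c * Gx x y) (\<lambda>x y. Fy x y + c * Gy x y)"
  using C1sqD(4,5)[OF assms(1)] C1sqD(4,5)[OF assms(2)] unfolding C1sq_def has_dx_def has_dy_def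
  by (auto intro!: cont2_intros C1sqD[OF assms(1)] C1sqD[OF assms(2)] derivative_eq_intros)

lemma C11sq_lincomb:
  assumes "C11sq F Fx Fy Fxy" "C11sq G Gx Gy Gxy"
  shows "C11sq (\<lambda>x y. F x y + c * G x y) (\<lambda>x y. Fx x y + c * Gx x y) (\<lambda>x y. Fy x y + c * Gy x y)
    (\<lambda>x y. Fxy x y + c * Gxy x y)"
proof (rule C11sqI)
  show "C1sq (\<lambda>x y. F x y + c * G x y) (\<lambda>x y. Fx x y + c * Gx x y) (\<lambda>x y. Fy x y + c * Gy x y)"
    by (intro C1sq_lincomb C11sqD(1)[OF assms(1)] C11sqD(1)[OF assms(2)])
  show "cont2 (\<lambda>x y. Fxy x y + c * Gxy x y)"
    by (intro cont2_intros C11sqD[OF assms(1)] C11sqD[OF assms(2)])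
  show "has_dy (\<lambda>x y. Fx x y + c * Gx x y) (\<lambda>x y. Fxy x y + c * Gxy x y)"
    using C11sqD(8)[OF assms(1)] C11sqD(8)[OF assms(2)] unfolding has_dy_def by (auto intro!: derivative_eq_intros)
  show "has_dx (\<lambda>x y. Fy x y + c * Gy x y) (\<lambda>x y. Fxy x y + c * Gxy x y)"
    using C11sqD(9)[OF assms(1)] C11sqD(9)[OF assms(2)] unfolding has_dx_def by (auto intro!: derivative_eq_intros)
qed

lemma has_dx_add: "has_dx F F' \<Longrightarrow> has_dx G G' \<Longrightarrow> has_dx (\<lambda>x y. F x y + G x y) (\<lambda>x y. F' x y + G' x y)"
  unfolding has_dx_def by (auto intro!: DERIV_add)

lemma has_dy_add: "has_dy F F' \<Longrightarrow> has_dy G G' \<Longrightarrow> has_dy (\<lambda>x y. F x y + G x y) (\<lambda>x y. F' x y + G' x y)"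
  unfolding has_dy_def by (auto intro!: DERIV_add)

lemma has_dx_mult_x:
  assumes "\<And>x. x \<in> {0..1} \<Longrightarrow> (f has_real_derivative f' x) (at x within {0..1})" "has_dx F G"
  shows "has_dx (\<lambda>x y. f x * F x y) (\<lambda>x y. f' x * F x y + f x * G x y)"
  unfolding has_dx_def
proof (intro ballI)
  fix x y :: real assume "x \<in> {0..1}" "y \<in> {0..1}"
  from DERIV_mult[OF assms(1)[OF this(1)] has_dxD[OF assms(2) this]]
  show "((\<lambda>x. f x * F x y) has_real_derivative f' x * F x y + f x * G x y) (at x within {0..1})"
    by (simp add: mult.commute)
qed

lemma has_dy_mult_x: "has_dy F G \<Longrightarrow> has_dy (\<lambda>x y. f x * F x y) (\<lambda>x y. f x * G x y)"
  unfolding has_dy_def by (auto intro!: DERIV_cmult)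

lemma has_dx_eq: "has_dx F G \<Longrightarrow> (\<And>x y. G x y = G' x y) \<Longrightarrow> has_dx F G'"
  by (simp add: has_dx_def)

lemma has_dy_eq: "has_dy F G \<Longrightarrow> (\<And>x y. G x y = G' x y) \<Longrightarrow> has_dy F G'"
  by (simp add: has_dy_def)

section \<open>Moving frame and strain of the curved strip\<close>

locale planar_frame =
  fixes T2 T3 k :: "real \<Rightarrow> real" and K :: real
  assumes dT2: "x \<in> {0..1} \<Longrightarrow> (T2 has_real_derivative - k x * T3 x) (at x within {0..1})"
    and dT3: "x \<in> {0..1} \<Longrightarrow> (T3 has_real_derivative k x * T2 x) (at x within {0..1})"
    and k_cont: "continuous_on {0..1} k"
    and k_bound: "x \<in> {0..1} \<Longrightarrow> \<bar>k x\<bar> \<le> K"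
    and unit: "x \<in> {0..1} \<Longrightarrow> (T2 x)\<^sup>2 + (T3 x)\<^sup>2 = 1"
begin

lemma mdT3: "x \<in> {0..1} \<Longrightarrow> ((\<lambda>x. - T3 x) has_real_derivative - (k x * T2 x)) (at x within {0..1})"
  by (intro DERIV_minus dT3)

lemma K_nonneg: "K \<ge> 0"
  using k_bound[of 0] by simp

lemma T_cont: "continuous_on {0..1} T2" "continuous_on {0..1} T3"
  using dT2 dT3 by (meson DERIV_continuous continuous_on_eq_continuous_within)+

lemma T_bound: "x \<in> {0..1} \<Longrightarrow> \<bar>T2 x\<bar> \<le> 1" "x \<in> {0..1} \<Longrightarrow> \<bar>T3 x\<bar> \<le> 1"
proof -
  assume x: "x \<in> {0..1}"
  have "(T2 x)\<^sup>2 \<le> 1" "(T3 x)\<^sup>2 \<le> 1"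
    using unit[OF x] zero_le_power2[of "T2 x"] zero_le_power2[of "T3 x"] by linarith+
  then show "\<bar>T2 x\<bar> \<le> 1" "\<bar>T3 x\<bar> \<le> 1" by (simp_all add: abs_square_le_1)
qed

text \<open>The ratio of lengths on the parallel curve at signed distance \<epsilon> t to lengths on
  the curve, with \<open>t = y - 1/2\<close>.\<close>

definition metr :: "real \<Rightarrow> real \<Rightarrow> real \<Rightarrow> real" where
  "metr \<epsilon> x y = 1 - \<epsilon> * (y - 1/2) * k x"

text \<open>The entries of the symmetrised gradient in the orthonormal frame: tangential, normal and
  mixed. The displacement is (p, q) in fixed Cartesian coordinates; only the frame rotates.\<close>

definition strain11 where "strain11 \<epsilon> px qx = (\<lambda>x y. (T2 x * px x y + T3 x * qx x y) / metr \<epsilon> x y)"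
definition strain22 where "strain22 \<epsilon> py qy = (\<lambda>x y. (- T3 x * py x y + T2 x * qy x y) / \<epsilon>)"
definition strain12 where "strain12 \<epsilon> px py qx qy = (\<lambda>x y.
  ((- T3 x * px x y + T2 x * qx x y) / metr \<epsilon> x y + (T2 x * py x y + T3 x * qy x y) / \<epsilon>) / 2)"

definition strain_energy :: "real \<Rightarrow> (real \<Rightarrow> real \<Rightarrow> real) \<Rightarrow> (real \<Rightarrow> real \<Rightarrow> real) \<Rightarrow> (real \<Rightarrow> real \<Rightarrow> real) \<Rightarrow> (real \<Rightarrow> real \<Rightarrow> real) \<Rightarrow> real" where
  "strain_energy \<epsilon> px py qx qy = int2 (\<lambda>x y. (strain11 \<epsilon> px qx x y)\<^sup>2 + (strain22 \<epsilon> py qy x y)\<^sup>2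
     + 2 * (strain12 \<epsilon> px py qx qy x y)\<^sup>2)"

text \<open>These bounds keep \<open>metr\<close> between 1/2 and 3/2.\<close>

definition thin :: "real \<Rightarrow> bool" where "thin \<epsilon> \<longleftrightarrow> 0 < \<epsilon> \<and> \<epsilon> \<le> 1 \<and> \<epsilon> * K \<le> 1"

lemma metr_bounds:
  assumes "thin \<epsilon>" "x \<in> {0..1}" "y \<in> {0..1}"
  shows "1/2 \<le> metr \<epsilon> x y" "metr \<epsilon> x y \<le> 3/2"
proof -
  have "\<bar>\<epsilon> * (y - 1/2) * k x\<bar> = \<bar>y - 1/2\<bar> * (\<epsilon> * \<bar>k x\<bar>)"
    using assms(1) by (simp add: abs_mult thin_def)
  also have "\<dots> \<le> 1/2 * (\<epsilon> * K)"
  proof (intro mult_mono mult_left_mono)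
    show "\<bar>y - 1/2\<bar> \<le> 1/2" using assms(3) by (simp only: abs_le_iff) auto
  qed (use assms k_bound[OF assms(2)] K_nonneg in \<open>auto simp: thin_def\<close>)
  also have "\<dots> \<le> 1/2" using assms(1) by (simp add: thin_def)
  finally show "1/2 \<le> metr \<epsilon> x y" "metr \<epsilon> x y \<le> 3/2"
    by (auto simp: metr_def abs_le_iff)
qed

lemma metr_abs: "thin \<epsilon> \<Longrightarrow> x \<in> {0..1} \<Longrightarrow> y \<in> {0..1} \<Longrightarrow> \<bar>metr \<epsilon> x y\<bar> \<le> 3/2"
  using metr_bounds[of \<epsilon> x y] by linarith

lemma metr_cont: "cont2 (metr \<epsilon>)"
  unfolding metr_def[abs_def] by (intro cont2_intros cont2_x[OF k_cont] cont2_y continuous_intros)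

lemma strain_cont:
  assumes "thin \<epsilon>" "cont2 px" "cont2 py" "cont2 qx" "cont2 qy"
  shows "cont2 (strain11 \<epsilon> px qx)" "cont2 (strain22 \<epsilon> py qy)" "cont2 (strain12 \<epsilon> px py qx qy)"
proof -
  have g: "metr \<epsilon> x y \<noteq> 0" if "x \<in> {0..1}" "y \<in> {0..1}" for x y
    using metr_bounds[OF assms(1) that] by linarith
  have e: "\<epsilon> \<noteq> 0" using assms(1) by (simp add: thin_def)
  show "cont2 (strain11 \<epsilon> px qx)" "cont2 (strain22 \<epsilon> py qy)" "cont2 (strain12 \<epsilon> px py qx qy)"
    unfolding strain11_def strain22_def strain12_def using g e
    by (intro cont2_divide cont2_add cont2_mult cont2_minus cont2_const metr_cont cont2_x T_cont continuous_intros assms; simp)+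
qed

lemma strain_energy_bounds:
  assumes "thin \<epsilon>" "cont2 px" "cont2 py" "cont2 qx" "cont2 qy"
  shows "int2 (\<lambda>x y. (strain11 \<epsilon> px qx x y)\<^sup>2) \<le> strain_energy \<epsilon> px py qx qy"
    "int2 (\<lambda>x y. (strain22 \<epsilon> py qy x y)\<^sup>2) \<le> strain_energy \<epsilon> px py qx qy"
    "int2 (\<lambda>x y. (2 * strain12 \<epsilon> px py qx qy x y)\<^sup>2) \<le> 2 * strain_energy \<epsilon> px py qx qy"
    "0 \<le> strain_energy \<epsilon> px py qx qy"
proof -
  note c = strain_cont[OF assms]
  show "int2 (\<lambda>x y. (strain11 \<epsilon> px qx x y)\<^sup>2) \<le> strain_energy \<epsilon> px py qx qy"
    unfolding strain_energy_def by (intro int2_mono cont2_intros c) auto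
  show "int2 (\<lambda>x y. (strain22 \<epsilon> py qy x y)\<^sup>2) \<le> strain_energy \<epsilon> px py qx qy"
    unfolding strain_energy_def by (intro int2_mono cont2_intros c) auto
  show "int2 (\<lambda>x y. (2 * strain12 \<epsilon> px py qx qy x y)\<^sup>2) \<le> 2 * strain_energy \<epsilon> px py qx qy"
    unfolding strain_energy_def int2_cmult[symmetric] by (intro int2_mono cont2_intros c) (auto simp: power_mult_distrib)
  show "0 \<le> strain_energy \<epsilon> px py qx qy"
    unfolding strain_energy_def by (intro int2_nonneg cont2_intros c) auto
qed

text \<open>For the tangential and normal components al, be of a displacement, the field
  ((al - mean al) / \<epsilon>, be + integral of k * mean al) has, up to lower order terms, strain of order
  (strain of the displacement) / \<epsilon> on the unit square, so the loss of a factor \<epsilon> is that of an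
  anisotropic rescaling of the square.\<close>

lemma rotation_bound_if_mean_zero:
  assumes C: "C > 0" and korn: "\<And>a ax ay b bx by bxy. C1sq a ax ay \<Longrightarrow> C11sq b bx by bxy \<Longrightarrow>
    (\<exists>c. int2 (\<lambda>x y. (ay x y + c)\<^sup>2) + int2 (\<lambda>x y. (bx x y - c)\<^sup>2) \<le> C *
      (int2 (\<lambda>x y. (ax x y)\<^sup>2) + int2 (\<lambda>x y. (by x y)\<^sup>2) + int2 (\<lambda>x y. (ay x y + bx x y)\<^sup>2)))"
    and e: "thin \<epsilon>" "10 * C * K\<^sup>2 * \<epsilon>\<^sup>2 \<le> 1"
    and p: "C11sq p px py pxy" and q: "C11sq q qx qy qxy"
  defines "Y \<equiv> (\<lambda>x y. - (T2 x * py x y + T3 x * qy x y) / \<epsilon>)"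
  assumes Y0: "int2 Y = 0"
  shows "int2 (\<lambda>x y. (Y x y)\<^sup>2) \<le> C * (56 + 4 * K\<^sup>2) * strain_energy \<epsilon> px py qx qy / \<epsilon>\<^sup>2"
proof -
  define S where "S = strain_energy \<epsilon> px py qx qy"
  have e0: "\<epsilon> > 0" "\<epsilon> \<le> 1" using e by (auto simp: thin_def)
  note pc = C11sqD[OF p] and qc = C11sqD[OF q]
  note sc = strain_cont[OF e(1) pc(3,4) qc(3,4)]
  note sb = strain_energy_bounds[OF e(1) pc(3,4) qc(3,4), folded S_def]
  note Tc = cont2_x[OF T_cont(1)] cont2_x[OF T_cont(2)] cont2_x[OF k_cont]
  define E11 where "E11 = strain11 \<epsilon> px qx"
  define E22 where "E22 = strain22 \<epsilon> py qy"
  define H where "H = (\<lambda>x y. 2 * strain12 \<epsilon> px py qx qy x y)"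
  define X where "X = (\<lambda>x y. - T3 x * px x y + T2 x * qx x y)"
  define V where "V = (\<lambda>x y. T2 x * px x y + T3 x * qx x y)"
  have Ec: "cont2 E11" "cont2 E22" "cont2 H" unfolding E11_def E22_def H_def by (intro cont2_intros sc)+
  have XYc: "cont2 X" "cont2 V" unfolding X_def V_def by (intro cont2_intros Tc pc qc)+
  have Yc: "cont2 Y" unfolding Y_def using e0
    by (intro cont2_divide cont2_intros Tc pc qc) auto
  have g0: "metr \<epsilon> x y \<noteq> 0" if "x \<in> {0..1}" "y \<in> {0..1}" for x y
    using metr_bounds[OF e(1) that] by linarith
  have V_eq: "V x y = metr \<epsilon> x y * E11 x y" if "x \<in> {0..1}" "y \<in> {0..1}" for x y
    using g0[OF that] by (simp add: V_def E11_def strain11_def)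
  \<comment> \<open>The normal component of the s-derivative, divided by \<open>metr\<close>,
    differs from \<open>Y\<close> only by the shear \<open>H\<close>; in this sense \<open>Y\<close>
    is the local rotation.\<close>
  have X_eq: "X x y = metr \<epsilon> x y * (H x y + Y x y)" if "x \<in> {0..1}" "y \<in> {0..1}" for x y
  proof -
    have "H x y + Y x y = X x y / metr \<epsilon> x y" by (simp add: X_def H_def strain12_def Y_def add_divide_distrib diff_divide_distrib)
    then show ?thesis using g0[OF that] by simp
  qed
  \<comment> \<open>The tangential and normal components. Differentiating the frame along the curve
    adds the curvature terms \<open>k * be\<close> and \<open>- k * al\<close> in \<open>alx\<close>
    and \<open>bex\<close>.\<close>
  define al where "al = (\<lambda>x y. T2 x * p x y + T3 x * q x y)"
  define be where "be = (\<lambda>x y. - T3 x * p x y + T2 x * q x y)"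
  define alx where "alx = (\<lambda>x y. V x y + k x * be x y)"
  define aly where "aly = (\<lambda>x y. T2 x * py x y + T3 x * qy x y)"
  define bex where "bex = (\<lambda>x y. X x y - k x * al x y)"
  define bey where "bey = (\<lambda>x y. - T3 x * py x y + T2 x * qy x y)"
  define bexy where "bexy = (\<lambda>x y. - T3 x * pxy x y + T2 x * qxy x y - k x * aly x y)"
  have abc: "cont2 al" "cont2 be" "cont2 aly" "cont2 bey" unfolding al_def be_def aly_def bey_def by (intro cont2_intros Tc pc qc)+
  have abc': "cont2 alx" "cont2 bex" "cont2 bexy" unfolding alx_def bex_def bexy_def by (intro cont2_intros Tc pc qc XYc abc)+
  have al1: "has_dx al alx" "has_dy al aly"
    using has_dx_add[OF has_dx_mult_x[OF dT2 pc(6)] has_dx_mult_x[OF dT3 qc(6)]]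
      has_dy_add[OF has_dy_mult_x[OF pc(7), of T2] has_dy_mult_x[OF qc(7), of T3]]
    unfolding al_def alx_def aly_def V_def be_def by (auto elim!: has_dx_eq has_dy_eq simp: algebra_simps)
  have be1: "has_dx be bex" "has_dy be bey" "has_dx bey bexy"
    using has_dx_add[OF has_dx_mult_x[OF mdT3 pc(6)] has_dx_mult_x[OF dT2 qc(6)]]
      has_dy_add[OF has_dy_mult_x[OF pc(7), of "\<lambda>x. - T3 x"] has_dy_mult_x[OF qc(7), of T2]]
      has_dx_add[OF has_dx_mult_x[OF mdT3 pc(9)] has_dx_mult_x[OF dT2 qc(9)]]
    unfolding be_def bex_def bey_def bexy_def X_def al_def aly_def
    by (auto elim!: has_dx_eq has_dy_eq simp: algebra_simps)
  have be2: "has_dy bex bexy"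
    using has_dy_add[OF has_dy_add[OF has_dy_mult_x[OF pc(8), of "\<lambda>x. - T3 x"] has_dy_mult_x[OF qc(8), of T2]]
        has_dy_mult_x[OF al1(2), of "\<lambda>x. - k x"]]
    unfolding bex_def bexy_def X_def by simp
  define A where "A = (\<lambda>x. integral {0..1} (\<lambda>y. al x y))"
  define A' where "A' = (\<lambda>x. integral {0..1} (\<lambda>y. alx x y))"
  have Ac: "continuous_on {0..1} A" "continuous_on {0..1} A'" unfolding A_def A'_def by (intro cont2_integral_y abc abc')+
  have dA: "(A has_real_derivative A' x) (at x within {0..1})" if "x \<in> {0..1}" for x
    unfolding A_def A'_def using abc abc' al1 that by (intro has_dx_integral_y)
  define W where "W = (\<lambda>x. integral {0..x} (\<lambda>z. k z * A z))"
  have dW: "(W has_real_derivative k x * A x) (at x within {0..1})" if "x \<in> {0..1}" for x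
    unfolding W_def using that by (intro integral_has_real_derivative continuous_intros k_cont Ac)
  have Wc: "continuous_on {0..1} W"
    using dW by (meson DERIV_continuous continuous_on_eq_continuous_within)
  define U where "U = (\<lambda>x y. (al x y - A x) / \<epsilon>)"
  define Ux where "Ux = (\<lambda>x y. (alx x y - A' x) / \<epsilon>)"
  have Uc: "cont2 U" "cont2 Ux" unfolding U_def Ux_def using e0
    by (intro cont2_divide cont2_intros cont2_x[OF Ac(1)] cont2_x[OF Ac(2)] abc abc'; simp)+
  have U1: "C1sq U Ux (\<lambda>x y. - Y x y)"
    unfolding C1sq_def
  proof (intro conjI Uc cont2_minus Yc)
    show "has_dx U Ux" unfolding has_dx_def U_def Ux_def
      by (intro ballI DERIV_cdivide DERIV_diff has_dxD[OF al1(1)] dA)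
    show "has_dy U (\<lambda>x y. - Y x y)" using al1 e0 unfolding has_dy_def U_def Y_def aly_def
      by (auto intro!: derivative_eq_intros simp: minus_divide_left)
  qed
  \<comment> \<open>Adding \<open>W\<close> removes the section mean of \<open>al\<close> from the
    curvature term: \<open>Z\<close> equals \<open>X - \<epsilon> * k * U\<close>, where only the
    oscillation is left, with a factor \<epsilon>.\<close>
  define Z where "Z = (\<lambda>x y. bex x y + k x * A x)"
  have U2: "C11sq (\<lambda>x y. be x y + W x) Z bey bexy"
    unfolding C11sq_def C1sq_def Z_def
  proof (intro conjI cont2_intros abc abc' Tc cont2_x[OF Ac(1)] cont2_x[OF Wc])
    show "has_dx (\<lambda>x y. be x y + W x) (\<lambda>x y. bex x y + k x * A x)"
      using be1 dW unfolding has_dx_def by (auto intro!: derivative_eq_intros)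
    show "has_dy (\<lambda>x y. be x y + W x) bey" using be1 unfolding has_dy_def by (auto intro!: derivative_eq_intros)
    show "has_dy (\<lambda>x y. bex x y + k x * A x) bexy" using be2 unfolding has_dy_def by (auto intro!: derivative_eq_intros)
  qed (rule be1)+
  define nY where "nY = int2 (\<lambda>x y. (Y x y)\<^sup>2)"
  have nYp: "nY \<ge> 0" unfolding nY_def by (rule int2_sq_nonneg[OF Yc])
  have bey_eq: "bey x y = \<epsilon> * E22 x y" for x y
    using e0 by (simp add: bey_def E22_def strain22_def)
  have bey_le: "int2 (\<lambda>x y. (bey x y)\<^sup>2) \<le> \<epsilon>\<^sup>2 * S"
    unfolding bey_eq power_mult_distrib int2_cmult using sb(2) by (simp add: E22_def mult_left_mono)
  \<comment> \<open>Here the factor 1/\<epsilon> is lost. The tangential part costs 2 * 4 * 9/4 =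
    18; in the curvature part \<open>be\<close> is replaced by its oscillation over a section, which
    \<open>bey\<close> controls.\<close>
  have Ux_le: "int2 (\<lambda>x y. (Ux x y)\<^sup>2) \<le> (18 + 2 * K\<^sup>2) * S / \<epsilon>\<^sup>2"
  proof -
    have A'_eq: "A' x = integral {0..1} (\<lambda>y. V x y) + k x * integral {0..1} (\<lambda>y. be x y)" if "x \<in> {0..1}" for x
    proof -
      have "integral {0..1} (\<lambda>y. V x y + k x * be x y) = integral {0..1} (\<lambda>y. V x y) + integral {0..1} (\<lambda>y. k x * be x y)"
        by (intro integral_add integrable_continuous_interval continuous_on_mult continuous_on_const
            cont2_slice_y[OF XYc(2) that] cont2_slice_y[OF abc(2) that])
      then show ?thesis by (simp add: A'_def alx_def)
    qed
    have cV: "cont2 (\<lambda>x y. V x y - integral {0..1} (\<lambda>y. V x y))" "cont2 (\<lambda>x y. be x y - integral {0..1} (\<lambda>y. be x y))"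
      by (intro cont2_diff cont2_x cont2_integral_y XYc abc)+
    have 1: "int2 (\<lambda>x y. (k x * (be x y - integral {0..1} (\<lambda>y. be x y)))\<^sup>2) \<le> K\<^sup>2 * S"
    proof -
      have "int2 (\<lambda>x y. (be x y - integral {0..1} (\<lambda>y. be x y))\<^sup>2) \<le> int2 (\<lambda>x y. (bey x y)\<^sup>2)"
        using abc be1 by (intro int2_sq_minus_mean_y_le)
      also have "\<dots> \<le> S" using bey_le mult_left_le_one_le[OF sb(4), of "\<epsilon>\<^sup>2"] e0 by (simp add: power_le_one)
      finally have "K\<^sup>2 * int2 (\<lambda>x y. (be x y - integral {0..1} (\<lambda>y. be x y))\<^sup>2) \<le> K\<^sup>2 * S"
        by (rule mult_left_mono) simp
      moreover have "int2 (\<lambda>x y. (k x * (be x y - integral {0..1} (\<lambda>y. be x y)))\<^sup>2)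
          \<le> K\<^sup>2 * int2 (\<lambda>x y. (be x y - integral {0..1} (\<lambda>y. be x y))\<^sup>2)"
        using k_bound by (intro int2_sq_mult_le Tc cV)
      ultimately show ?thesis by linarith
    qed
    have 2: "int2 (\<lambda>x y. (V x y - integral {0..1} (\<lambda>y. V x y))\<^sup>2) \<le> 9 * S"
    proof -
      have "int2 (\<lambda>x y. (V x y)\<^sup>2) = int2 (\<lambda>x y. (metr \<epsilon> x y * E11 x y)\<^sup>2)"
        by (rule int2_cong) (simp add: V_eq)
      also have "\<dots> \<le> (3/2)\<^sup>2 * int2 (\<lambda>x y. (E11 x y)\<^sup>2)"
        by (intro int2_sq_mult_le Ec metr_cont metr_abs e(1))
      finally have "int2 (\<lambda>x y. (V x y)\<^sup>2) \<le> 9/4 * S" using sb(1) unfolding E11_def power_divide by simp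
      then show ?thesis using int2_sq_minus_ymean_le[OF XYc(2)] by linarith
    qed
    have "int2 (\<lambda>x y. (alx x y - A' x)\<^sup>2) = int2 (\<lambda>x y. ((V x y - integral {0..1} (\<lambda>y. V x y))
        + k x * (be x y - integral {0..1} (\<lambda>y. be x y)))\<^sup>2)"
      by (rule int2_cong) (simp add: A'_eq alx_def algebra_simps)
    also have "\<dots> \<le> 2 * int2 (\<lambda>x y. (V x y - integral {0..1} (\<lambda>y. V x y))\<^sup>2)
        + 2 * int2 (\<lambda>x y. (k x * (be x y - integral {0..1} (\<lambda>y. be x y)))\<^sup>2)"
      by (intro int2_sq_add_le cont2_mult cV Tc)
    also have "\<dots> \<le> 2 * (9 * S) + 2 * (K\<^sup>2 * S)" using 1 2 by linarith
    finally have "int2 (\<lambda>x y. (alx x y - A' x)\<^sup>2) \<le> (18 + 2 * K\<^sup>2) * S"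
      by (simp add: distrib_right)
    moreover have "int2 (\<lambda>x y. (Ux x y)\<^sup>2) = int2 (\<lambda>x y. (1 / \<epsilon>\<^sup>2) * (alx x y - A' x)\<^sup>2)"
      by (simp add: Ux_def power_divide)
    ultimately show ?thesis using e0 by (simp only: int2_cmult) (simp add: divide_right_mono)
  qed
  \<comment> \<open>\<open>U\<close> has mean zero on every section and y-derivative
    \<open>- Y\<close>.\<close>
  have U_le: "int2 (\<lambda>x y. (U x y)\<^sup>2) \<le> nY"
  proof -
    have "int2 (\<lambda>x y. (U x y)\<^sup>2) = int2 (\<lambda>x y. (U x y - integral {0..1} (\<lambda>y. U x y))\<^sup>2)"
    proof (rule int2_cong)
      fix x y :: real assume x: "x \<in> {0..1}"
      have "integral {0..1} (\<lambda>y. U x y) = integral {0..1} (\<lambda>y. al x y / \<epsilon> - A x / \<epsilon>)"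
        by (simp add: U_def diff_divide_distrib)
      also have "\<dots> = integral {0..1} (\<lambda>y. al x y / \<epsilon>) - integral {0..1::real} (\<lambda>y. A x / \<epsilon>)"
        using e0 by (intro integral_diff integrable_continuous_interval continuous_intros cont2_slice_y abc x) auto
      also have "\<dots> = 0" by (simp add: A_def)
      finally show "(U x y)\<^sup>2 = (U x y - integral {0..1} (\<lambda>y. U x y))\<^sup>2" by simp
    qed
    also have "\<dots> \<le> int2 (\<lambda>x y. (- Y x y)\<^sup>2)"
      using C1sqD[OF U1] by (intro int2_sq_minus_mean_y_le)
    finally show ?thesis by (simp add: nY_def)
  qed
  \<comment> \<open>The shear of the rescaled field is \<open>metr * H\<close> up to terms of size
    \<open>\<epsilon> * k\<close> times \<open>Y\<close>, since \<open>metr\<close> differs from 1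
    by that order; the constant 5 is 2 * (2 * 1/4 + 2).\<close>
  have h_le: "int2 (\<lambda>x y. (- Y x y + Z x y)\<^sup>2) \<le> 9 * S + 5 * \<epsilon>\<^sup>2 * K\<^sup>2 * nY"
  proof -
    have cR: "cont2 (\<lambda>x y. (y - 1/2) * Y x y)" by (intro cont2_intros cont2_y continuous_intros Yc)
    have cR2: "cont2 (\<lambda>x y. (y - 1/2) * Y x y + U x y)" by (intro cont2_add cR Uc)
    have "int2 (\<lambda>x y. (- Y x y + Z x y)\<^sup>2)
      = int2 (\<lambda>x y. (metr \<epsilon> x y * H x y - (\<epsilon> * k x) * ((y - 1/2) * Y x y + U x y))\<^sup>2)"
    proof (rule int2_cong)
      fix x y :: real assume xy: "x \<in> {0..1}" "y \<in> {0..1}"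
      have "Z x y = X x y - \<epsilon> * k x * U x y"
        using e0 by (simp add: Z_def bex_def U_def field_simps)
      then have "- Y x y + Z x y = metr \<epsilon> x y * H x y - (\<epsilon> * k x) * ((y - 1/2) * Y x y + U x y)"
        unfolding X_eq[OF xy] by (simp add: metr_def algebra_simps)
      then show "(- Y x y + Z x y)\<^sup>2 = (metr \<epsilon> x y * H x y - (\<epsilon> * k x) * ((y - 1/2) * Y x y + U x y))\<^sup>2"
        by simp
    qed
    also have "\<dots> \<le> 2 * int2 (\<lambda>x y. (metr \<epsilon> x y * H x y)\<^sup>2)
        + 2 * int2 (\<lambda>x y. ((\<epsilon> * k x) * ((y - 1/2) * Y x y + U x y))\<^sup>2)"
      by (intro int2_sq_diff_le cont2_mult metr_cont Ec cont2_const Tc cR2)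
    also have "\<dots> \<le> 2 * (9/2 * S) + 2 * ((\<epsilon> * K)\<^sup>2 * (5/2 * nY))"
    proof (intro add_mono mult_left_mono)
      have "int2 (\<lambda>x y. (metr \<epsilon> x y * H x y)\<^sup>2) \<le> (3/2)\<^sup>2 * int2 (\<lambda>x y. (H x y)\<^sup>2)"
        by (intro int2_sq_mult_le Ec metr_cont metr_abs e(1))
      then show "int2 (\<lambda>x y. (metr \<epsilon> x y * H x y)\<^sup>2) \<le> 9/2 * S"
        using sb(3) unfolding H_def power_divide by simp
      have "int2 (\<lambda>x y. ((y - 1/2) * Y x y)\<^sup>2) \<le> (1/2)\<^sup>2 * nY"
        unfolding nY_def by (intro int2_sq_mult_le Yc cont2_y continuous_intros) (simp only: abs_le_iff, auto)
      then have "int2 (\<lambda>x y. ((y - 1/2) * Y x y + U x y)\<^sup>2) \<le> 5/2 * nY"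
        using int2_sq_add_le[OF cR Uc(1)] U_le unfolding power_divide by simp
      then have "(\<epsilon> * K)\<^sup>2 * int2 (\<lambda>x y. ((y - 1/2) * Y x y + U x y)\<^sup>2) \<le> (\<epsilon> * K)\<^sup>2 * (5/2 * nY)"
        by (rule mult_left_mono) simp
      moreover have "int2 (\<lambda>x y. ((\<epsilon> * k x) * ((y - 1/2) * Y x y + U x y))\<^sup>2) \<le> (\<epsilon> * K)\<^sup>2 * int2 (\<lambda>x y. ((y - 1/2) * Y x y + U x y)\<^sup>2)"
        using e0 k_bound by (intro int2_sq_mult_le cont2_mult cont2_const Tc cR2) (auto simp: abs_mult)
      ultimately show "int2 (\<lambda>x y. ((\<epsilon> * k x) * ((y - 1/2) * Y x y + U x y))\<^sup>2) \<le> (\<epsilon> * K)\<^sup>2 * (5/2 * nY)"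
        by linarith
    qed auto
    finally show ?thesis by (simp add: power_mult_distrib mult_ac)
  qed
  obtain c where c: "int2 (\<lambda>x y. (- Y x y + c)\<^sup>2) + int2 (\<lambda>x y. (Z x y - c)\<^sup>2) \<le> C *
      (int2 (\<lambda>x y. (Ux x y)\<^sup>2) + int2 (\<lambda>x y. (bey x y)\<^sup>2) + int2 (\<lambda>x y. (- Y x y + Z x y)\<^sup>2))"
    using korn[OF U1 U2] by blast
  \<comment> \<open>The mean of \<open>Y\<close> is zero, so shifting it by any constant can only
    increase its norm. This eliminates the unknown rotation \<open>c\<close> of Korn's
    inequality.\<close>
  have "int2 (\<lambda>x y. (- Y x y + c)\<^sup>2) = int2 (\<lambda>x y. (Y x y)\<^sup>2 + ((- 2 * c) * Y x y + c\<^sup>2))"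
    by (simp add: power2_eq_square algebra_simps)
  also have "\<dots> = nY + (int2 (\<lambda>x y. (- 2 * c) * Y x y) + int2 (\<lambda>x y. c\<^sup>2))"
    unfolding nY_def by (subst int2_add int2_add; (intro cont2_intros Yc)?)+ simp
  also have "\<dots> \<ge> nY" unfolding int2_cmult Y0 by simp
  finally have 1: "nY \<le> int2 (\<lambda>x y. (- Y x y + c)\<^sup>2)" .
  have "int2 (\<lambda>x y. (Z x y - c)\<^sup>2) \<ge> 0"
    by (intro int2_sq_nonneg cont2_intros C11sqD[OF U2])
  with 1 c have "nY \<le> C * (int2 (\<lambda>x y. (Ux x y)\<^sup>2) + int2 (\<lambda>x y. (bey x y)\<^sup>2) + int2 (\<lambda>x y. (- Y x y + Z x y)\<^sup>2))"
    by linarith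
  also have "\<dots> \<le> C * ((18 + 2 * K\<^sup>2) * S / \<epsilon>\<^sup>2 + \<epsilon>\<^sup>2 * S + (9 * S + 5 * \<epsilon>\<^sup>2 * K\<^sup>2 * nY))"
    using C Ux_le bey_le h_le by (intro mult_left_mono add_mono) auto
  also have "\<dots> \<le> C * ((18 + 2 * K\<^sup>2) * S / \<epsilon>\<^sup>2 + S / \<epsilon>\<^sup>2 + (9 * S / \<epsilon>\<^sup>2 + 5 * \<epsilon>\<^sup>2 * K\<^sup>2 * nY))"
  proof -
    have e2: "\<epsilon>\<^sup>2 \<le> 1" "0 < \<epsilon>\<^sup>2" using e0 by (auto simp: power_le_one)
    have a: "S \<le> S / \<epsilon>\<^sup>2" using e2 sb(4) by (simp add: pos_le_divide_eq mult_left_le)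
    have b: "\<epsilon>\<^sup>2 * S \<le> S" using e2 by (intro mult_left_le_one_le sb(4)) auto
    show ?thesis using C a b by (intro mult_left_mono add_mono) auto
  qed
  also have "\<dots> = C * (28 + 2 * K\<^sup>2) * S / \<epsilon>\<^sup>2 + (10 * C * K\<^sup>2 * \<epsilon>\<^sup>2) * nY / 2"
    by (simp add: algebra_simps add_divide_distrib)
  \<comment> \<open>The smallness assumption on \<epsilon> leaves at most half of \<open>nY\<close>
    on the right, which is absorbed and accounts for the final factor 2.\<close>
  also have "\<dots> \<le> C * (28 + 2 * K\<^sup>2) * S / \<epsilon>\<^sup>2 + 1 * nY / 2"
    using e(2) nYp by (intro add_left_mono divide_right_mono mult_right_mono) auto
  finally have "nY \<le> 2 * (C * (28 + 2 * K\<^sup>2) * S / \<epsilon>\<^sup>2)" by linarith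
  also have "\<dots> = C * (2 * (28 + 2 * K\<^sup>2)) * S / \<epsilon>\<^sup>2" by (simp only: mult_ac times_divide_eq_right)
  finally show ?thesis unfolding nY_def[symmetric] S_def[symmetric] by simp
qed

end

section \<open>Infinitesimal rotations and the estimate for smooth fields\<close>

locale planar_curve = planar_frame +
  fixes G2 G3 :: "real \<Rightarrow> real"
  assumes dG2: "x \<in> {0..1} \<Longrightarrow> (G2 has_real_derivative T2 x) (at x within {0..1})"
    and dG3: "x \<in> {0..1} \<Longrightarrow> (G3 has_real_derivative T3 x) (at x within {0..1})"
begin

text \<open>\<open>rot1\<close> and \<open>rot2\<close> are the two components of the quarter turn
  of the position vector, which is the curve plus \<epsilon> t times the normal; the next four
  functions are their derivatives.\<close>

definition rot1 :: "real \<Rightarrow> real \<Rightarrow> real \<Rightarrow> real" where "rot1 \<epsilon> x y = - (G3 x + \<epsilon> * (y - 1/2) * T2 x)"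
definition rot2 :: "real \<Rightarrow> real \<Rightarrow> real \<Rightarrow> real" where "rot2 \<epsilon> x y = G2 x - \<epsilon> * (y - 1/2) * T3 x"
definition rot1x :: "real \<Rightarrow> real \<Rightarrow> real \<Rightarrow> real" where "rot1x \<epsilon> x y = - metr \<epsilon> x y * T3 x"
definition rot2x :: "real \<Rightarrow> real \<Rightarrow> real \<Rightarrow> real" where "rot2x \<epsilon> x y = metr \<epsilon> x y * T2 x"
definition rot1y :: "real \<Rightarrow> real \<Rightarrow> real \<Rightarrow> real" where "rot1y \<epsilon> x y = - \<epsilon> * T2 x"
definition rot2y :: "real \<Rightarrow> real \<Rightarrow> real \<Rightarrow> real" where "rot2y \<epsilon> x y = - \<epsilon> * T3 x"

lemma G_cont: "continuous_on {0..1} G2" "continuous_on {0..1} G3"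
  using dG2 dG3 by (meson DERIV_continuous continuous_on_eq_continuous_within)+

lemma C11sq_rot1: "C11sq (rot1 \<epsilon>) (rot1x \<epsilon>) (rot1y \<epsilon>) (\<lambda>x y. \<epsilon> * k x * T3 x)"
proof -
  have "cont2 (rot1 \<epsilon>)" "cont2 (rot1x \<epsilon>)" "cont2 (rot1y \<epsilon>)" "cont2 (\<lambda>x y. \<epsilon> * k x * T3 x)"
    unfolding rot1_def[abs_def] rot1x_def[abs_def] rot1y_def[abs_def] metr_def[abs_def]
    by (intro cont2_intros cont2_x[OF k_cont] cont2_x[OF T_cont(1)] cont2_x[OF T_cont(2)] cont2_x[OF G_cont(2)] cont2_y continuous_intros)+
  moreover have "has_dx (rot1 \<epsilon>) (rot1x \<epsilon>)" unfolding has_dx_def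
  proof (intro ballI)
    fix x y :: real assume x: "x \<in> {0..1}"
    have "((\<lambda>x. rot1 \<epsilon> x y) has_real_derivative - (T3 x + (\<epsilon> * (y - 1/2)) * (- k x * T3 x))) (at x within {0..1})"
      unfolding rot1_def by (intro DERIV_minus DERIV_add DERIV_cmult dG3 dT2 x)
    then show "((\<lambda>x. rot1 \<epsilon> x y) has_real_derivative rot1x \<epsilon> x y) (at x within {0..1})"
      by (simp add: rot1x_def metr_def algebra_simps)
  qed
  moreover have "has_dy (rot1 \<epsilon>) (rot1y \<epsilon>)" "has_dy (rot1x \<epsilon>) (\<lambda>x y. \<epsilon> * k x * T3 x)"
    unfolding has_dy_def rot1_def rot1y_def rot1x_def metr_def by (auto intro!: derivative_eq_intros)
  moreover have "has_dx (rot1y \<epsilon>) (\<lambda>x y. \<epsilon> * k x * T3 x)" unfolding has_dx_def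
  proof (intro ballI)
    fix x y :: real assume x: "x \<in> {0..1}"
    have "((\<lambda>x. rot1y \<epsilon> x y) has_real_derivative - \<epsilon> * (- k x * T3 x)) (at x within {0..1})"
      unfolding rot1y_def by (intro DERIV_cmult dT2 x)
    then show "((\<lambda>x. rot1y \<epsilon> x y) has_real_derivative \<epsilon> * k x * T3 x) (at x within {0..1})" by (simp add: mult.assoc)
  qed
  ultimately show ?thesis by (simp add: C11sq_def C1sq_def)
qed

lemma C11sq_rot2: "C11sq (rot2 \<epsilon>) (rot2x \<epsilon>) (rot2y \<epsilon>) (\<lambda>x y. - \<epsilon> * k x * T2 x)"
proof -
  have "cont2 (rot2 \<epsilon>)" "cont2 (rot2x \<epsilon>)" "cont2 (rot2y \<epsilon>)" "cont2 (\<lambda>x y. - \<epsilon> * k x * T2 x)"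
    unfolding rot2_def[abs_def] rot2x_def[abs_def] rot2y_def[abs_def] metr_def[abs_def]
    by (intro cont2_intros cont2_x[OF k_cont] cont2_x[OF T_cont(1)] cont2_x[OF T_cont(2)] cont2_x[OF G_cont(1)] cont2_y continuous_intros)+
  moreover have "has_dx (rot2 \<epsilon>) (rot2x \<epsilon>)" unfolding has_dx_def
  proof (intro ballI)
    fix x y :: real assume x: "x \<in> {0..1}"
    have "((\<lambda>x. rot2 \<epsilon> x y) has_real_derivative T2 x - (\<epsilon> * (y - 1/2)) * (k x * T2 x)) (at x within {0..1})"
      unfolding rot2_def by (intro DERIV_diff DERIV_cmult dG2 dT3 x)
    then show "((\<lambda>x. rot2 \<epsilon> x y) has_real_derivative rot2x \<epsilon> x y) (at x within {0..1})"
      by (simp add: rot2x_def metr_def algebra_simps)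
  qed
  moreover have "has_dy (rot2 \<epsilon>) (rot2y \<epsilon>)" "has_dy (rot2x \<epsilon>) (\<lambda>x y. - \<epsilon> * k x * T2 x)"
    unfolding has_dy_def rot2_def rot2y_def rot2x_def metr_def by (auto intro!: derivative_eq_intros)
  moreover have "has_dx (rot2y \<epsilon>) (\<lambda>x y. - \<epsilon> * k x * T2 x)" unfolding has_dx_def
  proof (intro ballI)
    fix x y :: real assume x: "x \<in> {0..1}"
    have "((\<lambda>x. rot2y \<epsilon> x y) has_real_derivative - \<epsilon> * (k x * T2 x)) (at x within {0..1})"
      unfolding rot2y_def by (intro DERIV_cmult dT3 x)
    then show "((\<lambda>x. rot2y \<epsilon> x y) has_real_derivative - \<epsilon> * k x * T2 x) (at x within {0..1})" by (simp add: mult.assoc)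
  qed
  ultimately show ?thesis by (simp add: C11sq_def C1sq_def)
qed

text \<open>After division by \<open>metr\<close> and \<epsilon> the two derivatives of the rotation
  are the normal and minus the tangent, so its gradient is skew in the frame and the two
  contributions to the mixed strain cancel.\<close>

lemma strain_energy_plus_rot:
  assumes "thin \<epsilon>"
  shows "strain_energy \<epsilon> (\<lambda>x y. px x y + c * rot1x \<epsilon> x y) (\<lambda>x y. py x y + c * rot1y \<epsilon> x y)
     (\<lambda>x y. qx x y + c * rot2x \<epsilon> x y) (\<lambda>x y. qy x y + c * rot2y \<epsilon> x y) = strain_energy \<epsilon> px py qx qy"
  unfolding strain_energy_def
proof (rule int2_cong)
  fix x y :: real assume xy: "x \<in> {0..1}" "y \<in> {0..1}"
  have g: "metr \<epsilon> x y \<noteq> 0" using metr_bounds[OF assms xy] by linarith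
  have e: "\<epsilon> \<noteq> 0" using assms by (simp add: thin_def)
  have "strain11 \<epsilon> (\<lambda>x y. px x y + c * rot1x \<epsilon> x y) (\<lambda>x y. qx x y + c * rot2x \<epsilon> x y) x y = strain11 \<epsilon> px qx x y"
    by (simp add: strain11_def rot1x_def rot2x_def algebra_simps)
  moreover have "strain22 \<epsilon> (\<lambda>x y. py x y + c * rot1y \<epsilon> x y) (\<lambda>x y. qy x y + c * rot2y \<epsilon> x y) x y = strain22 \<epsilon> py qy x y"
    by (simp add: strain22_def rot1y_def rot2y_def algebra_simps)
  moreover have "strain12 \<epsilon> (\<lambda>x y. px x y + c * rot1x \<epsilon> x y) (\<lambda>x y. py x y + c * rot1y \<epsilon> x y)
     (\<lambda>x y. qx x y + c * rot2x \<epsilon> x y) (\<lambda>x y. qy x y + c * rot2y \<epsilon> x y) x y = strain12 \<epsilon> px py qx qy x y"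
  proof -
    have "- T3 x * (px x y + c * rot1x \<epsilon> x y) + T2 x * (qx x y + c * rot2x \<epsilon> x y)
      = (- T3 x * px x y + T2 x * qx x y) + metr \<epsilon> x y * (c * ((T2 x)\<^sup>2 + (T3 x)\<^sup>2))"
      by (simp add: rot1x_def rot2x_def power2_eq_square algebra_simps)
    moreover have "T2 x * (py x y + c * rot1y \<epsilon> x y) + T3 x * (qy x y + c * rot2y \<epsilon> x y)
      = (T2 x * py x y + T3 x * qy x y) - \<epsilon> * (c * ((T2 x)\<^sup>2 + (T3 x)\<^sup>2))"
      by (simp add: rot1y_def rot2y_def power2_eq_square algebra_simps)
    ultimately show ?thesis
      unfolding strain12_def using g e by (simp add: add_divide_distrib diff_divide_distrib)
  qed
  ultimately show "(strain11 \<epsilon> (\<lambda>x y. px x y + c * rot1x \<epsilon> x y) (\<lambda>x y. qx x y + c * rot2x \<epsilon> x y) x y)\<^sup>2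
    + (strain22 \<epsilon> (\<lambda>x y. py x y + c * rot1y \<epsilon> x y) (\<lambda>x y. qy x y + c * rot2y \<epsilon> x y) x y)\<^sup>2
    + 2 * (strain12 \<epsilon> (\<lambda>x y. px x y + c * rot1x \<epsilon> x y) (\<lambda>x y. py x y + c * rot1y \<epsilon> x y)
     (\<lambda>x y. qx x y + c * rot2x \<epsilon> x y) (\<lambda>x y. qy x y + c * rot2y \<epsilon> x y) x y)\<^sup>2
    = (strain11 \<epsilon> px qx x y)\<^sup>2 + (strain22 \<epsilon> py qy x y)\<^sup>2 + 2 * (strain12 \<epsilon> px py qx qy x y)\<^sup>2"
    by simp
qed

text \<open>The strain gives all frame components of the gradient except the rotation, which is
  \<open>Y\<close>. The frame is orthonormal, so the Cartesian derivatives are recovered by the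
  transposed matrix, whose entries are at most 1.\<close>

lemma gradient_bound:
  assumes e: "thin \<epsilon>" and c: "cont2 px" "cont2 py" "cont2 qx" "cont2 qy"
  defines "Y \<equiv> (\<lambda>x y. - (T2 x * py x y + T3 x * qy x y) / \<epsilon>)"
  defines "D \<equiv> 30 * strain_energy \<epsilon> px py qx qy + 10 * int2 (\<lambda>x y. (Y x y)\<^sup>2)"
  shows "int2 (\<lambda>x y. (px x y)\<^sup>2) \<le> D" "int2 (\<lambda>x y. (qx x y)\<^sup>2) \<le> D"
    "int2 (\<lambda>x y. (py x y)\<^sup>2) \<le> D" "int2 (\<lambda>x y. (qy x y)\<^sup>2) \<le> D"
proof -
  have e0: "\<epsilon> > 0" "\<epsilon> \<le> 1" using e by (auto simp: thin_def)
  define S where "S = strain_energy \<epsilon> px py qx qy"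
  note sc = strain_cont[OF e c]
  note sb = strain_energy_bounds[OF e c, folded S_def]
  note Tc = cont2_x[OF T_cont(1)] cont2_x[OF T_cont(2)]
  have Yc: "cont2 Y" unfolding Y_def using e0 by (intro cont2_divide cont2_intros Tc c) auto
  define nY where "nY = int2 (\<lambda>x y. (Y x y)\<^sup>2)"
  have nYp: "nY \<ge> 0" unfolding nY_def by (rule int2_sq_nonneg[OF Yc])
  define H where "H = (\<lambda>x y. 2 * strain12 \<epsilon> px py qx qy x y)"
  define V where "V = (\<lambda>x y. metr \<epsilon> x y * strain11 \<epsilon> px qx x y)"
  define X where "X = (\<lambda>x y. metr \<epsilon> x y * (H x y + Y x y))"
  define P where "P = (\<lambda>x y. \<epsilon> * Y x y)"
  define R where "R = (\<lambda>x y. \<epsilon> * strain22 \<epsilon> py qy x y)"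
  have Hc: "cont2 H" unfolding H_def by (intro cont2_intros sc)
  have cc: "cont2 V" "cont2 X" "cont2 P" "cont2 R"
    unfolding V_def X_def P_def R_def by (intro cont2_intros sc Hc Yc metr_cont)+
  have V: "int2 (\<lambda>x y. (V x y)\<^sup>2) \<le> 9/4 * S"
    using int2_sq_mult_le[OF sc(1) metr_cont metr_abs[OF e]] sb(1) unfolding V_def power_divide by fastforce
  have X: "int2 (\<lambda>x y. (X x y)\<^sup>2) \<le> 9 * S + 9/2 * nY"
  proof -
    have "int2 (\<lambda>x y. (X x y)\<^sup>2) \<le> (3/2)\<^sup>2 * int2 (\<lambda>x y. (H x y + Y x y)\<^sup>2)"
      unfolding X_def by (intro int2_sq_mult_le metr_cont metr_abs e cont2_add Hc Yc)
    moreover have "int2 (\<lambda>x y. (H x y + Y x y)\<^sup>2) \<le> 2 * (2 * S) + 2 * nY"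
      using int2_sq_add_le[OF Hc Yc] sb(3) unfolding H_def nY_def by linarith
    ultimately show ?thesis unfolding power_divide by simp
  qed
  have P: "int2 (\<lambda>x y. (P x y)\<^sup>2) \<le> 1\<^sup>2 * nY"
    unfolding P_def nY_def using e0 by (intro int2_sq_mult_le Yc cont2_const) auto
  have "int2 (\<lambda>x y. (R x y)\<^sup>2) \<le> 1\<^sup>2 * int2 (\<lambda>x y. (strain22 \<epsilon> py qy x y)\<^sup>2)"
    unfolding R_def using e0 by (intro int2_sq_mult_le sc cont2_const) auto
  then have R: "int2 (\<lambda>x y. (R x y)\<^sup>2) \<le> S" using sb(2) by simp
  have le: "int2 (\<lambda>x y. (f x * F x y + h x * G x y)\<^sup>2) \<le> 2 * int2 (\<lambda>x y. (F x y)\<^sup>2) + 2 * int2 (\<lambda>x y. (G x y)\<^sup>2)"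
    if "cont2 F" "cont2 G" "cont2 (\<lambda>x y. f x)" "cont2 (\<lambda>x y. h x)" "\<And>x. x \<in> {0..1} \<Longrightarrow> \<bar>f x\<bar> \<le> 1" "\<And>x. x \<in> {0..1} \<Longrightarrow> \<bar>h x\<bar> \<le> 1"
    for f h F G
    using int2_sq_add_le[OF cont2_mult[OF that(3,1)] cont2_mult[OF that(4,2)]]
      int2_sq_mult_le[OF that(1,3,5)] int2_sq_mult_le[OF that(2,4,6)] by simp
  have g: "metr \<epsilon> x y \<noteq> 0" if "x \<in> {0..1}" "y \<in> {0..1}" for x y
    using metr_bounds[OF e that] by linarith
  have V_eq: "V x y = T2 x * px x y + T3 x * qx x y" if "x \<in> {0..1}" "y \<in> {0..1}" for x y
    using g[OF that] by (simp add: V_def strain11_def)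
  have X_eq: "X x y = - T3 x * px x y + T2 x * qx x y" if "x \<in> {0..1}" "y \<in> {0..1}" for x y
  proof -
    have "H x y + Y x y = (- T3 x * px x y + T2 x * qx x y) / metr \<epsilon> x y"
      by (simp add: H_def strain12_def Y_def add_divide_distrib diff_divide_distrib)
    then show ?thesis using g[OF that] by (simp add: X_def)
  qed
  have P_eq: "P x y = - (T2 x * py x y + T3 x * qy x y)" for x y
    using e0 by (simp add: P_def Y_def)
  have R_eq: "R x y = - T3 x * py x y + T2 x * qy x y" for x y
    using e0 by (simp add: R_def strain22_def)
  have u: "T2 x * T2 x + T3 x * T3 x = 1" if "x \<in> {0..1}" for x
    using unit[OF that] by (simp add: power2_eq_square)
  have px_eq: "px x y = T2 x * V x y + (- T3 x) * X x y" and qx_eq: "qx x y = T3 x * V x y + T2 x * X x y"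
    and py_eq: "py x y = (- T2 x) * P x y + (- T3 x) * R x y" and qy_eq: "qy x y = (- T3 x) * P x y + T2 x * R x y"
    if "x \<in> {0..1}" "y \<in> {0..1}" for x y
  proof -
    have "T2 x * V x y + (- T3 x) * X x y = (T2 x * T2 x + T3 x * T3 x) * px x y"
      "T3 x * V x y + T2 x * X x y = (T2 x * T2 x + T3 x * T3 x) * qx x y"
      "(- T2 x) * P x y + (- T3 x) * R x y = (T2 x * T2 x + T3 x * T3 x) * py x y"
      "(- T3 x) * P x y + T2 x * R x y = (T2 x * T2 x + T3 x * T3 x) * qy x y"
      unfolding V_eq[OF that] X_eq[OF that] P_eq R_eq by (simp_all add: algebra_simps)
    then show "px x y = T2 x * V x y + (- T3 x) * X x y" "qx x y = T3 x * V x y + T2 x * X x y"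
      "py x y = (- T2 x) * P x y + (- T3 x) * R x y" "qy x y = (- T3 x) * P x y + T2 x * R x y"
      unfolding u[OF that(1)] by simp_all
  qed
  have Tm: "cont2 (\<lambda>x y. - T2 x)" "cont2 (\<lambda>x y. - T3 x)" by (intro cont2_minus Tc)+
  have "int2 (\<lambda>x y. (px x y)\<^sup>2) = int2 (\<lambda>x y. (T2 x * V x y + (- T3 x) * X x y)\<^sup>2)"
    by (rule int2_cong) (simp only: px_eq[symmetric])
  also have "\<dots> \<le> 2 * int2 (\<lambda>x y. (V x y)\<^sup>2) + 2 * int2 (\<lambda>x y. (X x y)\<^sup>2)"
    by (rule le[OF cc(1,2) Tc(1) Tm(2)]) (use T_bound in auto)
  finally show "int2 (\<lambda>x y. (px x y)\<^sup>2) \<le> D"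
    using V X nYp sb(4) unfolding D_def S_def[symmetric] nY_def[symmetric] by argo
  have "int2 (\<lambda>x y. (qx x y)\<^sup>2) = int2 (\<lambda>x y. (T3 x * V x y + T2 x * X x y)\<^sup>2)"
    by (rule int2_cong) (simp only: qx_eq[symmetric])
  also have "\<dots> \<le> 2 * int2 (\<lambda>x y. (V x y)\<^sup>2) + 2 * int2 (\<lambda>x y. (X x y)\<^sup>2)"
    by (rule le[OF cc(1,2) Tc(2) Tc(1)]) (use T_bound in auto)
  finally show "int2 (\<lambda>x y. (qx x y)\<^sup>2) \<le> D"
    using V X nYp sb(4) unfolding D_def S_def[symmetric] nY_def[symmetric] by argo
  have "int2 (\<lambda>x y. (py x y)\<^sup>2) = int2 (\<lambda>x y. ((- T2 x) * P x y + (- T3 x) * R x y)\<^sup>2)"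
    by (rule int2_cong) (simp only: py_eq[symmetric])
  also have "\<dots> \<le> 2 * int2 (\<lambda>x y. (P x y)\<^sup>2) + 2 * int2 (\<lambda>x y. (R x y)\<^sup>2)"
    by (rule le[OF cc(3,4) Tm]) (use T_bound in auto)
  finally show "int2 (\<lambda>x y. (py x y)\<^sup>2) \<le> D"
    using P R nYp sb(4) unfolding D_def S_def[symmetric] nY_def[symmetric] by simp
  have "int2 (\<lambda>x y. (qy x y)\<^sup>2) = int2 (\<lambda>x y. ((- T3 x) * P x y + T2 x * R x y)\<^sup>2)"
    by (rule int2_cong) (simp only: qy_eq[symmetric])
  also have "\<dots> \<le> 2 * int2 (\<lambda>x y. (P x y)\<^sup>2) + 2 * int2 (\<lambda>x y. (R x y)\<^sup>2)"
    by (rule le[OF cc(3,4) Tm(2) Tc(1)]) (use T_bound in auto)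
  finally show "int2 (\<lambda>x y. (qy x y)\<^sup>2) \<le> D"
    using P R nYp sb(4) unfolding D_def S_def[symmetric] nY_def[symmetric] by simp
qed

text \<open>Normalising the mean rotation allows \<open>Y\<close> to be bounded by strain over
  \<epsilon>; the gradient bound then controls all derivatives, and the Poincare inequality the
  field up to the translation (l, m).\<close>

theorem korn_curved:
  "\<exists>\<epsilon>0>0. \<exists>C>0. \<forall>\<epsilon>. 0 < \<epsilon> \<and> \<epsilon> < \<epsilon>0 \<longrightarrow> thin \<epsilon> \<and>
    (\<forall>p px py pxy q qx qy qxy. C11sq p px py pxy \<longrightarrow> C11sq q qx qy qxy \<longrightarrow>
      (\<exists>c l m. int2 (\<lambda>x y. (p x y + c * rot1 \<epsilon> x y - l)\<^sup>2) + int2 (\<lambda>x y. (q x y + c * rot2 \<epsilon> x y - m)\<^sup>2)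
        + int2 (\<lambda>x y. (px x y + c * rot1x \<epsilon> x y)\<^sup>2) + int2 (\<lambda>x y. (qx x y + c * rot2x \<epsilon> x y)\<^sup>2)
        + int2 (\<lambda>x y. (py x y + c * rot1y \<epsilon> x y)\<^sup>2) + int2 (\<lambda>x y. (qy x y + c * rot2y \<epsilon> x y)\<^sup>2)
        \<le> C / \<epsilon>\<^sup>2 * strain_energy \<epsilon> px py qx qy))"
proof -
  obtain C where C: "C > 0" and korn: "\<And>a ax ay b bx by bxy. C1sq a ax ay \<Longrightarrow> C11sq b bx by bxy \<Longrightarrow>
    (\<exists>c. int2 (\<lambda>x y. (ay x y + c)\<^sup>2) + int2 (\<lambda>x y. (bx x y - c)\<^sup>2) \<le> C *
      (int2 (\<lambda>x y. (ax x y)\<^sup>2) + int2 (\<lambda>x y. (by x y)\<^sup>2) + int2 (\<lambda>x y. (ay x y + bx x y)\<^sup>2)))"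
    using korn_square by blast
  \<comment> \<open>Below \<open>1 / M\<close> the three smallness conditions hold together:
    \<open>\<epsilon> \<le> 1\<close>, \<open>\<epsilon> * K \<le> 1\<close> and the absorption
    condition with \<open>10 * C * K\<^sup>2\<close>.\<close>
  define M where "M = 1 + K + 10 * C * K\<^sup>2"
  have M: "M \<ge> 1" "M \<ge> K" "M \<ge> 10 * C * K\<^sup>2" using C K_nonneg by (auto simp: M_def)
  define C1 where "C1 = C * (56 + 4 * K\<^sup>2)"
  have C1: "C1 \<ge> 0" unfolding C1_def using C by simp
  show ?thesis
  proof (rule exI[of _ "1 / M"], rule conjI, use M in simp, rule exI[of _ "12 * (30 + 10 * C1)"], rule conjI, use C1 in simp,
      intro allI impI)
    fix \<epsilon> assume e: "0 < \<epsilon> \<and> \<epsilon> < 1 / M"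
    then have eM: "\<epsilon> * M < 1" using M by (simp add: pos_less_divide_eq)
    have "\<epsilon> * 1 \<le> \<epsilon> * M" "\<epsilon> * K \<le> \<epsilon> * M" "\<epsilon> * (10 * C * K\<^sup>2) \<le> \<epsilon> * M"
      using e M by (auto intro!: mult_left_mono)
    then have e1: "\<epsilon> \<le> 1" "\<epsilon> * K \<le> 1" "\<epsilon> * (10 * C * K\<^sup>2) \<le> 1" using eM by linarith+
    have thin: "thin \<epsilon>" using e e1 by (simp add: thin_def)
    have e2: "10 * C * K\<^sup>2 * \<epsilon>\<^sup>2 \<le> 1"
    proof -
      have "10 * C * K\<^sup>2 * \<epsilon>\<^sup>2 = \<epsilon> * (\<epsilon> * (10 * C * K\<^sup>2))" by (simp add: power2_eq_square)
      also have "\<dots> \<le> 1 * 1" using e e1 C by (intro mult_mono) auto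
      finally show ?thesis by simp
    qed
    show "thin \<epsilon> \<and>
    (\<forall>p px py pxy q qx qy qxy. C11sq p px py pxy \<longrightarrow> C11sq q qx qy qxy \<longrightarrow>
      (\<exists>c l m. int2 (\<lambda>x y. (p x y + c * rot1 \<epsilon> x y - l)\<^sup>2) + int2 (\<lambda>x y. (q x y + c * rot2 \<epsilon> x y - m)\<^sup>2)
        + int2 (\<lambda>x y. (px x y + c * rot1x \<epsilon> x y)\<^sup>2) + int2 (\<lambda>x y. (qx x y + c * rot2x \<epsilon> x y)\<^sup>2)
        + int2 (\<lambda>x y. (py x y + c * rot1y \<epsilon> x y)\<^sup>2) + int2 (\<lambda>x y. (qy x y + c * rot2y \<epsilon> x y)\<^sup>2)
        \<le> 12 * (30 + 10 * C1) / \<epsilon>\<^sup>2 * strain_energy \<epsilon> px py qx qy))"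
    proof (intro conjI thin allI impI)
      fix p px py pxy q qx qy qxy :: "real \<Rightarrow> real \<Rightarrow> real"
      assume p: "C11sq p px py pxy" and q: "C11sq q qx qy qxy"
      note pc = C11sqD[OF p] and qc = C11sqD[OF q]
      define Y where "Y = (\<lambda>x y. - (T2 x * py x y + T3 x * qy x y) / \<epsilon>)"
      have Yc: "cont2 Y" unfolding Y_def using e
        by (intro cont2_divide cont2_intros cont2_x[OF T_cont(1)] cont2_x[OF T_cont(2)] pc qc) auto
      \<comment> \<open>Adding \<open>c\<close> times the rotation field shifts \<open>Y\<close> by
        exactly \<open>c\<close> and does not change the strain; this value makes the mean
        zero.\<close>
      define c where "c = - int2 Y"
      note p' = C11sq_lincomb[OF p C11sq_rot1, of c \<epsilon>] and q' = C11sq_lincomb[OF q C11sq_rot2, of c \<epsilon>]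
      define P where "P = (\<lambda>x y. p x y + c * rot1 \<epsilon> x y)"
      define Px where "Px = (\<lambda>x y. px x y + c * rot1x \<epsilon> x y)"
      define Py where "Py = (\<lambda>x y. py x y + c * rot1y \<epsilon> x y)"
      define Q where "Q = (\<lambda>x y. q x y + c * rot2 \<epsilon> x y)"
      define Qx where "Qx = (\<lambda>x y. qx x y + c * rot2x \<epsilon> x y)"
      define Qy where "Qy = (\<lambda>x y. qy x y + c * rot2y \<epsilon> x y)"
      note P = p'[folded P_def Px_def Py_def] and Q = q'[folded Q_def Qx_def Qy_def]
      note Pc = C11sqD[OF P] and Qc = C11sqD[OF Q]
      define S where "S = strain_energy \<epsilon> px py qx qy"
      have S: "strain_energy \<epsilon> Px Py Qx Qy = S"
        unfolding S_def Px_def Py_def Qx_def Qy_def by (rule strain_energy_plus_rot[OF thin])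
      have S0: "S \<ge> 0" unfolding S_def by (rule strain_energy_bounds(4)[OF thin pc(3,4) qc(3,4)])
      define Y' where "Y' = (\<lambda>x y. - (T2 x * Py x y + T3 x * Qy x y) / \<epsilon>)"
      have "int2 Y' = int2 (\<lambda>x y. Y x y + c)"
      proof (rule int2_cong)
        fix x y :: real assume x: "x \<in> {0..1}"
        have "T2 x * Py x y + T3 x * Qy x y = (T2 x * py x y + T3 x * qy x y) - \<epsilon> * (c * ((T2 x)\<^sup>2 + (T3 x)\<^sup>2))"
          by (simp add: Py_def Qy_def rot1y_def rot2y_def power2_eq_square algebra_simps)
        then have "Y' x y = - ((T2 x * py x y + T3 x * qy x y) - \<epsilon> * c) / \<epsilon>"
          by (simp add: Y'_def unit[OF x])
        also have "\<dots> = Y x y + c" using e by (simp add: Y_def field_simps)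
        finally show "Y' x y = Y x y + c" .
      qed
      also have "\<dots> = 0" by (subst int2_add) (auto simp: Yc c_def)
      finally have Y0: "int2 Y' = 0" .
      have nY: "int2 (\<lambda>x y. (Y' x y)\<^sup>2) \<le> C1 * S / \<epsilon>\<^sup>2"
        unfolding S[symmetric] C1_def Y'_def
        by (rule rotation_bound_if_mean_zero[OF C _ thin e2 P Q Y0[unfolded Y'_def]], rule korn)
      define D where "D = 30 * S + 10 * int2 (\<lambda>x y. (Y' x y)\<^sup>2)"
      have "S \<le> S / \<epsilon>\<^sup>2" using S0 e e1 by (simp add: pos_le_divide_eq mult_left_le power_le_one)
      then have D: "D \<le> (30 + 10 * C1) / \<epsilon>\<^sup>2 * S"
        using nY unfolding D_def by (simp add: distrib_right add_divide_distrib)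
      have D_eq: "D = 30 * S + 10 * int2 (\<lambda>x y. (- (T2 x * Py x y + T3 x * Qy x y) / \<epsilon>)\<^sup>2)"
        by (simp add: D_def Y'_def)
      note gb = gradient_bound[OF thin Pc(3,4) Qc(3,4), unfolded S, folded D_eq]
      have 1: "int2 (\<lambda>x y. (P x y - int2 P)\<^sup>2) \<le> 4 * D"
        using int2_sq_minus_mean_le[OF Pc(2,3,4,6,7)] gb by linarith
      have 2: "int2 (\<lambda>x y. (Q x y - int2 Q)\<^sup>2) \<le> 4 * D"
        using int2_sq_minus_mean_le[OF Qc(2,3,4,6,7)] gb by linarith
      \<comment> \<open>Each of the two Poincare terms costs \<open>4 * D\<close> and each of the
        four derivatives \<open>D\<close>.\<close>
      have "int2 (\<lambda>x y. (P x y - int2 P)\<^sup>2) + int2 (\<lambda>x y. (Q x y - int2 Q)\<^sup>2)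
        + int2 (\<lambda>x y. (Px x y)\<^sup>2) + int2 (\<lambda>x y. (Qx x y)\<^sup>2) + int2 (\<lambda>x y. (Py x y)\<^sup>2) + int2 (\<lambda>x y. (Qy x y)\<^sup>2)
        \<le> 12 * D" using 1 2 gb by linarith
      also have "\<dots> \<le> 12 * ((30 + 10 * C1) / \<epsilon>\<^sup>2 * S)" using D by simp
      also have "\<dots> = 12 * (30 + 10 * C1) / \<epsilon>\<^sup>2 * S" by (simp add: algebra_simps)
      finally show "\<exists>c l m. int2 (\<lambda>x y. (p x y + c * rot1 \<epsilon> x y - l)\<^sup>2) + int2 (\<lambda>x y. (q x y + c * rot2 \<epsilon> x y - m)\<^sup>2)
        + int2 (\<lambda>x y. (px x y + c * rot1x \<epsilon> x y)\<^sup>2) + int2 (\<lambda>x y. (qx x y + c * rot2x \<epsilon> x y)\<^sup>2)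
        + int2 (\<lambda>x y. (py x y + c * rot1y \<epsilon> x y)\<^sup>2) + int2 (\<lambda>x y. (qy x y + c * rot2y \<epsilon> x y)\<^sup>2)
        \<le> 12 * (30 + 10 * C1) / \<epsilon>\<^sup>2 * strain_energy \<epsilon> px py qx qy"
        unfolding P_def Px_def Py_def Q_def Qx_def Qy_def S_def by (intro exI)
    qed
  qed
qed

end

section \<open>Smooth functions and cut-offs\<close>

text \<open>The whole sequence of derivatives is the witness, so smoothness of a function is shown
  by exhibiting one explicit sequence.\<close>

definition smooth1 :: "(real \<Rightarrow> real) \<Rightarrow> bool" where
  "smooth1 f \<longleftrightarrow> (\<exists>D. D 0 = f \<and> (\<forall>n x. (D n has_real_derivative D (Suc n) x) (at x)))"

lemma smooth1_deriv:
  assumes "smooth1 f"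
  obtains f' where "smooth1 f'" "\<And>x. (f has_real_derivative f' x) (at x)"
proof -
  obtain D where D: "D 0 = f" "\<And>n x. (D n has_real_derivative D (Suc n) x) (at x)"
    using assms unfolding smooth1_def by blast
  have "smooth1 (D 1)"
    unfolding smooth1_def using D(2) by (intro exI[of _ "\<lambda>n. D (Suc n)"]) auto
  with D show ?thesis using that[of "D 1"] by auto
qed

lemma smooth1_affine: "smooth1 f \<Longrightarrow> smooth1 (\<lambda>x. f (a * x + b))"
proof -
  assume "smooth1 f"
  then obtain D where D: "D 0 = f" "\<And>n x. (D n has_real_derivative D (Suc n) x) (at x)"
    unfolding smooth1_def by blast
  have "((\<lambda>x. a ^ n * D n (a * x + b)) has_real_derivative a ^ Suc n * D (Suc n) (a * x + b)) (at x)" for n x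
    by (rule derivative_eq_intros DERIV_chain2[OF D(2)] refl | simp)+
  then show ?thesis
    unfolding smooth1_def using D(1) by (intro exI[of _ "\<lambda>n x. a ^ n * D n (a * x + b)"]) auto
qed

lemma smooth1_const: "smooth1 (\<lambda>x. c)"
proof -
  have "((\<lambda>x. if n = 0 then c else 0) has_real_derivative 0) (at x)" for n :: nat and x :: real
    by simp
  then show ?thesis
    unfolding smooth1_def by (intro exI[of _ "\<lambda>n x. if n = 0 then c else 0"]) auto
qed

lemma smooth1_cos: "smooth1 cos"
proof -
  have "((\<lambda>x. cos (x + real n * (pi/2))) has_real_derivative cos (x + real (Suc n) * (pi/2))) (at x)" for n x
  proof -
    have "cos (x + real (Suc n) * (pi/2)) = cos ((x + real n * (pi/2)) + pi/2)"
      by (simp add: field_simps)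
    also have "\<dots> = - sin (x + real n * (pi/2))" by (simp only: cos_add) simp
    finally show ?thesis by (auto intro!: derivative_eq_intros)
  qed
  then show ?thesis
    unfolding smooth1_def by (intro exI[of _ "\<lambda>n x. cos (x + real n * (pi/2))"]) auto
qed

lemma smooth1_sin: "smooth1 sin"
  using smooth1_affine[OF smooth1_cos, of 1 "- (pi/2)"] by (simp add: cos_diff)

section \<open>A smooth step and truncations near the ends of an interval\<close>

definition bump :: "real \<Rightarrow> real" where "bump x = (if x > 0 then exp (- (1/x)) else 0)"

definition bump' :: "real \<Rightarrow> real" where "bump' x = (if x > 0 then exp (- (1/x)) / x\<^sup>2 else 0)"

lemma poly_exp_tendsto_0: "((\<lambda>z::real. poly q z * exp (- z)) \<longlongrightarrow> 0) at_top"
proof -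
  have "((\<lambda>z::real. \<Sum>i\<le>degree q. coeff q i * (z ^ i / exp z)) \<longlongrightarrow> (\<Sum>i\<le>degree q. coeff q i * 0)) at_top"
    by (intro tendsto_intros tendsto_power_div_exp_0)
  then show ?thesis
    by (simp add: poly_altdef sum_distrib_right exp_minus divide_inverse mult.assoc)
qed

text \<open>With \<open>z = 1/x\<close> the derivative in x is minus z squared times the derivative
  in z, so \<open>q(z) exp(-z)\<close> becomes \<open>z\<^sup>2 (q - q') exp(-z)\<close>: the family
  is closed under differentiation.\<close>

lemma poly_bump_deriv:
  fixes q :: "real poly"
  defines "F \<equiv> (\<lambda>q x. if x > 0 then poly q (1/x) * exp (- (1/x)) else 0 :: real)"
  shows "(F q has_real_derivative F ([:0,0,1:] * (q - pderiv q)) x) (at x)"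
proof -
  consider "x > 0" | "x < 0" | "x = 0" by linarith
  then show ?thesis
  proof cases
    case 1
    have "((\<lambda>x. poly q (1/x) * exp (- (1/x))) has_real_derivative
        poly ([:0,0,1:] * (q - pderiv q)) (1/x) * exp (- (1/x))) (at x)"
      using 1 by (auto intro!: derivative_eq_intros DERIV_chain2[OF poly_DERIV] simp: power2_eq_square field_simps)
    then have "(F q has_real_derivative poly ([:0,0,1:] * (q - pderiv q)) (1/x) * exp (- (1/x))) (at x)"
      by (rule has_field_derivative_transform_within_open[where S="{0<..}"]) (use 1 in \<open>auto simp: F_def\<close>)
    then show ?thesis using 1 by (simp add: F_def)
  next
    case 2
    have "((\<lambda>x. 0) has_real_derivative 0) (at x)" by simp
    then have "(F q has_real_derivative 0) (at x)"
      by (rule has_field_derivative_transform_within_open[where S="{..<0}"]) (use 2 in \<open>auto simp: F_def\<close>)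
    then show ?thesis using 2 by (simp add: F_def)
  next
    case 3
    have lim: "((\<lambda>h. (F q h - F q 0) / (h - 0)) \<longlongrightarrow> 0) (at 0)"
    proof (rule filterlim_split_at)
      have "eventually (\<lambda>h::real. (F q h - F q 0) / (h - 0) = 0) (at_left 0)"
        by (auto simp: eventually_at_filter F_def)
      then show "((\<lambda>h. (F q h - F q 0) / (h - 0)) \<longlongrightarrow> 0) (at_left 0)"
        by (rule tendsto_eventually)
      \<comment> \<open>The quotient by h contributes one more factor z = 1/h, which is
        multiplication of \<open>q\<close> by the variable.\<close>
      have "((\<lambda>h. poly (pCons 0 q) (inverse h) * exp (- inverse h)) \<longlongrightarrow> 0) (at_right (0::real))"
        by (rule filterlim_compose[OF poly_exp_tendsto_0 filterlim_inverse_at_top_right])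
      moreover have "eventually (\<lambda>h::real. poly (pCons 0 q) (inverse h) * exp (- inverse h) = (F q h - F q 0) / (h - 0)) (at_right 0)"
        by (auto simp: eventually_at_filter F_def field_simps)
      ultimately show "((\<lambda>h. (F q h - F q 0) / (h - 0)) \<longlongrightarrow> 0) (at_right 0)"
        by (rule Lim_transform_eventually)
    qed
    then show ?thesis using 3 by (simp add: has_field_derivative_iff F_def)
  qed
qed

lemma smooth1_bump: "smooth1 bump"
proof -
  define P where "P = (\<lambda>n. ((\<lambda>q. [:0,0,1:] * (q - pderiv q)) ^^ n) (1 :: real poly))"
  define F where "F = (\<lambda>(q::real poly) (x::real). if x > 0 then poly q (1/x) * exp (- (1/x)) else 0)"
  have "P (Suc n) = [:0,0,1:] * (P n - pderiv (P n))" for n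
    unfolding P_def by (simp only: funpow.simps o_apply)
  then have "(F (P n) has_real_derivative F (P (Suc n)) x) (at x)" for n x
    using poly_bump_deriv[of "P n" x] unfolding F_def by presburger
  moreover have "F (P 0) = bump" by (auto simp: F_def P_def bump_def)
  ultimately show ?thesis unfolding smooth1_def by (intro exI[of _ "\<lambda>n. F (P n)"]) auto
qed

lemma bump_deriv: "(bump has_real_derivative bump' x) (at x)"
proof -
  have "(\<lambda>x. if x > 0 then poly 1 (1/x) * exp (- (1/x)) else 0) = bump"
    "(\<lambda>x::real. if x > 0 then poly ([:0,0,1:] * (1 - pderiv 1)) (1/x) * exp (- (1/x)) else 0) = bump'"
    by (auto simp: bump_def bump'_def power2_eq_square)
  then show ?thesis using poly_bump_deriv[of 1 x] by (metis (no_types, lifting))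
qed

lemma bump_bounds: "0 \<le> bump x" "bump x \<le> 1"
  by (auto simp: bump_def)

text \<open>The factor \<open>1 + x\<close> is adapted to the argument \<open>n * x - 1\<close>: it
  becomes \<open>n * x\<close>, so the derivative of the rescaled step is at most 3/x for every
  n.\<close>

lemma bump'_bounds: "0 \<le> bump' x" "(1 + x) * bump' x \<le> 3"
proof -
  show "0 \<le> bump' x" by (auto simp: bump'_def)
  show "(1 + x) * bump' x \<le> 3"
  proof (cases "x > 0")
    case True
    define z where "z = 1/x"
    have z: "z > 0" using True by (simp add: z_def)
    have "(1 + x) * bump' x = (z\<^sup>2 + z) * exp (- z)"
      using True by (simp add: bump'_def z_def power2_eq_square field_simps)
    also have "\<dots> \<le> 3"
    proof -
      have "1 + z + z\<^sup>2 / 2 \<le> exp z" using exp_lower_Taylor_quadratic[of z] z by simp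
      then have "z\<^sup>2 + z \<le> 3 * exp z" using z zero_le_power2[of z] by linarith
      then have "(z\<^sup>2 + z) * exp (- z) \<le> 3 * exp z * exp (- z)" by (rule mult_right_mono) simp
      then show ?thesis by (simp add: mult.assoc exp_add[symmetric])
    qed
    finally show ?thesis .
  qed (simp add: bump'_def)
qed

text \<open>It vanishes within distance 1/n of 0 and 1. There is no plateau of value 1; it tends to
  1 pointwise inside because \<open>bump\<close> does so at infinity.\<close>

definition trunc :: "nat \<Rightarrow> real \<Rightarrow> real" where
  "trunc n x = bump (real n * x - 1) * bump (real n * (1 - x) - 1)"

definition trunc' :: "nat \<Rightarrow> real \<Rightarrow> real" where
  "trunc' n x = real n * bump' (real n * x - 1) * bump (real n * (1 - x) - 1)
     - bump (real n * x - 1) * (real n * bump' (real n * (1 - x) - 1))"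

lemma trunc_deriv: "(trunc n has_real_derivative trunc' n x) (at x)"
  unfolding trunc_def[abs_def] trunc'_def
  by (rule derivative_eq_intros DERIV_chain2[OF bump_deriv] refl | simp add: algebra_simps)+

lemma trunc_bounds: "0 \<le> trunc n x" "trunc n x \<le> 1"
  by (auto simp: trunc_def bump_bounds mult_le_one)

lemma trunc_0: "trunc n x \<noteq> 0 \<Longrightarrow> n > 0 \<and> x \<in> {1 / real n..1 - 1 / real n}"
  by (cases "n = 0") (auto simp: trunc_def bump_def field_simps split: if_splits)

text \<open>Independence of n is the point: against a function vanishing linearly at both ends, the
  derivatives of all truncations have a common bound.\<close>

lemma trunc'_bound:
  assumes "0 < x" "x < 1"
  shows "\<bar>trunc' n x\<bar> \<le> 3 / x + 3 / (1 - x)"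
proof -
  have *: "real n * bump' (real n * x - 1) \<le> 3 / x" if "x > 0" for x
    using bump'_bounds(2)[of "real n * x - 1"] that by (simp add: pos_le_divide_eq mult_ac)
  have "\<bar>trunc' n x\<bar> \<le> \<bar>real n * bump' (real n * x - 1) * bump (real n * (1 - x) - 1)\<bar>
      + \<bar>bump (real n * x - 1) * (real n * bump' (real n * (1 - x) - 1))\<bar>"
    unfolding trunc'_def by (rule abs_triangle_ineq4)
  also have "\<dots> = real n * bump' (real n * x - 1) * bump (real n * (1 - x) - 1)
      + bump (real n * x - 1) * (real n * bump' (real n * (1 - x) - 1))"
    by (simp add: abs_mult bump_bounds bump'_bounds)
  also have "\<dots> \<le> real n * bump' (real n * x - 1) * 1 + 1 * (real n * bump' (real n * (1 - x) - 1))"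
    by (intro add_mono mult_mono bump_bounds mult_nonneg_nonneg bump'_bounds) auto
  also have "\<dots> \<le> 3 / x + 3 / (1 - x)" using *[of x] *[of "1 - x"] assms by simp
  finally show ?thesis .
qed

lemma trunc_tendsto:
  assumes "0 < x" "x < 1"
  shows "(\<lambda>n. trunc n x) \<longlonglongrightarrow> 1" "(\<lambda>n. trunc' n x) \<longlonglongrightarrow> 0"
proof -
  have lim: "filterlim (\<lambda>n. real n * x - 1) at_top sequentially" if "x > 0" for x
    using that by real_asymp
  have ev: "eventually (\<lambda>n. real n * x - 1 > 0) sequentially" if "x > 0" for x
    using filterlim_at_top_dense[THEN iffD1, OF lim[OF that], rule_format, of 0] .
  have b: "(\<lambda>n. bump (real n * x - 1)) \<longlonglongrightarrow> 1" if "x > 0" for x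
  proof -
    have "(\<lambda>n. exp (- (1 / (real n * x - 1)))) \<longlonglongrightarrow> 1" using that by real_asymp
    then show ?thesis
      by (rule Lim_transform_eventually) (use ev[OF that] in \<open>auto elim!: eventually_mono simp: bump_def\<close>)
  qed
  have b': "(\<lambda>n. real n * bump' (real n * x - 1)) \<longlonglongrightarrow> 0" if "x > 0" for x
  proof -
    have "(\<lambda>n. real n * (exp (- (1 / (real n * x - 1))) / (real n * x - 1)\<^sup>2)) \<longlonglongrightarrow> 0" using that by real_asymp
    then show ?thesis
      by (rule Lim_transform_eventually) (use ev[OF that] in \<open>auto elim!: eventually_mono simp: bump'_def\<close>)
  qed
  have x: "1 - x > 0" using assms by simp
  show "(\<lambda>n. trunc n x) \<longlonglongrightarrow> 1"
    unfolding trunc_def using tendsto_mult[OF b[OF assms(1)] b[OF x]] by simp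
  show "(\<lambda>n. trunc' n x) \<longlonglongrightarrow> 0"
    unfolding trunc'_def
    using tendsto_diff[OF tendsto_mult[OF b'[OF assms(1)] b[OF x]] tendsto_mult[OF b[OF assms(1)] b'[OF x]]] by simp
qed

text \<open>Sums and products of smooth functions of one variable. The class contains the
  truncations and the trigonometric functions, and its closure under \<open>pdir\<close> reduces
  smoothness to an induction over the directions.\<close>

inductive_set Csm :: "(real \<times> real \<Rightarrow> real) set" where
  Csm_fst: "smooth1 f \<Longrightarrow> (\<lambda>p. f (fst p)) \<in> Csm"
| Csm_snd: "smooth1 f \<Longrightarrow> (\<lambda>p. f (snd p)) \<in> Csm"
| Csm_add: "F \<in> Csm \<Longrightarrow> G \<in> Csm \<Longrightarrow> (\<lambda>p. F p + G p) \<in> Csm"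
| Csm_mult: "F \<in> Csm \<Longrightarrow> G \<in> Csm \<Longrightarrow> (\<lambda>p. F p * G p) \<in> Csm"

lemma Csm_const: "(\<lambda>p. c) \<in> Csm"
  using Csm_fst[OF smooth1_const] .

lemma pdir_eq: "(\<And>p. (F has_derivative D p) (at p)) \<Longrightarrow> pdir e F = (\<lambda>p. D p e)"
  unfolding pdir_def by (rule ext) (metis frechet_derivative_at)

text \<open>Both halves are needed in one induction: the derivative of a product stays in the class
  only because the directional derivatives of both factors do.\<close>

lemma Csm_has_derivative:
  assumes "F \<in> Csm"
  shows "\<exists>D. (\<forall>p. (F has_derivative D p) (at p)) \<and> (\<forall>e. (\<lambda>p. D p e) \<in> Csm)"
  using assms
proof induction
  case (Csm_fst f)
  then obtain f' where f': "smooth1 f'" "\<And>x. (f has_real_derivative f' x) (at x)" using smooth1_deriv by blast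
  have "((\<lambda>p. f (fst p)) has_derivative (\<lambda>h. f' (fst p) * fst h)) (at p)" for p :: "real \<times> real"
    using has_derivative_compose[OF has_derivative_fst[OF has_derivative_ident] f'(2)[unfolded has_field_derivative_def], of p]
    by simp
  moreover have "(\<lambda>p. f' (fst p) * fst e) \<in> Csm" for e :: "real \<times> real"
    by (intro Csm.Csm_mult Csm.Csm_fst f' Csm_const)
  ultimately show ?case by (intro exI[of _ "\<lambda>p h. f' (fst p) * fst h"]) auto
next
  case (Csm_snd f)
  then obtain f' where f': "smooth1 f'" "\<And>x. (f has_real_derivative f' x) (at x)" using smooth1_deriv by blast
  have "((\<lambda>p. f (snd p)) has_derivative (\<lambda>h. f' (snd p) * snd h)) (at p)" for p :: "real \<times> real"
    using has_derivative_compose[OF has_derivative_snd[OF has_derivative_ident] f'(2)[unfolded has_field_derivative_def], of p]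
    by simp
  moreover have "(\<lambda>p. f' (snd p) * snd e) \<in> Csm" for e :: "real \<times> real"
    by (intro Csm.Csm_mult Csm.Csm_snd f' Csm_const)
  ultimately show ?case by (intro exI[of _ "\<lambda>p h. f' (snd p) * snd h"]) auto
next
  case (Csm_add F G)
  then obtain D E where "\<forall>p. (F has_derivative D p) (at p)" "\<forall>e. (\<lambda>p. D p e) \<in> Csm"
    "\<forall>p. (G has_derivative E p) (at p)" "\<forall>e. (\<lambda>p. E p e) \<in> Csm" by blast
  then show ?case
    by (intro exI[of _ "\<lambda>p h. D p h + E p h"]) (auto intro!: has_derivative_add Csm.Csm_add)
next
  case (Csm_mult F G)
  then obtain D E where "\<forall>p. (F has_derivative D p) (at p)" "\<forall>e. (\<lambda>p. D p e) \<in> Csm"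
    "\<forall>p. (G has_derivative E p) (at p)" "\<forall>e. (\<lambda>p. E p e) \<in> Csm" by blast
  with Csm_mult(1,2) show ?case
    by (intro exI[of _ "\<lambda>p h. F p * E p h + D p h * G p"]) (auto intro!: has_derivative_mult Csm.Csm_add Csm.Csm_mult)
qed

lemma Csm_pdir: "F \<in> Csm \<Longrightarrow> pdir e F \<in> Csm"
  using Csm_has_derivative[of F] pdir_eq[of F _ e] by metis

lemma Csm_differentiable: "F \<in> Csm \<Longrightarrow> F differentiable at p"
  using Csm_has_derivative[of F] unfolding differentiable_def by blast

lemma Csm_continuous: "F \<in> Csm \<Longrightarrow> continuous_on A F"
  by (meson Csm_differentiable continuous_at_imp_continuous_on differentiable_imp_continuous_within)

lemma Csm_smooth2:
  assumes "F \<in> Csm"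
  shows "smooth2 F"
proof -
  have "iter_pd es F \<in> Csm" for es
    by (induction es) (auto intro: assms Csm_pdir)
  then show ?thesis
    unfolding smooth2_def
    by (auto simp: differentiable_on_def Csm_continuous intro: differentiable_at_withinI Csm_differentiable)
qed

lemma pdir_mult:
  assumes "F \<in> Csm" "G \<in> Csm"
  shows "pdir e (\<lambda>p. F p * G p) = (\<lambda>p. F p * pdir e G p + pdir e F p * G p)"
proof -
  obtain D E where D: "\<And>p. (F has_derivative D p) (at p)" and E: "\<And>p. (G has_derivative E p) (at p)"
    using Csm_has_derivative[OF assms(1)] Csm_has_derivative[OF assms(2)] by blast
  have "((\<lambda>p. F p * G p) has_derivative (\<lambda>h. F p * E p h + D p h * G p)) (at p)" for p
    by (intro has_derivative_mult D E)
  from pdir_eq[OF this] show ?thesis unfolding pdir_eq[OF D] pdir_eq[OF E] .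
qed

lemma pdir_fst:
  assumes "\<And>x. (f has_real_derivative f' x) (at x)"
  shows "pdir e_s (\<lambda>p. f (fst p)) = (\<lambda>p. f' (fst p))" "pdir e_t (\<lambda>p. f (fst p)) = (\<lambda>p. 0)"
proof -
  have "((\<lambda>p. f (fst p)) has_derivative (\<lambda>h. f' (fst p) * fst h)) (at p)" for p :: "real \<times> real"
    using has_derivative_compose[OF has_derivative_fst[OF has_derivative_ident] assms[unfolded has_field_derivative_def], of p]
    by simp
  from pdir_eq[OF this] show "pdir e_s (\<lambda>p. f (fst p)) = (\<lambda>p. f' (fst p))" "pdir e_t (\<lambda>p. f (fst p)) = (\<lambda>p. 0)"
    by (auto simp: e_s_def e_t_def)
qed

lemma pdir_snd:
  assumes "\<And>x. (f has_real_derivative f' x) (at x)"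
  shows "pdir e_t (\<lambda>p. f (snd p)) = (\<lambda>p. f' (snd p))" "pdir e_s (\<lambda>p. f (snd p)) = (\<lambda>p. 0)"
proof -
  have "((\<lambda>p. f (snd p)) has_derivative (\<lambda>h. f' (snd p) * snd h)) (at p)" for p :: "real \<times> real"
    using has_derivative_compose[OF has_derivative_snd[OF has_derivative_ident] assms[unfolded has_field_derivative_def], of p]
    by simp
  from pdir_eq[OF this] show "pdir e_t (\<lambda>p. f (snd p)) = (\<lambda>p. f' (snd p))" "pdir e_s (\<lambda>p. f (snd p)) = (\<lambda>p. 0)"
    by (auto simp: e_s_def e_t_def)
qed

section \<open>Truncations of the strip as test functions\<close>

definition trunc2 :: "nat \<Rightarrow> real \<times> real \<Rightarrow> real" where
  "trunc2 n p = trunc n (fst p) * trunc n (snd p + 1/2)"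

lemma trunc_fst_Csm: "(\<lambda>p. trunc n (fst p)) \<in> Csm"
proof -
  have "(\<lambda>p. bump (real n * fst p + (-1)) * bump ((- real n) * fst p + (real n - 1))) \<in> Csm"
    by (intro Csm_mult Csm_fst[of "\<lambda>x. bump (_ * x + _)"] smooth1_affine smooth1_bump)
  then show ?thesis by (simp add: trunc_def algebra_simps)
qed

lemma trunc_snd_Csm: "(\<lambda>p. trunc n (snd p + 1/2)) \<in> Csm"
proof -
  have "(\<lambda>p. bump (real n * snd p + (real n / 2 - 1)) * bump ((- real n) * snd p + (real n / 2 - 1))) \<in> Csm"
    by (intro Csm_mult Csm_snd[of "\<lambda>x. bump (_ * x + _)"] smooth1_affine smooth1_bump)
  then show ?thesis by (simp add: trunc_def algebra_simps)
qed

lemma trunc2_Csm: "trunc2 n \<in> Csm"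
  unfolding trunc2_def[abs_def] by (intro Csm_mult trunc_fst_Csm trunc_snd_Csm)

lemma trunc_shift_deriv: "((\<lambda>t. trunc n (t + 1/2)) has_real_derivative trunc' n (x + 1/2)) (at x)"
proof -
  have "((\<lambda>t. t + 1/2) has_real_derivative 1) (at x)" by (auto intro!: derivative_eq_intros)
  from DERIV_chain2[where f="trunc n", OF trunc_deriv this] show ?thesis by simp
qed

lemma pdir_trunc2:
  "pdir e_s (trunc2 n) = (\<lambda>p. trunc' n (fst p) * trunc n (snd p + 1/2))"
  "pdir e_t (trunc2 n) = (\<lambda>p. trunc n (fst p) * trunc' n (snd p + 1/2))"
  unfolding trunc2_def[abs_def] pdir_mult[OF trunc_fst_Csm trunc_snd_Csm]
  by (simp_all add: pdir_fst[OF trunc_deriv] pdir_snd[where f="\<lambda>t. trunc n (t + 1/2)", OF trunc_shift_deriv])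

lemma test_fn_trunc2:
  assumes "F \<in> Csm"
  shows "test_fn (\<lambda>p. trunc2 n p * F p)"
proof -
  define B where "B = {1 / real n..1 - 1 / real n} \<times> {1 / real n - 1/2..1/2 - 1 / real n}"
  have sub: "{p. trunc2 n p * F p \<noteq> 0} \<subseteq> B"
    using trunc_0 by (fastforce simp: trunc2_def B_def)
  have "compact B" unfolding B_def by (intro compact_Times) auto
  then have cl: "closure {p. trunc2 n p * F p \<noteq> 0} \<subseteq> B"
    using sub by (simp add: closure_minimal compact_imp_closed)
  have "closure {p. trunc2 n p * F p \<noteq> 0} \<subseteq> stripS"
  proof (cases "n = 0")
    case True
    then have "{p. trunc2 n p * F p \<noteq> 0} = {}" using trunc_0 by (force simp: trunc2_def)
    then show ?thesis by (simp only: closure_empty) simp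
  next
    case False
    define d where "d = 1 / real n"
    have "d > 0" using False by (simp add: d_def)
    then have "B \<subseteq> stripS" unfolding B_def d_def[symmetric] by (auto simp: stripS_def)
    then show ?thesis using cl by blast
  qed
  moreover have "compact (closure {p. trunc2 n p * F p \<noteq> 0})"
    unfolding compact_closure using bounded_subset[OF compact_imp_bounded[OF \<open>compact B\<close>] sub] .
  ultimately show ?thesis
    unfolding test_fn_def by (intro conjI Csm_smooth2 Csm_mult trunc2_Csm assms) auto
qed

section \<open>Square-integrable functions on the strip\<close>

text \<open>Set integrals over the strip become ordinary integrals for a measure of total mass
  1.\<close>

abbreviation muS :: "(real \<times> real) measure" where "muS \<equiv> restrict_space lborel stripS"

definition clS :: "(real \<times> real) set" where "clS = {0..1} \<times> {-1/2..1/2}"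

lemma stripS_box: "stripS = box (0, -1/2) (1, 1/2)"
  by (auto simp: stripS_def mem_box Basis_prod_def)

lemma clS_cbox: "clS = cbox (0, -1/2) (1, 1/2)"
  by (auto simp: clS_def cbox_Pair_eq)

lemma stripS_sets [measurable, simp]: "stripS \<in> sets borel" "stripS \<in> sets lborel"
  by (auto simp: stripS_box)

lemma stripS_subset_clS: "stripS \<subseteq> clS"
  by (auto simp: stripS_def clS_def)

lemma space_muS [simp]: "space muS = stripS"
  by (simp add: space_restrict_space)

lemma LINT_muS: "(LINT p:stripS|lborel. f p) = integral\<^sup>L muS (f :: real \<times> real \<Rightarrow> real)"
  by (simp add: set_lebesgue_integral_def integral_restrict_space)

lemma L2S_muS: "L2S f \<longleftrightarrow> f \<in> borel_measurable muS \<and> integrable muS (\<lambda>p. (f p)\<^sup>2)"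
  by (simp add: L2S_def set_borel_measurable_def set_integrable_def integrable_restrict_space
      borel_measurable_restrict_space_iff)

lemma emeasure_muS: "emeasure muS stripS = 1"
  by (simp add: emeasure_restrict_space stripS_box emeasure_lborel_box_eq Basis_prod_def inner_prod_def)

lemma finite_measure_muS: "finite_measure muS"
  by (rule finite_measureI) (simp add: emeasure_muS)

lemma measure_muS: "measure muS stripS = 1"
  by (simp add: measure_def emeasure_muS)

lemma integrable_muS_bounded:
  assumes "f \<in> borel_measurable muS" "\<And>p. p \<in> stripS \<Longrightarrow> \<bar>f p\<bar> \<le> (B::real)"
  shows "integrable muS f"
proof -
  interpret finite_measure muS by (rule finite_measure_muS)
  show ?thesis using assms by (intro integrable_const_bound[where B=B]) auto
qed

lemma L2S_measurable: "L2S f \<Longrightarrow> f \<in> borel_measurable muS"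
  by (simp add: L2S_muS)

lemma L2S_sq: "L2S f \<Longrightarrow> integrable muS (\<lambda>p. (f p)\<^sup>2)"
  by (simp add: L2S_muS)

lemma L2S_mult_integrable:
  assumes "L2S f" "L2S g"
  shows "integrable muS (\<lambda>p. f p * g p)"
proof (rule Bochner_Integration.integrable_bound)
  show "integrable muS (\<lambda>p. (f p)\<^sup>2 + (g p)\<^sup>2)" using assms by (simp add: L2S_sq)
  show "(\<lambda>p. f p * g p) \<in> borel_measurable muS" using assms by (intro borel_measurable_times L2S_measurable)
  have "\<bar>a * b\<bar> \<le> a\<^sup>2 + b\<^sup>2" for a b :: real
  proof -
    have "2 * (\<bar>a\<bar> * \<bar>b\<bar>) \<le> a\<^sup>2 + b\<^sup>2"
      using zero_le_power2[of "\<bar>a\<bar> - \<bar>b\<bar>"] by (simp add: power2_diff)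
    moreover have "0 \<le> \<bar>a\<bar> * \<bar>b\<bar>" by simp
    ultimately show ?thesis unfolding abs_mult by linarith
  qed
  then show "AE p in muS. norm (f p * g p) \<le> norm ((f p)\<^sup>2 + (g p)\<^sup>2)" by simp
qed

lemma L2S_add:
  assumes "L2S f" "L2S g"
  shows "L2S (\<lambda>p. f p + g p)"
proof -
  have "integrable muS (\<lambda>p. (f p)\<^sup>2 + 2 * (f p * g p) + (g p)\<^sup>2)"
    using assms by (simp add: L2S_sq L2S_mult_integrable)
  moreover have "(\<lambda>p. f p + g p) \<in> borel_measurable muS"
    using assms by (intro borel_measurable_add L2S_measurable)
  ultimately show ?thesis by (simp add: L2S_muS power2_sum algebra_simps)
qed

lemma L2S_bounded_mult:
  assumes "L2S f" "g \<in> borel_measurable muS" "\<And>p. p \<in> stripS \<Longrightarrow> \<bar>g p\<bar> \<le> B"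
  shows "L2S (\<lambda>p. g p * f p)"
  unfolding L2S_muS
proof
  show m: "(\<lambda>p. g p * f p) \<in> borel_measurable muS"
    by (intro borel_measurable_times assms(2) L2S_measurable[OF assms(1)])
  show "integrable muS (\<lambda>p. (g p * f p)\<^sup>2)"
  proof (rule Bochner_Integration.integrable_bound)
    show "integrable muS (\<lambda>p. B\<^sup>2 * (f p)\<^sup>2)" using assms by (simp add: L2S_sq)
    show "(\<lambda>p. (g p * f p)\<^sup>2) \<in> borel_measurable muS" by (intro borel_measurable_power m)
    show "AE p in muS. norm ((g p * f p)\<^sup>2) \<le> norm (B\<^sup>2 * (f p)\<^sup>2)"
      using assms(3) by (intro AE_I2) (auto simp: power_mult_distrib intro!: mult_right_mono sq_le_if_abs_le)
  qed
qed

lemma L2S_cmult: "L2S f \<Longrightarrow> L2S (\<lambda>p. c * f p)"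
  by (rule L2S_bounded_mult[where B="\<bar>c\<bar>"]) auto

lemma L2S_minus: "L2S f \<Longrightarrow> L2S (\<lambda>p. - f p)"
  using L2S_cmult[of f "-1"] by simp

lemma L2S_diff: "L2S f \<Longrightarrow> L2S g \<Longrightarrow> L2S (\<lambda>p. f p - g p)"
  using L2S_add[of f "\<lambda>p. - g p"] L2S_minus by simp

lemma L2S_0: "L2S (\<lambda>p. 0)"
  by (simp add: L2S_muS)

lemma L2S_sum: "finite I \<Longrightarrow> (\<And>i. i \<in> I \<Longrightarrow> L2S (f i)) \<Longrightarrow> L2S (\<lambda>p. \<Sum>i\<in>I. f i p)"
  by (induction I rule: finite_induct) (auto intro: L2S_add L2S_0)

lemma bounded_L2S:
  assumes "f \<in> borel_measurable muS" "\<And>p. p \<in> stripS \<Longrightarrow> \<bar>f p\<bar> \<le> B"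
  shows "L2S f"
  unfolding L2S_muS using assms
  by (auto intro!: integrable_muS_bounded[where B="B\<^sup>2"] sq_le_if_abs_le)

lemma continuous_clS_measurable:
  fixes f :: "real \<times> real \<Rightarrow> real"
  assumes "continuous_on clS f"
  shows "f \<in> borel_measurable muS"
proof -
  have "continuous_on stripS f" using assms stripS_subset_clS by (rule continuous_on_subset)
  then have "(\<lambda>p. indicator stripS p *\<^sub>R f p) \<in> borel_measurable borel"
    by (intro borel_measurable_continuous_on_indicator) simp_all
  then show ?thesis by (simp add: borel_measurable_restrict_space_iff)
qed

lemma continuous_clS_bounded:
  fixes f :: "real \<times> real \<Rightarrow> real"
  assumes "continuous_on clS f"
  obtains B where "B > 0" "\<And>p. p \<in> clS \<Longrightarrow> \<bar>f p\<bar> \<le> B"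
proof -
  have "compact (f ` clS)" using assms by (intro compact_continuous_image) (auto simp: clS_cbox)
  then have "bounded (f ` clS)" by (rule compact_imp_bounded)
  then show ?thesis using that unfolding bounded_pos by auto
qed

lemma continuous_L2S:
  assumes "continuous_on clS f"
  shows "L2S f"
proof -
  obtain B where "\<And>p. p \<in> clS \<Longrightarrow> \<bar>f p\<bar> \<le> B" using continuous_clS_bounded[OF assms] by blast
  then show ?thesis using continuous_clS_measurable[OF assms] stripS_subset_clS by (intro bounded_L2S) auto
qed

lemma L2S_integrable: "L2S f \<Longrightarrow> integrable muS f"
  using L2S_mult_integrable[OF _ continuous_L2S[OF continuous_on_const], of f 1] by simp

definition L2sq :: "(real \<times> real \<Rightarrow> real) \<Rightarrow> real" where "L2sq f = integral\<^sup>L muS (\<lambda>p. (f p)\<^sup>2)"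

lemma L2sq_nonneg: "L2sq f \<ge> 0"
  by (simp add: L2sq_def)

lemma L2sq_add_le: "L2S f \<Longrightarrow> L2S g \<Longrightarrow> L2sq (\<lambda>p. f p + g p) \<le> 2 * L2sq f + 2 * L2sq g"
proof -
  assume a: "L2S f" "L2S g"
  have "L2sq (\<lambda>p. f p + g p) \<le> integral\<^sup>L muS (\<lambda>p. 2 * (f p)\<^sup>2 + 2 * (g p)\<^sup>2)"
    unfolding L2sq_def using a by (intro integral_mono L2S_sq L2S_add) (auto simp: L2S_sq intro: sq_add_le)
  also have "\<dots> = 2 * L2sq f + 2 * L2sq g" using a by (simp add: L2sq_def L2S_sq)
  finally show ?thesis .
qed

lemma L2sq_bounded_mult_le:
  assumes "L2S f" "g \<in> borel_measurable muS" "\<And>p. p \<in> stripS \<Longrightarrow> \<bar>g p\<bar> \<le> B"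
  shows "L2sq (\<lambda>p. g p * f p) \<le> B\<^sup>2 * L2sq f"
proof -
  have "L2sq (\<lambda>p. g p * f p) \<le> integral\<^sup>L muS (\<lambda>p. B\<^sup>2 * (f p)\<^sup>2)"
    unfolding L2sq_def using assms L2S_sq[OF L2S_bounded_mult[OF assms]]
    by (intro integral_mono) (auto simp: L2S_sq power_mult_distrib intro!: mult_right_mono sq_le_if_abs_le)
  then show ?thesis by (simp add: L2sq_def)
qed

lemma L2sq_0_AE: "L2S f \<Longrightarrow> L2sq f = 0 \<Longrightarrow> AE p in muS. f p = 0"
  unfolding L2sq_def using integral_nonneg_eq_0_iff_AE[of muS "\<lambda>p. (f p)\<^sup>2"] by (simp add: L2S_sq)

text \<open>The bridge between Lebesgue integrals on the strip, used for weak derivatives, and the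
  integrals over the closed square, with \<open>t = y - 1/2\<close>.\<close>

lemma integral_muS_int2:
  assumes "continuous_on clS F"
  shows "integral\<^sup>L muS F = int2 (\<lambda>x y. F (x, y - 1/2))"
proof -
  have "set_integrable lborel stripS F"
    using L2S_integrable[OF continuous_L2S[OF assms]] by (simp add: set_integrable_def integrable_restrict_space)
  then have "integral\<^sup>L muS F = integral stripS F"
    by (simp add: LINT_muS[symmetric] set_borel_integral_eq_integral)
  also have "\<dots> = integral (cbox (0, -1/2) (1, 1/2)) F"
    unfolding stripS_box by (rule integral_open_interval)
  also have "\<dots> = integral {0..1} (\<lambda>x. integral {-1/2..1/2} (\<lambda>t. F (x, t)))"
    using assms by (subst integral_prod_continuous) (auto simp: clS_cbox)
  also have "\<dots> = integral {0..1} (\<lambda>x. integral {0..1} (\<lambda>y. F (x, y - 1/2)))"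
  proof (rule integral_cong)
    fix x :: real assume x: "x \<in> {0..1}"
    have "continuous_on {0 + -1/2..1 + -1/2} (\<lambda>t. F (x, t))"
      using x by (intro continuous_on_compose2[OF assms] continuous_intros) (auto simp: clS_def)
    from integral_shift[OF this]
    show "integral {-1/2..1/2} (\<lambda>t. F (x, t)) = integral {0..1} (\<lambda>y. F (x, y - 1/2))"
      by (simp add: o_def)
  qed
  also have "\<dots> = int2 (\<lambda>x y. F (x, y - 1/2))"
  proof (rule int2_iterated[symmetric])
    show "cont2 (\<lambda>x y. F (x, y - 1/2))" unfolding cont2_def
      by (intro continuous_on_compose2[OF assms] continuous_intros) (auto simp: clS_def usq_def)
  qed
  finally show ?thesis .
qed

lemma cont2_shift: "continuous_on clS F \<Longrightarrow> cont2 (\<lambda>x y. F (x, y - 1/2))"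
  unfolding cont2_def
  by (rule continuous_on_compose2[where t=clS and g=F]) (auto simp: clS_def usq_def intro!: continuous_intros)

section \<open>Weak derivatives\<close>

lemma Csm_measurable: "F \<in> Csm \<Longrightarrow> F \<in> borel_measurable muS"
  by (intro continuous_clS_measurable Csm_continuous)

lemma Csm_L2S: "F \<in> Csm \<Longrightarrow> L2S F"
  by (intro continuous_L2S Csm_continuous)

lemma trunc2_bounds: "0 \<le> trunc2 n p" "trunc2 n p \<le> 1"
  by (auto simp: trunc2_def trunc_bounds mult_le_one)

lemma trunc2_tendsto:
  assumes "p \<in> stripS"
  shows "(\<lambda>n. trunc2 n p) \<longlonglongrightarrow> 1" "(\<lambda>n. pdir e_s (trunc2 n) p) \<longlonglongrightarrow> 0" "(\<lambda>n. pdir e_t (trunc2 n) p) \<longlonglongrightarrow> 0"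
proof -
  have x: "0 < fst p" "fst p < 1" "0 < snd p + 1/2" "snd p + 1/2 < 1" using assms by (auto simp: stripS_def)
  note l = trunc_tendsto[OF x(1,2)] trunc_tendsto[OF x(3,4)]
  show "(\<lambda>n. trunc2 n p) \<longlonglongrightarrow> 1" "(\<lambda>n. pdir e_s (trunc2 n) p) \<longlonglongrightarrow> 0" "(\<lambda>n. pdir e_t (trunc2 n) p) \<longlonglongrightarrow> 0"
    unfolding pdir_trunc2 unfolding trunc2_def
    using tendsto_mult[OF l(1,3)] tendsto_mult[OF l(2,3)] tendsto_mult[OF l(1,4)] by simp_all
qed

lemma integral_trunc2_tendsto:
  assumes "L2S d" "F \<in> Csm"
  shows "(\<lambda>n. integral\<^sup>L muS (\<lambda>p. d p * (trunc2 n p * F p))) \<longlonglongrightarrow> integral\<^sup>L muS (\<lambda>p. d p * F p)"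
proof (rule integral_dominated_convergence)
  show "(\<lambda>p. d p * F p) \<in> borel_measurable muS" using assms by (intro borel_measurable_times L2S_measurable Csm_measurable)
  show "(\<lambda>p. d p * (trunc2 n p * F p)) \<in> borel_measurable muS" for n
    using assms by (intro borel_measurable_times L2S_measurable Csm_measurable trunc2_Csm)
  show "integrable muS (\<lambda>p. \<bar>d p * F p\<bar>)"
    by (intro integrable_abs L2S_mult_integrable Csm_L2S assms)
  show "AE p in muS. (\<lambda>n. d p * (trunc2 n p * F p)) \<longlonglongrightarrow> d p * F p"
  proof (rule AE_I2)
    fix p assume "p \<in> space muS"
    then have "(\<lambda>n. d p * (trunc2 n p * F p)) \<longlonglongrightarrow> d p * (1 * F p)"
      by (intro tendsto_intros trunc2_tendsto) simp
    then show "(\<lambda>n. d p * (trunc2 n p * F p)) \<longlonglongrightarrow> d p * F p" by simp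
  qed
  show "AE p in muS. norm (d p * (trunc2 n p * F p)) \<le> \<bar>d p * F p\<bar>" for n
  proof (rule AE_I2)
    fix p
    have "\<bar>d p * (trunc2 n p * F p)\<bar> = trunc2 n p * \<bar>d p * F p\<bar>" using trunc2_bounds[of n p] by (simp add: abs_mult)
    also have "\<dots> \<le> 1 * \<bar>d p * F p\<bar>" by (intro mult_right_mono trunc2_bounds) auto
    finally show "norm (d p * (trunc2 n p * F p)) \<le> \<bar>d p * F p\<bar>" by simp
  qed
qed

text \<open>The test functions may be replaced by smooth functions that vanish only on the two sides
  that e crosses, since the cut-off's derivative grows like the reciprocal distance to the boundary.\<close>

lemma weak_pd_test:
  assumes f: "L2S f" and g: "weak_pd e f g" and F: "F \<in> Csm"
    and b: "\<And>n p. p \<in> stripS \<Longrightarrow> \<bar>pdir e (trunc2 n) p * F p\<bar> \<le> K"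
    and lim: "\<And>p. p \<in> stripS \<Longrightarrow> (\<lambda>n. pdir e (trunc2 n) p) \<longlonglongrightarrow> 0"
  shows "integral\<^sup>L muS (\<lambda>p. f p * pdir e F p) = - integral\<^sup>L muS (\<lambda>p. g p * F p)"
proof -
  note dF = Csm_pdir[OF F, of e]
  have g2: "L2S g" using g by (simp add: weak_pd_def)
  \<comment> \<open>The weak derivative identity for the truncated function
    \<open>trunc2 n * F\<close>, expanded by the product rule; the second term on the left is the
    error of truncation.\<close>
  have eq: "integral\<^sup>L muS (\<lambda>p. f p * (trunc2 n p * pdir e F p)) + integral\<^sup>L muS (\<lambda>p. f p * (pdir e (trunc2 n) p * F p))
      = - integral\<^sup>L muS (\<lambda>p. g p * (trunc2 n p * F p))" for n
  proof -
    have "integral\<^sup>L muS (\<lambda>p. f p * pdir e (\<lambda>p. trunc2 n p * F p) p) = - integral\<^sup>L muS (\<lambda>p. g p * (trunc2 n p * F p))"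
      using g test_fn_trunc2[OF F, of n] by (simp add: weak_pd_def LINT_muS)
    moreover have "integral\<^sup>L muS (\<lambda>p. f p * (trunc2 n p * pdir e F p) + f p * (pdir e (trunc2 n) p * F p))
       = integral\<^sup>L muS (\<lambda>p. f p * (trunc2 n p * pdir e F p)) + integral\<^sup>L muS (\<lambda>p. f p * (pdir e (trunc2 n) p * F p))"
      by (intro Bochner_Integration.integral_add L2S_mult_integrable f Csm_L2S Csm_mult trunc2_Csm dF F Csm_pdir)
    ultimately show ?thesis unfolding pdir_mult[OF trunc2_Csm F] by (simp add: distrib_left)
  qed
  \<comment> \<open>\<open>K * \<bar>f p\<bar>\<close> dominates the error terms, which tend to 0 at
    every point of the strip.\<close>
  have 0: "(\<lambda>n. integral\<^sup>L muS (\<lambda>p. f p * (pdir e (trunc2 n) p * F p))) \<longlonglongrightarrow> integral\<^sup>L muS (\<lambda>p. 0)"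
  proof (rule integral_dominated_convergence)
    show "(\<lambda>p. f p * (pdir e (trunc2 n) p * F p)) \<in> borel_measurable muS" for n
      by (intro borel_measurable_times L2S_measurable[OF f] Csm_measurable trunc2_Csm F Csm_pdir)
    show "integrable muS (\<lambda>p. K * \<bar>f p\<bar>)" using L2S_integrable[OF f] by simp
    show "AE p in muS. (\<lambda>n. f p * (pdir e (trunc2 n) p * F p)) \<longlonglongrightarrow> 0"
    proof (rule AE_I2)
      fix p assume "p \<in> space muS"
      then have "(\<lambda>n. f p * (pdir e (trunc2 n) p * F p)) \<longlonglongrightarrow> f p * (0 * F p)"
        by (intro tendsto_intros lim) simp
      then show "(\<lambda>n. f p * (pdir e (trunc2 n) p * F p)) \<longlonglongrightarrow> 0" by simp
    qed
    show "AE p in muS. norm (f p * (pdir e (trunc2 n) p * F p)) \<le> K * \<bar>f p\<bar>" for n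
      using b by (intro AE_I2) (simp add: abs_mult mult.commute[of K] mult_left_mono)
  qed simp
  have "(\<lambda>n. integral\<^sup>L muS (\<lambda>p. f p * (trunc2 n p * pdir e F p)) + integral\<^sup>L muS (\<lambda>p. f p * (pdir e (trunc2 n) p * F p)))
      \<longlonglongrightarrow> integral\<^sup>L muS (\<lambda>p. f p * pdir e F p) + 0"
    using 0 by (intro tendsto_add integral_trunc2_tendsto f dF) simp
  moreover have "(\<lambda>n. - integral\<^sup>L muS (\<lambda>p. g p * (trunc2 n p * F p))) \<longlonglongrightarrow> - integral\<^sup>L muS (\<lambda>p. g p * F p)"
    by (intro tendsto_minus integral_trunc2_tendsto g2 F)
  ultimately show ?thesis unfolding eq using LIMSEQ_unique by fastforce
qed

text \<open>A linear bound at both ends in s compensates the reciprocal distances in the derivative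
  of the truncation; each of the two ends contributes \<open>3 * K\<close>.\<close>

lemma weak_pd_test_s:
  assumes f: "L2S f" and g: "weak_pd e_s f g" and F: "F \<in> Csm"
    and b: "\<And>p. p \<in> stripS \<Longrightarrow> \<bar>F p\<bar> \<le> K * fst p \<and> \<bar>F p\<bar> \<le> K * (1 - fst p)"
  shows "integral\<^sup>L muS (\<lambda>p. f p * pdir e_s F p) = - integral\<^sup>L muS (\<lambda>p. g p * F p)"
proof (rule weak_pd_test[OF f g F])
  fix n p assume p: "p \<in> stripS"
  then have x: "0 < fst p" "fst p < 1" by (auto simp: stripS_def)
  have "\<bar>pdir e_s (trunc2 n) p * F p\<bar> = \<bar>trunc' n (fst p)\<bar> * trunc n (snd p + 1/2) * \<bar>F p\<bar>"
    by (simp add: pdir_trunc2 abs_mult trunc_bounds)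
  also have "\<dots> \<le> (3 / fst p + 3 / (1 - fst p)) * 1 * \<bar>F p\<bar>"
    using x by (intro mult_right_mono mult_mono trunc'_bound trunc_bounds) auto
  also have "\<dots> = 3 / fst p * \<bar>F p\<bar> + 3 / (1 - fst p) * \<bar>F p\<bar>" by (simp add: distrib_right)
  also have "\<dots> \<le> 3 / fst p * (K * fst p) + 3 / (1 - fst p) * (K * (1 - fst p))"
    using x b[OF p] by (intro add_mono mult_left_mono) auto
  also have "\<dots> = 6 * K" using x by (simp add: field_simps)
  finally show "\<bar>pdir e_s (trunc2 n) p * F p\<bar> \<le> 6 * K" .
qed (rule trunc2_tendsto)

lemma weak_pd_test_t:
  assumes f: "L2S f" and g: "weak_pd e_t f g" and F: "F \<in> Csm"
    and b: "\<And>p. p \<in> stripS \<Longrightarrow> \<bar>F p\<bar> \<le> K * (snd p + 1/2) \<and> \<bar>F p\<bar> \<le> K * (1 - (snd p + 1/2))"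
  shows "integral\<^sup>L muS (\<lambda>p. f p * pdir e_t F p) = - integral\<^sup>L muS (\<lambda>p. g p * F p)"
proof (rule weak_pd_test[OF f g F])
  fix n p assume p: "p \<in> stripS"
  define y where "y = snd p + 1/2"
  have y: "0 < y" "y < 1" using p by (auto simp: stripS_def y_def)
  have "\<bar>pdir e_t (trunc2 n) p * F p\<bar> = trunc n (fst p) * \<bar>trunc' n y\<bar> * \<bar>F p\<bar>"
    by (simp add: pdir_trunc2 abs_mult trunc_bounds y_def)
  also have "\<dots> \<le> 1 * (3 / y + 3 / (1 - y)) * \<bar>F p\<bar>"
    using y by (intro mult_right_mono mult_mono trunc'_bound trunc_bounds) auto
  also have "\<dots> = 3 / y * \<bar>F p\<bar> + 3 / (1 - y) * \<bar>F p\<bar>" by (simp add: distrib_right)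
  also have "\<dots> \<le> 3 / y * (K * y) + 3 / (1 - y) * (K * (1 - y))"
    using y b[OF p] unfolding y_def[symmetric] by (intro add_mono mult_left_mono) auto
  also have "\<dots> = 6 * K" using y by (simp add: field_simps)
  finally show "\<bar>pdir e_t (trunc2 n) p * F p\<bar> \<le> 6 * K" .
qed (rule trunc2_tendsto)

section \<open>Completeness of the cosine systems\<close>

lemma L2sq_tendsto_0:
  assumes f: "L2S f" and h: "\<And>n. h n \<in> borel_measurable muS"
    and le: "\<And>n p. p \<in> stripS \<Longrightarrow> \<bar>f p - h n p\<bar> \<le> \<bar>f p\<bar>"
    and lim: "\<And>p. p \<in> stripS \<Longrightarrow> (\<lambda>n. h n p) \<longlonglongrightarrow> f p"
  shows "(\<lambda>n. L2sq (\<lambda>p. f p - h n p)) \<longlonglongrightarrow> 0"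
proof -
  have "(\<lambda>n. L2sq (\<lambda>p. f p - h n p)) \<longlonglongrightarrow> integral\<^sup>L muS (\<lambda>p. 0)"
    unfolding L2sq_def
  proof (rule integral_dominated_convergence)
    show "(\<lambda>p. (f p - h n p)\<^sup>2) \<in> borel_measurable muS" for n
      by (intro borel_measurable_power borel_measurable_diff h L2S_measurable f)
    show "integrable muS (\<lambda>p. (f p)\<^sup>2)" by (rule L2S_sq[OF f])
    show "AE p in muS. (\<lambda>n. (f p - h n p)\<^sup>2) \<longlonglongrightarrow> 0"
    proof (rule AE_I2)
      fix p assume "p \<in> space muS"
      then have "(\<lambda>n. (f p - h n p)\<^sup>2) \<longlonglongrightarrow> (f p - f p)\<^sup>2" by (intro tendsto_intros lim) simp
      then show "(\<lambda>n. (f p - h n p)\<^sup>2) \<longlonglongrightarrow> 0" by simp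
    qed
    show "AE p in muS. norm ((f p - h n p)\<^sup>2) \<le> (f p)\<^sup>2" for n
      using le sq_le_if_abs_le by (intro AE_I2) fastforce
  qed simp
  then show ?thesis by simp
qed

text \<open>Clipping at height n converges pointwise and never increases the error beyond
  \<open>\<bar>f p\<bar>\<close>.\<close>

lemma L2S_approx_bounded:
  assumes f: "L2S f" and d: "\<delta> > 0"
  obtains h B where "h \<in> borel_measurable muS" "B > 0" "\<And>p. \<bar>h p\<bar> \<le> B" "L2sq (\<lambda>p. f p - h p) < \<delta>"
proof -
  define h where "h = (\<lambda>n p. max (- real n) (min (real n) (f p)))"
  have hm: "h n \<in> borel_measurable muS" for n
    unfolding h_def using L2S_measurable[OF f] by (intro borel_measurable_max borel_measurable_min) auto
  have "(\<lambda>n. L2sq (\<lambda>p. f p - h n p)) \<longlonglongrightarrow> 0"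
  proof (rule L2sq_tendsto_0[OF f hm])
    show "\<bar>f p - h n p\<bar> \<le> \<bar>f p\<bar>" for n p by (auto simp: h_def max_def min_def)
    show "(\<lambda>n. h n p) \<longlonglongrightarrow> f p" for p
    proof (rule tendsto_eventually)
      obtain N where N: "real N \<ge> \<bar>f p\<bar>" using real_arch_simple by blast
      show "eventually (\<lambda>n. h n p = f p) sequentially"
        using eventually_ge_at_top[of N] by eventually_elim (use N in \<open>auto simp: h_def max_def min_def\<close>)
    qed
  qed
  then obtain n where "L2sq (\<lambda>p. f p - h n p) < \<delta>"
    using eventually_happens'[OF sequentially_bot order_tendstoD(2)[OF _ d]] by blast
  then show ?thesis
    using that[of "h n" "real n + 1"] hm by (fastforce simp: h_def)
qed

text \<open>After reduction to a bounded function, measurability supplies continuous functions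
  converging almost everywhere. They are clipped at the same bound, which gives a constant as
  dominating function.\<close>

lemma L2S_approx_continuous:
  assumes f: "L2S f" and d: "\<delta> > 0"
  obtains g where "continuous_on UNIV g" "L2sq (\<lambda>p. f p - g p) < \<delta>"
proof -
  obtain h B where h: "h \<in> borel_measurable muS" "B > 0" "\<And>p. \<bar>h p\<bar> \<le> B" "L2sq (\<lambda>p. f p - h p) < \<delta> / 4"
    using L2S_approx_bounded[OF f, of "\<delta> / 4"] d by auto
  have h2: "L2S h" using h by (intro bounded_L2S) auto
  define H where "H = (\<lambda>p. indicator stripS p *\<^sub>R h p)"
  have "H \<in> borel_measurable lborel"
    using h(1) unfolding H_def by (simp add: borel_measurable_restrict_space_iff)
  then have "H \<in> borel_measurable lebesgue" by (rule measurable_completion)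
  then have "H measurable_on UNIV" by (intro lebesgue_measurable_imp_measurable_on_real) auto
  then obtain N g where N: "negligible N" and g: "\<And>n. continuous_on UNIV (g n)"
    and lim: "\<And>p. p \<notin> N \<Longrightarrow> (\<lambda>n. g n p) \<longlonglongrightarrow> H p"
    unfolding measurable_on_def by auto
  define G where "G = (\<lambda>n p. max (- B) (min B (g n p)))"
  have Gc: "continuous_on A (G n)" for n A
    unfolding G_def by (intro continuous_intros continuous_on_subset[OF g]) auto
  have "N \<in> null_sets lebesgue" using N negligible_iff_null_sets by blast
  then have "AE p in lebesgue. p \<notin> N" by (rule AE_not_in)
  then have "AE p in lborel. p \<notin> N" by (simp add: AE_completion_iff)
  then have AE: "AE p in muS. p \<notin> N" by (subst AE_restrict_space_iff) auto
  have "(\<lambda>n. integral\<^sup>L muS (\<lambda>p. (h p - G n p)\<^sup>2)) \<longlonglongrightarrow> integral\<^sup>L muS (\<lambda>p. 0)"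
  proof (rule integral_dominated_convergence)
    show "(\<lambda>p. (h p - G n p)\<^sup>2) \<in> borel_measurable muS" for n
      by (intro borel_measurable_power borel_measurable_diff h continuous_clS_measurable Gc)
    show "integrable muS (\<lambda>p. (2 * B)\<^sup>2)" by (rule integrable_muS_bounded) auto
    show "AE p in muS. (\<lambda>n. (h p - G n p)\<^sup>2) \<longlonglongrightarrow> 0"
      using AE AE_space
    proof eventually_elim
      case (elim p)
      have "(\<lambda>n. (h p - G n p)\<^sup>2) \<longlonglongrightarrow> (h p - max (- B) (min B (H p)))\<^sup>2"
        unfolding G_def using elim by (intro tendsto_intros lim)
      moreover have "max (- B) (min B (H p)) = h p"
        using elim h(3)[of p] by (auto simp: H_def max_def min_def)
      ultimately show ?case by simp
    qed
    show "AE p in muS. norm ((h p - G n p)\<^sup>2) \<le> (2 * B)\<^sup>2" for n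
    proof (rule AE_I2)
      fix p
      have "\<bar>h p - G n p\<bar> \<le> 2 * B" using h(3)[of p] h(2) by (auto simp: G_def max_def min_def abs_le_iff)
      then have "(h p - G n p)\<^sup>2 \<le> (2 * B)\<^sup>2" by (rule sq_le_if_abs_le)
      then show "norm ((h p - G n p)\<^sup>2) \<le> (2 * B)\<^sup>2" by simp
    qed
  qed simp
  then have "(\<lambda>n. L2sq (\<lambda>p. h p - G n p)) \<longlonglongrightarrow> 0" by (simp add: L2sq_def)
  then obtain n where n: "L2sq (\<lambda>p. h p - G n p) < \<delta> / 4"
    using eventually_happens'[OF sequentially_bot order_tendstoD(2)[of _ 0 sequentially "\<delta> / 4"]] d by auto
  have "L2sq (\<lambda>p. f p - G n p) = L2sq (\<lambda>p. (f p - h p) + (h p - G n p))" by simp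
  also have "\<dots> \<le> 2 * L2sq (\<lambda>p. f p - h p) + 2 * L2sq (\<lambda>p. h p - G n p)"
    by (intro L2sq_add_le L2S_diff f h2 continuous_L2S Gc)
  also have "\<dots> < \<delta>" using h(4) n by simp
  finally show ?thesis using that[OF Gc] by blast
qed

section \<open>Three trigonometric systems and their spans\<close>

definition cb :: "nat \<Rightarrow> real \<Rightarrow> real" where "cb m x = cos (real m * pi * x)"
definition sb :: "nat \<Rightarrow> real \<Rightarrow> real" where "sb m x = sin (real m * pi * x)"

text \<open>Up to factors, the s-derivatives of \<open>phi\<close> are the \<open>psi\<close> and
  its t-derivatives the \<open>chi\<close>. The sine factor vanishes on the two sides crossed by the
  direction concerned, so \<open>psi\<close> and \<open>chi\<close> are admissible in the extended
  weak derivative identities.\<close>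

definition phi :: "nat \<times> nat \<Rightarrow> real \<times> real \<Rightarrow> real" where
  "phi i p = cb (fst i) (fst p) * cb (snd i) (snd p + 1/2)"
definition psi :: "nat \<times> nat \<Rightarrow> real \<times> real \<Rightarrow> real" where
  "psi i p = sb (fst i) (fst p) * cb (snd i) (snd p + 1/2)"
definition chi :: "nat \<times> nat \<Rightarrow> real \<times> real \<Rightarrow> real" where
  "chi i p = cb (fst i) (fst p) * sb (snd i) (snd p + 1/2)"

inductive lin_span :: "('i \<Rightarrow> real \<times> real \<Rightarrow> real) \<Rightarrow> (real \<times> real \<Rightarrow> real) \<Rightarrow> bool" for e where
  base: "lin_span e (\<lambda>p. c * e i p)"
| add: "lin_span e F \<Longrightarrow> lin_span e G \<Longrightarrow> lin_span e (\<lambda>p. F p + G p)"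

lemma lin_span_cmult: "lin_span e F \<Longrightarrow> lin_span e (\<lambda>p. c * F p)"
proof (induction rule: lin_span.induct)
  case (base d i)
  have "lin_span e (\<lambda>p. (c * d) * e i p)" by (rule lin_span.base)
  then show ?case by (simp add: mult.assoc)
next
  case (add F G)
  show ?case unfolding distrib_left by (rule lin_span.add[OF add.IH])
qed

lemma lin_span_sum:
  assumes "lin_span e F"
  shows "\<exists>I a. finite I \<and> F = (\<lambda>p. \<Sum>i\<in>I. a i * e i p)"
  using assms
proof induction
  case (base c i)
  show ?case by (intro exI[of _ "{i}"] exI[of _ "\<lambda>_. c"]) auto
next
  case (add F G)
  then obtain I a J b where I: "finite I" "F = (\<lambda>p. \<Sum>i\<in>I. a i * e i p)" and J: "finite J" "G = (\<lambda>p. \<Sum>i\<in>J. b i * e i p)"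
    by blast
  have F: "F p = (\<Sum>i\<in>I \<union> J. (if i \<in> I then a i else 0) * e i p)" for p
    unfolding I(2) using I J by (intro sum.mono_neutral_cong_left) auto
  have G: "G p = (\<Sum>i\<in>I \<union> J. (if i \<in> J then b i else 0) * e i p)" for p
    unfolding J(2) using I J by (intro sum.mono_neutral_cong_left) auto
  have eq: "(\<lambda>p. F p + G p) = (\<lambda>p. \<Sum>i\<in>I \<union> J. ((if i \<in> I then a i else 0) + (if i \<in> J then b i else 0)) * e i p)"
    by (rule ext) (simp only: F G sum.distrib[symmetric] distrib_right)
  show ?case by (rule exI, rule exI, rule conjI[OF _ eq]) (simp add: I(1) J(1))
qed

text \<open>The product formula for cosines; the case distinction gives the absolute difference of
  the indices, which are natural numbers.\<close>

lemma cb_mult: "cb m x * cb n x = (cb (m + n) x + cb (if m \<ge> n then m - n else n - m) x) / 2"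
proof -
  have "cb (if m \<ge> n then m - n else n - m) x = cos (real m * pi * x - real n * pi * x)"
  proof (cases "m \<ge> n")
    case True
    then show ?thesis by (simp add: cb_def of_nat_diff left_diff_distrib)
  next
    case False
    then have "cb (if m \<ge> n then m - n else n - m) x = cos (- (real m * pi * x - real n * pi * x))"
      by (simp add: cb_def of_nat_diff left_diff_distrib)
    then show ?thesis by (simp only: cos_minus)
  qed
  then show ?thesis by (simp add: cb_def cos_times_cos distrib_right add.commute)
qed

text \<open>For \<open>m = 0\<close> the index \<open>m - 1\<close> would have to be -1, and the
  sine of the negated argument is \<open>- sb 1 x\<close>.\<close>

lemma sb1_cb_mult: "sb 1 x * cb m x = (sb (m + 1) x - (if m = 0 then - sb 1 x else sb (m - 1) x)) / 2"
proof (cases m)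
  case 0
  then show ?thesis by (simp add: sb_def cb_def)
next
  case (Suc k)
  have "sb 1 x * cb m x = (sin (pi * x + real m * pi * x) + sin (pi * x - real m * pi * x)) / 2"
    by (simp add: sb_def cb_def sin_times_cos)
  moreover have "sin (pi * x - real m * pi * x) = - sb (m - 1) x"
  proof -
    have "pi * x - real m * pi * x = - (real (m - 1) * pi * x)" using Suc by (simp add: algebra_simps)
    then show ?thesis by (simp only: sb_def sin_minus)
  qed
  moreover have "sin (pi * x + real m * pi * x) = sb (m + 1) x" by (simp add: sb_def algebra_simps)
  ultimately show ?thesis using Suc by simp
qed

lemma lin_span_phi_mult_base: "lin_span phi (\<lambda>p. phi i p * phi j p)"
proof -
  define d where "d = (\<lambda>m n. if m \<ge> n then m - n else n - m :: nat)"
  define A where "A = (\<lambda>p. phi (fst i + fst j, snd i + snd j) p)"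
  define B where "B = (\<lambda>p. phi (fst i + fst j, d (snd i) (snd j)) p)"
  define C where "C = (\<lambda>p. phi (d (fst i) (fst j), snd i + snd j) p)"
  define D where "D = (\<lambda>p. phi (d (fst i) (fst j), d (snd i) (snd j)) p)"
  have "phi i p * phi j p = 1/4 * A p + 1/4 * B p + 1/4 * C p + 1/4 * D p" for p
  proof -
    have 1: "cb m x * cb n x = (cb (m + n) x + cb (d m n) x) / 2" for m n x
      by (simp only: cb_mult d_def)
    have 2: "((x + y) / 2) * ((z + w) / 2) = 1/4 * (x * z) + 1/4 * (x * w) + 1/4 * (y * z) + 1/4 * (y * w)" for x y z w :: real
      by (simp add: field_simps)
    have "phi i p * phi j p = (cb (fst i) (fst p) * cb (fst j) (fst p)) * (cb (snd i) (snd p + 1/2) * cb (snd j) (snd p + 1/2))"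
      by (simp add: phi_def)
    also have "\<dots> = 1/4 * A p + 1/4 * B p + 1/4 * C p + 1/4 * D p"
      unfolding 1 2 by (simp only: A_def B_def C_def D_def phi_def fst_conv snd_conv)
    finally show ?thesis .
  qed
  moreover have "lin_span phi (\<lambda>p. 1/4 * A p + 1/4 * B p + 1/4 * C p + 1/4 * D p)"
    unfolding A_def B_def C_def D_def by (intro lin_span.intros)
  ultimately show ?thesis by simp
qed

lemma lin_span_phi_mult:
  assumes "lin_span phi F" "lin_span phi G"
  shows "lin_span phi (\<lambda>p. F p * G p)"
  using assms
proof (induction arbitrary: G)
  case (base c i)
  from base show ?case
  proof (induction)
    case (base d j)
    have "lin_span phi (\<lambda>p. (c * d) * (phi i p * phi j p))" by (intro lin_span_cmult lin_span_phi_mult_base)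
    then show ?case by (simp add: mult_ac)
  next
    case (add F G)
    then show ?case unfolding distrib_left by (intro lin_span.add)
  qed
next
  case (add F F')
  then show ?case unfolding distrib_right by (intro lin_span.add)
qed

lemma lin_span_phi_const: "lin_span phi (\<lambda>p. c)"
proof -
  have "lin_span phi (\<lambda>p. c * phi (0, 0) p)" by (rule lin_span.base)
  then show ?thesis by (simp add: phi_def cb_def)
qed

text \<open>The span is closed under products and contains the constants and both coordinates, here
  the cosines of index 1.\<close>

lemma lin_span_phi_polynomial:
  assumes "real_polynomial_function P"
  shows "lin_span phi (\<lambda>p. P (cb 1 (fst p), cb 1 (snd p + 1/2)))"
  using assms
proof induction
  case (linear f)
  have "lin_span phi (\<lambda>p. f (1, 0) * phi (1, 0) p + f (0, 1) * phi (0, 1) p)" by (intro lin_span.intros)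
  moreover have "f (cb 1 (fst p), cb 1 (snd p + 1/2)) = f (1, 0) * phi (1, 0) p + f (0, 1) * phi (0, 1) p" for p :: "real \<times> real"
  proof -
    have "f (a, b) = a * f (1, 0) + b * f (0, 1)" for a b
    proof -
      have l: "linear f" using linear by (rule bounded_linear.linear)
      have "f (a, b) = f (a *\<^sub>R (1, 0) + b *\<^sub>R (0, 1))" by simp
      also have "\<dots> = a * f (1, 0) + b * f (0, 1)"
        unfolding linear_add[OF l] linear_scale[OF l] by simp
      finally show ?thesis .
    qed
    from this[of "cb 1 (fst p)" "cb 1 (snd p + 1/2)"] show ?thesis by (simp add: phi_def cb_def)
  qed
  ultimately show ?case by simp
next
  case (const c)
  show ?case by (rule lin_span_phi_const)
next
  case (add f g)
  then show ?case by (intro lin_span.add)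
next
  case (mult f g)
  then show ?case by (intro lin_span_phi_mult)
qed

lemma smooth1_cb: "smooth1 (cb m)"
  unfolding cb_def[abs_def] using smooth1_affine[OF smooth1_cos, of "real m * pi" 0] by simp

lemma smooth1_sb: "smooth1 (sb m)"
  unfolding sb_def[abs_def] using smooth1_affine[OF smooth1_sin, of "real m * pi" 0] by simp

lemma Csm_snd_shift: "smooth1 f \<Longrightarrow> (\<lambda>p. f (snd p + 1/2)) \<in> Csm"
  using Csm_snd[OF smooth1_affine[of f 1 "1/2"]] by simp

lemma Csm_basis: "phi i \<in> Csm" "psi i \<in> Csm" "chi i \<in> Csm"
  unfolding phi_def[abs_def] psi_def[abs_def] chi_def[abs_def]
  by (intro Csm_mult Csm_fst Csm_snd_shift smooth1_cb smooth1_sb)+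

lemma lin_span_Csm: "lin_span e F \<Longrightarrow> (\<And>i. e i \<in> Csm) \<Longrightarrow> F \<in> Csm"
  by (induction rule: lin_span.induct) (auto intro: Csm_add Csm_mult Csm_const)

text \<open>The substitution by \<open>arccos\<close> turns a continuous function on the strip into
  one on the square of side from -1 to 1, where polynomials are dense; undoing it gives a cosine
  sum. The errors add to at most 2 * \<delta>/4 + 2 * \<delta>/8.\<close>

lemma phi_complete:
  assumes f: "L2S f" and d: "\<delta> > 0"
  obtains F where "lin_span phi F" "L2sq (\<lambda>p. f p - F p) < \<delta>"
proof -
  obtain g where g: "continuous_on UNIV g" "L2sq (\<lambda>p. f p - g p) < \<delta> / 4"
    using L2S_approx_continuous[OF f, of "\<delta> / 4"] d by auto
  define \<eta> where "\<eta> = sqrt (\<delta> / 8)"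
  have \<eta>: "\<eta> > 0" "\<eta>\<^sup>2 = \<delta> / 8" using d by (auto simp: \<eta>_def)
  define G where "G = (\<lambda>q. g (arccos (fst q) / pi, arccos (snd q) / pi - 1/2))"
  have "continuous_on ({-1..1} \<times> {-1..1}) G"
    unfolding G_def
    by (intro continuous_on_compose2[OF g(1)] continuous_intros continuous_on_compose2[OF continuous_on_arccos']) auto
  then obtain P where P: "real_polynomial_function P" "\<And>q. q \<in> {-1..1} \<times> {-1..1} \<Longrightarrow> \<bar>G q - P q\<bar> < \<eta>"
    using Stone_Weierstrass_real_polynomial_function[of "{-1..1} \<times> {-1..1}" G \<eta>] \<eta>(1) compact_Times[of "{-1..1::real}" "{-1..1::real}"]
    by auto
  define F where "F = (\<lambda>p. P (cb 1 (fst p), cb 1 (snd p + 1/2)))"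
  have F: "lin_span phi F" unfolding F_def by (rule lin_span_phi_polynomial[OF P(1)])
  have FL: "L2S F" by (intro Csm_L2S lin_span_Csm[OF F] Csm_basis)
  have gL: "L2S g" by (intro continuous_L2S continuous_on_subset[OF g(1)]) simp
  have le: "(g p - F p)\<^sup>2 \<le> \<delta> / 8" if "p \<in> stripS" for p
  proof -
    obtain s t where p: "p = (s, t)" by force
    have st: "0 \<le> s" "s \<le> 1" "0 \<le> t + 1/2" "t + 1/2 \<le> 1" using that by (auto simp: p stripS_def)
    have "arccos (cb 1 s) = pi * s" "arccos (cb 1 (t + 1/2)) = pi * (t + 1/2)"
      using st by (auto simp: cb_def intro!: arccos_cos simp del: distrib_left_numeral)
    then have "G (cb 1 s, cb 1 (t + 1/2)) = g p" by (simp add: G_def p)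
    moreover have "\<bar>G (cb 1 s, cb 1 (t + 1/2)) - P (cb 1 s, cb 1 (t + 1/2))\<bar> < \<eta>"
      by (intro P(2)) (auto simp: cb_def)
    ultimately have "\<bar>g p - F p\<bar> \<le> \<eta>" by (simp add: F_def p)
    then show ?thesis unfolding \<eta>(2)[symmetric] by (rule sq_le_if_abs_le)
  qed
  have "L2sq (\<lambda>p. g p - F p) \<le> integral\<^sup>L muS (\<lambda>p. \<delta> / 8)"
    unfolding L2sq_def using le
    by (intro integral_mono L2S_sq L2S_diff gL FL integrable_muS_bounded[where B="\<bar>\<delta> / 8\<bar>"]) auto
  also have "\<dots> = \<delta> / 8" by (simp add: measure_muS)
  finally have 1: "L2sq (\<lambda>p. g p - F p) \<le> \<delta> / 8" .
  have "L2sq (\<lambda>p. f p - F p) = L2sq (\<lambda>p. (f p - g p) + (g p - F p))" by simp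
  also have "\<dots> \<le> 2 * L2sq (\<lambda>p. f p - g p) + 2 * L2sq (\<lambda>p. g p - F p)"
    by (intro L2sq_add_le L2S_diff f gL FL)
  also have "\<dots> < \<delta>" using g(2) 1 d by simp
  finally show ?thesis using that[OF F] by blast
qed

text \<open>The approximation of \<open>f\<close> is \<sigma> times a cosine sum for
  \<open>f / \<sigma>\<close>. This quotient may fail to be square-integrable, so it is regularised
  to \<open>h n\<close>, for which \<open>\<sigma> * h n\<close> is \<open>f\<close> times a factor
  in [0, 1] tending to 1.\<close>

lemma mult_complete:
  assumes f: "L2S f" and d: "\<delta> > 0" and s: "\<sigma> \<in> Csm" "\<And>p. \<bar>\<sigma> p\<bar> \<le> 1" "\<And>p. p \<in> stripS \<Longrightarrow> \<sigma> p \<noteq> 0"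
    and e: "\<And>F. lin_span phi F \<Longrightarrow> lin_span e (\<lambda>p. \<sigma> p * F p)"
  obtains F where "lin_span e F" "L2sq (\<lambda>p. f p - F p) < \<delta>"
proof -
  define h where "h = (\<lambda>n p. \<sigma> p / ((\<sigma> p)\<^sup>2 + 1 / real (Suc n)) * f p)"
  have den: "(\<sigma> p)\<^sup>2 + 1 / real (Suc n) > 0" for n p by (intro add_nonneg_pos) auto
  have hL: "L2S (h n)" for n
    unfolding h_def
  proof (rule L2S_bounded_mult[OF f])
    show "(\<lambda>p. \<sigma> p / ((\<sigma> p)\<^sup>2 + 1 / real (Suc n))) \<in> borel_measurable muS"
      by (intro borel_measurable_divide borel_measurable_add borel_measurable_power Csm_measurable s borel_measurable_const)
    fix p
    have "\<bar>\<sigma> p\<bar> / ((\<sigma> p)\<^sup>2 + 1 / real (Suc n)) \<le> 1 / (1 / real (Suc n))"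
      using s(2)[of p] den[of p n] by (intro frac_le) auto
    then show "\<bar>\<sigma> p / ((\<sigma> p)\<^sup>2 + 1 / real (Suc n))\<bar> \<le> real (Suc n)"
      using den[of p n] by (simp add: abs_divide)
  qed
  have "(\<lambda>n. L2sq (\<lambda>p. f p - \<sigma> p * h n p)) \<longlonglongrightarrow> 0"
  proof (rule L2sq_tendsto_0[OF f])
    show "(\<lambda>p. \<sigma> p * h n p) \<in> borel_measurable muS" for n
      by (intro borel_measurable_times Csm_measurable s L2S_measurable hL)
    have eq: "\<sigma> p * h n p = (\<sigma> p)\<^sup>2 / ((\<sigma> p)\<^sup>2 + 1 / real (Suc n)) * f p" for n p
      by (simp add: h_def power2_eq_square)
    show "\<bar>f p - \<sigma> p * h n p\<bar> \<le> \<bar>f p\<bar>" for n p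
    proof -
      define r where "r = (\<sigma> p)\<^sup>2 / ((\<sigma> p)\<^sup>2 + 1 / real (Suc n))"
      have r: "0 \<le> r" "r \<le> 1" using den[of p n] by (auto simp: r_def)
      have "f p - \<sigma> p * h n p = (1 - r) * f p" unfolding eq r_def[symmetric] by (simp add: algebra_simps)
      then show ?thesis using r by (simp add: abs_mult mult_left_le_one_le)
    qed
    show "(\<lambda>n. \<sigma> p * h n p) \<longlonglongrightarrow> f p" if "p \<in> stripS" for p
    proof -
      have "(\<lambda>n. (\<sigma> p)\<^sup>2 / ((\<sigma> p)\<^sup>2 + 1 / real (Suc n)) * f p) \<longlonglongrightarrow> (\<sigma> p)\<^sup>2 / ((\<sigma> p)\<^sup>2 + 0) * f p"
        using s(3)[OF that] LIMSEQ_inverse_real_of_nat by (intro tendsto_intros) (auto simp: inverse_eq_divide)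
      then show ?thesis unfolding eq using s(3)[OF that] by simp
    qed
  qed
  then obtain n where n: "L2sq (\<lambda>p. f p - \<sigma> p * h n p) < \<delta> / 4"
    using eventually_happens'[OF sequentially_bot order_tendstoD(2)[of _ 0 sequentially "\<delta> / 4"]] d by auto
  obtain F where F: "lin_span phi F" "L2sq (\<lambda>p. h n p - F p) < \<delta> / 4"
    using phi_complete[OF hL, of "\<delta> / 4" n] d by auto
  have FL: "L2S F" by (intro Csm_L2S lin_span_Csm[OF F(1)] Csm_basis)
  have sm: "\<sigma> \<in> borel_measurable muS" by (rule Csm_measurable[OF s(1)])
  have "L2sq (\<lambda>p. \<sigma> p * (h n p - F p)) \<le> 1\<^sup>2 * L2sq (\<lambda>p. h n p - F p)"
    by (intro L2sq_bounded_mult_le L2S_diff hL FL sm s)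
  then have 1: "L2sq (\<lambda>p. \<sigma> p * (h n p - F p)) < \<delta> / 4" using F(2) by simp
  have "L2sq (\<lambda>p. f p - \<sigma> p * F p) = L2sq (\<lambda>p. (f p - \<sigma> p * h n p) + \<sigma> p * (h n p - F p))"
    by (simp add: algebra_simps)
  also have "\<dots> \<le> 2 * L2sq (\<lambda>p. f p - \<sigma> p * h n p) + 2 * L2sq (\<lambda>p. \<sigma> p * (h n p - F p))"
    by (intro L2sq_add_le L2S_diff f hL FL L2S_bounded_mult[OF _ sm s(2)])
  also have "\<dots> < \<delta>" using n 1 d by simp
  finally show ?thesis using that[OF e[OF F(1)]] by blast
qed

text \<open>The first sine in s has no zero inside the strip, and multiplying a cosine by it gives a
  combination of two sines.\<close>

lemma psi_complete:
  assumes f: "L2S f" and d: "\<delta> > 0"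
  obtains F where "lin_span psi F" "L2sq (\<lambda>p. f p - F p) < \<delta>"
proof (rule mult_complete[OF f d, where \<sigma>="\<lambda>p. sb 1 (fst p)" and e=psi])
  show "(\<lambda>p. sb 1 (fst p)) \<in> Csm" by (intro Csm_fst smooth1_sb)
  show "\<bar>sb 1 (fst p)\<bar> \<le> 1" for p :: "real \<times> real" by (simp add: sb_def)
  show "sb 1 (fst p) \<noteq> 0" if "p \<in> stripS" for p
    using that sin_gt_zero[of "pi * fst p"] by (auto simp: sb_def stripS_def)
  show "lin_span psi (\<lambda>p. sb 1 (fst p) * F p)" if "lin_span phi F" for F
    using that
  proof induction
    case (base c i)
    have *: "sb 1 (fst p) * (c * phi i p) = (c / 2) * psi (fst i + 1, snd i) p
        + (if fst i = 0 then c / 2 else - c / 2) * psi (if fst i = 0 then 1 else fst i - 1, snd i) p" for p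
    proof -
      have "sb 1 (fst p) * (c * phi i p) = c * (sb 1 (fst p) * cb (fst i) (fst p)) * cb (snd i) (snd p + 1/2)"
        by (simp add: phi_def)
      also have "\<dots> = (c / 2) * psi (fst i + 1, snd i) p
        + (if fst i = 0 then c / 2 else - c / 2) * psi (if fst i = 0 then 1 else fst i - 1, snd i) p"
        unfolding sb1_cb_mult psi_def fst_conv snd_conv by (cases "fst i = 0") (simp_all add: field_simps)
      finally show ?thesis .
    qed
    show ?case unfolding * by (intro lin_span.intros)
  next
    case (add F G)
    then show ?case unfolding distrib_left by (intro lin_span.add)
  qed
qed (rule that)

lemma chi_complete:
  assumes f: "L2S f" and d: "\<delta> > 0"
  obtains F where "lin_span chi F" "L2sq (\<lambda>p. f p - F p) < \<delta>"
proof (rule mult_complete[OF f d, where \<sigma>="\<lambda>p. sb 1 (snd p + 1/2)" and e=chi])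
  show "(\<lambda>p. sb 1 (snd p + 1/2)) \<in> Csm" by (intro Csm_snd_shift smooth1_sb)
  show "\<bar>sb 1 (snd p + 1/2)\<bar> \<le> 1" for p :: "real \<times> real" by (simp add: sb_def)
  show "sb 1 (snd p + 1/2) \<noteq> 0" if "p \<in> stripS" for p
  proof -
    have "pi * (snd p + 1/2) > 0" "pi * (snd p + 1/2) < pi * 1"
      using that by (auto simp: stripS_def intro!: mult_pos_pos simp del: mult_1_right)
    then show ?thesis using sin_gt_zero[of "pi * (snd p + 1/2)"] by (simp add: sb_def)
  qed
  show "lin_span chi (\<lambda>p. sb 1 (snd p + 1/2) * F p)" if "lin_span phi F" for F
    using that
  proof induction
    case (base c i)
    have *: "sb 1 (snd p + 1/2) * (c * phi i p) = (c / 2) * chi (fst i, snd i + 1) p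
        + (if snd i = 0 then c / 2 else - c / 2) * chi (fst i, if snd i = 0 then 1 else snd i - 1) p" for p
    proof -
      have "sb 1 (snd p + 1/2) * (c * phi i p) = c * (sb 1 (snd p + 1/2) * cb (snd i) (snd p + 1/2)) * cb (fst i) (fst p)"
        by (simp add: phi_def)
      also have "\<dots> = (c / 2) * chi (fst i, snd i + 1) p
        + (if snd i = 0 then c / 2 else - c / 2) * chi (fst i, if snd i = 0 then 1 else snd i - 1) p"
        unfolding sb1_cb_mult chi_def fst_conv snd_conv by (cases "snd i = 0") (simp_all add: field_simps)
      finally show ?thesis .
    qed
    show ?case unfolding * by (intro lin_span.intros)
  next
    case (add F G)
    then show ?case unfolding distrib_left by (intro lin_span.add)
  qed
qed (rule that)

section \<open>Cosine expansion of Sobolev functions\<close>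

lemma cb_deriv: "(cb m has_real_derivative - (real m * pi) * sb m x) (at x)"
  unfolding cb_def[abs_def] sb_def by (auto intro!: derivative_eq_intros)

lemma sb_deriv: "(sb m has_real_derivative (real m * pi) * cb m x) (at x)"
  unfolding cb_def sb_def[abs_def] by (auto intro!: derivative_eq_intros)

lemma shift_deriv:
  assumes "\<And>x. (f has_real_derivative f' x) (at x)"
  shows "((\<lambda>t. f (t + 1/2)) has_real_derivative f' (x + 1/2)) (at x)"
proof -
  have "((\<lambda>t. t + 1/2) has_real_derivative 1) (at x)" by (auto intro!: derivative_eq_intros)
  from DERIV_chain2[OF assms this] show ?thesis by simp
qed

text \<open>Recovers the full derivative from the directional ones, so that sum rules for
  \<open>pdir\<close> follow from those for \<open>has_derivative\<close>.\<close>

lemma Csm_has_derivative_pdir: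
  assumes "F \<in> Csm"
  shows "(F has_derivative (\<lambda>h. pdir h F p)) (at p)"
  using Csm_differentiable[OF assms, of p] by (simp add: pdir_def frechet_derivative_works)

lemma pdir_add:
  assumes "F \<in> Csm" "G \<in> Csm"
  shows "pdir e (\<lambda>p. F p + G p) = (\<lambda>p. pdir e F p + pdir e G p)"
  by (rule pdir_eq[where D="\<lambda>p h. pdir h F p + pdir h G p"])
    (intro has_derivative_add Csm_has_derivative_pdir assms)

lemma pdir_sum:
  assumes "\<And>i. b i \<in> Csm"
  shows "pdir e (\<lambda>p. \<Sum>i\<in>I. a i * b i p) = (\<lambda>p. \<Sum>i\<in>I. a i * pdir e (b i) p)"
  by (rule pdir_eq[where D="\<lambda>p h. \<Sum>i\<in>I. a i * pdir h (b i) p"])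
    (intro has_derivative_sum has_derivative_mult_right Csm_has_derivative_pdir assms)

lemma pdir_basis:
  "pdir e_s (phi i) = (\<lambda>p. - (real (fst i) * pi) * psi i p)"
  "pdir e_t (phi i) = (\<lambda>p. - (real (snd i) * pi) * chi i p)"
  "pdir e_s (psi i) = (\<lambda>p. (real (fst i) * pi) * phi i p)"
  "pdir e_t (chi i) = (\<lambda>p. (real (snd i) * pi) * phi i p)"
  unfolding phi_def[abs_def] psi_def[abs_def] chi_def[abs_def]
    pdir_mult[OF Csm_fst[OF smooth1_cb] Csm_snd_shift[OF smooth1_cb]]
    pdir_mult[OF Csm_fst[OF smooth1_sb] Csm_snd_shift[OF smooth1_cb]]
    pdir_mult[OF Csm_fst[OF smooth1_cb] Csm_snd_shift[OF smooth1_sb]]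
    pdir_fst[OF cb_deriv] pdir_fst[OF sb_deriv]
    pdir_snd[where f="\<lambda>t. cb n (t + 1/2)" for n, OF shift_deriv[OF cb_deriv]]
    pdir_snd[where f="\<lambda>t. sb n (t + 1/2)" for n, OF shift_deriv[OF sb_deriv]]
  by (simp_all add: fun_eq_iff)

lemma pdir_const: "pdir e (\<lambda>p. c) = (\<lambda>p. 0)"
  by (rule pdir_eq[where D="\<lambda>p h. 0"]) simp

lemma Csm_mixed:
  assumes "F \<in> Csm"
  shows "pdir e_s (pdir e_t F) = pdir e_t (pdir e_s F)"
  using assms
proof induction
  case (Csm_fst f)
  then obtain f' where f': "smooth1 f'" "\<And>x. (f has_real_derivative f' x) (at x)" using smooth1_deriv by blast
  obtain f'' where f'': "\<And>x. (f' has_real_derivative f'' x) (at x)" using smooth1_deriv[OF f'(1)] by blast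
  show ?case by (simp add: pdir_fst[OF f'(2)] pdir_fst[OF f''] pdir_const)
next
  case (Csm_snd f)
  then obtain f' where f': "smooth1 f'" "\<And>x. (f has_real_derivative f' x) (at x)" using smooth1_deriv by blast
  obtain f'' where f'': "\<And>x. (f' has_real_derivative f'' x) (at x)" using smooth1_deriv[OF f'(1)] by blast
  show ?case by (simp add: pdir_snd[OF f'(2)] pdir_snd[OF f''] pdir_const)
next
  case (Csm_add F G)
  then show ?case by (simp add: pdir_add Csm_pdir)
next
  case (Csm_mult F G)
  then show ?case
    by (simp add: pdir_mult pdir_add Csm_pdir Csm.Csm_mult Csm.Csm_add) (simp add: fun_eq_iff algebra_simps)
qed

section \<open>Orthogonality relations and best approximation\<close>

lemma integral_cb: "integral {0..1} (cb m) = (if m = 0 then 1 else 0)"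
proof (cases "m = 0")
  case True
  then have "cb m = (\<lambda>x. 1)" by (simp add: cb_def fun_eq_iff)
  then show ?thesis using True by simp
next
  case False
  have "(cb m has_integral sb m 1 / (real m * pi) - sb m 0 / (real m * pi)) {0..1}"
  proof (rule integral_deriv_01)
    fix x :: real
    have "((\<lambda>x. sb m x / (real m * pi)) has_real_derivative (real m * pi) * cb m x / (real m * pi)) (at x)"
      by (intro DERIV_cdivide sb_deriv)
    then show "((\<lambda>x. sb m x / (real m * pi)) has_real_derivative cb m x) (at x within {0..1})"
      using False by (simp add: has_field_derivative_at_within)
  qed auto
  moreover have "sb m 1 = 0" "sb m 0 = 0" by (simp_all add: sb_def)
  ultimately show ?thesis using False by (simp add: integral_unique)
qed

text \<open>The squared norm of the cosine of index m on the unit interval.\<close>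

definition nu :: "nat \<Rightarrow> real" where "nu m = (if m = 0 then 1 else 1/2)"

lemma cb_cont: "continuous_on A (cb m)" and sb_cont: "continuous_on A (sb m)"
  unfolding cb_def[abs_def] sb_def[abs_def] by (intro continuous_intros)+

lemma integral_cb_cb: "integral {0..1} (\<lambda>x. cb m x * cb n x) = (if m = n then nu m else 0)"
proof -
  have "integral {0..1} (\<lambda>x. cb m x * cb n x)
    = integral {0..1} (\<lambda>x. (1/2) * cb (m + n) x + (1/2) * cb (if m \<ge> n then m - n else n - m) x)"
    unfolding cb_mult by (simp only: add_divide_distrib) simp
  also have "\<dots> = integral {0..1} (\<lambda>x. (1/2) * cb (m + n) x) + integral {0..1} (\<lambda>x. (1/2) * cb (if m \<ge> n then m - n else n - m) x)"
    by (intro integral_add integrable_continuous_interval continuous_intros cb_cont)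
  also have "\<dots> = (1/2) * (if m + n = 0 then 1 else 0) + (1/2) * (if (if m \<ge> n then m - n else n - m) = 0 then 1 else 0)"
    by (simp only: integral_mult_right integral_cb)
  also have "\<dots> = (if m = n then nu m else 0)" by (auto simp: nu_def)
  finally show ?thesis .
qed

lemma sb_mult: "sb m x * sb n x = (cb (if m \<ge> n then m - n else n - m) x - cb (m + n) x) / 2"
proof -
  have "cb (if m \<ge> n then m - n else n - m) x = 2 * (cb m x * cb n x) - cb (m + n) x"
  proof -
    have "P = (A + B) / 2 \<Longrightarrow> B = 2 * P - A" for P A B :: real by simp
    from this[OF cb_mult] show ?thesis .
  qed
  moreover have "cb (m + n) x = cb m x * cb n x - sb m x * sb n x"
    by (simp add: cb_def sb_def distrib_right cos_add)
  ultimately show ?thesis by simp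
qed

lemma integral_sb_sb: "integral {0..1} (\<lambda>x. sb m x * sb n x) = (if m = n \<and> m \<noteq> 0 then 1/2 else 0)"
proof -
  have "integral {0..1} (\<lambda>x. sb m x * sb n x)
    = integral {0..1} (\<lambda>x. (1/2) * cb (if m \<ge> n then m - n else n - m) x - (1/2) * cb (m + n) x)"
    unfolding sb_mult by (simp only: diff_divide_distrib) simp
  also have "\<dots> = integral {0..1} (\<lambda>x. (1/2) * cb (if m \<ge> n then m - n else n - m) x) - integral {0..1} (\<lambda>x. (1/2) * cb (m + n) x)"
    by (intro integral_diff integrable_continuous_interval continuous_intros cb_cont)
  also have "\<dots> = (1/2) * (if (if m \<ge> n then m - n else n - m) = 0 then 1 else 0) - (1/2) * (if m + n = 0 then 1 else 0)"
    by (simp only: integral_mult_right integral_cb)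
  also have "\<dots> = (if m = n \<and> m \<noteq> 0 then 1/2 else 0)" by auto
  finally show ?thesis .
qed

lemma int2_tensor:
  assumes "continuous_on {0..1} f" "continuous_on {0..1} g"
  shows "int2 (\<lambda>x y. f x * g y) = integral {0..1} f * integral {0..1} g"
proof -
  have "cont2 (\<lambda>x y. f x * g y)" by (intro cont2_mult cont2_x cont2_y assms)
  then show ?thesis by (simp add: int2_iterated)
qed

lemma integral_muS_tensor:
  fixes f g :: "real \<Rightarrow> real"
  assumes "continuous_on UNIV f" "continuous_on UNIV g"
  shows "integral\<^sup>L muS (\<lambda>p. f (fst p) * g (snd p + 1/2)) = integral {0..1} f * integral {0..1} g"
proof -
  have "continuous_on clS (\<lambda>p. f (fst p) * g (snd p + 1/2))"
    by (intro continuous_intros continuous_on_compose2[OF assms(1)] continuous_on_compose2[OF assms(2)]) auto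
  from integral_muS_int2[OF this]
  have "integral\<^sup>L muS (\<lambda>p. f (fst p) * g (snd p + 1/2)) = int2 (\<lambda>x y. f x * g y)" by simp
  also have "\<dots> = integral {0..1} f * integral {0..1} g"
    by (intro int2_tensor continuous_on_subset[OF assms(1)] continuous_on_subset[OF assms(2)]) auto
  finally show ?thesis .
qed

lemma basis_orthogonal:
  "integral\<^sup>L muS (\<lambda>p. phi i p * phi j p) = (if i = j then nu (fst i) * nu (snd i) else 0)"
  "integral\<^sup>L muS (\<lambda>p. psi i p * psi j p) = (if i = j \<and> fst i \<noteq> 0 then nu (fst i) * nu (snd i) else 0)"
  "integral\<^sup>L muS (\<lambda>p. chi i p * chi j p) = (if i = j \<and> snd i \<noteq> 0 then nu (fst i) * nu (snd i) else 0)"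
proof -
  have c: "continuous_on UNIV (\<lambda>x. cb m x * cb n x)" "continuous_on UNIV (\<lambda>x. sb m x * sb n x)" for m n
    by (intro continuous_intros cb_cont sb_cont)+
  have "(\<lambda>p. phi i p * phi j p) = (\<lambda>p. (cb (fst i) (fst p) * cb (fst j) (fst p)) * (cb (snd i) (snd p + 1/2) * cb (snd j) (snd p + 1/2)))"
    "(\<lambda>p. psi i p * psi j p) = (\<lambda>p. (sb (fst i) (fst p) * sb (fst j) (fst p)) * (cb (snd i) (snd p + 1/2) * cb (snd j) (snd p + 1/2)))"
    "(\<lambda>p. chi i p * chi j p) = (\<lambda>p. (cb (fst i) (fst p) * cb (fst j) (fst p)) * (sb (snd i) (snd p + 1/2) * sb (snd j) (snd p + 1/2)))"
    by (simp_all add: phi_def psi_def chi_def fun_eq_iff)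
  then show "integral\<^sup>L muS (\<lambda>p. phi i p * phi j p) = (if i = j then nu (fst i) * nu (snd i) else 0)"
    "integral\<^sup>L muS (\<lambda>p. psi i p * psi j p) = (if i = j \<and> fst i \<noteq> 0 then nu (fst i) * nu (snd i) else 0)"
    "integral\<^sup>L muS (\<lambda>p. chi i p * chi j p) = (if i = j \<and> snd i \<noteq> 0 then nu (fst i) * nu (snd i) else 0)"
    using integral_muS_tensor[OF c(1)[of "fst i" "fst j"] c(1)[of "snd i" "snd j"]]
      integral_muS_tensor[OF c(2)[of "fst i" "fst j"] c(1)[of "snd i" "snd j"]]
      integral_muS_tensor[OF c(1)[of "fst i" "fst j"] c(2)[of "snd i" "snd j"]]
    by (auto simp: integral_cb_cb integral_sb_sb nu_def prod_eq_iff)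
qed

lemma L2sq_add_orthogonal:
  assumes "L2S d" "L2S w" "integral\<^sup>L muS (\<lambda>p. d p * w p) = 0"
  shows "L2sq (\<lambda>p. d p + w p) = L2sq d + L2sq w"
proof -
  have "L2sq (\<lambda>p. d p + w p) = integral\<^sup>L muS (\<lambda>p. (d p)\<^sup>2 + (w p)\<^sup>2 + 2 * (d p * w p))"
    unfolding L2sq_def by (intro Bochner_Integration.integral_cong) (auto simp: power2_sum)
  also have "\<dots> = L2sq d + L2sq w + 2 * integral\<^sup>L muS (\<lambda>p. d p * w p)"
    using assms(1,2) by (simp add: L2S_sq L2S_mult_integrable L2sq_def)
  finally show ?thesis using assms(3) by simp
qed

text \<open>The difference between the two sums is orthogonal to the remainder of the Fourier sum,
  so any other coefficients add a square. The alternative in the norm hypothesis admits the elements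
  of \<open>psi\<close> and \<open>chi\<close> that are identically zero: their coefficient is 0 and
  need not be normalised.\<close>

lemma orthogonal_projection_le:
  assumes I: "finite I" and f: "L2S f" and e: "\<And>i. L2S (e i)"
    and orth: "\<And>i j. i \<in> I \<Longrightarrow> j \<in> I \<Longrightarrow> i \<noteq> j \<Longrightarrow> integral\<^sup>L muS (\<lambda>p. e i p * e j p) = 0"
    and norm: "\<And>i. i \<in> I \<Longrightarrow> (integral\<^sup>L muS (\<lambda>p. e i p * e i p) = n i \<and> n i \<noteq> 0) \<or> integral\<^sup>L muS (\<lambda>p. f p * e i p) = 0"
  shows "L2sq (\<lambda>p. f p - (\<Sum>i\<in>I. integral\<^sup>L muS (\<lambda>p. f p * e i p) / n i * e i p))
    \<le> L2sq (\<lambda>p. f p - (\<Sum>i\<in>I. a i * e i p))"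
proof -
  define c where "c = (\<lambda>i. integral\<^sup>L muS (\<lambda>p. f p * e i p) / n i)"
  define d where "d = (\<lambda>p. f p - (\<Sum>i\<in>I. c i * e i p))"
  have sL: "L2S (\<lambda>p. \<Sum>i\<in>I. a i * e i p)" for a :: "_ \<Rightarrow> real" using I e by (intro L2S_sum L2S_cmult)
  have dL: "L2S d" unfolding d_def by (intro L2S_diff f sL)
  have de: "integral\<^sup>L muS (\<lambda>p. d p * e j p) = 0" if j: "j \<in> I" for j
  proof -
    have "integral\<^sup>L muS (\<lambda>p. d p * e j p) = integral\<^sup>L muS (\<lambda>p. f p * e j p - (\<Sum>i\<in>I. c i * (e i p * e j p)))"
      by (simp add: d_def left_diff_distrib sum_distrib_right mult.assoc)
    also have "\<dots> = integral\<^sup>L muS (\<lambda>p. f p * e j p) - (\<Sum>i\<in>I. c i * integral\<^sup>L muS (\<lambda>p. e i p * e j p))"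
      using I f e by (subst Bochner_Integration.integral_diff) (auto intro!: L2S_mult_integrable integrable_sum integrable_mult_right simp: Bochner_Integration.integral_sum L2S_mult_integrable)
    also have "(\<Sum>i\<in>I. c i * integral\<^sup>L muS (\<lambda>p. e i p * e j p)) = c j * integral\<^sup>L muS (\<lambda>p. e j p * e j p)"
      using orth j by (subst sum.remove[OF I j]) (auto intro!: sum.neutral)
    also have "integral\<^sup>L muS (\<lambda>p. f p * e j p) - \<dots> = 0"
      using norm[OF j] by (auto simp: c_def)
    finally show ?thesis .
  qed
  define w where "w = (\<lambda>p. \<Sum>i\<in>I. (c i - a i) * e i p)"
  have wL: "L2S w" unfolding w_def by (rule sL)
  have "integral\<^sup>L muS (\<lambda>p. d p * w p) = integral\<^sup>L muS (\<lambda>p. \<Sum>i\<in>I. (c i - a i) * (d p * e i p))"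
    by (simp add: w_def sum_distrib_left mult_ac)
  also have "\<dots> = (\<Sum>i\<in>I. (c i - a i) * integral\<^sup>L muS (\<lambda>p. d p * e i p))"
    using dL e by (subst Bochner_Integration.integral_sum) (auto intro!: integrable_mult_right L2S_mult_integrable)
  also have "\<dots> = 0" using de by simp
  finally have "L2sq (\<lambda>p. d p + w p) = L2sq d + L2sq w" by (intro L2sq_add_orthogonal dL wL)
  moreover have "(\<lambda>p. d p + w p) = (\<lambda>p. f p - (\<Sum>i\<in>I. a i * e i p))"
    by (simp add: d_def w_def left_diff_distrib sum_subtractf)
  ultimately show ?thesis using L2sq_nonneg[of w] unfolding d_def c_def by simp
qed

text \<open>Linear vanishing at both ends, as the extended weak derivative identities require; the
  second bound uses that the sine is zero at integer multiples of \<open>pi\<close>.\<close>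

lemma sb_bound:
  assumes "0 \<le> x" "x \<le> 1"
  shows "\<bar>sb m x\<bar> \<le> real m * pi * x" "\<bar>sb m x\<bar> \<le> real m * pi * (1 - x)"
proof -
  show "\<bar>sb m x\<bar> \<le> real m * pi * x"
    using abs_sin_x_le_abs_x[of "real m * pi * x"] assms by (simp add: sb_def abs_mult)
  have "sin (real m * pi * (1 - x)) = sin (real m * pi) * cos (real m * pi * x) - cos (real m * pi) * sin (real m * pi * x)"
    by (simp add: right_diff_distrib sin_diff)
  then have "\<bar>sin (real m * pi * (1 - x))\<bar> = \<bar>sb m x\<bar>" by (simp add: sb_def abs_mult cos_npi)
  then show "\<bar>sb m x\<bar> \<le> real m * pi * (1 - x)"
    using abs_sin_x_le_abs_x[of "real m * pi * (1 - x)"] assms by (simp add: abs_mult)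
qed

text \<open>Testing against \<open>psi i\<close> moves the derivative onto the sine and yields the
  cosine coefficient, with no boundary condition on f.\<close>

lemma weak_pd_coefficient_s:
  assumes "L2S f" "weak_pd e_s f g"
  shows "integral\<^sup>L muS (\<lambda>p. g p * psi i p) = - (real (fst i) * pi) * integral\<^sup>L muS (\<lambda>p. f p * phi i p)"
proof -
  have "integral\<^sup>L muS (\<lambda>p. f p * pdir e_s (psi i) p) = - integral\<^sup>L muS (\<lambda>p. g p * psi i p)"
  proof (rule weak_pd_test_s[OF assms Csm_basis(2), where K="real (fst i) * pi"])
    fix p assume p: "p \<in> stripS"
    have "\<bar>psi i p\<bar> \<le> \<bar>sb (fst i) (fst p)\<bar>"
      by (simp add: psi_def abs_mult cb_def mult_left_le)
    then show "\<bar>psi i p\<bar> \<le> real (fst i) * pi * fst p \<and> \<bar>psi i p\<bar> \<le> real (fst i) * pi * (1 - fst p)"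
      using sb_bound[of "fst p" "fst i"] p by (auto simp: stripS_def)
  qed
  moreover have "integral\<^sup>L muS (\<lambda>p. f p * pdir e_s (psi i) p) = (real (fst i) * pi) * integral\<^sup>L muS (\<lambda>p. f p * phi i p)"
    unfolding pdir_basis by (subst integral_mult_right_zero[symmetric]) (simp add: mult_ac)
  ultimately show ?thesis by simp
qed

lemma weak_pd_coefficient_t:
  assumes "L2S f" "weak_pd e_t f g"
  shows "integral\<^sup>L muS (\<lambda>p. g p * chi i p) = - (real (snd i) * pi) * integral\<^sup>L muS (\<lambda>p. f p * phi i p)"
proof -
  have "integral\<^sup>L muS (\<lambda>p. f p * pdir e_t (chi i) p) = - integral\<^sup>L muS (\<lambda>p. g p * chi i p)"
  proof (rule weak_pd_test_t[OF assms Csm_basis(3), where K="real (snd i) * pi"])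
    fix p assume p: "p \<in> stripS"
    have "\<bar>chi i p\<bar> \<le> \<bar>sb (snd i) (snd p + 1/2)\<bar>"
      by (simp add: chi_def abs_mult cb_def mult_left_le_one_le)
    moreover have "0 \<le> snd p + 1/2" "snd p + 1/2 \<le> 1" using p by (auto simp: stripS_def)
    ultimately show "\<bar>chi i p\<bar> \<le> real (snd i) * pi * (snd p + 1/2) \<and> \<bar>chi i p\<bar> \<le> real (snd i) * pi * (1 - (snd p + 1/2))"
      using sb_bound[of "snd p + 1/2" "snd i"] by linarith
  qed
  moreover have "integral\<^sup>L muS (\<lambda>p. f p * pdir e_t (chi i) p) = (real (snd i) * pi) * integral\<^sup>L muS (\<lambda>p. f p * phi i p)"
    unfolding pdir_basis by (subst integral_mult_right_zero[symmetric]) (simp add: mult_ac)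
  ultimately show ?thesis by simp
qed

text \<open>Termwise differentiation of the cosine partial sum of f gives the sine-cosine partial sums of the
  weak derivatives, so all three converge because the three systems are complete.\<close>

theorem weak_pd_approx:
  assumes f: "L2S f" and gs: "weak_pd e_s f gs" and gt: "weak_pd e_t f gt" and d: "\<delta> > 0"
  shows "\<exists>F\<in>Csm. L2sq (\<lambda>p. f p - F p) < \<delta> \<and> L2sq (\<lambda>p. gs p - pdir e_s F p) < \<delta> \<and> L2sq (\<lambda>p. gt p - pdir e_t F p) < \<delta>"
proof -
  have gsL: "L2S gs" and gtL: "L2S gt" using gs gt by (simp_all add: weak_pd_def)
  obtain A where A: "lin_span phi A" "L2sq (\<lambda>p. f p - A p) < \<delta>" using phi_complete[OF f d] .
  obtain B where B: "lin_span psi B" "L2sq (\<lambda>p. gs p - B p) < \<delta>" using psi_complete[OF gsL d] .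
  obtain D where D: "lin_span chi D" "L2sq (\<lambda>p. gt p - D p) < \<delta>" using chi_complete[OF gtL d] .
  obtain IA a where IA: "finite IA" "A = (\<lambda>p. \<Sum>i\<in>IA. a i * phi i p)" using lin_span_sum[OF A(1)] by blast
  obtain IB b where IB: "finite IB" "B = (\<lambda>p. \<Sum>i\<in>IB. b i * psi i p)" using lin_span_sum[OF B(1)] by blast
  obtain ID c where ID: "finite ID" "D = (\<lambda>p. \<Sum>i\<in>ID. c i * chi i p)" using lin_span_sum[OF D(1)] by blast
  \<comment> \<open>A common index set for all three systems. Enlarging it does no harm, since the
    Fourier sum over \<open>I\<close> is at least as good as any combination supported in
    \<open>I\<close>.\<close>
  define I where "I = IA \<union> IB \<union> ID"
  have I: "finite I" unfolding I_def using IA(1) IB(1) ID(1) by simp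
  have pad: "(\<Sum>i\<in>J. u i * b i p) = (\<Sum>i\<in>I. (if i \<in> J then u i else 0) * b i p)"
    if "J \<subseteq> I" for J u and b :: "nat \<times> nat \<Rightarrow> real \<times> real \<Rightarrow> real" and p
    using that I by (intro sum.mono_neutral_cong_left) auto
  have sub: "IA \<subseteq> I" "IB \<subseteq> I" "ID \<subseteq> I" by (auto simp: I_def)
  define n where "n = (\<lambda>i::nat \<times> nat. nu (fst i) * nu (snd i))"
  have nu0: "nu m \<noteq> 0" for m by (simp add: nu_def)
  define F where "F = (\<lambda>p. \<Sum>i\<in>I. integral\<^sup>L muS (\<lambda>p. f p * phi i p) / n i * phi i p)"
  have F: "F \<in> Csm"
  proof -
    have "(\<lambda>p. \<Sum>i\<in>J. u i * phi i p) \<in> Csm" if "finite J" for J u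
      using that by (induction J rule: finite_induct) (auto intro!: Csm_add Csm_mult Csm_const Csm_basis)
    from this[OF I] show ?thesis unfolding F_def .
  qed
  have Fs: "pdir e_s F = (\<lambda>p. \<Sum>i\<in>I. integral\<^sup>L muS (\<lambda>p. gs p * psi i p) / n i * psi i p)"
    unfolding F_def pdir_sum[OF Csm_basis(1)] pdir_basis weak_pd_coefficient_s[OF f gs]
    by (intro ext sum.cong) (auto simp: mult_ac)
  have Ft: "pdir e_t F = (\<lambda>p. \<Sum>i\<in>I. integral\<^sup>L muS (\<lambda>p. gt p * chi i p) / n i * chi i p)"
    unfolding F_def pdir_sum[OF Csm_basis(1)] pdir_basis weak_pd_coefficient_t[OF f gt]
    by (intro ext sum.cong) (auto simp: mult_ac)
  have "L2sq (\<lambda>p. f p - F p) \<le> L2sq (\<lambda>p. f p - A p)"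
    unfolding F_def IA(2) pad[OF sub(1)]
    by (intro orthogonal_projection_le I f Csm_L2S Csm_basis) (auto simp: basis_orthogonal n_def nu0)
  moreover have "L2sq (\<lambda>p. gs p - pdir e_s F p) \<le> L2sq (\<lambda>p. gs p - B p)"
    unfolding Fs IB(2) pad[OF sub(2)]
    by (intro orthogonal_projection_le I gsL Csm_L2S Csm_basis)
      (auto simp: basis_orthogonal n_def nu0 weak_pd_coefficient_s[OF f gs])
  moreover have "L2sq (\<lambda>p. gt p - pdir e_t F p) \<le> L2sq (\<lambda>p. gt p - D p)"
    unfolding Ft ID(2) pad[OF sub(3)]
    by (intro orthogonal_projection_le I gtL Csm_L2S Csm_basis)
      (auto simp: basis_orthogonal n_def nu0 weak_pd_coefficient_t[OF f gt])
  ultimately show ?thesis using A(2) B(2) D(2) by (intro bexI[OF _ F]) linarith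
qed

text \<open>By truncation \<open>d\<close> is orthogonal to every cosine sum. If \<open>d\<close>
  were nonzero, completeness would give a cosine sum closer to \<open>d\<close> than 0 is, against
  Pythagoras.\<close>

lemma L2sq_0_if_tests_0:
  assumes d: "L2S d" and t: "\<And>\<phi>. test_fn \<phi> \<Longrightarrow> integral\<^sup>L muS (\<lambda>p. d p * \<phi> p) = 0"
  shows "L2sq d = 0"
proof (rule ccontr)
  assume "L2sq d \<noteq> 0"
  then have "L2sq d > 0" using L2sq_nonneg[of d] by linarith
  then obtain F where F: "lin_span phi F" "L2sq (\<lambda>p. d p - F p) < L2sq d" using phi_complete[OF d] by blast
  have FC: "F \<in> Csm" by (intro lin_span_Csm[OF F(1)] Csm_basis)
  have "(\<lambda>n::nat. 0) \<longlonglongrightarrow> integral\<^sup>L muS (\<lambda>p. d p * F p)"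
    using integral_trunc2_tendsto[OF d FC] t[OF test_fn_trunc2[OF FC]] by simp
  then have "integral\<^sup>L muS (\<lambda>p. d p * F p) = 0" using LIMSEQ_unique tendsto_const by blast
  then have "L2sq (\<lambda>p. d p + - F p) = L2sq d + L2sq (\<lambda>p. - F p)"
    by (intro L2sq_add_orthogonal d L2S_minus Csm_L2S FC) simp
  then show False using F(2) L2sq_nonneg[of "\<lambda>p. - F p"] by simp
qed

lemma weak_pd_unique:
  assumes "weak_pd e f g" "weak_pd e f h"
  shows "AE p in muS. g p = h p"
proof -
  have gh: "L2S g" "L2S h" using assms by (simp_all add: weak_pd_def)
  have "integral\<^sup>L muS (\<lambda>p. (g p - h p) * \<phi> p) = 0" if \<phi>: "test_fn \<phi>" for \<phi>
  proof -
    have "L2S \<phi>" using \<phi> unfolding test_fn_def smooth2_def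
      by (intro continuous_L2S) (metis continuous_on_subset iter_pd.simps(1) top_greatest)
    then have "integral\<^sup>L muS (\<lambda>p. g p * \<phi> p - h p * \<phi> p) = integral\<^sup>L muS (\<lambda>p. g p * \<phi> p) - integral\<^sup>L muS (\<lambda>p. h p * \<phi> p)"
      using gh by (intro Bochner_Integration.integral_diff L2S_mult_integrable)
    also have "\<dots> = 0" using assms \<phi> unfolding weak_pd_def LINT_muS by (metis add.inverse_inverse diff_self)
    finally show ?thesis by (simp add: left_diff_distrib)
  qed
  then have "L2sq (\<lambda>p. g p - h p) = 0" by (intro L2sq_0_if_tests_0 L2S_diff gh)
  from L2sq_0_AE[OF L2S_diff[OF gh] this] show ?thesis by eventually_elim simp
qed

section \<open>Classical derivatives as weak derivatives\<close>

definition lift :: "(real \<Rightarrow> real \<Rightarrow> real) \<Rightarrow> real \<times> real \<Rightarrow> real" where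
  "lift P p = P (fst p) (snd p + 1/2)"

lemma lift_continuous: "cont2 P \<Longrightarrow> continuous_on clS (lift P)"
proof -
  assume P: "cont2 P"
  have "continuous_on clS (\<lambda>p. (fst p, snd p + 1/2 :: real))" by (intro continuous_intros)
  moreover have "(\<lambda>p. (fst p, snd p + 1/2)) ` clS \<subseteq> usq" by (auto simp: clS_def usq_def)
  ultimately show ?thesis
    using continuous_on_compose2[OF P[unfolded cont2_def]] by (fastforce simp: lift_def[abs_def])
qed

lemma lift_L2S: "cont2 P \<Longrightarrow> L2S (lift P)"
  by (intro continuous_L2S lift_continuous)

lemma integral_lift: "cont2 P \<Longrightarrow> integral\<^sup>L muS (lift P) = int2 P"
  using integral_muS_int2[OF lift_continuous, of P] by (simp add: lift_def)

lemma L2sq_lift: "cont2 P \<Longrightarrow> L2sq (lift P) = int2 (\<lambda>x y. (P x y)\<^sup>2)"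
  using integral_lift[OF cont2_power, of P 2] by (simp add: L2sq_def lift_def[abs_def])

lemma lift_shift: "lift (\<lambda>x y. F (x, y - 1/2)) = F"
  by (simp add: lift_def fun_eq_iff)

lemma has_dx_pdir:
  assumes "\<And>p. f differentiable at p"
  shows "has_dx (\<lambda>x y. f (x, y - 1/2)) (\<lambda>x y. pdir e_s f (x, y - 1/2))"
  unfolding has_dx_def
proof (intro ballI)
  fix x y :: real
  have d: "(f has_derivative (\<lambda>h. pdir h f (x, y - 1/2))) (at (x, y - 1/2))"
    using assms by (simp add: pdir_def frechet_derivative_works)
  have "((\<lambda>x. (x, y - 1/2)) has_derivative (\<lambda>h. (h, 0))) (at x)"
    by (intro has_derivative_Pair has_derivative_ident has_derivative_const)
  from has_derivative_compose[OF this d]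
  have "((\<lambda>x. f (x, y - 1/2)) has_derivative (\<lambda>h. pdir (h, 0) f (x, y - 1/2))) (at x)" .
  moreover have "pdir (h, 0) f (x, y - 1/2) = pdir e_s f (x, y - 1/2) * h" for h
    using linear_scale[OF has_derivative_linear[OF d], of h "(1, 0)"] by (simp add: e_s_def mult.commute)
  ultimately show "((\<lambda>x. f (x, y - 1/2)) has_real_derivative pdir e_s f (x, y - 1/2)) (at x within {0..1})"
    by (simp add: has_field_derivative_def has_derivative_at_withinI)
qed

lemma has_dy_pdir:
  assumes "\<And>p. f differentiable at p"
  shows "has_dy (\<lambda>x y. f (x, y - 1/2)) (\<lambda>x y. pdir e_t f (x, y - 1/2))"
  unfolding has_dy_def
proof (intro ballI)
  fix x y :: real
  have d: "(f has_derivative (\<lambda>h. pdir h f (x, y - 1/2))) (at (x, y - 1/2))"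
    using assms by (simp add: pdir_def frechet_derivative_works)
  have "((\<lambda>y. (x, y - 1/2)) has_derivative (\<lambda>h. (0, h))) (at y)"
    by (auto intro!: derivative_eq_intros)
  from has_derivative_compose[OF this d]
  have "((\<lambda>y. f (x, y - 1/2)) has_derivative (\<lambda>h. pdir (0, h) f (x, y - 1/2))) (at y)" .
  moreover have "pdir (0, h) f (x, y - 1/2) = pdir e_t f (x, y - 1/2) * h" for h
    using linear_scale[OF has_derivative_linear[OF d], of h "(0, 1)"] by (simp add: e_t_def mult.commute)
  ultimately show "((\<lambda>y. f (x, y - 1/2)) has_real_derivative pdir e_t f (x, y - 1/2)) (at y within {0..1})"
    by (simp add: has_field_derivative_def has_derivative_at_withinI)
qed

text \<open>Makes the smooth approximants eligible for the estimates on the square; equality of the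
  mixed derivatives comes from the inductive construction of the class.\<close>

lemma Csm_C11sq:
  assumes F: "F \<in> Csm"
  shows "C11sq (\<lambda>x y. F (x, y - 1/2)) (\<lambda>x y. pdir e_s F (x, y - 1/2)) (\<lambda>x y. pdir e_t F (x, y - 1/2))
    (\<lambda>x y. pdir e_t (pdir e_s F) (x, y - 1/2))"
proof -
  note d = Csm_differentiable[OF F] Csm_differentiable[OF Csm_pdir[OF F]]
  have "has_dx (\<lambda>x y. pdir e_t F (x, y - 1/2)) (\<lambda>x y. pdir e_t (pdir e_s F) (x, y - 1/2))"
    using has_dx_pdir[OF d(2), of e_t] unfolding Csm_mixed[OF F] .
  then show ?thesis unfolding C11sq_def C1sq_def
    by (intro conjI cont2_shift Csm_continuous Csm_pdir F has_dx_pdir has_dy_pdir d)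
qed

lemma test_fn_props:
  assumes "test_fn \<phi>"
  shows "\<And>p. \<phi> differentiable at p" "continuous_on A \<phi>" "continuous_on A (pdir e \<phi>)" "\<And>p. p \<notin> stripS \<Longrightarrow> \<phi> p = 0"
proof -
  have s: "iter_pd es \<phi> differentiable_on UNIV \<and> continuous_on UNIV (iter_pd es \<phi>)" for es
    using assms by (simp add: test_fn_def smooth2_def)
  show "\<And>p. \<phi> differentiable at p" using s[of "[]"] unfolding differentiable_on_def by auto
  show "continuous_on A \<phi>" using s[of "[]"] continuous_on_subset by auto
  show "continuous_on A (pdir e \<phi>)" using s[of "[e]"] continuous_on_subset by auto
  show "\<phi> p = 0" if "p \<notin> stripS" for p
    using assms that closure_subset[of "{p. \<phi> p \<noteq> 0}"] by (auto simp: test_fn_def)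
qed

text \<open>A test function vanishes on the four sides, so integrating the derivative of the product
  over each line gives 0.\<close>

lemma weak_pd_lift:
  assumes P: "C1sq P Px Py"
  shows "weak_pd e_s (lift P) (lift Px)" "weak_pd e_t (lift P) (lift Py)"
proof -
  note c = C1sqD[OF P]
  {
    fix \<phi> assume \<phi>: "test_fn \<phi>"
    note t = test_fn_props[OF \<phi>]
    define Q where "Q = (\<lambda>x y. \<phi> (x, y - 1/2))"
    define Qs where "Qs = (\<lambda>x y. pdir e_s \<phi> (x, y - 1/2))"
    define Qt where "Qt = (\<lambda>x y. pdir e_t \<phi> (x, y - 1/2))"
    have Qc: "cont2 Q" "cont2 Qs" "cont2 Qt" unfolding Q_def Qs_def Qt_def by (intro cont2_shift t)+
    have Qd: "has_dx Q Qs" "has_dy Q Qt" unfolding Q_def Qs_def Qt_def by (intro has_dx_pdir has_dy_pdir t)+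
    have Q0: "Q 0 y = 0" "Q 1 y = 0" "Q x 0 = 0" "Q x 1 = 0" for x y
      unfolding Q_def by (intro t, auto simp: stripS_def)+
    have l: "lift Q = \<phi>" "lift Qs = pdir e_s \<phi>" "lift Qt = pdir e_t \<phi>"
      unfolding Q_def Qs_def Qt_def by (rule lift_shift)+
    have i: "integral\<^sup>L muS (\<lambda>p. lift A p * lift B p) = int2 (\<lambda>x y. A x y * B x y)" if "cont2 A" "cont2 B" for A B
      using integral_lift[OF cont2_mult[OF that]] by (simp add: lift_def[abs_def])
    have "int2 (\<lambda>x y. P x y * Qs x y + Px x y * Q x y) = integral {0..1} (\<lambda>y. integral {0..1} (\<lambda>x. P x y * Qs x y + Px x y * Q x y))"
      by (intro int2_iterated' cont2_intros c Qc)
    also have "\<dots> = integral {0..1::real} (\<lambda>y. 0)"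
    proof (rule integral_cong)
      fix y :: real assume y: "y \<in> {0..1}"
      have "((\<lambda>x. P x y * Qs x y + Px x y * Q x y) has_integral P 1 y * Q 1 y - P 0 y * Q 0 y) {0..1}"
        by (rule integral_deriv_01) (auto intro!: derivative_eq_intros has_dxD[OF c(4) _ y] has_dxD[OF Qd(1) _ y])
      then show "integral {0..1} (\<lambda>x. P x y * Qs x y + Px x y * Q x y) = 0" by (simp add: Q0 integral_unique)
    qed
    finally have "int2 (\<lambda>x y. P x y * Qs x y) = - int2 (\<lambda>x y. Px x y * Q x y)"
      using int2_add[OF cont2_mult[OF c(1) Qc(2)] cont2_mult[OF c(2) Qc(1)]] by simp
    then have 1: "integral\<^sup>L muS (\<lambda>p. lift P p * pdir e_s \<phi> p) = - integral\<^sup>L muS (\<lambda>p. lift Px p * \<phi> p)"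
      using i[OF c(1) Qc(2)] i[OF c(2) Qc(1)] unfolding l by simp
    have "int2 (\<lambda>x y. P x y * Qt x y + Py x y * Q x y) = integral {0..1} (\<lambda>x. integral {0..1} (\<lambda>y. P x y * Qt x y + Py x y * Q x y))"
      by (intro int2_iterated cont2_intros c Qc)
    also have "\<dots> = integral {0..1::real} (\<lambda>x. 0)"
    proof (rule integral_cong)
      fix x :: real assume x: "x \<in> {0..1}"
      have "((\<lambda>y. P x y * Qt x y + Py x y * Q x y) has_integral P x 1 * Q x 1 - P x 0 * Q x 0) {0..1}"
        by (rule integral_deriv_01) (auto intro!: derivative_eq_intros has_dyD[OF c(5) x] has_dyD[OF Qd(2) x])
      then show "integral {0..1} (\<lambda>y. P x y * Qt x y + Py x y * Q x y) = 0" by (simp add: Q0 integral_unique)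
    qed
    finally have "int2 (\<lambda>x y. P x y * Qt x y) = - int2 (\<lambda>x y. Py x y * Q x y)"
      using int2_add[OF cont2_mult[OF c(1) Qc(3)] cont2_mult[OF c(3) Qc(1)]] by simp
    then have 2: "integral\<^sup>L muS (\<lambda>p. lift P p * pdir e_t \<phi> p) = - integral\<^sup>L muS (\<lambda>p. lift Py p * \<phi> p)"
      using i[OF c(1) Qc(3)] i[OF c(3) Qc(1)] unfolding l by simp
    note 1 2
  }
  then show "weak_pd e_s (lift P) (lift Px)" "weak_pd e_t (lift P) (lift Py)"
    unfolding weak_pd_def LINT_muS using lift_L2S[OF c(2)] lift_L2S[OF c(3)] by blast+
qed

section \<open>The Sobolev inner product\<close>

lemma W12sD:
  assumes "W12s f"
  shows "L2S f" "weak_pd e_s f (wd_s f)" "weak_pd e_t f (wd_t f)" "L2S (wd_s f)" "L2S (wd_t f)"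
proof -
  show "L2S f" using assms by (simp add: W12s_def)
  show s: "weak_pd e_s f (wd_s f)" using assms someI_ex[of "weak_pd e_s f"] unfolding W12s_def wd_s_def by blast
  show t: "weak_pd e_t f (wd_t f)" using assms someI_ex[of "weak_pd e_t f"] unfolding W12s_def wd_t_def by blast
  show "L2S (wd_s f)" "L2S (wd_t f)" using s t by (simp_all add: weak_pd_def)
qed

lemma W12sI: "L2S f \<Longrightarrow> weak_pd e_s f g \<Longrightarrow> weak_pd e_t f h \<Longrightarrow> W12s f"
  by (auto simp: W12s_def)

text \<open>\<open>wd_s\<close> and \<open>wd_t\<close> are arbitrary choices; uniqueness identifies
  them with any known weak derivative up to a null set. Hence all later linearity statements hold
  only almost everywhere.\<close>

lemma wd_AE:
  assumes "L2S f" "weak_pd e_s f g" "weak_pd e_t f h"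
  shows "AE p in muS. wd_s f p = g p" "AE p in muS. wd_t f p = h p"
  using W12sD[OF W12sI[OF assms]] assms weak_pd_unique by blast+

lemma weak_pd_lincomb:
  assumes "L2S f" "L2S f'" "weak_pd e f g" "weak_pd e f' g'"
  shows "weak_pd e (\<lambda>p. f p + c * f' p) (\<lambda>p. g p + c * g' p)"
  unfolding weak_pd_def LINT_muS
proof (intro conjI allI impI)
  have g: "L2S g" "L2S g'" using assms by (simp_all add: weak_pd_def)
  show "L2S (\<lambda>p. g p + c * g' p)" by (intro L2S_add L2S_cmult g)
  fix \<phi> assume \<phi>: "test_fn \<phi>"
  have pL: "L2S \<phi>" "L2S (pdir e \<phi>)" by (intro continuous_L2S test_fn_props[OF \<phi>])+
  have sp: "integral\<^sup>L muS (\<lambda>p. (u p + c * u' p) * w p) = integral\<^sup>L muS (\<lambda>p. u p * w p) + c * integral\<^sup>L muS (\<lambda>p. u' p * w p)"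
    if "L2S u" "L2S u'" "L2S w" for u u' w
    using L2S_mult_integrable[OF that(1,3)] L2S_mult_integrable[OF that(2,3)] by (simp add: distrib_right mult.assoc)
  have "integral\<^sup>L muS (\<lambda>p. f p * pdir e \<phi> p) = - integral\<^sup>L muS (\<lambda>p. g p * \<phi> p)"
    "integral\<^sup>L muS (\<lambda>p. f' p * pdir e \<phi> p) = - integral\<^sup>L muS (\<lambda>p. g' p * \<phi> p)"
    using assms(3,4) \<phi> by (simp_all add: weak_pd_def LINT_muS)
  then show "integral\<^sup>L muS (\<lambda>p. (f p + c * f' p) * pdir e \<phi> p) = - integral\<^sup>L muS (\<lambda>p. (g p + c * g' p) * \<phi> p)"
    unfolding sp[OF assms(1,2) pL(2)] sp[OF g pL(1)] by simp
qed

lemma W12s_lincomb: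
  assumes "W12s f" "W12s f'"
  shows "W12s (\<lambda>p. f p + c * f' p)"
    "AE p in muS. wd_s (\<lambda>p. f p + c * f' p) p = wd_s f p + c * wd_s f' p"
    "AE p in muS. wd_t (\<lambda>p. f p + c * f' p) p = wd_t f p + c * wd_t f' p"
proof -
  note f = W12sD[OF assms(1)] and f' = W12sD[OF assms(2)]
  have L: "L2S (\<lambda>p. f p + c * f' p)" by (intro L2S_add L2S_cmult f f')
  note w = weak_pd_lincomb[OF f(1) f'(1) f(2) f'(2), of c] weak_pd_lincomb[OF f(1) f'(1) f(3) f'(3), of c]
  show "W12s (\<lambda>p. f p + c * f' p)" by (rule W12sI[OF L w])
  show "AE p in muS. wd_s (\<lambda>p. f p + c * f' p) p = wd_s f p + c * wd_s f' p"
    "AE p in muS. wd_t (\<lambda>p. f p + c * f' p) p = wd_t f p + c * wd_t f' p"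
    by (rule wd_AE[OF L w])+
qed

lemma W12s_lift:
  assumes "C1sq P Px Py"
  shows "W12s (lift P)" "AE p in muS. wd_s (lift P) p = lift Px p" "AE p in muS. wd_t (lift P) p = lift Py p"
  using W12sI[OF lift_L2S weak_pd_lift[OF assms]] wd_AE[OF lift_L2S weak_pd_lift[OF assms]] C1sqD(1)[OF assms] by auto

definition ip :: "(real \<times> real \<Rightarrow> real) \<Rightarrow> (real \<times> real \<Rightarrow> real) \<Rightarrow> real" where
  "ip f g = integral\<^sup>L muS (\<lambda>p. f p * g p + wd_s f p * wd_s g p + wd_t f p * wd_t g p)"

lemma ip_integrable:
  assumes "W12s f" "W12s g"
  shows "integrable muS (\<lambda>p. f p * g p + wd_s f p * wd_s g p + wd_t f p * wd_t g p)"
  by (intro Bochner_Integration.integrable_add L2S_mult_integrable W12sD[OF assms(1)] W12sD[OF assms(2)])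

lemma ip_sym: "ip f g = ip g f"
  by (simp add: ip_def mult.commute)

lemma ip_lincomb:
  assumes "W12s f" "W12s f'" "W12s g"
  shows "ip (\<lambda>p. f p + c * f' p) g = ip f g + c * ip f' g"
proof -
  note l = W12s_lincomb[OF assms(1,2), of c]
  have "ip (\<lambda>p. f p + c * f' p) g = integral\<^sup>L muS (\<lambda>p. (f p * g p + wd_s f p * wd_s g p + wd_t f p * wd_t g p)
      + c * (f' p * g p + wd_s f' p * wd_s g p + wd_t f' p * wd_t g p))"
    unfolding ip_def
  proof (rule integral_cong_AE)
    show "(\<lambda>p. (f p + c * f' p) * g p + wd_s (\<lambda>p. f p + c * f' p) p * wd_s g p + wd_t (\<lambda>p. f p + c * f' p) p * wd_t g p)
        \<in> borel_measurable muS"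
      by (intro borel_measurable_integrable ip_integrable l assms)
    show "(\<lambda>p. (f p * g p + wd_s f p * wd_s g p + wd_t f p * wd_t g p)
      + c * (f' p * g p + wd_s f' p * wd_s g p + wd_t f' p * wd_t g p)) \<in> borel_measurable muS"
      by (intro borel_measurable_integrable Bochner_Integration.integrable_add integrable_mult_right ip_integrable assms)
    show "AE p in muS. (f p + c * f' p) * g p + wd_s (\<lambda>p. f p + c * f' p) p * wd_s g p + wd_t (\<lambda>p. f p + c * f' p) p * wd_t g p
      = (f p * g p + wd_s f p * wd_s g p + wd_t f p * wd_t g p) + c * (f' p * g p + wd_s f' p * wd_s g p + wd_t f' p * wd_t g p)"
      using l(2,3) by eventually_elim (simp add: algebra_simps)
  qed
  also have "\<dots> = ip f g + c * ip f' g"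
    unfolding ip_def using ip_integrable[OF assms(1,3)] ip_integrable[OF assms(2,3)] by simp
  finally show ?thesis .
qed

lemma ip_self:
  assumes "W12s f"
  shows "ip f f = L2sq f + L2sq (wd_s f) + L2sq (wd_t f)"
  using L2S_sq[OF W12sD(1)[OF assms]] L2S_sq[OF W12sD(4)[OF assms]] L2S_sq[OF W12sD(5)[OF assms]]
  by (simp add: ip_def L2sq_def power2_eq_square)

lemma L2sq_cong_AE:
  assumes "AE p in muS. f p = g p" "L2S f" "L2S g"
  shows "L2sq f = L2sq g"
  unfolding L2sq_def using assms(1) borel_measurable_integrable[OF L2S_sq[OF assms(2)]] borel_measurable_integrable[OF L2S_sq[OF assms(3)]]
  by (intro integral_cong_AE) (auto elim!: eventually_mono)

lemma ip_self_eq: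
  assumes "L2S f" "weak_pd e_s f g" "weak_pd e_t f h"
  shows "ip f f = L2sq f + L2sq g + L2sq h"
proof -
  note w = W12sI[OF assms]
  have "L2S g" "L2S h" using assms by (simp_all add: weak_pd_def)
  then have "L2sq (wd_s f) = L2sq g" "L2sq (wd_t f) = L2sq h"
    using wd_AE[OF assms] W12sD[OF w] by (auto intro!: L2sq_cong_AE)
  then show ?thesis using ip_self[OF w] by simp
qed

text \<open>The form is only semidefinite on functions, as null sets are not factored out. This
  replaces the Cauchy-Schwarz inequality wherever a difference of norm zero has to be
  neglected.\<close>

lemma ip_zero:
  assumes "W12s f" "W12s g" "ip f f = 0"
  shows "ip f g = 0"
proof -
  note f = W12sD[OF assms(1)] and g = W12sD[OF assms(2)]
  have "L2sq f = 0" "L2sq (wd_s f) = 0" "L2sq (wd_t f) = 0"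
    using assms(3) ip_self[OF assms(1)] L2sq_nonneg[of f] L2sq_nonneg[of "wd_s f"] L2sq_nonneg[of "wd_t f"] by linarith+
  then have "AE p in muS. f p = 0" "AE p in muS. wd_s f p = 0" "AE p in muS. wd_t f p = 0"
    using f by (auto intro: L2sq_0_AE)
  then have "AE p in muS. f p * g p + wd_s f p * wd_s g p + wd_t f p * wd_t g p = 0"
    by eventually_elim simp
  then have "ip f g = integral\<^sup>L muS (\<lambda>p. 0)"
    unfolding ip_def by (intro integral_cong_AE borel_measurable_integrable ip_integrable assms) auto
  then show ?thesis by simp
qed

section \<open>The scalar product of vector fields\<close>

abbreviation comp1 :: "(real \<times> real \<Rightarrow> real \<times> real) \<Rightarrow> real \<times> real \<Rightarrow> real" where "comp1 v \<equiv> \<lambda>p. fst (v p)"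
abbreviation comp2 :: "(real \<times> real \<Rightarrow> real \<times> real) \<Rightarrow> real \<times> real \<Rightarrow> real" where "comp2 v \<equiv> \<lambda>p. snd (v p)"

lemma W12_inner_ip: "W12_inner v w = ip (comp1 v) (comp1 w) + ip (comp2 v) (comp2 w)"
proof -
  \<comment> \<open>The definition sums over the set of the two projections, which has two elements
    only if they differ.\<close>
  have "(fst :: real \<times> real \<Rightarrow> real) \<noteq> snd" by (metis fst_conv snd_conv zero_neq_one)
  then show ?thesis by (simp add: W12_inner_def ip_def LINT_muS)
qed

lemma W12D: "v \<in> W12 \<Longrightarrow> W12s (comp1 v)" "v \<in> W12 \<Longrightarrow> W12s (comp2 v)"
  by (auto simp: W12_def)

lemma W12_lincomb: "v \<in> W12 \<Longrightarrow> w \<in> W12 \<Longrightarrow> (\<lambda>p. v p + c *\<^sub>R w p) \<in> W12"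
  by (auto simp: W12_def intro: W12s_lincomb)

lemma W12_inner_lincomb:
  "v \<in> W12 \<Longrightarrow> w \<in> W12 \<Longrightarrow> u \<in> W12 \<Longrightarrow> W12_inner (\<lambda>p. v p + c *\<^sub>R w p) u = W12_inner v u + c * W12_inner w u"
  unfolding W12_inner_ip by (simp add: ip_lincomb W12D algebra_simps)

lemma W12_inner_sym: "W12_inner v w = W12_inner w v"
  unfolding W12_inner_ip by (simp add: ip_sym)

lemma W12_inner_lincomb':
  "v \<in> W12 \<Longrightarrow> w \<in> W12 \<Longrightarrow> u \<in> W12 \<Longrightarrow> W12_inner u (\<lambda>p. v p + c *\<^sub>R w p) = W12_inner u v + c * W12_inner u w"
  using W12_inner_lincomb[of v w u c] by (simp add: W12_inner_sym)

lemma W12_diff: "v \<in> W12 \<Longrightarrow> w \<in> W12 \<Longrightarrow> (\<lambda>p. v p - w p) \<in> W12"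
  using W12_lincomb[of v w "-1"] by simp

lemma W12_inner_diff:
  "v \<in> W12 \<Longrightarrow> w \<in> W12 \<Longrightarrow> u \<in> W12 \<Longrightarrow> W12_inner (\<lambda>p. v p - w p) u = W12_inner v u - W12_inner w u"
  "v \<in> W12 \<Longrightarrow> w \<in> W12 \<Longrightarrow> u \<in> W12 \<Longrightarrow> W12_inner u (\<lambda>p. v p - w p) = W12_inner u v - W12_inner u w"
  using W12_inner_lincomb[of v w u "-1"] W12_inner_lincomb'[of v w u "-1"] by simp_all

lemma ip_self_nonneg: "W12s f \<Longrightarrow> ip f f \<ge> 0"
  by (simp add: ip_self L2sq_nonneg)

lemma W12_inner_nonneg: "v \<in> W12 \<Longrightarrow> W12_inner v v \<ge> 0"
  unfolding W12_inner_ip by (intro add_nonneg_nonneg ip_self_nonneg W12D)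

lemma W12_inner_zero:
  assumes "v \<in> W12" "w \<in> W12" "W12_inner v v = 0"
  shows "W12_inner v w = 0"
proof -
  have "ip (comp1 v) (comp1 v) = 0" "ip (comp2 v) (comp2 v) = 0"
    using assms(3) ip_self_nonneg[OF W12D(1)[OF assms(1)]] ip_self_nonneg[OF W12D(2)[OF assms(1)]]
    unfolding W12_inner_ip by linarith+
  then show ?thesis unfolding W12_inner_ip using assms by (simp add: ip_zero W12D)
qed

text \<open>\<open>v - u\<close> is the orthogonal sum of \<open>v - w\<close> and
  \<open>w - u\<close>. The hypotheses mention only \<open>w\<close> and the competitor
  \<open>u\<close>, so the lemma serves both for rigid motions and for \<open>Meps\<close>.\<close>

lemma W12_pythagoras:
  assumes "v \<in> W12" "w \<in> W12" "u \<in> W12"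
    and "W12_inner (\<lambda>p. v p - w p) w = 0" "W12_inner (\<lambda>p. v p - w p) u = 0"
  shows "W12_inner (\<lambda>p. v p - w p) (\<lambda>p. v p - w p) \<le> W12_inner (\<lambda>p. v p - u p) (\<lambda>p. v p - u p)"
proof -
  define a where "a = (\<lambda>p. v p - w p)"
  define b where "b = (\<lambda>p. w p - u p)"
  have ab: "a \<in> W12" "b \<in> W12" unfolding a_def b_def by (intro W12_diff assms)+
  have 0: "W12_inner a b = 0" unfolding b_def
    using W12_inner_diff(2)[OF assms(2,3) ab(1)] assms(4,5) by (simp add: a_def)
  have sum: "(\<lambda>p. v p - u p) = (\<lambda>p. a p + 1 *\<^sub>R b p)" by (simp add: a_def b_def)
  have c: "(\<lambda>p. a p + 1 *\<^sub>R b p) \<in> W12" by (intro W12_lincomb ab)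
  have "W12_inner (\<lambda>p. a p + 1 *\<^sub>R b p) (\<lambda>p. a p + 1 *\<^sub>R b p) = W12_inner a a + W12_inner b b"
    unfolding W12_inner_lincomb[OF ab c] W12_inner_lincomb'[OF ab ab(1)] W12_inner_lincomb'[OF ab ab(2)]
    using 0 W12_inner_sym[of b a] by simp
  then show ?thesis unfolding sum using W12_inner_nonneg[OF ab(2)] by (simp add: a_def)
qed

section \<open>Rigid motions of the curved strip\<close>

context planar_curve
begin

section \<open>The strain of weak derivatives\<close>

definition e11 where "e11 \<epsilon> p a1 a2 = (T2 (fst p) * a1 + T3 (fst p) * a2) / metr \<epsilon> (fst p) (snd p + 1/2)"
definition e22 where "e22 \<epsilon> p b1 b2 = (- T3 (fst p) * b1 + T2 (fst p) * b2) / \<epsilon>"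
definition e12 where "e12 \<epsilon> p a1 a2 b1 b2 = ((- T3 (fst p) * a1 + T2 (fst p) * a2) / metr \<epsilon> (fst p) (snd p + 1/2)
  + (T2 (fst p) * b1 + T3 (fst p) * b2) / \<epsilon>) / 2"

definition edens :: "real \<Rightarrow> real \<times> real \<Rightarrow> real \<Rightarrow> real \<Rightarrow> real \<Rightarrow> real \<Rightarrow> real" where
  "edens \<epsilon> p a1 a2 b1 b2 = (e11 \<epsilon> p a1 a2)\<^sup>2 + (e22 \<epsilon> p b1 b2)\<^sup>2 + 2 * (e12 \<epsilon> p a1 a2 b1 b2)\<^sup>2"

definition energy :: "real \<Rightarrow> (real \<times> real \<Rightarrow> real \<times> real) \<Rightarrow> real" where
  "energy \<epsilon> v = integral\<^sup>L muS (\<lambda>p. edens \<epsilon> p (wd_s (comp1 v) p) (wd_s (comp2 v) p) (wd_t (comp1 v) p) (wd_t (comp2 v) p))"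

text \<open>The Frobenius norm of a symmetric part does not depend on the orthonormal basis. For the
  frame (x, y), (-y, x) both sides are homogeneous of degree two in (x, y), which makes it a
  polynomial identity.\<close>

lemma frobenius_rotation:
  fixes a b c d x y :: real
  shows "(a * x + c * - y)\<^sup>2 + ((a * y + c * x + (b * x + d * - y)) / 2)\<^sup>2
      + (((b * x + d * - y + (a * y + c * x)) / 2)\<^sup>2 + (b * y + d * x)\<^sup>2)
    = (x * a + y * b)\<^sup>2 + (- y * c + x * d)\<^sup>2 + 2 * ((- y * a + x * b + (x * c + y * d)) / 2)\<^sup>2"
proof -
  define S where "S = a * y + c * x + (b * x + d * - y)"
  define T where "T = - y * a + x * b + (x * c + y * d)"
  have "2 * (a * x + c * - y)\<^sup>2 + S\<^sup>2 + 2 * (b * y + d * x)\<^sup>2 = 2 * (x * a + y * b)\<^sup>2 + 2 * (- y * c + x * d)\<^sup>2 + T\<^sup>2"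
    unfolding S_def T_def by (simp add: power2_eq_square algebra_simps)
  then show ?thesis unfolding T_def[symmetric] S_def[symmetric] add.commute[of "b * x + d * - y"]
    by (simp add: power_divide)
qed

lemma symGradRT_sq_sum:
  assumes e: "thin \<epsilon>" and p: "p \<in> stripS"
  shows "(\<Sum>i\<in>{1::nat,2}. \<Sum>j\<in>{1::nat,2}. (symGradRT T2 T3 k \<epsilon> v p i j)\<^sup>2)
    = edens \<epsilon> p (wd_s (comp1 v) p) (wd_s (comp2 v) p) (wd_t (comp1 v) p) (wd_t (comp2 v) p)"
proof -
  have x: "fst p \<in> {0..1}" "snd p + 1/2 \<in> {0..1}" using p by (auto simp: stripS_def)
  define g where "g = metr \<epsilon> (fst p) (snd p + 1/2)"
  have g: "1 - \<epsilon> * snd p * k (fst p) = g" by (simp add: g_def metr_def)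
  define a where "a = wd_s (comp1 v) p / g"
  define b where "b = wd_s (comp2 v) p / g"
  define c where "c = wd_t (comp1 v) p / \<epsilon>"
  define d where "d = wd_t (comp2 v) p / \<epsilon>"
  define x where "x = T2 (fst p)"
  define y where "y = T3 (fst p)"
  have "(\<Sum>i\<in>{1::nat,2}. \<Sum>j\<in>{1::nat,2}. (symGradRT T2 T3 k \<epsilon> v p i j)\<^sup>2)
    = (a * x + c * - y)\<^sup>2 + ((a * y + c * x + (b * x + d * - y)) / 2)\<^sup>2
      + (((b * x + d * - y + (a * y + c * x)) / 2)\<^sup>2 + (b * y + d * x)\<^sup>2)"
  proof -
    have G: "gradRT T2 T3 k \<epsilon> v p 1 1 = a * x + c * - y" "gradRT T2 T3 k \<epsilon> v p 1 2 = a * y + c * x"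
      "gradRT T2 T3 k \<epsilon> v p 2 1 = b * x + d * - y" "gradRT T2 T3 k \<epsilon> v p 2 2 = b * y + d * x"
      by (simp_all add: gradRT_def Let_def g a_def b_def c_def d_def x_def y_def)
    have h: "(z + z) / 2 = z" for z :: real by simp
    have "(\<Sum>i\<in>{1::nat,2}. \<Sum>j\<in>{1::nat,2}. f i j) = f 1 1 + f 1 2 + (f 2 1 + f 2 2)" for f :: "nat \<Rightarrow> nat \<Rightarrow> real"
      by simp
    from this[of "\<lambda>i j. (symGradRT T2 T3 k \<epsilon> v p i j)\<^sup>2"] show ?thesis unfolding symGradRT_def G h .
  qed
  also note frobenius_rotation
  also have "(x * a + y * b)\<^sup>2 + (- y * c + x * d)\<^sup>2 + 2 * ((- y * a + x * b + (x * c + y * d)) / 2)\<^sup>2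
    = edens \<epsilon> p (wd_s (comp1 v) p) (wd_s (comp2 v) p) (wd_t (comp1 v) p) (wd_t (comp2 v) p)"
    unfolding edens_def e11_def e22_def e12_def g_def[symmetric] x_def[symmetric] y_def[symmetric]
    by (simp add: a_def b_def c_def d_def add_divide_distrib diff_divide_distrib)
  finally show ?thesis .
qed

lemma symL2_energy: "thin \<epsilon> \<Longrightarrow> symL2 T2 T3 k \<epsilon> v = sqrt (energy \<epsilon> v)"
  unfolding symL2_def energy_def LINT_muS
  by (intro arg_cong[where f=sqrt] Bochner_Integration.integral_cong refl symGradRT_sq_sum) auto

lemma e_L2S:
  assumes e: "thin \<epsilon>" and L: "L2S a1" "L2S a2" "L2S b1" "L2S b2"
  shows "L2S (\<lambda>p. e11 \<epsilon> p (a1 p) (a2 p))" "L2S (\<lambda>p. e22 \<epsilon> p (b1 p) (b2 p))"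
    "L2S (\<lambda>p. e12 \<epsilon> p (a1 p) (a2 p) (b1 p) (b2 p))"
proof -
  have m: "L2S (\<lambda>p. lift P p * f p)" if P: "cont2 P" "L2S f" for P f
  proof -
    obtain B where "\<And>p. p \<in> clS \<Longrightarrow> \<bar>lift P p\<bar> \<le> B" using continuous_clS_bounded[OF lift_continuous[OF P(1)]] by blast
    then show ?thesis
      using stripS_subset_clS by (intro L2S_bounded_mult P continuous_clS_measurable lift_continuous) blast
  qed
  have g: "metr \<epsilon> x y \<noteq> 0" if "x \<in> {0..1}" "y \<in> {0..1}" for x y
    using metr_bounds[OF e that] by linarith
  have e0: "\<epsilon> \<noteq> 0" using e by (simp add: thin_def)
  note Tc = cont2_x[OF T_cont(1)] cont2_x[OF T_cont(2)]
  have c: "cont2 (\<lambda>x y. T2 x / metr \<epsilon> x y)" "cont2 (\<lambda>x y. T3 x / metr \<epsilon> x y)" "cont2 (\<lambda>x y. T2 x / \<epsilon>)" "cont2 (\<lambda>x y. T3 x / \<epsilon>)"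
    using g e0 by (intro cont2_divide Tc metr_cont cont2_const; simp)+
  have "L2S (\<lambda>p. lift (\<lambda>x y. T2 x / metr \<epsilon> x y) p * a1 p + lift (\<lambda>x y. T3 x / metr \<epsilon> x y) p * a2 p)"
    by (intro L2S_add m c L)
  then show "L2S (\<lambda>p. e11 \<epsilon> p (a1 p) (a2 p))" by (simp add: e11_def lift_def add_divide_distrib)
  have "L2S (\<lambda>p. lift (\<lambda>x y. T2 x / \<epsilon>) p * b2 p - lift (\<lambda>x y. T3 x / \<epsilon>) p * b1 p)"
    by (intro L2S_diff m c L)
  then show "L2S (\<lambda>p. e22 \<epsilon> p (b1 p) (b2 p))" by (simp add: e22_def lift_def diff_divide_distrib)
  have "L2S (\<lambda>p. (1/2) * ((lift (\<lambda>x y. T2 x / metr \<epsilon> x y) p * a2 p - lift (\<lambda>x y. T3 x / metr \<epsilon> x y) p * a1 p)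
     + (lift (\<lambda>x y. T2 x / \<epsilon>) p * b1 p + lift (\<lambda>x y. T3 x / \<epsilon>) p * b2 p)))"
    by (intro L2S_diff L2S_add L2S_cmult m c L)
  then show "L2S (\<lambda>p. e12 \<epsilon> p (a1 p) (a2 p) (b1 p) (b2 p))"
    by (simp add: e12_def lift_def diff_divide_distrib add_divide_distrib)
qed

lemma edens_integrable:
  assumes e: "thin \<epsilon>" and L: "L2S a1" "L2S a2" "L2S b1" "L2S b2"
  shows "integrable muS (\<lambda>p. edens \<epsilon> p (a1 p) (a2 p) (b1 p) (b2 p))"
  unfolding edens_def
  by (intro Bochner_Integration.integrable_add integrable_mult_right L2S_sq e_L2S[OF e L])

lemma edens_add_le:
  "edens \<epsilon> p (a1 + a1') (a2 + a2') (b1 + b1') (b2 + b2') \<le> 2 * edens \<epsilon> p a1 a2 b1 b2 + 2 * edens \<epsilon> p a1' a2' b1' b2'"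
proof -
  have "e11 \<epsilon> p (a1 + a1') (a2 + a2') = e11 \<epsilon> p a1 a2 + e11 \<epsilon> p a1' a2'"
    "e22 \<epsilon> p (b1 + b1') (b2 + b2') = e22 \<epsilon> p b1 b2 + e22 \<epsilon> p b1' b2'"
    "e12 \<epsilon> p (a1 + a1') (a2 + a2') (b1 + b1') (b2 + b2') = e12 \<epsilon> p a1 a2 b1 b2 + e12 \<epsilon> p a1' a2' b1' b2'"
    by (simp_all add: e11_def e22_def e12_def algebra_simps add_divide_distrib diff_divide_distrib)
  then show ?thesis
    using sq_add_le[of "e11 \<epsilon> p a1 a2" "e11 \<epsilon> p a1' a2'"] sq_add_le[of "e22 \<epsilon> p b1 b2" "e22 \<epsilon> p b1' b2'"]
      sq_add_le[of "e12 \<epsilon> p a1 a2 b1 b2" "e12 \<epsilon> p a1' a2' b1' b2'"]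
    unfolding edens_def by simp
qed

text \<open>A crude bound, applied only to the error of a smooth approximation. Its dependence on
  \<epsilon> does not reach the final constant because the accuracy is chosen after
  \<epsilon>.\<close>

lemma edens_le:
  assumes e: "thin \<epsilon>" and p: "p \<in> stripS"
  shows "edens \<epsilon> p a1 a2 b1 b2 \<le> 8 / \<epsilon>\<^sup>2 * (a1\<^sup>2 + a2\<^sup>2 + b1\<^sup>2 + b2\<^sup>2)"
proof -
  have x: "fst p \<in> {0..1}" "snd p + 1/2 \<in> {0..1}" using p by (auto simp: stripS_def)
  define g where "g = metr \<epsilon> (fst p) (snd p + 1/2)"
  have g: "g \<ge> 1/2" unfolding g_def by (rule metr_bounds[OF e x])
  have e0: "0 < \<epsilon>" "\<epsilon> \<le> 1" using e by (auto simp: thin_def)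
  define x where "x = T2 (fst p)"
  define y where "y = T3 (fst p)"
  have u: "x\<^sup>2 + y\<^sup>2 = 1" unfolding x_def y_def by (rule unit) fact
  have cs: "(x * q + y * r)\<^sup>2 \<le> q\<^sup>2 + r\<^sup>2" "(- y * q + x * r)\<^sup>2 \<le> q\<^sup>2 + r\<^sup>2" for q r
  proof -
    have "(x * q + y * r)\<^sup>2 + (- y * q + x * r)\<^sup>2 = q\<^sup>2 + r\<^sup>2" using u by algebra
    then show "(x * q + y * r)\<^sup>2 \<le> q\<^sup>2 + r\<^sup>2" "(- y * q + x * r)\<^sup>2 \<le> q\<^sup>2 + r\<^sup>2"
      using zero_le_power2[of "x * q + y * r"] zero_le_power2[of "- y * q + x * r"] by linarith+
  qed
  define A where "A = a1\<^sup>2 + a2\<^sup>2"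
  define B where "B = (b1\<^sup>2 + b2\<^sup>2) / \<epsilon>\<^sup>2"
  have dg: "(z / g)\<^sup>2 \<le> 4 * A" if "z\<^sup>2 \<le> A" for z
  proof -
    have "g\<^sup>2 \<ge> (1/2)\<^sup>2" using g by (intro power_mono) auto
    then have "z\<^sup>2 * 1 \<le> A * (4 * g\<^sup>2)" using that by (intro mult_mono) (auto simp: A_def power_divide)
    then show ?thesis using g by (simp add: power_divide divide_le_eq algebra_simps)
  qed
  have de: "(z / \<epsilon>)\<^sup>2 \<le> B" if "z\<^sup>2 \<le> b1\<^sup>2 + b2\<^sup>2" for z
    using that e0 by (simp add: B_def power_divide divide_right_mono)
  have 1: "(e11 \<epsilon> p a1 a2)\<^sup>2 \<le> 4 * A" "(e22 \<epsilon> p b1 b2)\<^sup>2 \<le> B"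
    unfolding e11_def e22_def g_def[symmetric] x_def[symmetric] y_def[symmetric]
    by (intro dg de; simp only: A_def cs)+
  have "2 * (e12 \<epsilon> p a1 a2 b1 b2)\<^sup>2 = ((- y * a1 + x * a2) / g + (x * b1 + y * b2) / \<epsilon>)\<^sup>2 / 2"
    unfolding e12_def g_def[symmetric] x_def[symmetric] y_def[symmetric] by (simp add: power_divide)
  also have "\<dots> \<le> ((- y * a1 + x * a2) / g)\<^sup>2 + ((x * b1 + y * b2) / \<epsilon>)\<^sup>2"
    using sq_add_le[of "(- y * a1 + x * a2) / g" "(x * b1 + y * b2) / \<epsilon>"] by linarith
  also have "\<dots> \<le> 4 * A + B" by (intro add_mono dg de; simp only: A_def cs)
  finally have "edens \<epsilon> p a1 a2 b1 b2 \<le> 8 * A + 2 * B" using 1 unfolding edens_def by linarith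
  also have "\<dots> \<le> 8 / \<epsilon>\<^sup>2 * (a1\<^sup>2 + a2\<^sup>2 + b1\<^sup>2 + b2\<^sup>2)"
  proof -
    have "A \<le> A / \<epsilon>\<^sup>2" using e0 by (simp add: A_def pos_le_divide_eq mult_left_le power_le_one)
    moreover have "B \<ge> 0" by (simp add: B_def)
    ultimately have "8 * A + 2 * B \<le> 8 * (A / \<epsilon>\<^sup>2) + 8 * B" by linarith
    also have "\<dots> = 8 / \<epsilon>\<^sup>2 * (a1\<^sup>2 + a2\<^sup>2 + b1\<^sup>2 + b2\<^sup>2)" by (simp add: A_def B_def add_divide_distrib algebra_simps)
    finally show ?thesis .
  qed
  finally show ?thesis .
qed

lemma strain_energy_edens:
  assumes e: "thin \<epsilon>" and c: "cont2 px" "cont2 py" "cont2 qx" "cont2 qy"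
  shows "strain_energy \<epsilon> px py qx qy = integral\<^sup>L muS (\<lambda>p. edens \<epsilon> p (lift px p) (lift qx p) (lift py p) (lift qy p))"
proof -
  have "cont2 (\<lambda>x y. (strain11 \<epsilon> px qx x y)\<^sup>2 + (strain22 \<epsilon> py qy x y)\<^sup>2 + 2 * (strain12 \<epsilon> px py qx qy x y)\<^sup>2)"
    by (intro cont2_intros strain_cont[OF e c])
  from integral_lift[OF this] show ?thesis
    unfolding strain_energy_def lift_def[abs_def] edens_def e11_def e22_def e12_def strain11_def strain22_def strain12_def
    by simp
qed

text \<open>The three-parameter family of infinitesimal rigid motions of the curved strip:
  \<open>c\<close> times the quarter turn plus the translation (l, m).\<close>

definition rig :: "real \<Rightarrow> real \<Rightarrow> real \<Rightarrow> real \<Rightarrow> real \<times> real \<Rightarrow> real \<times> real" where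
  "rig \<epsilon> c l m = (\<lambda>p. (lift (\<lambda>x y. l + c * rot1 \<epsilon> x y) p, lift (\<lambda>x y. m + c * rot2 \<epsilon> x y) p))"

lemma C1sq_const: "C1sq (\<lambda>x y. c) (\<lambda>x y. 0) (\<lambda>x y. 0)"
  by (simp add: C1sq_def has_dx_def has_dy_def)

lemma C1sq_rig:
  "C1sq (\<lambda>x y. l + c * rot1 \<epsilon> x y) (\<lambda>x y. 0 + c * rot1x \<epsilon> x y) (\<lambda>x y. 0 + c * rot1y \<epsilon> x y)"
  "C1sq (\<lambda>x y. m + c * rot2 \<epsilon> x y) (\<lambda>x y. 0 + c * rot2x \<epsilon> x y) (\<lambda>x y. 0 + c * rot2y \<epsilon> x y)"
  by (intro C1sq_lincomb C1sq_const C11sqD(1)[OF C11sq_rot1] C11sqD(1)[OF C11sq_rot2])+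

lemma rig_W12: "rig \<epsilon> c l m \<in> W12"
  unfolding W12_def rig_def using W12s_lift(1)[OF C1sq_rig(1)] W12s_lift(1)[OF C1sq_rig(2)] by simp

lemma rig_Meps:
  assumes e: "thin \<epsilon>"
  shows "rig \<epsilon> c l m \<in> Meps T2 T3 k \<epsilon>"
proof -
  have c1: "comp1 (rig \<epsilon> c l m) = lift (\<lambda>x y. l + c * rot1 \<epsilon> x y)"
    and c2: "comp2 (rig \<epsilon> c l m) = lift (\<lambda>x y. m + c * rot2 \<epsilon> x y)" by (simp_all add: rig_def)
  have "AE p in muS. \<forall>i\<in>{1::nat,2}. \<forall>j\<in>{1::nat,2}. symGradRT T2 T3 k \<epsilon> (rig \<epsilon> c l m) p i j = 0"
    using W12s_lift(2)[OF C1sq_rig(1)[of l c \<epsilon>]] W12s_lift(2)[OF C1sq_rig(2)[of m c \<epsilon>]]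
      W12s_lift(3)[OF C1sq_rig(1)[of l c \<epsilon>]] W12s_lift(3)[OF C1sq_rig(2)[of m c \<epsilon>]] AE_space
  proof eventually_elim
    case (elim p)
    have x: "fst p \<in> {0..1}" "snd p + 1/2 \<in> {0..1}" using elim(5)[unfolded space_muS] by (auto simp: stripS_def)
    define g where "g = metr \<epsilon> (fst p) (snd p + 1/2)"
    have g: "1 - \<epsilon> * snd p * k (fst p) = g" by (simp add: g_def metr_def)
    have g0: "g \<noteq> 0" using metr_bounds[OF e x] by (simp add: g_def)
    have e0: "\<epsilon> \<noteq> 0" using e by (simp add: thin_def)
    have d: "wd_s (comp1 (rig \<epsilon> c l m)) p = - (g * (c * T3 (fst p)))" "wd_s (comp2 (rig \<epsilon> c l m)) p = g * (c * T2 (fst p))"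
      "wd_t (comp1 (rig \<epsilon> c l m)) p = - (\<epsilon> * (c * T2 (fst p)))" "wd_t (comp2 (rig \<epsilon> c l m)) p = - (\<epsilon> * (c * T3 (fst p)))"
      unfolding c1 c2 elim by (simp_all add: lift_def rot1x_def rot2x_def rot1y_def rot2y_def g_def)
    show ?case
      by (simp add: symGradRT_def gradRT_def Let_def g d g0 e0)
  qed
  then have "AE p in lborel. p \<in> stripS \<longrightarrow> (\<forall>i\<in>{1::nat,2}. \<forall>j\<in>{1::nat,2}. symGradRT T2 T3 k \<epsilon> (rig \<epsilon> c l m) p i j = 0)"
    by (subst (asm) AE_restrict_space_iff) auto
  then show ?thesis by (simp add: Meps_def rig_W12)
qed

lemma Meps_energy:
  assumes e: "thin \<epsilon>" and v: "v \<in> Meps T2 T3 k \<epsilon>"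
  shows "v \<in> W12" "energy \<epsilon> v = 0"
proof -
  show "v \<in> W12" using v by (simp add: Meps_def)
  have "AE p in lborel. p \<in> stripS \<longrightarrow> (\<forall>i\<in>{1::nat,2}. \<forall>j\<in>{1::nat,2}. symGradRT T2 T3 k \<epsilon> v p i j = 0)"
    using v by (simp add: Meps_def)
  then have "AE p in muS. \<forall>i\<in>{1::nat,2}. \<forall>j\<in>{1::nat,2}. symGradRT T2 T3 k \<epsilon> v p i j = 0"
    by (subst AE_restrict_space_iff) auto
  then have "AE p in muS. edens \<epsilon> p (wd_s (comp1 v) p) (wd_s (comp2 v) p) (wd_t (comp1 v) p) (wd_t (comp2 v) p) = 0"
    using AE_space
  proof eventually_elim
    case (elim p)
    then show ?case using symGradRT_sq_sum[OF e, of p v] by simp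
  qed
  then show "energy \<epsilon> v = 0" unfolding energy_def by (rule integral_eq_zero_AE)
qed

text \<open>The motion is built up from \<open>rig \<epsilon> 0 0 0\<close> by adding multiples of
  the three generators; that zero field contributes nothing since it is a difference of equal
  fields.\<close>

lemma W12_inner_rig:
  assumes "u \<in> W12"
  shows "W12_inner (rig \<epsilon> c l m) u = c * W12_inner (rig \<epsilon> 1 0 0) u + l * W12_inner (rig \<epsilon> 0 1 0) u + m * W12_inner (rig \<epsilon> 0 0 1) u"
proof -
  define w where "w = (\<lambda>p. rig \<epsilon> 0 0 0 p + c *\<^sub>R rig \<epsilon> 1 0 0 p)"
  define w' where "w' = (\<lambda>p. w p + l *\<^sub>R rig \<epsilon> 0 1 0 p)"
  have w: "w \<in> W12" "w' \<in> W12" unfolding w'_def w_def by (intro W12_lincomb rig_W12)+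
  have eq: "rig \<epsilon> c l m = (\<lambda>p. w' p + m *\<^sub>R rig \<epsilon> 0 0 1 p)"
    by (simp add: w_def w'_def rig_def lift_def fun_eq_iff)
  have z: "rig \<epsilon> 0 0 0 = (\<lambda>p. rig \<epsilon> 1 0 0 p - rig \<epsilon> 1 0 0 p)"
    by (simp add: rig_def lift_def fun_eq_iff zero_prod_def)
  have "W12_inner (rig \<epsilon> 0 0 0) u = 0"
    unfolding z W12_inner_diff(1)[OF rig_W12 rig_W12 assms] by simp
  then show ?thesis
    unfolding eq W12_inner_lincomb[OF w(2) rig_W12 assms]
    unfolding w'_def W12_inner_lincomb[OF w(1) rig_W12 assms]
    unfolding w_def W12_inner_lincomb[OF rig_W12 rig_W12 assms] by simp
qed

lemma ip_const: "ip (lift (\<lambda>x y. c)) (lift (\<lambda>x y. c)) = c\<^sup>2"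
  using ip_self_eq[OF lift_L2S weak_pd_lift[OF C1sq_const], of c] by (simp add: L2sq_lift)

lemma W12_inner_translations:
  "W12_inner (rig \<epsilon> 0 1 0) (rig \<epsilon> 0 1 0) = 1" "W12_inner (rig \<epsilon> 0 0 1) (rig \<epsilon> 0 0 1) = 1"
  "W12_inner (rig \<epsilon> 0 1 0) (rig \<epsilon> 0 0 1) = 0"
proof -
  note W = W12s_lift(1)[OF C1sq_const]
  have 0: "ip (lift (\<lambda>x y. 0)) (lift (\<lambda>x y. 1)) = 0"
    by (rule ip_zero[OF W W]) (simp add: ip_const)
  show "W12_inner (rig \<epsilon> 0 1 0) (rig \<epsilon> 0 1 0) = 1" "W12_inner (rig \<epsilon> 0 0 1) (rig \<epsilon> 0 0 1) = 1"
    "W12_inner (rig \<epsilon> 0 1 0) (rig \<epsilon> 0 0 1) = 0"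
    unfolding W12_inner_ip rig_def using 0 ip_sym[of "lift (\<lambda>x y. 1)" "lift (\<lambda>x y. 0)"] by (simp_all add: ip_const)
qed

text \<open>Gram-Schmidt in the span of three fields. The translations are orthonormal because the
  strip has area 1, and \<open>q\<close> is the rotation minus its translation part.\<close>

lemma rig_projection:
  assumes v: "v \<in> W12"
  shows "\<exists>c l m. \<forall>c' l' m'. W12_inner (\<lambda>p. v p - rig \<epsilon> c l m p) (rig \<epsilon> c' l' m') = 0"
proof -
  define R where "R = rig \<epsilon> 1 0 0"
  define E1 where "E1 = rig \<epsilon> 0 1 0"
  define E2 where "E2 = rig \<epsilon> 0 0 1"
  have W: "R \<in> W12" "E1 \<in> W12" "E2 \<in> W12" unfolding R_def E1_def E2_def by (rule rig_W12)+
  have lin: "W12_inner (rig \<epsilon> c l m) u = c * W12_inner R u + l * W12_inner E1 u + m * W12_inner E2 u" if "u \<in> W12" for c l m u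
    unfolding R_def E1_def E2_def by (rule W12_inner_rig[OF that])
  have tr: "W12_inner E1 E1 = 1" "W12_inner E2 E2 = 1" "W12_inner E1 E2 = 0" "W12_inner E2 E1 = 0"
    using W12_inner_translations[of \<epsilon>] W12_inner_sym[of E1 E2] by (simp_all add: E1_def E2_def)
  define a where "a = W12_inner R E1"
  define b where "b = W12_inner R E2"
  define q where "q = rig \<epsilon> 1 (- a) (- b)"
  have qW: "q \<in> W12" unfolding q_def by (rule rig_W12)
  have qE: "W12_inner q E1 = 0" "W12_inner q E2 = 0"
    unfolding q_def lin[OF W(2)] lin[OF W(3)] tr a_def b_def by simp_all
  have qq: "W12_inner q q = W12_inner R q"
    using lin[OF qW, of 1 "- a" "- b"] qE W12_inner_sym[of E1 q] W12_inner_sym[of E2 q] unfolding q_def[symmetric] by simp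
  define t where "t = W12_inner v q / W12_inner q q"
  \<comment> \<open>If \<open>q\<close> has norm zero, the quotient \<open>t\<close> is 0 by the
    convention for division and the left side vanishes as well.\<close>
  have tq: "W12_inner v q = t * W12_inner q q"
    using W12_inner_zero[OF qW v] W12_inner_sym[of v q] by (cases "W12_inner q q = 0") (auto simp: t_def)
  define w where "w = rig \<epsilon> t (W12_inner v E1 - t * a) (W12_inner v E2 - t * b)"
  have wW: "w \<in> W12" unfolding w_def by (rule rig_W12)
  have dW: "(\<lambda>p. v p - w p) \<in> W12" by (intro W12_diff v wW)
  have 1: "W12_inner (\<lambda>p. v p - w p) E1 = 0"
    unfolding W12_inner_diff(1)[OF v wW W(2)] unfolding w_def lin[OF W(2)] tr a_def[symmetric] by simp
  have 2: "W12_inner (\<lambda>p. v p - w p) E2 = 0"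
    unfolding W12_inner_diff(1)[OF v wW W(3)] unfolding w_def lin[OF W(3)] tr b_def[symmetric] by simp
  have 3: "W12_inner (\<lambda>p. v p - w p) q = 0"
    unfolding W12_inner_diff(1)[OF v wW qW] unfolding w_def lin[OF qW]
    using qE W12_inner_sym[of E1 q] W12_inner_sym[of E2 q] tq qq by simp
  have 4: "W12_inner (\<lambda>p. v p - w p) R = 0"
    using 1 2 3 lin[OF dW, of 1 "- a" "- b"] unfolding q_def[symmetric]
    by (simp add: W12_inner_sym[of _ "\<lambda>p. v p - w p"])
  have "W12_inner (\<lambda>p. v p - w p) (rig \<epsilon> c' l' m') = 0" for c' l' m'
    using lin[OF dW, of c' l' m'] 1 2 4 by (simp add: W12_inner_sym[of _ "\<lambda>p. v p - w p"])
  then show ?thesis unfolding w_def by blast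
qed

text \<open>The smooth estimate is applied to approximants of both components, and the rigid motion
  found for them is kept for \<open>v\<close>. This motion depends on \<delta>, which is why a
  remainder is still present.\<close>

theorem korn_W12:
  "\<exists>\<epsilon>0>0. \<exists>C>0. \<forall>\<epsilon>. 0 < \<epsilon> \<and> \<epsilon> < \<epsilon>0 \<longrightarrow> thin \<epsilon> \<and> (\<forall>v\<in>W12. \<forall>\<delta>>0. \<exists>c l m.
     W12_inner (\<lambda>p. v p - rig \<epsilon> c l m p) (\<lambda>p. v p - rig \<epsilon> c l m p) \<le> \<delta> + C / \<epsilon>\<^sup>2 * energy \<epsilon> v)"
proof -
  obtain \<epsilon>0 C where eC: "\<epsilon>0 > 0" "C > 0" and kc0: "\<forall>\<epsilon>. 0 < \<epsilon> \<and> \<epsilon> < \<epsilon>0 \<longrightarrow> thin \<epsilon> \<and>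
    (\<forall>p px py pxy q qx qy qxy. C11sq p px py pxy \<longrightarrow> C11sq q qx qy qxy \<longrightarrow>
      (\<exists>c l m. int2 (\<lambda>x y. (p x y + c * rot1 \<epsilon> x y - l)\<^sup>2) + int2 (\<lambda>x y. (q x y + c * rot2 \<epsilon> x y - m)\<^sup>2)
        + int2 (\<lambda>x y. (px x y + c * rot1x \<epsilon> x y)\<^sup>2) + int2 (\<lambda>x y. (qx x y + c * rot2x \<epsilon> x y)\<^sup>2)
        + int2 (\<lambda>x y. (py x y + c * rot1y \<epsilon> x y)\<^sup>2) + int2 (\<lambda>x y. (qy x y + c * rot2y \<epsilon> x y)\<^sup>2)
        \<le> C / \<epsilon>\<^sup>2 * strain_energy \<epsilon> px py qx qy))"
    using korn_curved by (elim exE conjE) (rule that)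
  note kc = mp[OF spec[OF kc0]]
  show ?thesis
  proof (rule exI[of _ \<epsilon>0], rule conjI, rule eC, rule exI[of _ "4 * C"], rule conjI, use eC in simp, intro allI impI conjI ballI)
    fix \<epsilon> assume e: "0 < \<epsilon> \<and> \<epsilon> < \<epsilon>0"
    show thin: "thin \<epsilon>" using kc[OF e] by blast
    fix v and \<delta> :: real assume v: "v \<in> W12" and \<delta>: "\<delta> > 0"
    note v1 = W12sD[OF W12D(1)[OF v]] and v2 = W12sD[OF W12D(2)[OF v]]
    \<comment> \<open>The total error in units of \<open>d\<close>: six terms of
      \<open>2 * d\<close> from the norm, and \<open>2 * C / \<epsilon>\<^sup>2\<close> times
      \<open>64 / \<epsilon>\<^sup>2\<close> from the energy of the approximation error.\<close>
    define M where "M = 12 + 128 * C / \<epsilon> ^ 4"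
    have M: "M > 0" unfolding M_def using eC e by (intro add_pos_nonneg) auto
    define d where "d = \<delta> / M"
    have d: "d > 0" using M \<delta> by (simp add: d_def)
    obtain F1 where F1: "F1 \<in> Csm" "L2sq (\<lambda>p. comp1 v p - F1 p) < d" "L2sq (\<lambda>p. wd_s (comp1 v) p - pdir e_s F1 p) < d"
      "L2sq (\<lambda>p. wd_t (comp1 v) p - pdir e_t F1 p) < d" using weak_pd_approx[OF v1(1-3) d] by blast
    obtain F2 where F2: "F2 \<in> Csm" "L2sq (\<lambda>p. comp2 v p - F2 p) < d" "L2sq (\<lambda>p. wd_s (comp2 v) p - pdir e_s F2 p) < d"
      "L2sq (\<lambda>p. wd_t (comp2 v) p - pdir e_t F2 p) < d" using weak_pd_approx[OF v2(1-3) d] by blast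
    define P where "P = (\<lambda>x y. F1 (x, y - 1/2))"
    define Px where "Px = (\<lambda>x y. pdir e_s F1 (x, y - 1/2))"
    define Py where "Py = (\<lambda>x y. pdir e_t F1 (x, y - 1/2))"
    define Q where "Q = (\<lambda>x y. F2 (x, y - 1/2))"
    define Qx where "Qx = (\<lambda>x y. pdir e_s F2 (x, y - 1/2))"
    define Qy where "Qy = (\<lambda>x y. pdir e_t F2 (x, y - 1/2))"
    have lift: "lift P = F1" "lift Px = pdir e_s F1" "lift Py = pdir e_t F1" "lift Q = F2" "lift Qx = pdir e_s F2" "lift Qy = pdir e_t F2"
      unfolding P_def Px_def Py_def Q_def Qx_def Qy_def by (rule lift_shift)+
    note CP = Csm_C11sq[OF F1(1), folded P_def Px_def Py_def] and CQ = Csm_C11sq[OF F2(1), folded Q_def Qx_def Qy_def]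
    note Pc = C11sqD[OF CP] and Qc = C11sqD[OF CQ]
    define S where "S = strain_energy \<epsilon> Px Py Qx Qy"
    obtain c l m where clm: "int2 (\<lambda>x y. (P x y + c * rot1 \<epsilon> x y - l)\<^sup>2) + int2 (\<lambda>x y. (Q x y + c * rot2 \<epsilon> x y - m)\<^sup>2)
        + int2 (\<lambda>x y. (Px x y + c * rot1x \<epsilon> x y)\<^sup>2) + int2 (\<lambda>x y. (Qx x y + c * rot2x \<epsilon> x y)\<^sup>2)
        + int2 (\<lambda>x y. (Py x y + c * rot1y \<epsilon> x y)\<^sup>2) + int2 (\<lambda>x y. (Qy x y + c * rot2y \<epsilon> x y)\<^sup>2)
        \<le> C / \<epsilon>\<^sup>2 * S"
      using kc[OF e] CP CQ unfolding S_def by meson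
    note r1 = C1sq_rig(1)[of l "- c" \<epsilon>] and r2 = C1sq_rig(2)[of m "- c" \<epsilon>]
    have split: "L2sq (\<lambda>p. f p + (-1) * lift B p) \<le> 2 * d + 2 * int2 (\<lambda>x y. (A x y - B x y)\<^sup>2)"
      if "L2S f" "cont2 A" "cont2 B" "L2sq (\<lambda>p. f p - lift A p) < d" for f A B
    proof -
      have "L2sq (\<lambda>p. f p + (-1) * lift B p) = L2sq (\<lambda>p. (f p - lift A p) + lift (\<lambda>x y. A x y - B x y) p)"
        by (simp add: lift_def)
      also have "\<dots> \<le> 2 * L2sq (\<lambda>p. f p - lift A p) + 2 * L2sq (lift (\<lambda>x y. A x y - B x y))"
        by (intro L2sq_add_le L2S_diff that lift_L2S cont2_diff)
      also have "L2sq (lift (\<lambda>x y. A x y - B x y)) = int2 (\<lambda>x y. (A x y - B x y)\<^sup>2)"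
        by (intro L2sq_lift cont2_diff that)
      finally show ?thesis using that(4) by linarith
    qed
    note w1 = weak_pd_lincomb[OF v1(1) lift_L2S[OF C1sqD(1)[OF r1]] v1(2) weak_pd_lift(1)[OF r1], of "-1"]
      weak_pd_lincomb[OF v1(1) lift_L2S[OF C1sqD(1)[OF r1]] v1(3) weak_pd_lift(2)[OF r1], of "-1"]
    note w2 = weak_pd_lincomb[OF v2(1) lift_L2S[OF C1sqD(1)[OF r2]] v2(2) weak_pd_lift(1)[OF r2], of "-1"]
      weak_pd_lincomb[OF v2(1) lift_L2S[OF C1sqD(1)[OF r2]] v2(3) weak_pd_lift(2)[OF r2], of "-1"]
    have L1: "L2S (\<lambda>p. comp1 v p + (-1) * lift (\<lambda>x y. l + - c * rot1 \<epsilon> x y) p)"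
      by (intro L2S_add L2S_cmult v1 lift_L2S C1sqD(1)[OF r1])
    have L2: "L2S (\<lambda>p. comp2 v p + (-1) * lift (\<lambda>x y. m + - c * rot2 \<epsilon> x y) p)"
      by (intro L2S_add L2S_cmult v2 lift_L2S C1sqD(1)[OF r2])
    define u where "u = (\<lambda>p. v p - rig \<epsilon> (- c) l m p)"
    have cu: "comp1 u = (\<lambda>p. comp1 v p + (-1) * lift (\<lambda>x y. l + - c * rot1 \<epsilon> x y) p)"
      "comp2 u = (\<lambda>p. comp2 v p + (-1) * lift (\<lambda>x y. m + - c * rot2 \<epsilon> x y) p)"
      by (simp_all add: u_def rig_def)
    have "W12_inner u u = L2sq (\<lambda>p. comp1 v p + (-1) * lift (\<lambda>x y. l + - c * rot1 \<epsilon> x y) p)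
       + L2sq (\<lambda>p. wd_s (comp1 v) p + (-1) * lift (\<lambda>x y. 0 + - c * rot1x \<epsilon> x y) p)
       + L2sq (\<lambda>p. wd_t (comp1 v) p + (-1) * lift (\<lambda>x y. 0 + - c * rot1y \<epsilon> x y) p)
       + (L2sq (\<lambda>p. comp2 v p + (-1) * lift (\<lambda>x y. m + - c * rot2 \<epsilon> x y) p)
       + L2sq (\<lambda>p. wd_s (comp2 v) p + (-1) * lift (\<lambda>x y. 0 + - c * rot2x \<epsilon> x y) p)
       + L2sq (\<lambda>p. wd_t (comp2 v) p + (-1) * lift (\<lambda>x y. 0 + - c * rot2y \<epsilon> x y) p))"
      unfolding W12_inner_ip cu ip_self_eq[OF L1 w1] ip_self_eq[OF L2 w2] ..
    also have "\<dots> \<le> (2 * d + 2 * int2 (\<lambda>x y. (P x y - (l + - c * rot1 \<epsilon> x y))\<^sup>2))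
       + (2 * d + 2 * int2 (\<lambda>x y. (Px x y - (0 + - c * rot1x \<epsilon> x y))\<^sup>2))
       + (2 * d + 2 * int2 (\<lambda>x y. (Py x y - (0 + - c * rot1y \<epsilon> x y))\<^sup>2))
       + ((2 * d + 2 * int2 (\<lambda>x y. (Q x y - (m + - c * rot2 \<epsilon> x y))\<^sup>2))
       + (2 * d + 2 * int2 (\<lambda>x y. (Qx x y - (0 + - c * rot2x \<epsilon> x y))\<^sup>2))
       + (2 * d + 2 * int2 (\<lambda>x y. (Qy x y - (0 + - c * rot2y \<epsilon> x y))\<^sup>2)))"
      by (intro add_mono split v1 v2 Pc Qc C1sqD[OF r1] C1sqD[OF r2]; simp only: lift F1 F2)
    also have "\<dots> = 12 * d + 2 * (int2 (\<lambda>x y. (P x y + c * rot1 \<epsilon> x y - l)\<^sup>2) + int2 (\<lambda>x y. (Q x y + c * rot2 \<epsilon> x y - m)\<^sup>2)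
        + int2 (\<lambda>x y. (Px x y + c * rot1x \<epsilon> x y)\<^sup>2) + int2 (\<lambda>x y. (Qx x y + c * rot2x \<epsilon> x y)\<^sup>2)
        + int2 (\<lambda>x y. (Py x y + c * rot1y \<epsilon> x y)\<^sup>2) + int2 (\<lambda>x y. (Qy x y + c * rot2y \<epsilon> x y)\<^sup>2))"
      by (simp add: algebra_simps)
    also have "\<dots> \<le> 12 * d + 2 * (C / \<epsilon>\<^sup>2 * S)"
      by (intro add_left_mono mult_left_mono clm) simp
    finally have 1: "W12_inner u u \<le> 12 * d + 2 * (C / \<epsilon>\<^sup>2 * S)" .
    \<comment> \<open>The energy is a quadratic form, so that of the approximant is at most twice
      the energy of \<open>v\<close> plus twice that of the error.\<close>
    have 2: "S \<le> 2 * energy \<epsilon> v + 64 / \<epsilon>\<^sup>2 * d"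
    proof -
      define a1 where "a1 = (\<lambda>p. pdir e_s F1 p - wd_s (comp1 v) p)"
      define a2 where "a2 = (\<lambda>p. pdir e_s F2 p - wd_s (comp2 v) p)"
      define b1 where "b1 = (\<lambda>p. pdir e_t F1 p - wd_t (comp1 v) p)"
      define b2 where "b2 = (\<lambda>p. pdir e_t F2 p - wd_t (comp2 v) p)"
      note FL = Csm_L2S[OF Csm_pdir[OF F1(1)]] Csm_L2S[OF Csm_pdir[OF F2(1)]]
      have L: "L2S a1" "L2S a2" "L2S b1" "L2S b2"
        unfolding a1_def a2_def b1_def b2_def by (intro L2S_diff FL v1 v2)+
      have sw: "L2sq (\<lambda>p. f p - g p) = L2sq (\<lambda>p. g p - f p)" for f g
        unfolding L2sq_def by (simp add: power2_commute)
      have small: "L2sq a1 < d" "L2sq a2 < d" "L2sq b1 < d" "L2sq b2 < d"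
        unfolding a1_def a2_def b1_def b2_def sw[of "pdir _ _"] by (rule F1 F2)+
      note i1 = edens_integrable[OF thin v1(4) v2(4) v1(5) v2(5)] and i2 = edens_integrable[OF thin L]
      have "S = integral\<^sup>L muS (\<lambda>p. edens \<epsilon> p (pdir e_s F1 p) (pdir e_s F2 p) (pdir e_t F1 p) (pdir e_t F2 p))"
        unfolding S_def strain_energy_edens[OF thin Pc(3,4) Qc(3,4)] lift ..
      also have "\<dots> \<le> integral\<^sup>L muS (\<lambda>p. 2 * edens \<epsilon> p (wd_s (comp1 v) p) (wd_s (comp2 v) p) (wd_t (comp1 v) p) (wd_t (comp2 v) p)
          + 2 * edens \<epsilon> p (a1 p) (a2 p) (b1 p) (b2 p))"
      proof (rule integral_mono)
        show "integrable muS (\<lambda>p. edens \<epsilon> p (pdir e_s F1 p) (pdir e_s F2 p) (pdir e_t F1 p) (pdir e_t F2 p))"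
          by (intro edens_integrable thin FL)
        show "integrable muS (\<lambda>p. 2 * edens \<epsilon> p (wd_s (comp1 v) p) (wd_s (comp2 v) p) (wd_t (comp1 v) p) (wd_t (comp2 v) p)
          + 2 * edens \<epsilon> p (a1 p) (a2 p) (b1 p) (b2 p))"
          by (intro Bochner_Integration.integrable_add integrable_mult_right i1 i2)
        show "edens \<epsilon> p (pdir e_s F1 p) (pdir e_s F2 p) (pdir e_t F1 p) (pdir e_t F2 p)
          \<le> 2 * edens \<epsilon> p (wd_s (comp1 v) p) (wd_s (comp2 v) p) (wd_t (comp1 v) p) (wd_t (comp2 v) p)
          + 2 * edens \<epsilon> p (a1 p) (a2 p) (b1 p) (b2 p)" for p
          using edens_add_le[of \<epsilon> p "wd_s (comp1 v) p" "a1 p" "wd_s (comp2 v) p" "a2 p" "wd_t (comp1 v) p" "b1 p" "wd_t (comp2 v) p" "b2 p"]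
          by (simp add: a1_def a2_def b1_def b2_def)
      qed
      also have "\<dots> = 2 * energy \<epsilon> v + 2 * integral\<^sup>L muS (\<lambda>p. edens \<epsilon> p (a1 p) (a2 p) (b1 p) (b2 p))"
        unfolding energy_def using i1 i2 by simp
      also have "integral\<^sup>L muS (\<lambda>p. edens \<epsilon> p (a1 p) (a2 p) (b1 p) (b2 p))
          \<le> integral\<^sup>L muS (\<lambda>p. 8 / \<epsilon>\<^sup>2 * ((a1 p)\<^sup>2 + (a2 p)\<^sup>2 + (b1 p)\<^sup>2 + (b2 p)\<^sup>2))"
        using edens_le[OF thin]
        by (intro integral_mono i2 integrable_mult_right Bochner_Integration.integrable_add L2S_sq L) auto
      also have "\<dots> = 8 / \<epsilon>\<^sup>2 * (L2sq a1 + L2sq a2 + L2sq b1 + L2sq b2)"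
        unfolding L2sq_def using L2S_sq[OF L(1)] L2S_sq[OF L(2)] L2S_sq[OF L(3)] L2S_sq[OF L(4)] by simp
      also have "\<dots> \<le> 8 / \<epsilon>\<^sup>2 * (4 * d)"
        using small e by (intro mult_left_mono) auto
      finally show ?thesis by simp
    qed
    have "W12_inner u u \<le> 12 * d + 2 * (C / \<epsilon>\<^sup>2 * (2 * energy \<epsilon> v + 64 / \<epsilon>\<^sup>2 * d))"
      using 1 mult_left_mono[OF 2, of "C / \<epsilon>\<^sup>2"] eC by fastforce
    also have "\<dots> = d * M + 4 * C / \<epsilon>\<^sup>2 * energy \<epsilon> v"
      using e by (simp add: M_def power2_eq_square power4_eq_xxxx field_simps)
    also have "d * M = \<delta>" using M by (simp add: d_def)
    finally show "\<exists>c l m. W12_inner (\<lambda>p. v p - rig \<epsilon> c l m p) (\<lambda>p. v p - rig \<epsilon> c l m p) \<le> \<delta> + 4 * C / \<epsilon>\<^sup>2 * energy \<epsilon> v"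
      unfolding u_def by blast
  qed
qed

theorem projection_estimate:
  "\<exists>\<epsilon>0>0. \<exists>C>0. \<forall>\<epsilon>. 0 < \<epsilon> \<and> \<epsilon> < \<epsilon>0 \<longrightarrow> (\<forall>v\<in>W12.
     W12_norm (\<lambda>p. v p - Pi_eps T2 T3 k \<epsilon> v p) \<le> C / \<epsilon> * symL2 T2 T3 k \<epsilon> v)"
proof -
  obtain \<epsilon>0 C where eC: "\<epsilon>0 > 0" "C > 0" and korn: "\<And>\<epsilon>. 0 < \<epsilon> \<and> \<epsilon> < \<epsilon>0 \<Longrightarrow> thin \<epsilon> \<and> (\<forall>v\<in>W12. \<forall>\<delta>>0. \<exists>c l m.
     W12_inner (\<lambda>p. v p - rig \<epsilon> c l m p) (\<lambda>p. v p - rig \<epsilon> c l m p) \<le> \<delta> + C / \<epsilon>\<^sup>2 * energy \<epsilon> v)"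
    using korn_W12 by blast
  show ?thesis
  proof (rule exI[of _ \<epsilon>0], rule conjI, rule eC, rule exI[of _ "sqrt C"], rule conjI, use eC in simp, intro allI impI ballI)
    fix \<epsilon> v assume e: "0 < \<epsilon> \<and> \<epsilon> < \<epsilon>0" and v: "v \<in> W12"
    have thin: "thin \<epsilon>" using korn[OF e] by blast
    have proj: "\<exists>c l m. (\<forall>c' l' m'. W12_inner (\<lambda>p. w p - rig \<epsilon> c l m p) (rig \<epsilon> c' l' m') = 0) \<and>
        W12_inner (\<lambda>p. w p - rig \<epsilon> c l m p) (\<lambda>p. w p - rig \<epsilon> c l m p) \<le> C / \<epsilon>\<^sup>2 * energy \<epsilon> w" if w: "w \<in> W12" for w
    proof -
      obtain c l m where o: "\<And>c' l' m'. W12_inner (\<lambda>p. w p - rig \<epsilon> c l m p) (rig \<epsilon> c' l' m') = 0"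
        using rig_projection[OF w] by blast
      have "W12_inner (\<lambda>p. w p - rig \<epsilon> c l m p) (\<lambda>p. w p - rig \<epsilon> c l m p) \<le> C / \<epsilon>\<^sup>2 * energy \<epsilon> w"
      \<comment> \<open>The orthogonal projection onto the rigid motions does not depend on \<delta>
        and is at least as close as each motion from \<open>korn_W12\<close>, so \<delta> can be
        sent to 0.\<close>
      proof (rule field_le_epsilon)
        fix \<delta> :: real assume "\<delta> > 0"
        then obtain c' l' m' where
          "W12_inner (\<lambda>p. w p - rig \<epsilon> c' l' m' p) (\<lambda>p. w p - rig \<epsilon> c' l' m' p) \<le> \<delta> + C / \<epsilon>\<^sup>2 * energy \<epsilon> w"
          using korn[OF e] w by blast
        moreover have "W12_inner (\<lambda>p. w p - rig \<epsilon> c l m p) (\<lambda>p. w p - rig \<epsilon> c l m p)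
            \<le> W12_inner (\<lambda>p. w p - rig \<epsilon> c' l' m' p) (\<lambda>p. w p - rig \<epsilon> c' l' m' p)"
          by (intro W12_pythagoras w rig_W12 o)
        ultimately show "W12_inner (\<lambda>p. w p - rig \<epsilon> c l m p) (\<lambda>p. w p - rig \<epsilon> c l m p) \<le> C / \<epsilon>\<^sup>2 * energy \<epsilon> w + \<delta>"
          by linarith
      qed
      with o show ?thesis by blast
    qed
    obtain c l m where o: "\<And>c' l' m'. W12_inner (\<lambda>p. v p - rig \<epsilon> c l m p) (rig \<epsilon> c' l' m') = 0"
      and le: "W12_inner (\<lambda>p. v p - rig \<epsilon> c l m p) (\<lambda>p. v p - rig \<epsilon> c l m p) \<le> C / \<epsilon>\<^sup>2 * energy \<epsilon> v"
      using proj[OF v] by blast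
    have dW: "(\<lambda>p. v p - rig \<epsilon> c l m p) \<in> W12" by (intro W12_diff v rig_W12)
    \<comment> \<open>An element of \<open>Meps\<close> has zero energy, so the estimate puts it at
      distance zero from a rigid motion; orthogonality to rigid motions thus extends to all of
      \<open>Meps\<close>.\<close>
    have orth: "W12_inner (\<lambda>p. v p - rig \<epsilon> c l m p) u = 0" if u: "u \<in> Meps T2 T3 k \<epsilon>" for u
    proof -
      note uW = Meps_energy(1)[OF thin u]
      obtain c' l' m' where "W12_inner (\<lambda>p. u p - rig \<epsilon> c' l' m' p) (\<lambda>p. u p - rig \<epsilon> c' l' m' p) \<le> C / \<epsilon>\<^sup>2 * energy \<epsilon> u"
        using proj[OF uW] by blast
      moreover have uR: "(\<lambda>p. u p - rig \<epsilon> c' l' m' p) \<in> W12" by (intro W12_diff uW rig_W12)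
      ultimately have "W12_inner (\<lambda>p. u p - rig \<epsilon> c' l' m' p) (\<lambda>p. u p - rig \<epsilon> c' l' m' p) = 0"
        using W12_inner_nonneg[OF uR] Meps_energy(2)[OF thin u] by simp
      from W12_inner_zero[OF uR dW this]
      have "W12_inner (\<lambda>p. v p - rig \<epsilon> c l m p) (\<lambda>p. u p - rig \<epsilon> c' l' m' p) = 0" by (simp add: W12_inner_sym)
      then show ?thesis unfolding W12_inner_diff(2)[OF uW rig_W12 dW] using o by simp
    qed
    define w where "w = Pi_eps T2 T3 k \<epsilon> v"
    \<comment> \<open>The motion just found shows that a projection exists, so the choice operator
      in \<open>Pi_eps\<close> returns a field with the same two properties, though possibly another
      one.\<close>
    have "w \<in> Meps T2 T3 k \<epsilon> \<and> (\<forall>u\<in>Meps T2 T3 k \<epsilon>. W12_inner (\<lambda>p. v p - w p) u = 0)"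
      unfolding w_def Pi_eps_def by (rule someI[of _ "rig \<epsilon> c l m"]) (use rig_Meps[OF thin] orth in blast)
    then have w: "w \<in> Meps T2 T3 k \<epsilon>" and wo: "\<And>u. u \<in> Meps T2 T3 k \<epsilon> \<Longrightarrow> W12_inner (\<lambda>p. v p - w p) u = 0" by auto
    have "W12_inner (\<lambda>p. v p - w p) (\<lambda>p. v p - w p) \<le> W12_inner (\<lambda>p. v p - rig \<epsilon> c l m p) (\<lambda>p. v p - rig \<epsilon> c l m p)"
      by (intro W12_pythagoras v rig_W12 wo w rig_Meps thin Meps_energy(1)[OF thin w])
    with le have "W12_inner (\<lambda>p. v p - w p) (\<lambda>p. v p - w p) \<le> C / \<epsilon>\<^sup>2 * energy \<epsilon> v" by linarith
    then have "W12_norm (\<lambda>p. v p - w p) \<le> sqrt (C / \<epsilon>\<^sup>2 * energy \<epsilon> v)"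
      unfolding W12_norm_def by simp
    also have "\<dots> = sqrt C / \<epsilon> * symL2 T2 T3 k \<epsilon> v"
      using e by (simp add: symL2_energy[OF thin] real_sqrt_mult real_sqrt_divide)
    finally show "W12_norm (\<lambda>p. v p - Pi_eps T2 T3 k \<epsilon> v p) \<le> sqrt C / \<epsilon> * symL2 T2 T3 k \<epsilon> v"
      unfolding w_def .
  qed
qed

end

theorem mainTheorem2:
  fixes G2 G3 :: "nat \<Rightarrow> real \<Rightarrow> real"
  assumes C6: "Ck_derivs 6 G2" "Ck_derivs 6 G3"
    and simple: "inj_on (\<lambda>s. (G2 0 s, G3 0 s)) {0..1}"
    and arclength: "\<forall>s\<in>{0..1}. (G2 1 s)\<^sup>2 + (G3 1 s)\<^sup>2 = 1"
    and k_def: "\<forall>s. k s = G2 2 s * (- G3 1 s) + G3 2 s * G2 1 s"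
    and k_nonzero: "\<exists>s\<in>{0..1}. k s \<noteq> 0"
  shows "\<exists>\<epsilon>0>0. \<exists>C>0. \<forall>\<epsilon>. 0 < \<epsilon> \<and> \<epsilon> < \<epsilon>0 \<longrightarrow> (\<forall>v\<in>W12.
           W12_norm (\<lambda>p. v p - Pi_eps (G2 1) (G3 1) k \<epsilon> v p)
             \<le> C / \<epsilon> * symL2 (G2 1) (G3 1) k \<epsilon> v)"
proof -
  have D: "(G i has_real_derivative G (Suc i) x) (at x within {0..1})"
    if "Ck_derivs 6 G" "x \<in> {0..1}" "i < 6" for G i x
    using that by (auto simp: Ck_derivs_def)
  have cont: "continuous_on {0..1} (G i)" if "Ck_derivs 6 G" "i < 6" for G i
    using D[OF that(1) _ that(2)] by (meson DERIV_continuous continuous_on_eq_continuous_within)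
  have kc: "continuous_on {0..1} k"
  proof -
    have k: "k = (\<lambda>s. G2 2 s * (- G3 1 s) + G3 2 s * G2 1 s)" using k_def by auto
    show ?thesis unfolding k
      by (intro continuous_on_add continuous_on_mult continuous_on_minus cont[OF C6(1)] cont[OF C6(2)]) simp_all
  qed
  have "compact (k ` {0..1})" using kc by (intro compact_continuous_image) auto
  then obtain K where K: "\<And>x. x \<in> {0..1} \<Longrightarrow> \<bar>k x\<bar> \<le> K"
    using compact_imp_bounded bounded_real by (metis imageI)
  \<comment> \<open>Differentiating the unit speed condition shows that the second derivative is
    orthogonal to the tangent; its normal component is \<open>k\<close> by definition. One-sided
    derivatives are unique since no point of the interval is isolated.\<close>
  have frame: "G2 2 x = - k x * G3 1 x \<and> G3 2 x = k x * G2 1 x" if x: "x \<in> {0..1}" for x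
  proof -
    have d1: "((\<lambda>s. (G2 1 s)\<^sup>2 + (G3 1 s)\<^sup>2) has_real_derivative 2 * (G2 1 x * G2 2 x + G3 1 x * G3 2 x)) (at x within {0..1})"
      using D[OF C6(1) x, of 1] D[OF C6(2) x, of 1]
      by (auto intro!: derivative_eq_intros simp: numeral_2_eq_2 algebra_simps)
    have d2: "((\<lambda>s. (G2 1 s)\<^sup>2 + (G3 1 s)\<^sup>2) has_real_derivative 0) (at x within {0..1})"
      by (rule has_field_derivative_transform_within[where f="\<lambda>s. 1" and d=1]) (use arclength x in auto)
    have "at x within {0..1} \<noteq> bot" using x by (simp add: trivial_limit_within islimpt_Icc)
    then have 0: "G2 1 x * G2 2 x + G3 1 x * G3 2 x = 0"
      using vector_derivative_unique_within[OF _ d1[unfolded has_real_derivative_iff_has_vector_derivative]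
        d2[unfolded has_real_derivative_iff_has_vector_derivative]] by simp
    have u: "(G2 1 x)\<^sup>2 + (G3 1 x)\<^sup>2 = 1" using arclength x by blast
    have kx: "k x = G2 2 x * (- G3 1 x) + G3 2 x * G2 1 x" using k_def by blast
    show ?thesis using 0 u kx by algebra
  qed
  \<comment> \<open>The tangent is the first derivative of the curve, and \<open>K\<close> bounds
    the curvature by compactness.\<close>
  interpret planar_curve "G2 1" "G3 1" k K "G2 0" "G3 0"
  proof
    fix x :: real assume x: "x \<in> {0..1}"
    show "(G2 1 has_real_derivative - k x * G3 1 x) (at x within {0..1})"
      using D[OF C6(1) x, of 1] frame[OF x] by (simp add: numeral_2_eq_2)
    show "(G3 1 has_real_derivative k x * G2 1 x) (at x within {0..1})"
      using D[OF C6(2) x, of 1] frame[OF x] by (simp add: numeral_2_eq_2)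
    show "\<bar>k x\<bar> \<le> K" by (rule K[OF x])
    show "(G2 1 x)\<^sup>2 + (G3 1 x)\<^sup>2 = 1" using arclength x by blast
    show "(G2 0 has_real_derivative G2 1 x) (at x within {0..1})" "(G3 0 has_real_derivative G3 1 x) (at x within {0..1})"
      using D[OF C6(1) x, of 0] D[OF C6(2) x, of 0] by simp_all
  qed (rule kc)
  show ?thesis by (rule projection_estimate)
qed

end
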